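(* Let $K$ be the Sierpinski sickle, with its normalized $\alpha$-dimensional Hausdorff measure $\mu$, $\alpha=\log 17/\log 7$. Then the critical exponents of the Besov spaces $B^\sigma_{2,\infty}$ on $(K,\mu)$ are $$\sigma^*=\frac12\Big(1+\frac{\log 17}{\log 7}\Big),\qquad \sigma^\#=\frac12\Big(\frac{2\log 17-\log 2}{\log 7}\Big).$$ Moreover: (i) $B^{\sigma^*}_{2,\infty}$ (which is contained in $C(K)$) is dense in $C(K)$, and $B^{\sigma^\#}_{2,\infty}$ is dense in $L^2(K,\mu)$. (ii) There are (non-primal) Dirichlet forms on $K$ that satisfy the energy self-similar identity; but the reverse recursive method does not yield a Dirichlet form on $K$, i.e. there is no sequence of positive conductances $(c_n)_{n\ge0}$ as required by that method.
   Context: **Sierpinski sickle.** Let $p_1=(0,0)$, $p_2=(1,0)$, $p_3=(\frac12,\frac{\sqrt3}2)$, $V_0=\{p_1,p_2,p_3\}$. For integers $i,j\ge0$ put $q(i,j)=\frac17(i\,p_2+j\,p_3)$; for $i+j\le 6$ the "cell $(i,j)$" is the image of the triangle with vertices $V_0$ under $x\mapsto\frac17x+q(i,j)$, so the images of $p_1,p_2,p_3$ are $q(i,j),q(i+1,j),q(i,j+1)$. The IFS $\{F_i\}_{i=1}^{17}$ consists of the $17$ maps $F_i(x)=\frac17x+a_i$ for the following cells: the five left cells $(0,0),\dots,(0,4)$; the three top cells $(0,5),(1,5),(0,6)$; and nine right cells forming a simple chain from $z_0=q(2,5)$ to $z_9=q(7,0)=p_2$: there are points $z_0,\dots,z_9$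 such that $z_{k-1}\neq z_k$ are vertices of the $k$-th right cell, consecutive right cells meet only at $z_k$, non-consecutive right cells are disjoint, the chain meets the left and top cells only in $z_0$, and the pair $\{z_{k-1},z_k\}$ is the image of $\{p_1,p_2\}$ for exactly four, of $\{p_2,p_3\}$ for exactly three, and of $\{p_3,p_1\}$ for exactly two of the nine right cells. (For example the right cells $(2,4),(3,3),(3,2),(2,2),(2,1),(3,0),(4,0),(5,0),(6,0)$; one such chain is fixed, and the assertions do not depend on which.) $K$ is the nonempty compact set with $K=\bigcup_{i=1}^{17}F_i(K)$. Put $V_n=\bigcup_iF_i(V_{n-1})$, $V_*=\bigcup_nV_n$; for a word $\omega=\omega_1\cdots\omega_n$, $|\omega|=n$, $F_\omega=F_{\omega_1}\circ\cdots\circ F_{\omega_n}$, $V_\omega=F_\omega(V_0)$. $K$ is a post-critically finite self-similar set with boundary $V_0$. **Besov spaces.** For $\sigma>0$, $[u]^2_{B^\sigma_{2,\infty}}=\sup_{0<r<1}r^{-\alpha-2\sigma}\int_K\int_{B(x,r)}|u(x)-u(y)|^2d\mu(y)d\mu(x)$ and $B^\sigma_{2,\infty}=\{u\in L^2(K,\mu):\|u\|_2+[u]_{B^\sigma_{2,\infty}}<\infty\}$. When $2\sigma>\alpha$, elements of $B^\sigma_{2,\infty}$ have continuous representatives and $B^\sigma_{2,\infty}$ is regarded as a subset of $C(K)$. The critical exponents are $\sigma^*=\sup\{\sigma: B^\sigma_{2,\infty}\cap C(K)\text{ is dense in }C(K)\}$ (sup norm) and $\sigma^\#=\sup\{\sigma: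 B^\sigma_{2,\infty}\text{ contains non-constant functions}\}$. **Dirichlet forms.** A Dirichlet form on $L^2(K,\nu)$ ($\nu$ a Radon measure with support $K$) is a closed, non-negative definite, densely defined symmetric bilinear form $\mathcal E$ with domain $\mathcal F$ having the Markov property; write $\mathcal E[u]=\mathcal E(u,u)$. A Dirichlet form "on $K$" means one on $L^2(K,\nu)$ for some Radon measure $\nu$ of full support, obtained as follows. One has energies $\mathcal E_n[u]=\sum_{|\omega|=n}\sum_{\{x,y\}\subset V_\omega}c_\omega(x,y)|u(x)-u(y)|^2$ on $V_n$ ($n\ge0$) with positive conductances $c_\omega(x,y)$, compatible in the sense that $\min\{\mathcal E_n[v]:v:V_n\to\mathbb R,\ v|_{V_{n-1}}=u\}=\mathcal E_{n-1}[u]$ for all $n\ge1$ and $u:V_{n-1}\to\mathbb R$; then $\mathcal E[u]=\lim_n\mathcal E_n[u]$ and $\mathcal F=\{u\in C(K):\mathcal E[u]<\infty\}$. "Non-primal" means that the $\mathcal E_n$ are not all scalar multiples of the primal energies $E_n[u]=\sum_{|\omega|=n}\sum_{\{x,y\}\subset V_\omega}|u(x)-u(y)|^2$. *Energy self-similar identity:* there are $0<\tau_i<1$ with $\mathcal E[u]=\sum_{i=1}^{17}\tau_i^{-1}\mathcal E[u\circ F_i]$ for all $u\in\mathcal F$. *Reverse recursive method:* the conductances on level $n$ are required to be the same on every $n$-cell, $c_\omega(F_\omega(p),F_\omega(q))=c_n(p,q)$ for all $|\omega|=n$ and $p\ne q$ in $V_0$; one fixes positive data $c_0$ on $V_0$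 and looks for positive $c_n$, $n\ge1$, making the sequence $(\mathcal E_n)$ compatible, i.e. such that $\min\{\mathcal E_n[v]:v:V_n\to\mathbb R,\ v|_{V_{n-1}}=u\}=\mathcal E_{n-1}[u]$ for all $n\ge1$ and $u:V_{n-1}\to\mathbb R$. *)

theory Defs
  imports "HOL-Analysis.Analysis"
begin

section \<open>The Sierpinski sickle\<close>

type_synonym plane = "real \<times> real"
type_synonym cell = "nat \<times> nat"

definition p1 :: plane where "p1 = (0, 0)"
definition p2 :: plane where "p2 = (1, 0)"
definition p3 :: plane where "p3 = (1/2, sqrt 3 / 2)"

definition V0 :: "plane set" where "V0 = {p1, p2, p3}"

definition q :: "nat \<Rightarrow> nat \<Rightarrow> plane" where
  "q i j = (1/7) *\<^sub>R (real i *\<^sub>R p2 + real j *\<^sub>R p3)"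

definition cell_map :: "cell \<Rightarrow> plane \<Rightarrow> plane" where
  "cell_map ij x = (1/7) *\<^sub>R x + q (fst ij) (snd ij)"

definition cell_triangle :: "cell \<Rightarrow> plane set" where
  "cell_triangle ij = cell_map ij ` (convex hull V0)"

definition left_cells :: "cell set" where
  "left_cells = {(0,0), (0,1), (0,2), (0,3), (0,4)}"

definition top_cells :: "cell set" where
  "top_cells = {(0,5), (1,5), (0,6)}"

text \<open>Only the values \<open>r 1, \<dots>, r 9\<close> and \<open>z 0, \<dots>, z 9\<close> matter.\<close>

definition right_chain :: "(nat \<Rightarrow> cell) \<Rightarrow> (nat \<Rightarrow> plane) \<Rightarrow> bool" where
  "right_chain r z \<longleftrightarrow>
     (\<forall>k\<in>{1..9}. fst (r k) + snd (r k) \<le> 6) \<and>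
     z 0 = q 2 5 \<and> z 9 = q 7 0 \<and>
     (\<forall>k\<in>{1..9}. z (k - 1) \<noteq> z k \<and> {z (k - 1), z k} \<subseteq> cell_map (r k) ` V0) \<and>
     (\<forall>k\<in>{1..8}. cell_triangle (r k) \<inter> cell_triangle (r (k + 1)) = {z k}) \<and>
     (\<forall>k\<in>{1..9}. \<forall>l\<in>{1..9}. k + 1 < l \<longrightarrow> cell_triangle (r k) \<inter> cell_triangle (r l) = {}) \<and>
     (\<Union>k\<in>{1..9}. cell_triangle (r k)) \<inter> (\<Union>ij\<in>left_cells \<union> top_cells. cell_triangle ij) = {z 0} \<and>
     card {k\<in>{1..9}. {z (k - 1), z k} = cell_map (r k) ` {p1, p2}} = 4 \<and>
     card {k\<in>{1..9}. {z (k - 1), z k} = cell_map (r k) ` {p2, p3}} = 3 \<and>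
     card {k\<in>{1..9}. {z (k - 1), z k} = cell_map (r k) ` {p3, p1}} = 2"

text \<open>The maps of the IFS are indexed by their cells instead of by \<open>1, \<dots>, 17\<close>.\<close>

definition sickle_cells :: "(nat \<Rightarrow> cell) \<Rightarrow> cell set" where
  "sickle_cells r = left_cells \<union> top_cells \<union> r ` {1..9}"

definition is_attractor :: "cell set \<Rightarrow> plane set \<Rightarrow> bool" where
  "is_attractor I K \<longleftrightarrow> compact K \<and> K \<noteq> {} \<and> K = (\<Union>i\<in>I. cell_map i ` K)"

primrec V :: "cell set \<Rightarrow> nat \<Rightarrow> plane set" where
  "V I 0 = V0"
| "V I (Suc n) = (\<Union>i\<in>I. cell_map i ` V I n)"

definition words :: "cell set \<Rightarrow> nat \<Rightarrow> cell list set" where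
  "words I n = {\<omega>. set \<omega> \<subseteq> I \<and> length \<omega> = n}"

definition word_map :: "cell list \<Rightarrow> plane \<Rightarrow> plane" where
  "word_map \<omega> = foldr (\<lambda>i f. cell_map i \<circ> f) \<omega> id"

definition Vw :: "cell list \<Rightarrow> plane set" where
  "Vw \<omega> = word_map \<omega> ` V0"


section \<open>Hausdorff measure\<close>

text \<open>\<^const>\<open>diameter\<close> is only meaningful on bounded sets, whence the boundedness condition.
  All uses have \<open>s > 0\<close>, so that sets of diameter 0 contribute \<open>0 powr s = 0\<close>.\<close>

definition hausdorff_pre :: "real \<Rightarrow> real \<Rightarrow> 'a::metric_space set \<Rightarrow> ennreal" where
  "hausdorff_pre s \<delta> A =
     (INF U\<in>{U :: nat \<Rightarrow> 'a set. A \<subseteq> (\<Union>i. U i) \<and> (\<forall>i. bounded (U i) \<and> diameter (U i) \<le> \<delta>)}.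
        \<Sum>i. ennreal (diameter (U i) powr s))"

definition hausdorff_outer :: "real \<Rightarrow> 'a::metric_space set \<Rightarrow> ennreal" where
  "hausdorff_outer s A = (SUP \<delta>\<in>{0<..}. hausdorff_pre s \<delta> A)"

definition hausdorff_measure :: "real \<Rightarrow> 'a::metric_space measure" where
  "hausdorff_measure s = measure_of UNIV (sets borel) (hausdorff_outer s)"

definition normalized_hausdorff :: "real \<Rightarrow> 'a::metric_space set \<Rightarrow> 'a measure" where
  "normalized_hausdorff s K = uniform_measure (restrict_space (hausdorff_measure s) K) K"


section \<open>Besov spaces\<close>

text \<open>Measures \<open>M\<close> below live on \<open>space M = K\<close>; functions are total functions of which only the
  values on \<open>K\<close> matter.  Elements of \<open>L\<^sup>2\<close> are represented by square-integrable functions, not by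
  classes modulo null sets.\<close>

definition L2 :: "'a measure \<Rightarrow> ('a \<Rightarrow> real) set" where
  "L2 M = {u. u \<in> borel_measurable M \<and> (\<integral>\<^sup>+x. ennreal ((u x)\<^sup>2) \<partial>M) < \<infinity>}"

definition besov_seminorm_sq ::
  "'a::metric_space measure \<Rightarrow> real \<Rightarrow> real \<Rightarrow> ('a \<Rightarrow> real) \<Rightarrow> ennreal" where
  "besov_seminorm_sq M \<alpha> \<sigma> u =
     (SUP r\<in>{0<..<1}. ennreal (r powr (- \<alpha> - 2 * \<sigma>)) *
        (\<integral>\<^sup>+x. (\<integral>\<^sup>+y\<in>ball x r. ennreal (\<bar>u x - u y\<bar>\<^sup>2) \<partial>M) \<partial>M))"

definition besov :: "'a::metric_space measure \<Rightarrow> real \<Rightarrow> real \<Rightarrow> ('a \<Rightarrow> real) set" where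
  "besov M \<alpha> \<sigma> = {u \<in> L2 M. besov_seminorm_sq M \<alpha> \<sigma> u < \<infinity>}"

definition dense_in_C :: "'a::topological_space set \<Rightarrow> ('a \<Rightarrow> real) set \<Rightarrow> bool" where
  "dense_in_C K A \<longleftrightarrow>
     (\<forall>f. continuous_on K f \<longrightarrow>
        (\<forall>e>0. \<exists>u\<in>A. continuous_on K u \<and> (\<forall>x\<in>K. \<bar>f x - u x\<bar> < e)))"

definition dense_in_L2 :: "'a measure \<Rightarrow> ('a \<Rightarrow> real) set \<Rightarrow> bool" where
  "dense_in_L2 M A \<longleftrightarrow>
     (\<forall>f\<in>L2 M. \<forall>e>0. \<exists>u\<in>A \<inter> L2 M. (\<integral>\<^sup>+x. ennreal ((f x - u x)\<^sup>2) \<partial>M) < ennreal e)"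

definition has_continuous_rep :: "'a::topological_space measure \<Rightarrow> 'a set \<Rightarrow> ('a \<Rightarrow> real) \<Rightarrow> bool" where
  "has_continuous_rep M K u \<longleftrightarrow> (\<exists>v. continuous_on K v \<and> (AE x in M. u x = v x))"

text \<open>The suprema are taken in the extended reals.\<close>

definition sigma_star :: "'a::metric_space measure \<Rightarrow> 'a set \<Rightarrow> real \<Rightarrow> ereal" where
  "sigma_star M K \<alpha> = Sup (ereal ` {\<sigma>. \<sigma> > 0 \<and> dense_in_C K (besov M \<alpha> \<sigma>)})"

definition sigma_sharp :: "'a::metric_space measure \<Rightarrow> real \<Rightarrow> ereal" where
  "sigma_sharp M \<alpha> =
     Sup (ereal ` {\<sigma>. \<sigma> > 0 \<and> (\<exists>u\<in>besov M \<alpha> \<sigma>. \<not> (\<exists>c. AE x in M. u x = c))})"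


section \<open>Dirichlet forms\<close>

definition radon_full_support :: "'a::topological_space set \<Rightarrow> 'a measure \<Rightarrow> bool" where
  "radon_full_support K M \<longleftrightarrow>
     sets M = sets (restrict_space borel K) \<and>
     (\<forall>C\<subseteq>K. compact C \<longrightarrow> emeasure M C < \<infinity>) \<and>
     (\<forall>A\<in>sets M. emeasure M A = (SUP C\<in>{C. C \<subseteq> A \<and> compact C}. emeasure M C)) \<and>
     (\<forall>U. open U \<and> U \<inter> K \<noteq> {} \<longrightarrow> emeasure M (U \<inter> K) > 0)"

definition E1 :: "'a measure \<Rightarrow> (('a \<Rightarrow> real) \<Rightarrow> ('a \<Rightarrow> real) \<Rightarrow> real) \<Rightarrow> ('a \<Rightarrow> real) \<Rightarrow> real" where
  "E1 M E u = E u u + (\<integral>x. (u x)\<^sup>2 \<partial>M)"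

text \<open>The clause on functions vanishing almost everywhere says (via Cauchy-Schwarz) that the form
  is well defined on classes modulo null sets.  Closedness is completeness of the domain with
  respect to \<^const>\<open>E1\<close>.\<close>

definition dirichlet_form ::
  "'a measure \<Rightarrow> (('a \<Rightarrow> real) \<Rightarrow> ('a \<Rightarrow> real) \<Rightarrow> real) \<Rightarrow> ('a \<Rightarrow> real) set \<Rightarrow> bool" where
  "dirichlet_form M E F \<longleftrightarrow>
     F \<subseteq> L2 M \<and>
     (\<lambda>x. 0) \<in> F \<and>
     (\<forall>u\<in>F. \<forall>v\<in>F. (\<lambda>x. u x + v x) \<in> F) \<and>
     (\<forall>a. \<forall>u\<in>F. (\<lambda>x. a * u x) \<in> F) \<and>
     (\<forall>u\<in>F. \<forall>v\<in>F. E u v = E v u) \<and>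
     (\<forall>u\<in>F. \<forall>v\<in>F. \<forall>w\<in>F. E (\<lambda>x. u x + v x) w = E u w + E v w) \<and>
     (\<forall>a. \<forall>u\<in>F. \<forall>v\<in>F. E (\<lambda>x. a * u x) v = a * E u v) \<and>
     (\<forall>u\<in>F. E u u \<ge> 0) \<and>
     (\<forall>u\<in>F. (AE x in M. u x = 0) \<longrightarrow> E u u = 0) \<and>
     dense_in_L2 M F \<and>
     (\<forall>f. (\<forall>n::nat. f n \<in> F) \<and>
          (\<forall>e>0. \<exists>N. \<forall>m\<ge>N. \<forall>n\<ge>N. E1 M E (\<lambda>x. f m x - f n x) < e) \<longrightarrow>
          (\<exists>g\<in>F. (\<lambda>n. E1 M E (\<lambda>x. f n x - g x)) \<longlonglongrightarrow> 0)) \<and>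
     (\<forall>u\<in>F. (\<lambda>x. min (max (u x) 0) 1) \<in> F \<and>
        E (\<lambda>x. min (max (u x) 0) 1) (\<lambda>x. min (max (u x) 0) 1) \<le> E u u)"

type_synonym conductance = "cell list \<Rightarrow> plane \<Rightarrow> plane \<Rightarrow> real"

definition conductances :: "cell set \<Rightarrow> conductance \<Rightarrow> bool" where
  "conductances I c \<longleftrightarrow>
     (\<forall>\<omega>\<in>lists I. \<forall>x\<in>Vw \<omega>. \<forall>y\<in>Vw \<omega>. x \<noteq> y \<longrightarrow> c \<omega> x y > 0 \<and> c \<omega> x y = c \<omega> y x)"

text \<open>The sum over unordered pairs is half the sum over ordered pairs.\<close>

definition energy_form ::
  "cell set \<Rightarrow> conductance \<Rightarrow> nat \<Rightarrow> (plane \<Rightarrow> real) \<Rightarrow> (plane \<Rightarrow> real) \<Rightarrow> real" where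
  "energy_form I c n u v =
     (\<Sum>\<omega>\<in>words I n. (\<Sum>x\<in>Vw \<omega>. \<Sum>y\<in>Vw \<omega>. c \<omega> x y * ((u x - u y) * (v x - v y))) / 2)"

definition energy :: "cell set \<Rightarrow> conductance \<Rightarrow> nat \<Rightarrow> (plane \<Rightarrow> real) \<Rightarrow> real" where
  "energy I c n u = energy_form I c n u u"

definition primal_energy :: "cell set \<Rightarrow> nat \<Rightarrow> (plane \<Rightarrow> real) \<Rightarrow> real" where
  "primal_energy I = energy I (\<lambda>\<omega> x y. 1)"

text \<open>The energy on \<open>V I n\<close> only depends on the values on \<open>V I n\<close>, so total functions can be used
  in place of functions on \<open>V I n\<close>.\<close>

definition compatible :: "cell set \<Rightarrow> conductance \<Rightarrow> bool" where
  "compatible I c \<longleftrightarrow>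
     (\<forall>n u. let S = {energy I c (Suc n) v | v. \<forall>x\<in>V I n. v x = u x}
            in energy I c n u \<in> S \<and> (\<forall>e\<in>S. energy I c n u \<le> e))"

definition limit_energy :: "cell set \<Rightarrow> conductance \<Rightarrow> (plane \<Rightarrow> real) \<Rightarrow> ennreal" where
  "limit_energy I c u = lim (\<lambda>n. ennreal (energy I c n u))"

definition limit_dom :: "cell set \<Rightarrow> plane set \<Rightarrow> conductance \<Rightarrow> (plane \<Rightarrow> real) set" where
  "limit_dom I K c = {u. continuous_on K u \<and> limit_energy I c u < \<infinity>}"

definition limit_form ::
  "cell set \<Rightarrow> conductance \<Rightarrow> (plane \<Rightarrow> real) \<Rightarrow> (plane \<Rightarrow> real) \<Rightarrow> real" where
  "limit_form I c u v = lim (\<lambda>n. energy_form I c n u v)"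

definition dirichlet_form_on :: "cell set \<Rightarrow> plane set \<Rightarrow> conductance \<Rightarrow> bool" where
  "dirichlet_form_on I K c \<longleftrightarrow>
     conductances I c \<and> compatible I c \<and>
     (\<exists>\<nu>. radon_full_support K \<nu> \<and> dirichlet_form \<nu> (limit_form I c) (limit_dom I K c))"

definition non_primal :: "cell set \<Rightarrow> conductance \<Rightarrow> bool" where
  "non_primal I c \<longleftrightarrow> \<not> (\<forall>n. \<exists>a. \<forall>u. energy I c n u = a * primal_energy I n u)"

definition energy_self_similar :: "cell set \<Rightarrow> plane set \<Rightarrow> conductance \<Rightarrow> bool" where
  "energy_self_similar I K c \<longleftrightarrow>
     (\<exists>\<tau>. (\<forall>i\<in>I. 0 < \<tau> i \<and> \<tau> i < 1) \<and>
          (\<forall>u\<in>limit_dom I K c.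
             limit_energy I c u = (\<Sum>i\<in>I. ennreal (1 / \<tau> i) * limit_energy I c (u \<circ> cell_map i))))"

text \<open>Symmetry and positivity of the data \<open>c\<^sub>n = d n\<close> on \<^const>\<open>V0\<close> are inherited from those of the
  conductances they induce on the \<open>n\<close>-cells.\<close>

definition reverse_recursive :: "cell set \<Rightarrow> (nat \<Rightarrow> plane \<Rightarrow> plane \<Rightarrow> real) \<Rightarrow> conductance \<Rightarrow> bool" where
  "reverse_recursive I d c \<longleftrightarrow>
     conductances I c \<and> compatible I c \<and>
     (\<forall>\<omega>\<in>lists I. \<forall>x\<in>V0. \<forall>y\<in>V0. x \<noteq> y \<longrightarrow>
        c \<omega> (word_map \<omega> x) (word_map \<omega> y) = d (length \<omega>) x y)"

end

theory Submission
  imports Defs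
begin

text \<open>
  Everything is reduced to the primal energies \<open>PE n u\<close>, the sums of the squared increments of \<open>u\<close> over
  the edges of the cells of level \<open>n\<close>.  Put \<open>\<theta> = 7 powr (\<alpha> - 2 * \<sigma>)\<close>.  For \<open>2 * \<theta> < 1\<close> a Besov
  function of order \<open>\<sigma>\<close> has a continuous representative with \<open>PE n u \<le> C * \<theta> ^ n\<close> (limits of cell
  means, \<open>besov_continuous_rep\<close>), and conversely a continuous function with such a decay is a Besov
  function (\<open>decay_imp_besov\<close>).  So the question is how fast the energies of interesting functions can
  decay.  The analysis needs that the normalized Hausdorff measure gives mass \<open>17 ^ (- n)\<close> to each cell
  of level \<open>n\<close>, which follows from a mass distribution argument and Caratheodory's criterion.

  The point \<open>p1\<close> is joined to \<open>p3\<close> by a straight chain of \<open>7\<close> cells, all of them crossed from \<open>p1\<close> to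
  \<open>p3\<close>.  Iterating, the increment between \<open>p1\<close> and \<open>p3\<close> has to be distributed over \<open>7 ^ n\<close> increments of
  the same kind, so \<open>7 ^ n * PE n u\<close> bounds it (\<open>path13\<close>).  If the energies decay faster than
  \<open>7 ^ (- n)\<close>, then \<open>u\<close> takes the same values at the images of \<open>p1\<close> and \<open>p3\<close> in every cell.  For such
  flat functions the straight chains cost nothing and carry nothing; an increment between \<open>p1\<close> and \<open>p2\<close> is
  distributed over the top cells and the seven right cells that are not crossed from \<open>p1\<close> to \<open>p3\<close>,
  and the optimal distribution has resistance \<open>17/2\<close> (\<open>path12\<close>).  Hence energies decaying faster than
  \<open>(2/17) ^ n\<close> force \<open>u\<close> to be constant.  Both rates are attained by self-similar functions with
  prescribed values at the corners (\<open>besov_functions_exist\<close>).  Glueing copies of them over the cells of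
  a fixed level gives density in \<open>C(K)\<close> at the rate \<open>1/7\<close>.  At the rate \<open>2/17\<close> flat functions with arbitrary corner
  values do not exist, but a flat bump vanishing at the corners and equal to \<open>1\<close> on a whole cell does;
  iterating it gives cutoffs equal to \<open>1\<close> outside a set of small measure, whence the density in
  \<open>L\<^sup>2\<close>.

  For a self-similar Dirichlet form the weights of the left, right and top cells are
  chosen so that one subdivision step reproduces the unit triangle network exactly.  The energies with these
  weights are then compatible, and the uniform contraction of all resistances turns the limit into a
  Dirichlet form.

  In the reverse recursive method all cells of one level carry the same three conductances.  The straight
  chains bound the effective conductance between \<open>p1\<close> and \<open>p3\<close> at level \<open>n\<close> by a multiple of
  \<open>7 ^ n\<close>, while testing with flat functions shows that the energy of a fixed function is at most
  \<open>(2/17) ^ n\<close> times this conductance, up to a constant.  Since \<open>14/17 < 1\<close> this function has no energy, which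
  contradicts the positivity of the conductances (\<open>no_reverse_recursion\<close>).
\<close>

section \<open>Lattice coordinates\<close>

definition cx :: "plane \<Rightarrow> real" where "cx x = fst x - snd x / sqrt 3"
definition cy :: "plane \<Rightarrow> real" where "cy x = 2 * snd x / sqrt 3"

lemma cx_cy_eqI:
  assumes "cx x = cx y" "cy x = cy y" shows "x = y"
proof -
  have "snd x = snd y" using assms(2) by (simp add: cy_def)
  moreover have "fst x = fst y" using assms(1) \<open>snd x = snd y\<close> by (simp add: cx_def)
  ultimately show ?thesis by (simp add: prod_eq_iff)
qed

lemma cx_V0 [simp]: "cx p1 = 0" "cx p2 = 1" "cx p3 = 0"
  and cy_V0 [simp]: "cy p1 = 0" "cy p2 = 0" "cy p3 = 1"
  by (simp_all add: cx_def cy_def p1_def p2_def p3_def)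

lemma V0_distinct [simp]: "p1 \<noteq> p2" "p2 \<noteq> p1" "p1 \<noteq> p3" "p3 \<noteq> p1" "p2 \<noteq> p3" "p3 \<noteq> p2"
  by (auto simp: p1_def p2_def p3_def)

lemma V0_mem [simp]: "p1 \<in> V0" "p2 \<in> V0" "p3 \<in> V0" and finite_V0 [simp]: "finite V0"
  by (auto simp: V0_def)

lemma cx_diff: "cx (x - y) = cx x - cx y" and cy_diff: "cy (x - y) = cy x - cy y"
  by (simp_all add: cx_def cy_def field_simps)

lemma continuous_on_cx: "continuous_on S cx" and continuous_on_cy: "continuous_on S cy"
  unfolding cx_def[abs_def] cy_def[abs_def] by (intro continuous_intros; simp)+

lemma norm_lattice: "(norm x)\<^sup>2 = (cx x)\<^sup>2 + cx x * cy x + (cy x)\<^sup>2" for x :: plane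
proof -
  have s: "sqrt 3 * sqrt 3 = 3" by simp
  have "(cx x)\<^sup>2 + cx x * cy x + (cy x)\<^sup>2 = (fst x)\<^sup>2 + 3 * (snd x)\<^sup>2 / (sqrt 3 * sqrt 3)"
    by (simp add: cx_def cy_def power2_eq_square field_simps)
  also have "\<dots> = (fst x)\<^sup>2 + (snd x)\<^sup>2" by simp
  finally show ?thesis by (simp add: norm_prod_def)
qed

lemma abs_lattice_le: "\<bar>cx x\<bar> \<le> 2 * norm x" "\<bar>cy x\<bar> \<le> 2 * norm x" "\<bar>cx x + cy x\<bar> \<le> 2 * norm x"
  for x :: plane
proof -
  have *: "a\<^sup>2 + a * b + b\<^sup>2 = 3/4 * a\<^sup>2 + (a/2 + b)\<^sup>2"
          "a\<^sup>2 + a * b + b\<^sup>2 = 3/4 * b\<^sup>2 + (b/2 + a)\<^sup>2"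
          "a\<^sup>2 + a * b + b\<^sup>2 = 3/4 * (a+b)\<^sup>2 + (a-b)\<^sup>2/4" for a b :: real
    by (simp_all add: power2_eq_square field_simps)
  have "t\<^sup>2 \<le> (2 * norm x)\<^sup>2" if "3/4 * t\<^sup>2 \<le> (norm x)\<^sup>2" for t
  proof -
    have "0 \<le> (norm x)\<^sup>2" "(2 * norm x)\<^sup>2 = 4 * (norm x)\<^sup>2" by (simp_all add: power_mult_distrib)
    then show ?thesis using that by linarith
  qed
  then have "\<bar>t\<bar> \<le> 2 * norm x" if "3/4 * t\<^sup>2 \<le> (norm x)\<^sup>2" for t
    using that by (metis abs_le_square_iff abs_mult abs_norm_cancel abs_numeral)
  note bound = this
  have "3/4 * (cx x)\<^sup>2 \<le> (norm x)\<^sup>2" "3/4 * (cy x)\<^sup>2 \<le> (norm x)\<^sup>2" "3/4 * (cx x + cy x)\<^sup>2 \<le> (norm x)\<^sup>2"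
    unfolding norm_lattice using *[of "cx x" "cy x"] zero_le_power2[of "cx x / 2 + cy x"]
      zero_le_power2[of "cy x / 2 + cx x"] zero_le_power2[of "cx x - cy x"] by linarith+
  then show "\<bar>cx x\<bar> \<le> 2 * norm x" "\<bar>cy x\<bar> \<le> 2 * norm x" "\<bar>cx x + cy x\<bar> \<le> 2 * norm x"
    using bound by blast+
qed

lemma cx_cell_map [simp]: "cx (cell_map i x) = (cx x + real (fst i)) / 7"
  and cy_cell_map [simp]: "cy (cell_map i x) = (cy x + real (snd i)) / 7"
  by (simp_all add: cell_map_def q_def cx_def cy_def p2_def p3_def field_simps)

lemma inj_cell_map: "inj (cell_map i)"
  by (auto simp: inj_def cell_map_def)

lemma cell_map_eq_iff [simp]: "cell_map i x = cell_map i y \<longleftrightarrow> x = y"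
  using inj_cell_map by (metis injD)

lemma q_coords [simp]: "cx (q i j) = i / 7" "cy (q i j) = j / 7"
  by (simp_all add: q_def cx_def cy_def p2_def p3_def field_simps)

lemma q_eq_iff [simp]: "q i j = q i' j' \<longleftrightarrow> i = i' \<and> j = j'"
  by (metis divide_cancel_right of_nat_eq_iff q_coords zero_neq_numeral)

lemma cell_map_V0 [simp]:
  "cell_map (i, j) p1 = q i j" "cell_map (i, j) p2 = q (Suc i) j" "cell_map (i, j) p3 = q i (Suc j)"
  by (intro cx_cy_eqI; simp)+

lemma q_corners: "q 0 0 = p1" "q 7 0 = p2" "q 0 7 = p3"
  by (intro cx_cy_eqI; simp)+

subsection \<open>Words\<close>

lemma word_map_Nil [simp]: "word_map [] = id"
  and word_map_Cons [simp]: "word_map (i # w) = cell_map i \<circ> word_map w"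
  by (simp_all add: word_map_def)

lemma word_map_append: "word_map (v @ w) = word_map v \<circ> word_map w"
  by (induction v) (auto simp: comp_assoc)

lemma inj_word_map: "inj (word_map w)"
  by (induction w) (simp_all add: inj_compose inj_cell_map del: comp_apply flip: comp_def)

lemma word_map_eq_iff [simp]: "word_map w x = word_map w y \<longleftrightarrow> x = y"
  using inj_word_map by (metis injD)

primrec posx :: "cell list \<Rightarrow> nat" where
  "posx [] = 0" | "posx (i # w) = posx w + 7 ^ length w * fst i"
primrec posy :: "cell list \<Rightarrow> nat" where
  "posy [] = 0" | "posy (i # w) = posy w + 7 ^ length w * snd i"

lemma cx_word_map: "cx (word_map w x) = (cx x + real (posx w)) / 7 ^ length w"
  and cy_word_map: "cy (word_map w x) = (cy x + real (posy w)) / 7 ^ length w"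
  by (induction w) (auto simp: field_simps)

lemma dist_word_map: "dist (word_map w x) (word_map w y) = dist x y / 7 ^ length w"
proof (induction w)
  case (Cons i w)
  have "dist (cell_map i a) (cell_map i b) = dist a b / 7" for a b
    by (simp add: cell_map_def dist_norm flip: scaleR_diff_right)
  then have "dist (word_map (i # w) x) (word_map (i # w) y) = dist (word_map w x) (word_map w y) / 7"
    unfolding word_map_Cons comp_apply .
  then show ?case using Cons by simp
qed simp

lemma continuous_on_word_map: "continuous_on S (word_map w)"
proof (rule continuous_onI)
  fix x e assume "x \<in> S" "(0::real) < e"
  have "dist (word_map w y) (word_map w x) \<le> dist y x" for y
    by (simp add: dist_word_map divide_le_eq mult_le_cancel_left1)
  then show "\<exists>d>0. \<forall>x'\<in>S. dist x' x < d \<longrightarrow> dist (word_map w x') (word_map w x) \<le> e"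
    using \<open>0 < e\<close> by (metis less_eq_real_def order_trans)
qed

lemma words_0 [simp]: "words I 0 = {[]}"
  by (auto simp: words_def)

lemma words_Suc: "words I (Suc n) = (\<lambda>(i, w). i # w) ` (I \<times> words I n)"
  by (auto simp: words_def length_Suc_conv image_iff)

lemma words_1: "words I 1 = (\<lambda>i. [i]) ` I" "words I (Suc 0) = (\<lambda>i. [i]) ` I"
  by (auto simp: words_Suc)

lemma finite_words: "finite I \<Longrightarrow> finite (words I n)"
  by (induction n) (auto simp: words_Suc)

lemma card_words: "finite I \<Longrightarrow> card (words I n) = card I ^ n"
proof (induction n)
  case (Suc n)
  have "inj_on (\<lambda>(i, w). i # w) (I \<times> words I n)" by (auto simp: inj_on_def)
  with Suc show ?case by (simp add: words_Suc card_image card_cartesian_product)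
qed simp

lemma sum_words_Suc:
  "(\<Sum>w\<in>words I (Suc n). f w) = (\<Sum>i\<in>I. \<Sum>w\<in>words I n. f (i # w))" if "finite I"
proof -
  have "inj_on (\<lambda>(i, w). i # w) (I \<times> words I n)" by (auto simp: inj_on_def)
  then show ?thesis unfolding words_Suc
    by (simp add: sum.reindex sum.cartesian_product case_prod_unfold that finite_words)
qed

lemma sum_words_add:
  "finite I \<Longrightarrow> (\<Sum>w\<in>words I (m + n). f w) = (\<Sum>v\<in>words I m. \<Sum>w\<in>words I n. f (v @ w))"
proof (induction m arbitrary: f)
  case (Suc m)
  have "(\<Sum>w\<in>words I (Suc m + n). f w) = (\<Sum>i\<in>I. \<Sum>w\<in>words I (m + n). f (i # w))"
    using Suc.prems by (simp add: sum_words_Suc)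
  also have "\<dots> = (\<Sum>i\<in>I. \<Sum>v\<in>words I m. \<Sum>w\<in>words I n. f ((i # v) @ w))"
    by (rule sum.cong[OF refl]) (simp add: Suc)
  finally show ?case using Suc.prems by (simp only: sum_words_Suc)
qed simp

lemma words_append: "v \<in> words I m \<Longrightarrow> w \<in> words I n \<Longrightarrow> v @ w \<in> words I (m + n)"
  by (auto simp: words_def)

lemma words_add_split:
  assumes "w \<in> words I (m + n)"
  obtains u v where "w = u @ v" "u \<in> words I m" "v \<in> words I n"
proof -
  have "take m w \<in> words I m" "drop m w \<in> words I n"
    using assms by (auto simp: words_def dest: in_set_takeD in_set_dropD)
  then show ?thesis using that[of "take m w" "drop m w"] by simp
qed

abbreviation lattice_cells :: "cell set" where "lattice_cells \<equiv> {..6} \<times> {..6}"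

lemma pos_less:
  assumes "set w \<subseteq> lattice_cells" shows "posx w < 7 ^ length w \<and> posy w < 7 ^ length w"
  using assms
proof (induction w)
  case (Cons i w)
  have "7 ^ length w * fst i \<le> 7 ^ length w * 6" "7 ^ length w * snd i \<le> 7 ^ length w * 6"
    using Cons.prems by auto
  moreover have "posx w < 7 ^ length w" "posy w < 7 ^ length w" using Cons by auto
  ultimately have "posx w + 7 ^ length w * fst i < 7 ^ length w + 7 ^ length w * 6"
    "posy w + 7 ^ length w * snd i < 7 ^ length w + 7 ^ length w * 6"
    by linarith+
  then show ?case by simp
qed simp

lemma pos_inj:
  assumes "length v = length w" "set v \<subseteq> lattice_cells" "set w \<subseteq> lattice_cells"
    "posx v = posx w" "posy v = posy w"
  shows "v = w"
  using assms
proof (induction v w rule: list_induct2)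
  case (Cons i v j w)
  have *: "a + m * b = a' + m * b' \<Longrightarrow> a < m \<Longrightarrow> a' < m \<Longrightarrow> a = a' \<and> b = b'" for a m b a' b' :: nat
  proof -
    assume h: "a + m * b = a' + m * b'" "a < m" "a' < m"
    then have "(a + m * b) mod m = (a' + m * b') mod m" "(a + m * b) div m = (a' + m * b') div m"
      by auto
    then have "a mod m = a' mod m" by simp
    then have "a = a'" using h(2,3) by simp
    moreover have "m > 0" using h by simp
    ultimately show ?thesis using h by simp
  qed
  have l: "posx v < 7 ^ length v" "posy v < 7 ^ length v" "posx w < 7 ^ length v" "posy w < 7 ^ length v"
    using pos_less[of v] pos_less[of w] Cons by auto
  have "posx v = posx w \<and> fst i = fst j" "posy v = posy w \<and> snd i = snd j"
    using *[of "posx v" "7 ^ length v" "fst i" "posx w" "fst j"]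
      *[of "posy v" "7 ^ length v" "snd i" "posy w" "snd j"] Cons.prems Cons.hyps l by simp_all
  then show ?case using Cons by (auto simp: prod_eq_iff)
qed simp

definition tri_hull :: "plane set" where
  "tri_hull = {x. 0 \<le> cx x \<and> 0 \<le> cy x \<and> cx x + cy x \<le> 1}"

lemma V0_iff: "x \<in> V0 \<longleftrightarrow> (cx x = 0 \<and> cy x = 0) \<or> (cx x = 1 \<and> cy x = 0) \<or> (cx x = 0 \<and> cy x = 1)"
  unfolding V0_def using cx_cy_eqI[of x p1] cx_cy_eqI[of x p2] cx_cy_eqI[of x p3] by auto

text \<open>The upward triangles of a triangular lattice only overlap at common corners.\<close>

lemma lattice_overlap:
  assumes x: "x \<in> tri_hull" and y: "y \<in> tri_hull"
    and eq: "cx x + real i = cx y + real i'" "cy x + real j = cy y + real j'"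
    and ne: "(i, j) \<noteq> (i', j')"
  shows "x \<in> V0 \<and> y \<in> V0"
proof -
  define a b c d where "a = cx x" "b = cy x" "c = cx y" "d = cy y"
  note defs = this
  have T: "0 \<le> a" "0 \<le> b" "a + b \<le> 1" "0 \<le> c" "0 \<le> d" "c + d \<le> 1"
    using x y by (auto simp: tri_hull_def defs)
  have k: "a - c = of_int (int i' - int i)" "b - d = of_int (int j' - int j)"
    using eq by (auto simp: defs)
  define k l where "k = int i' - int i" "l = int j' - int j"
  note kl = this
  have kl': "a - c = of_int k" "b - d = of_int l" using k by (auto simp: kl)
  have "a - c \<le> 1" "- 1 \<le> a - c" "b - d \<le> 1" "- 1 \<le> b - d" "(a - c) + (b - d) \<le> 1" "- 1 \<le> (a - c) + (b - d)"
    using T by linarith+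
  then have B: "k \<le> 1" "k \<ge> -1" "l \<le> 1" "l \<ge> -1" "k + l \<le> 1" "k + l \<ge> -1"
    unfolding kl' by linarith+
  have "k \<noteq> 0 \<or> l \<noteq> 0" using ne by (auto simp: kl)
  moreover have "k = -1 \<or> k = 0 \<or> k = 1" "l = -1 \<or> l = 0 \<or> l = 1" using B by linarith+
  ultimately have "(k = 0 \<and> l = 1) \<or> (k = 0 \<and> l = -1) \<or> (k = 1 \<and> l = 0) \<or> (k = -1 \<and> l = 0)
     \<or> (k = 1 \<and> l = -1) \<or> (k = -1 \<and> l = 1)"
    using B(5,6) by (elim disjE) simp_all
  then consider "k = 0 \<and> l = 1" | "k = 0 \<and> l = -1" | "k = 1 \<and> l = 0"
    | "k = -1 \<and> l = 0" | "k = 1 \<and> l = -1" | "k = -1 \<and> l = 1"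
    by blast
  then show ?thesis
  proof cases
    case 1
    then have "a - c = 0" "b - d = 1" using kl' by auto
    then have "a = 0 \<and> b = 1 \<and> c = 0 \<and> d = 0" using T by (intro conjI; linarith)
    then show ?thesis by (simp add: V0_iff defs)
  next
    case 2
    then have "a - c = 0" "b - d = -1" using kl' by auto
    then have "a = 0 \<and> b = 0 \<and> c = 0 \<and> d = 1" using T by (intro conjI; linarith)
    then show ?thesis by (simp add: V0_iff defs)
  next
    case 3
    then have "a - c = 1" "b - d = 0" using kl' by auto
    then have "a = 1 \<and> b = 0 \<and> c = 0 \<and> d = 0" using T by (intro conjI; linarith)
    then show ?thesis by (simp add: V0_iff defs)
  next
    case 4
    then have "a - c = -1" "b - d = 0" using kl' by auto
    then have "a = 0 \<and> b = 0 \<and> c = 1 \<and> d = 0" using T by (intro conjI; linarith)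
    then show ?thesis by (simp add: V0_iff defs)
  next
    case 5
    then have "a - c = 1" "b - d = -1" using kl' by auto
    then have "a = 1 \<and> b = 0 \<and> c = 0 \<and> d = 1" using T by (intro conjI; linarith)
    then show ?thesis by (simp add: V0_iff defs)
  next
    case 6
    then have "a - c = -1" "b - d = 1" using kl' by auto
    then have "a = 0 \<and> b = 1 \<and> c = 1 \<and> d = 0" using T by (intro conjI; linarith)
    then show ?thesis by (simp add: V0_iff defs)
  qed
qed

section \<open>The sickle\<close>

locale sickle =
  fixes r :: "nat \<Rightarrow> cell" and z :: "nat \<Rightarrow> plane" and K :: "plane set"
  assumes chain: "right_chain r z" and attractor: "is_attractor (sickle_cells r) K"
begin

abbreviation I :: "cell set" where "I \<equiv> sickle_cells r"

lemma r_le: "k \<in> {1..9} \<Longrightarrow> fst (r k) + snd (r k) \<le> 6"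
  and z_ends: "z 0 = q 2 5" "z 9 = q 7 0"
  and z_step: "k \<in> {1..9} \<Longrightarrow> z (k - 1) \<noteq> z k"
  and z_vertex: "k \<in> {1..9} \<Longrightarrow> {z (k - 1), z k} \<subseteq> cell_map (r k) ` V0"
  and consecutive: "k \<in> {1..8} \<Longrightarrow> cell_triangle (r k) \<inter> cell_triangle (r (k + 1)) = {z k}"
  and nonconsecutive:
    "k \<in> {1..9} \<Longrightarrow> l \<in> {1..9} \<Longrightarrow> k + 1 < l \<Longrightarrow> cell_triangle (r k) \<inter> cell_triangle (r l) = {}"
  and right_separate: "(\<Union>k\<in>{1..9}. cell_triangle (r k)) \<inter>
     (\<Union>ij\<in>left_cells \<union> top_cells. cell_triangle ij) = {z 0}"
  and card_12: "card {k\<in>{1..9}. {z (k - 1), z k} = cell_map (r k) ` {p1, p2}} = 4"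
  and card_23: "card {k\<in>{1..9}. {z (k - 1), z k} = cell_map (r k) ` {p2, p3}} = 3"
  and card_31: "card {k\<in>{1..9}. {z (k - 1), z k} = cell_map (r k) ` {p3, p1}} = 2"
proof -
  note c0 = chain[unfolded right_chain_def]
  note c1 = c0[THEN conjunct2] note c2 = c1[THEN conjunct2] note c3 = c2[THEN conjunct2]
  note c4 = c3[THEN conjunct2] note c5 = c4[THEN conjunct2] note c6 = c5[THEN conjunct2]
  note c7 = c6[THEN conjunct2] note c8 = c7[THEN conjunct2]
  show "k \<in> {1..9} \<Longrightarrow> fst (r k) + snd (r k) \<le> 6" by (rule bspec[OF c0[THEN conjunct1]])
  show "z 0 = q 2 5" "z 9 = q 7 0" by (rule c1[THEN conjunct1], rule c2[THEN conjunct1])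
  show "k \<in> {1..9} \<Longrightarrow> z (k - 1) \<noteq> z k" "k \<in> {1..9} \<Longrightarrow> {z (k - 1), z k} \<subseteq> cell_map (r k) ` V0"
    by (rule bspec[OF c3[THEN conjunct1], THEN conjunct1], assumption,
        rule bspec[OF c3[THEN conjunct1], THEN conjunct2], assumption)
  show "k \<in> {1..8} \<Longrightarrow> cell_triangle (r k) \<inter> cell_triangle (r (k + 1)) = {z k}"
    by (rule bspec[OF c4[THEN conjunct1]])
  show "k \<in> {1..9} \<Longrightarrow> l \<in> {1..9} \<Longrightarrow> k + 1 < l \<Longrightarrow> cell_triangle (r k) \<inter> cell_triangle (r l) = {}"
    by (rule bspec[OF bspec[OF c5[THEN conjunct1]], THEN mp])
  show "(\<Union>k\<in>{1..9}. cell_triangle (r k)) \<inter> (\<Union>ij\<in>left_cells \<union> top_cells. cell_triangle ij) = {z 0}"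
    "card {k\<in>{1..9}. {z (k - 1), z k} = cell_map (r k) ` {p1, p2}} = 4"
    "card {k\<in>{1..9}. {z (k - 1), z k} = cell_map (r k) ` {p2, p3}} = 3"
    "card {k\<in>{1..9}. {z (k - 1), z k} = cell_map (r k) ` {p3, p1}} = 2"
    by (rule c6[THEN conjunct1], rule c7[THEN conjunct1], rule c8[THEN conjunct1], rule c8[THEN conjunct2])
qed

lemma finite_I [simp]: "finite I"
  by (simp add: sickle_cells_def left_cells_def top_cells_def)

lemma I_le: "i \<in> I \<Longrightarrow> fst i + snd i \<le> 6"
  using r_le by (auto simp: sickle_cells_def left_cells_def top_cells_def)

lemma I_lattice: "I \<subseteq> lattice_cells"
  using I_le by fastforce

lemma words_lattice: "w \<in> words I n \<Longrightarrow> set w \<subseteq> lattice_cells"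
  using I_lattice by (auto simp: words_def)

lemma left_top_I: "j \<le> 4 \<Longrightarrow> (0, j) \<in> I" "(0, 5) \<in> I" "(Suc 0, 5) \<in> I" "(0, 6) \<in> I"
proof -
  show "j \<le> 4 \<Longrightarrow> (0, j) \<in> I"
    by (auto simp: sickle_cells_def left_cells_def top_cells_def)
qed (auto simp: sickle_cells_def top_cells_def)

lemma r_I: "k \<in> {1..9} \<Longrightarrow> r k \<in> I"
  by (auto simp: sickle_cells_def)

lemma vertex_in_triangle: "p \<in> V0 \<Longrightarrow> cell_map i p \<in> cell_triangle i"
  by (auto simp: cell_triangle_def hull_inc)

lemma r9: "r 9 = (6, 0)"
proof -
  obtain p where p: "p \<in> V0" "z 9 = cell_map (r 9) p" using z_vertex[of 9] by auto
  have "cx (q 7 0) = cx (cell_map (r 9) p)" "cy (q 7 0) = cy (cell_map (r 9) p)"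
    using p z_ends by simp_all
  then have "cx p + real (fst (r 9)) = 7" "cy p + real (snd (r 9)) = 0" by simp_all
  moreover have "fst (r 9) \<le> 6" using r_le[of 9] by simp
  ultimately have "fst (r 9) = 6 \<and> snd (r 9) = 0" using p(1) unfolding V0_iff by auto
  then show ?thesis by (simp add: prod_eq_iff)
qed

lemma corner_I: "(0, 0) \<in> I" "(6, 0) \<in> I" "(0, 6) \<in> I"
  using left_top_I r_I[of 9] r9 by auto

subsection \<open>The attractor\<close>

lemma compact_K: "compact K" and K_nonempty: "K \<noteq> {}" and K_eq: "K = (\<Union>i\<in>I. cell_map i ` K)"
  using attractor unfolding is_attractor_def by blast+

lemma closed_K: "closed K" by (simp add: compact_K compact_imp_closed)

lemma K_borel [measurable, simp]: "K \<in> sets borel" by (simp add: closed_K borel_closed)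

lemma cell_map_K: "i \<in> I \<Longrightarrow> x \<in> K \<Longrightarrow> cell_map i x \<in> K"
  using K_eq by blast

lemma word_map_K: "w \<in> words I n \<Longrightarrow> x \<in> K \<Longrightarrow> word_map w x \<in> K"
proof (induction n arbitrary: w)
  case (Suc n)
  then obtain i v where "w = i # v" "i \<in> I" "v \<in> words I n" by (auto simp: words_Suc)
  with Suc show ?case by (simp add: cell_map_K)
qed simp

lemma K_words: "x \<in> K \<Longrightarrow> \<exists>w\<in>words I n. \<exists>y\<in>K. x = word_map w y"
proof (induction n arbitrary: x)
  case (Suc n)
  obtain i y where i: "i \<in> I" "y \<in> K" "x = cell_map i y" using Suc.prems K_eq by blast
  obtain w y' where "w \<in> words I n" "y' \<in> K" "y = word_map w y'" using Suc.IH i(2) by blast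
  with i show ?case by (intro bexI[of _ "i # w"] bexI[of _ y']) (auto simp: words_Suc)
qed simp

lemma K_tri_hull: "K \<subseteq> tri_hull"
proof -
  obtain x0 where x0: "x0 \<in> K" "\<And>y. y \<in> K \<Longrightarrow> cx x0 \<le> cx y"
    using continuous_attains_inf[OF compact_K K_nonempty continuous_on_cx] by blast
  obtain i y where "y \<in> K" "x0 = cell_map i y" using x0(1) K_eq by blast
  then have "7 * cx x0 = cx y + real (fst i)" by simp
  then have 1: "0 \<le> cx x0" using x0(2)[OF \<open>y \<in> K\<close>] by linarith
  obtain y0 where y0: "y0 \<in> K" "\<And>y. y \<in> K \<Longrightarrow> cy y0 \<le> cy y"
    using continuous_attains_inf[OF compact_K K_nonempty continuous_on_cy] by blast
  obtain i y where "y \<in> K" "y0 = cell_map i y" using y0(1) K_eq by blast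
  then have "7 * cy y0 = cy y + real (snd i)" by simp
  then have 2: "0 \<le> cy y0" using y0(2)[OF \<open>y \<in> K\<close>] by linarith
  obtain m where m: "m \<in> K" "\<And>y. y \<in> K \<Longrightarrow> cx y + cy y \<le> cx m + cy m"
    using continuous_attains_sup[OF compact_K K_nonempty
        continuous_on_add[OF continuous_on_cx continuous_on_cy]] by blast
  obtain i y where iy: "i \<in> I" "y \<in> K" "m = cell_map i y" using m(1) K_eq by blast
  define n where "n = real (fst i + snd i)"
  have "7 * cx m + 7 * cy m = cx y + cy y + n" using iy(3) by (simp add: n_def add_divide_distrib)
  moreover have "n \<le> 6" unfolding n_def using I_le[OF iy(1)] by linarith
  ultimately have 3: "cx m + cy m \<le> 1" using m(2)[OF iy(2)] by linarith
  show ?thesis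
  proof
    fix x assume "x \<in> K"
    then show "x \<in> tri_hull"
      using 1 2 3 x0(2)[of x] y0(2)[of x] m(2)[of x] unfolding tri_hull_def by auto
  qed
qed

lemma K_coords: assumes "x \<in> K" shows "0 \<le> cx x" "0 \<le> cy x" "cx x + cy x \<le> 1"
  using subsetD[OF K_tri_hull assms] by (simp_all add: tri_hull_def)

lemma fixed_point_in_K:
  assumes "i \<in> I" "cell_map i p = p" shows "p \<in> K"
proof -
  obtain x where x: "x \<in> K" using K_nonempty by blast
  have w: "replicate n i \<in> words I n" for n using assms(1) by (auto simp: words_def)
  have fixp: "word_map (replicate n i) p = p" for n by (induction n) (auto simp: assms(2))
  have d: "dist (word_map (replicate n i) x) p = dist x p / 7 ^ n" for n
    using dist_word_map[of "replicate n i" x p] fixp[of n] by simp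
  have "(\<lambda>n. dist x p * (1/7) ^ n) \<longlonglongrightarrow> dist x p * 0"
    by (intro tendsto_mult tendsto_const LIMSEQ_realpow_zero) auto
  then have "(\<lambda>n. dist (word_map (replicate n i) x) p) \<longlonglongrightarrow> 0"
    by (simp add: d power_divide)
  then have "(\<lambda>n. word_map (replicate n i) x) \<longlonglongrightarrow> p" using tendsto_dist_iff by blast
  moreover have "word_map (replicate n i) x \<in> K" for n using word_map_K[OF w x] .
  ultimately show ?thesis
    using closed_sequentially[OF closed_K, of "\<lambda>n. word_map (replicate n i) x" p] by simp
qed

lemma corner_fixed: "cell_map (0, 0) p1 = p1" "cell_map (6, 0) p2 = p2" "cell_map (0, 6) p3 = p3"
  by (simp_all add: q_corners)

lemma V0_K: "V0 \<subseteq> K"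
  unfolding V0_def using fixed_point_in_K[OF corner_I(1) corner_fixed(1)] fixed_point_in_K[OF corner_I(2) corner_fixed(2)]
    fixed_point_in_K[OF corner_I(3) corner_fixed(3)] by simp

lemma p_K [simp]: "p1 \<in> K" "p2 \<in> K" "p3 \<in> K"
  using V0_K by (auto simp: V0_def)

lemma V_words: "V I n = (\<Union>w\<in>words I n. word_map w ` V0)"
proof (induction n)
  case (Suc n)
  have "V I (Suc n) = (\<Union>i\<in>I. \<Union>w\<in>words I n. cell_map i ` word_map w ` V0)" by (simp add: Suc image_UN)
  also have "\<dots> = (\<Union>w\<in>words I (Suc n). word_map w ` V0)"
    by (simp add: words_Suc image_comp case_prod_unfold comp_def) force
  finally show ?case .
qed simp

lemma dist_K_le: assumes "x \<in> K" "y \<in> K" shows "dist x y \<le> 5/4"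
proof -
  define a b where "a = cx (x - y)" "b = cy (x - y)"
  note ab = this
  have "-1 \<le> a" "a \<le> 1" "-1 \<le> b" "b \<le> 1" "-1 \<le> a + b" "a + b \<le> 1"
    using K_coords[OF assms(1)] K_coords[OF assms(2)] by (auto simp: ab cx_diff cy_diff)
  then have "a\<^sup>2 \<le> 1" "b\<^sup>2 \<le> 1" "(a + b)\<^sup>2 \<le> 1"
    by (auto simp: abs_square_le_1 abs_le_iff)
  moreover have "2 * (norm (x - y))\<^sup>2 = a\<^sup>2 + b\<^sup>2 + (a + b)\<^sup>2"
    unfolding norm_lattice ab by (simp add: power2_eq_square algebra_simps)
  ultimately have "(norm (x - y))\<^sup>2 \<le> (5/4)\<^sup>2" by (simp add: power2_eq_square)
  then show ?thesis unfolding dist_norm by (rule power2_le_imp_le) simp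
qed


text \<open>Post-critical finiteness at every level: two cells are triangles of the same
  lattice.\<close>

lemma cell_overlap:
  assumes w: "w \<in> words I n" and w': "w' \<in> words I n" and ne: "w \<noteq> w'"
    and x: "x \<in> K" and y: "y \<in> K" and eq: "word_map w x = word_map w' y"
  shows "x \<in> V0 \<and> y \<in> V0"
proof (rule lattice_overlap)
  have len: "length w = n" "length w' = n" using w w' by (auto simp: words_def)
  show "x \<in> tri_hull" "y \<in> tri_hull" using x y K_tri_hull by auto
  show "cx x + real (posx w) = cx y + real (posx w')" "cy x + real (posy w) = cy y + real (posy w')"
    using arg_cong[OF eq, of cx] arg_cong[OF eq, of cy] len by (auto simp: cx_word_map cy_word_map)
  show "(posx w, posy w) \<noteq> (posx w', posy w')"
    using pos_inj[of w w'] ne len words_lattice[OF w] words_lattice[OF w'] by auto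
qed

text \<open>The differences of the lattice positions are integers.  A distance below half a cell
  size leaves only the adjacent positions and, because of the shape of the triangles, these cells
  share a corner.\<close>

lemma near_cells:
  assumes w: "w \<in> words I n" and w': "w' \<in> words I n" and x: "x \<in> K" and y: "y \<in> K"
    and near: "dist (word_map w x) (word_map w' y) < 1 / (2 * 7 ^ n)"
  shows "\<exists>p\<in>V0. \<exists>p'\<in>V0. word_map w p = word_map w' p'"
    and "\<bar>int (posx w) - int (posx w')\<bar> \<le> 1 \<and> \<bar>int (posy w) - int (posy w')\<bar> \<le> 1"
proof -
  have len: "length w = n" "length w' = n" using w w' by (auto simp: words_def)
  define k l where "k = int (posx w) - int (posx w')" "l = int (posy w) - int (posy w')"
  note kl = this
  define d where "d = word_map w x - word_map w' y"
  have d: "norm d < 1 / (2 * 7 ^ n)" using near by (simp add: d_def dist_norm)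
  have "7 ^ n * cx d = cx x - cx y + of_int k" "7 ^ n * cy d = cy x - cy y + of_int l"
    unfolding d_def cx_diff cy_diff cx_word_map cy_word_map len kl by (simp_all add: field_simps)
  note e12 = this
  have e3: "(cx x + cy x) - (cx y + cy y) + of_int (k + l) = 7 ^ n * (cx d + cy d)"
    using e12 by (simp add: algebra_simps)
  have small: "\<bar>7 ^ n * t\<bar> < 1"  if "\<bar>t\<bar> \<le> 2 * norm d" for t :: real
  proof -
    have "\<bar>7 ^ n * t\<bar> = 7 ^ n * \<bar>t\<bar>" by (simp add: abs_mult)
    also have "\<dots> \<le> 7 ^ n * (2 * norm d)" using that by simp
    also have "\<dots> < 1" using d by (simp add: field_simps)
    finally show ?thesis .
  qed
  have B: "\<bar>cx x - cx y + of_int k\<bar> < 1" "\<bar>cy x - cy y + of_int l\<bar> < 1"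
    "\<bar>(cx x + cy x) - (cx y + cy y) + of_int (k + l)\<bar> < 1"
    unfolding e3 e12[symmetric] using small abs_lattice_le[of d] by blast+
  have "\<bar>k\<bar> \<le> 1" "\<bar>l\<bar> \<le> 1" "\<bar>k + l\<bar> \<le> 1"
    using B K_coords[OF x] K_coords[OF y] by linarith+
  then show "\<bar>int (posx w) - int (posx w')\<bar> \<le> 1 \<and> \<bar>int (posy w) - int (posy w')\<bar> \<le> 1"
    by (simp add: kl)
  have share: "word_map w p = word_map w' p'"
    if "cx p + of_int k = cx p'" "cy p + of_int l = cy p'" for p p'
    using that by (intro cx_cy_eqI) (auto simp: cx_word_map cy_word_map len kl)
  have "k = -1 \<or> k = 0 \<or> k = 1" "l = -1 \<or> l = 0 \<or> l = 1" using \<open>\<bar>k\<bar> \<le> 1\<close> \<open>\<bar>l\<bar> \<le> 1\<close> by linarith+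
  then consider "k = 0 \<and> l = 0" | "k = 0 \<and> l = 1" | "k = 0 \<and> l = -1" | "k = 1 \<and> l = 0"
    | "k = -1 \<and> l = 0" | "k = 1 \<and> l = -1" | "k = -1 \<and> l = 1"
    using \<open>\<bar>k + l\<bar> \<le> 1\<close> by (elim disjE) simp_all
  then show "\<exists>p\<in>V0. \<exists>p'\<in>V0. word_map w p = word_map w' p'"
  proof cases
    case 1 then show ?thesis using share[of p1 p1] by force
  next
    case 2 then show ?thesis using share[of p1 p3] by force
  next
    case 3 then show ?thesis using share[of p3 p1] by force
  next
    case 4 then show ?thesis using share[of p1 p2] by force
  next
    case 5 then show ?thesis using share[of p2 p1] by force
  next
    case 6 then show ?thesis using share[of p3 p2] by force
  next
    case 7 then show ?thesis using share[of p2 p3] by force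
  qed
qed

subsection \<open>Glueing\<close>

text \<open>Different cells meet in corners only, so agreement at the corners makes the pieces
  compatible.\<close>

lemma glue:
  fixes u :: "plane \<Rightarrow> real" and h :: "cell list \<Rightarrow> plane \<Rightarrow> real"
  assumes "\<And>w p. w \<in> words I n \<Longrightarrow> p \<in> V0 \<Longrightarrow> h w p = u (word_map w p)"
  obtains v where "\<And>w x. w \<in> words I n \<Longrightarrow> x \<in> K \<Longrightarrow> v (word_map w x) = h w x"
proof -
  define P where "P y wx \<longleftrightarrow> fst wx \<in> words I n \<and> snd wx \<in> K \<and> y = word_map (fst wx) (snd wx)" for y wx
  define v where "v y = (case SOME wx. P y wx of (w, x) \<Rightarrow> h w x)" for y
  have "v (word_map w x) = h w x" if wx: "w \<in> words I n" "x \<in> K" for w x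
  proof -
    obtain w' x' where s: "(SOME wx. P (word_map w x) wx) = (w', x')" by (meson surj_pair)
    have "P (word_map w x) (w, x)" using wx by (simp add: P_def)
    then have "P (word_map w x) (w', x')" using someI[of "P (word_map w x)"] s by metis
    then have w': "w' \<in> words I n" "x' \<in> K" "word_map w x = word_map w' x'" by (auto simp: P_def)
    have "h w x = h w' x'"
    proof (cases "w = w'")
      case False
      then have "x \<in> V0" "x' \<in> V0" using cell_overlap wx w' by blast+
      then show ?thesis using assms wx w' by simp
    qed (use w' in auto)
    then show ?thesis by (simp add: v_def s)
  qed
  then show ?thesis using that by blast
qed

lemma glue1:
  fixes u :: "plane \<Rightarrow> real" and h :: "cell \<Rightarrow> plane \<Rightarrow> real"
  assumes "\<And>i p. i \<in> I \<Longrightarrow> p \<in> V0 \<Longrightarrow> h i p = u (cell_map i p)"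
  obtains v where "\<And>i x. i \<in> I \<Longrightarrow> x \<in> K \<Longrightarrow> v (cell_map i x) = h i x"
proof -
  obtain v where v: "\<And>w x. w \<in> words I 1 \<Longrightarrow> x \<in> K \<Longrightarrow> v (word_map w x) = h (hd w) x"
    by (rule glue[of 1 "\<lambda>w. h (hd w)" u]) (auto simp: words_1 assms)
  have "v (cell_map i x) = h i x" if "i \<in> I" "x \<in> K" for i x
    using v[of "[i]" x] that by (simp add: words_1)
  then show ?thesis using that by blast
qed

text \<open>The cells of one level are finitely many closed sets.\<close>

lemma continuous_on_cells:
  fixes v :: "plane \<Rightarrow> real"
  assumes "\<And>w. w \<in> words I n \<Longrightarrow> continuous_on K (v \<circ> word_map w)"
  shows "continuous_on K v"
proof -
  have "continuous_on (\<Union>w\<in>words I n. word_map w ` K) v"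
  proof (rule continuous_on_closed_Union)
    show "finite (words I n)" by (simp add: finite_words)
    fix w assume w: "w \<in> words I n"
    have c: "continuous_on K (word_map w)" by (rule continuous_on_word_map)
    show "closed (word_map w ` K)"
      using compact_continuous_image[OF c compact_K] compact_imp_closed by blast
    obtain g where "homeomorphism K (word_map w ` K) (word_map w) g"
      using homeomorphism_compact[OF compact_K c refl] inj_on_subset[OF inj_word_map subset_UNIV] by blast
    then have g: "continuous_on (word_map w ` K) g" "g ` (word_map w ` K) = K"
       "\<And>y. y \<in> word_map w ` K \<Longrightarrow> word_map w (g y) = y"
      unfolding homeomorphism_def by auto
    have "continuous_on (g ` (word_map w ` K)) (v \<circ> word_map w)"
      unfolding g(2) by (rule assms[OF w])
    from continuous_on_compose[OF g(1) this]
    have "continuous_on (word_map w ` K) ((v \<circ> word_map w) \<circ> g)" .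
    then show "continuous_on (word_map w ` K) v"
      by (rule continuous_on_eq) (simp add: g(3))
  qed
  moreover have "(\<Union>w\<in>words I n. word_map w ` K) = K" using K_words word_map_K by blast
  ultimately show ?thesis by simp
qed

lemma continuous_on_cells1:
  fixes v :: "plane \<Rightarrow> real"
  assumes "\<And>i. i \<in> I \<Longrightarrow> continuous_on K (v \<circ> cell_map i)"
  shows "continuous_on K v"
proof (rule continuous_on_cells[of 1])
  fix w assume "w \<in> words I 1"
  then show "continuous_on K (v \<circ> word_map w)" using assms by (auto simp: words_1 simp del: comp_apply)
qed

end

section \<open>Quadratic forms on the cells\<close>

text \<open>The bilinear form of a triangular network with conductances \<open>a\<close>,
  \<open>b\<close>, \<open>c\<close> on the edges \<open>p1 p2\<close>, \<open>p2 p3\<close>,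
  \<open>p1 p3\<close>.\<close>

definition tri3 :: "real \<Rightarrow> real \<Rightarrow> real \<Rightarrow> (plane \<Rightarrow> real) \<Rightarrow> (plane \<Rightarrow> real) \<Rightarrow> real" where
  "tri3 a b c u v = a * (u p1 - u p2) * (v p1 - v p2) + b * (u p2 - u p3) * (v p2 - v p3)
     + c * (u p1 - u p3) * (v p1 - v p3)"

lemma tri3_perm:
  assumes "{a, b, c} = V0" "a \<noteq> b" "b \<noteq> c" "a \<noteq> c"
  shows "tri3 1 1 1 u v = (u a - u b) * (v a - v b) + (u b - u c) * (v b - v c) + (u a - u c) * (v a - v c)"
proof -
  have "a \<in> {p1, p2, p3}" "b \<in> {p1, p2, p3}" "c \<in> {p1, p2, p3}" using assms(1) by (auto simp: V0_def)
  then have "(a = p1 \<and> b = p2 \<and> c = p3) \<or> (a = p1 \<and> b = p3 \<and> c = p2) \<or> (a = p2 \<and> b = p1 \<and> c = p3)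
    \<or> (a = p2 \<and> b = p3 \<and> c = p1) \<or> (a = p3 \<and> b = p1 \<and> c = p2) \<or> (a = p3 \<and> b = p2 \<and> c = p1)"
    using assms(2-4) by blast
  then show ?thesis by (elim disjE) (auto simp: tri3_def algebra_simps)
qed

lemma tri3_nonneg: "0 \<le> a \<Longrightarrow> 0 \<le> b \<Longrightarrow> 0 \<le> c \<Longrightarrow> 0 \<le> tri3 a b c u u"
  by (simp add: tri3_def mult.assoc)

lemma energy_form_eq:
  assumes "conductances I c"
  shows "energy_form I c n u v = (\<Sum>w\<in>words I n. tri3 (c w (word_map w p1) (word_map w p2))
     (c w (word_map w p2) (word_map w p3)) (c w (word_map w p1) (word_map w p3))
     (u \<circ> word_map w) (v \<circ> word_map w))"
  unfolding energy_form_def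
proof (rule sum.cong[OF refl])
  fix w assume "w \<in> words I n"
  then have "w \<in> lists I" by (auto simp: words_def)
  then have sym: "c w (word_map w x) (word_map w y) = c w (word_map w y) (word_map w x)"
    if "x \<in> V0" "y \<in> V0" "x \<noteq> y" for x y
    using assms that unfolding conductances_def Vw_def by (metis imageI word_map_eq_iff)
  have s: "(\<Sum>x\<in>Vw w. f x) = f (word_map w p1) + f (word_map w p2) + f (word_map w p3)" for f :: "plane \<Rightarrow> real"
    unfolding Vw_def V0_def by (simp add: algebra_simps)
  show "(\<Sum>x\<in>Vw w. \<Sum>y\<in>Vw w. c w x y * ((u x - u y) * (v x - v y))) / 2 =
     tri3 (c w (word_map w p1) (word_map w p2)) (c w (word_map w p2) (word_map w p3))
       (c w (word_map w p1) (word_map w p3)) (u \<circ> word_map w) (v \<circ> word_map w)"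
    unfolding s tri3_def comp_def sym[OF V0_mem(2,1) V0_distinct(2)] sym[OF V0_mem(3,1) V0_distinct(4)]
      sym[OF V0_mem(3,2) V0_distinct(6)]
    by (simp add: field_simps)
qed

lemma prod_list_one [simp]: "prod_list (map (\<lambda>_. 1::real) w) = 1"
  by (induction w) auto

context sickle
begin

text \<open>Self-similar weights \<open>\<rho>\<close> on the cells and one network
  \<open>a\<close>, \<open>b\<close>, \<open>c\<close> in all cells.  Both the primal and the
  self-similar energies have this form, and those of the reverse recursive method have it at each
  level with \<open>\<rho> = 1\<close>.\<close>

definition wform :: "(cell \<Rightarrow> real) \<Rightarrow> real \<Rightarrow> real \<Rightarrow> real \<Rightarrow> nat \<Rightarrow> (plane \<Rightarrow> real) \<Rightarrow> (plane \<Rightarrow> real) \<Rightarrow> real" where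
  "wform \<rho> a b c n u v =
     (\<Sum>w\<in>words I n. prod_list (map \<rho> w) * tri3 a b c (u \<circ> word_map w) (v \<circ> word_map w))"

abbreviation PE :: "nat \<Rightarrow> (plane \<Rightarrow> real) \<Rightarrow> real" where
  "PE n u \<equiv> wform (\<lambda>_. 1) 1 1 1 n u u"

lemma wform_0 [simp]: "wform \<rho> a b c 0 u v = tri3 a b c u v"
  by (simp add: wform_def)

lemma wform_add:
  "wform \<rho> a b c (m + n) u v =
     (\<Sum>w\<in>words I m. prod_list (map \<rho> w) * wform \<rho> a b c n (u \<circ> word_map w) (v \<circ> word_map w))"
  unfolding wform_def sum_words_add[OF finite_I]
  by (simp add: sum_distrib_left word_map_append comp_assoc mult.assoc)

lemma wform_Suc:
  "wform \<rho> a b c (Suc n) u v = (\<Sum>i\<in>I. \<rho> i * wform \<rho> a b c n (u \<circ> cell_map i) (v \<circ> cell_map i))"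
  unfolding wform_def sum_words_Suc[OF finite_I]
  by (simp add: sum_distrib_left comp_assoc mult.assoc)

lemma wform_Suc': "wform \<rho> a b c (Suc n) u v =
     (\<Sum>w\<in>words I n. prod_list (map \<rho> w) * wform \<rho> a b c 1 (u \<circ> word_map w) (v \<circ> word_map w))"
  using wform_add[of \<rho> a b c n 1 u v] by simp

lemma wform_1: "wform \<rho> a b c 1 u v = (\<Sum>i\<in>I. \<rho> i * tri3 a b c (u \<circ> cell_map i) (v \<circ> cell_map i))"
  using wform_Suc[of \<rho> a b c 0 u v] by simp

lemma tri3_cong:
  "(\<And>x. x \<in> V0 \<Longrightarrow> u x = u' x) \<Longrightarrow> (\<And>x. x \<in> V0 \<Longrightarrow> v x = v' x) \<Longrightarrow> tri3 a b c u v = tri3 a b c u' v'"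
  by (simp add: tri3_def)

lemma wform_cong:
  assumes "\<And>x. x \<in> K \<Longrightarrow> u x = u' x" "\<And>x. x \<in> K \<Longrightarrow> v x = v' x"
  shows "wform \<rho> a b c n u v = wform \<rho> a b c n u' v'"
  unfolding wform_def
proof (rule sum.cong[OF refl])
  fix w assume w: "w \<in> words I n"
  have "word_map w p \<in> K" if "p \<in> V0" for p using word_map_K[OF w] V0_K that by blast
  then show "prod_list (map \<rho> w) * tri3 a b c (u \<circ> word_map w) (v \<circ> word_map w) =
      prod_list (map \<rho> w) * tri3 a b c (u' \<circ> word_map w) (v' \<circ> word_map w)"
    by (intro arg_cong2[of _ _ _ _ times] tri3_cong refl) (simp_all add: assms)
qed

lemma PE_nonneg: "0 \<le> PE n u"
  unfolding wform_def by (intro sum_nonneg) (simp add: tri3_nonneg)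

subsection \<open>The chain of right cells\<close>

text \<open>The \<open>k\<close>-th right cell is entered at the image of \<open>ea k\<close> and
  left at the image of \<open>eb k\<close>; the image of \<open>eh k\<close> hangs loosely.\<close>

definition ea :: "nat \<Rightarrow> plane" where "ea k = (SOME p. p \<in> V0 \<and> cell_map (r k) p = z (k - 1))"
definition eb :: "nat \<Rightarrow> plane" where "eb k = (SOME p. p \<in> V0 \<and> cell_map (r k) p = z k)"
definition eh :: "nat \<Rightarrow> plane" where "eh k = (SOME p. p \<in> V0 - {ea k, eb k})"

lemma ea: assumes "k \<in> {1..9}" shows "ea k \<in> V0" "cell_map (r k) (ea k) = z (k - 1)"
proof -
  have "\<exists>p. p \<in> V0 \<and> cell_map (r k) p = z (k - 1)" using z_vertex[OF assms] by auto
  from someI_ex[OF this] show "ea k \<in> V0" "cell_map (r k) (ea k) = z (k - 1)" by (auto simp: ea_def)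
qed

lemma eb: assumes "k \<in> {1..9}" shows "eb k \<in> V0" "cell_map (r k) (eb k) = z k"
proof -
  have "\<exists>p. p \<in> V0 \<and> cell_map (r k) p = z k" using z_vertex[OF assms] by auto
  from someI_ex[OF this] show "eb k \<in> V0" "cell_map (r k) (eb k) = z k" by (auto simp: eb_def)
qed

lemma ea_eb: "k \<in> {1..9} \<Longrightarrow> ea k \<noteq> eb k"
  using ea(2) eb(2) z_step by metis

lemma eh: assumes "k \<in> {1..9}"
  shows "eh k \<in> V0" "eh k \<noteq> ea k" "eh k \<noteq> eb k" "V0 = {ea k, eb k, eh k}"
proof -
  have c: "card V0 = 3" by (simp add: V0_def)
  have "card {ea k, eb k} = 2" using ea_eb[OF assms] by simp
  then have "\<not> V0 \<subseteq> {ea k, eb k}" using card_mono[of "{ea k, eb k}" V0] c by auto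
  then have "\<exists>p. p \<in> V0 - {ea k, eb k}" by blast
  from someI_ex[OF this] have h: "eh k \<in> V0 - {ea k, eb k}" by (simp add: eh_def)
  then show "eh k \<in> V0" "eh k \<noteq> ea k" "eh k \<noteq> eb k" by auto
  have "{ea k, eb k, eh k} \<subseteq> V0" "card {ea k, eb k, eh k} = 3"
    using h ea[OF assms] eb[OF assms] ea_eb[OF assms] by auto
  then show "V0 = {ea k, eb k, eh k}" using card_subset_eq[of V0 "{ea k, eb k, eh k}"] c by simp
qed

lemma z_in_triangle: "k \<in> {1..9} \<Longrightarrow> z (k - 1) \<in> cell_triangle (r k)" "k \<in> {1..9} \<Longrightarrow> z k \<in> cell_triangle (r k)"
  using ea eb vertex_in_triangle by metis+

lemma right_meet:
  assumes "k \<in> {1..9}" "l \<in> {1..9}" "k < l" "x \<in> cell_triangle (r k)" "x \<in> cell_triangle (r l)"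
  shows "l = k + 1 \<and> x = z k"
proof -
  have "\<not> k + 1 < l"
  proof
    assume "k + 1 < l"
    from nonconsecutive[OF assms(1,2) this] show False using assms(4,5) by blast
  qed
  then have l: "l = k + 1" using assms(3) by simp
  have "k \<in> {1..8}" using assms(1,2) l by simp
  from consecutive[OF this] show ?thesis using assms(4,5) l by blast
qed

lemma right_left_meet:
  assumes "k \<in> {1..9}" "i \<in> left_cells \<union> top_cells" "x \<in> cell_triangle (r k)" "x \<in> cell_triangle i"
  shows "x = z 0"
  using right_separate assms by blast

lemma z_inj: assumes "k < l" "l \<le> 9" shows "z k \<noteq> z l"
proof
  assume eq: "z k = z l"
  have l: "l \<in> {1..9}" using assms by auto
  show False
  proof (cases "l = k + 1")
    case True then show False using z_step[OF l] eq by simp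
  next
    case False
    have k: "k + 1 \<in> {1..9}" "k + 1 < l" using assms False by auto
    have "z k \<in> cell_triangle (r (k + 1))" using z_in_triangle(1)[OF k(1)] by simp
    then have "z k = z (k + 1)" using right_meet[OF k(1) l k(2)] z_in_triangle(2)[OF l] eq by simp
    then show False using z_step[OF k(1)] by simp
  qed
qed

lemma z_eq_iff: "k \<le> 9 \<Longrightarrow> l \<le> 9 \<Longrightarrow> z k = z l \<longleftrightarrow> k = l"
  by (metis linorder_neqE_nat z_inj)

definition hang :: "nat \<Rightarrow> plane" where "hang k = cell_map (r k) (eh k)"

lemma hang_in_triangle: "k \<in> {1..9} \<Longrightarrow> hang k \<in> cell_triangle (r k)"
  by (simp add: hang_def eh vertex_in_triangle)

lemma hang_ne_own: assumes "k \<in> {1..9}" shows "hang k \<noteq> z (k - 1)" "hang k \<noteq> z k"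
  unfolding hang_def using ea(2)[OF assms] eb(2)[OF assms] eh(2,3)[OF assms] by (metis cell_map_eq_iff)+

text \<open>The loose vertex of a cell is not on the chain, so functions may be prescribed there
  freely.\<close>

lemma hang_ne_z: assumes k: "k \<in> {1..9}" and l: "l \<le> 9" shows "hang k \<noteq> z l"
proof
  assume eq: "hang k = z l"
  have h: "z l \<in> cell_triangle (r k)" using hang_in_triangle[OF k] eq by simp
  consider "l = k" | "l > k" | "l < k" by linarith
  then show False
  proof cases
    case 1 then show False using hang_ne_own(2)[OF k] eq by simp
  next
    case 2
    then have "l \<in> {1..9}" using l k by auto
    from right_meet[OF k this 2 h z_in_triangle(2)[OF this]] show False using z_inj[OF 2 l] by simp
  next
    case 3
    show False
    proof (cases "l + 1 = k")
      case True then show False using hang_ne_own(1)[OF k] eq by auto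
    next
      case False
      then have l': "l + 1 \<in> {1..9}" "l + 1 < k" using 3 k by auto
      have "z l \<in> cell_triangle (r (l + 1))" using z_in_triangle(1)[OF l'(1)] by simp
      from right_meet[OF l'(1) k l'(2) this h] have "k = l + 1 + 1" "z l = z (l + 1)" by auto
      then show False using z_step[OF l'(1)] by simp
    qed
  qed
qed

lemma hang_inj: assumes "k \<in> {1..9}" "l \<in> {1..9}" "k < l" shows "hang k \<noteq> hang l"
  using right_meet[OF assms hang_in_triangle[OF assms(1)]] hang_in_triangle[OF assms(2)]
    hang_ne_own(2)[OF assms(1)] by auto

lemma hang_eq_iff: "k \<in> {1..9} \<Longrightarrow> l \<in> {1..9} \<Longrightarrow> hang k = hang l \<longleftrightarrow> k = l"
  by (metis linorder_neqE_nat hang_inj)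

lemma left_top_vertex:
  assumes i: "i \<in> left_cells \<union> top_cells" and p: "p \<in> V0"
  shows "k \<in> {1..9} \<Longrightarrow> cell_map i p \<noteq> hang k" and "k \<in> {1..9} \<Longrightarrow> cell_map i p \<noteq> z k"
proof -
  have t: "cell_map i p \<in> cell_triangle i" using vertex_in_triangle p .
  show "k \<in> {1..9} \<Longrightarrow> cell_map i p \<noteq> hang k"
    using right_left_meet[OF _ i hang_in_triangle] t hang_ne_z[of k 0] by auto
  show "k \<in> {1..9} \<Longrightarrow> cell_map i p \<noteq> z k"
    using right_left_meet[OF _ i z_in_triangle(2)] t z_eq_iff[of k 0] by auto
qed

lemma r_distinct: "inj_on r {1..9}"
proof (rule linorder_inj_onI)
  fix k l :: nat assume k: "k < l" "k \<in> {1..9}" "l \<in> {1..9}"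
  show "r k \<noteq> r l"
    using right_meet[OF k(2,3,1) hang_in_triangle[OF k(2)]] hang_ne_own(2)[OF k(2)]
      hang_in_triangle[OF k(2)] by auto
qed auto

lemma r_not_left_top: "k \<in> {1..9} \<Longrightarrow> r k \<notin> left_cells \<union> top_cells"
  using right_left_meet[of k "r k" "hang k"] hang_in_triangle hang_ne_z[of k 0] by auto

lemma sum_I:
  fixes f :: "cell \<Rightarrow> 'b::comm_monoid_add"
  shows "(\<Sum>i\<in>I. f i) = (\<Sum>j<5. f (0, j)) + f (0, 5) + f (Suc 0, 5) + f (0, 6) + (\<Sum>k=1..9. f (r k))"
proof -
  have lt: "left_cells \<union> top_cells = (\<lambda>j. (0, j)) ` {..<5} \<union> {(0,5), (Suc 0,5), (0,6)}"
    by (auto simp: left_cells_def top_cells_def)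
  have "sum f I = sum f (left_cells \<union> top_cells) + sum f (r ` {1..9})"
    unfolding sickle_cells_def
  proof (rule sum.union_disjoint)
    show "(left_cells \<union> top_cells) \<inter> r ` {1..9} = {}" using r_not_left_top by blast
  qed (auto simp: left_cells_def top_cells_def)
  also have "sum f (left_cells \<union> top_cells) = sum f ((\<lambda>j. (0, j)) ` {..<5}) + sum f {(0,5), (Suc 0,5), (0,6)}"
    unfolding lt by (intro sum.union_disjoint) auto
  also have "sum f ((\<lambda>j. (0, j)) ` {..<5}) = (\<Sum>j<5. f (0, j))"
    by (subst sum.reindex) (auto simp: inj_on_def)
  also have "sum f (r ` {1..9}) = (\<Sum>k=1..9. f (r k))"
    using sum.reindex[OF r_distinct, of f] by (simp only: comp_def)
  finally show ?thesis by (simp add: algebra_simps)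
qed

lemma card_I: "card I = 17"
proof -
  have "card I = (\<Sum>i\<in>I. 1)" by simp
  then show ?thesis unfolding sum_I by simp
qed

text \<open>Every assignment of values to the vertices of the \<open>1\<close>-cells that respects the
  identifications is realised by a function.\<close>

lemma level1_function:
  fixes L Lh Z Zh :: "nat \<Rightarrow> real" and x y w t :: real
  obtains u :: "plane \<Rightarrow> real" where
    "\<And>j. j < 5 \<Longrightarrow> u (cell_map (0, j) p1) = L j \<and> u (cell_map (0, j) p2) = Lh j \<and> u (cell_map (0, j) p3) = L (Suc j)"
    "u (cell_map (0, 5) p1) = L 5" "u (cell_map (0, 5) p2) = x" "u (cell_map (0, 5) p3) = y"
    "u (cell_map (Suc 0, 5) p1) = x" "u (cell_map (Suc 0, 5) p2) = Z 0" "u (cell_map (Suc 0, 5) p3) = w"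
    "u (cell_map (0, 6) p1) = y" "u (cell_map (0, 6) p2) = w" "u (cell_map (0, 6) p3) = t"
    "\<And>k. k \<in> {1..9} \<Longrightarrow> u (cell_map (r k) (ea k)) = Z (k - 1) \<and> u (cell_map (r k) (eb k)) = Z k
        \<and> u (cell_map (r k) (eh k)) = Zh k"
    "u p1 = L 0" "u p2 = Z 9" "u p3 = t"
proof -
  define f :: "nat \<Rightarrow> nat \<Rightarrow> real" where "f i j = (if i = 0 then (if j \<le> 5 then L j else if j = 6 then y else t)
     else if j \<le> 4 then Lh j else if i = 1 then (if j = 5 then x else w) else Z 0)" for i j
  define u :: "plane \<Rightarrow> real" where "u P = (if \<exists>k\<in>{1..9}. P = z k then Z (THE k. k \<in> {1..9} \<and> P = z k)
     else if \<exists>k\<in>{1..9}. P = hang k then Zh (THE k. k \<in> {1..9} \<and> P = hang k)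
     else f (THE i. \<exists>j. P = q i j) (THE j. \<exists>i. P = q i j))" for P
  have uz: "u (z k) = Z k" if k: "k \<in> {1..9}" for k
  proof -
    have "(THE k'. k' \<in> {1..9} \<and> z k = z k') = k"
      using k z_eq_iff[of k] by (intro the_equality) auto
    then show ?thesis using k by (auto simp: u_def)
  qed
  have uh: "u (hang k) = Zh k" if k: "k \<in> {1..9}" for k
  proof -
    have "(THE k'. k' \<in> {1..9} \<and> hang k = hang k') = k"
      using k hang_eq_iff[of k] by (intro the_equality) auto
    then show ?thesis using k hang_ne_z[OF k] by (auto simp: u_def)
  qed
  have uq: "u (q i j) = f i j" if ij: "c \<in> left_cells \<union> top_cells" "p \<in> V0" "q i j = cell_map c p" for i j c p
  proof -
    have "(THE i'. \<exists>j'. q i j = q i' j') = i" "(THE j'. \<exists>i'. q i j = q i' j') = j" by auto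
    then show ?thesis using left_top_vertex[OF ij(1,2)] ij(3) by (auto simp: u_def)
  qed
  have uz0: "u (z 0) = Z 0"
    using uq[of "(Suc 0, 5)" p2 2 5] by (simp add: z_ends top_cells_def f_def eval_nat_numeral)
  have uz': "u (z k) = Z k" if "k \<le> 9" for k using that uz[of k] uz0 by (cases "k = 0") auto
  have U: "u (cell_map (i, j) p1) = f i j" "u (cell_map (i, j) p2) = f (Suc i) j" "u (cell_map (i, j) p3) = f i (Suc j)"
    if "(i, j) \<in> left_cells \<union> top_cells" for i j
    using uq[OF that V0_mem(1), of i j] uq[OF that V0_mem(2), of "Suc i" j] uq[OF that V0_mem(3), of i "Suc j"] by simp_all
  have lt: "j < 5 \<Longrightarrow> (0, j) \<in> left_cells \<union> top_cells" "(0, 5) \<in> left_cells \<union> top_cells"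
    "(Suc 0, 5) \<in> left_cells \<union> top_cells" "(0, 6) \<in> left_cells \<union> top_cells" for j
    by (auto simp: left_cells_def top_cells_def)
  show ?thesis
  proof (rule that)
    show "u (cell_map (0, j) p1) = L j \<and> u (cell_map (0, j) p2) = Lh j \<and> u (cell_map (0, j) p3) = L (Suc j)"
      if "j < 5" for j
      using U[OF lt(1)[OF that]] that by (simp add: f_def)
    show "u (cell_map (r k) (ea k)) = Z (k - 1) \<and> u (cell_map (r k) (eb k)) = Z k
        \<and> u (cell_map (r k) (eh k)) = Zh k" if k: "k \<in> {1..9}" for k
      using ea(2)[OF k] eb(2)[OF k] uz'[of "k - 1"] uz'[of k] uh[OF k] k by (auto simp: hang_def)
    show "u p2 = Z 9" using uz'[of 9] by (simp add: z_ends q_corners)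
    show "u p1 = L 0" using U(1)[OF lt(1)[of 0]] by (simp add: q_corners f_def)
    show "u p3 = t" using U(3)[OF lt(4)] by (simp add: q_corners f_def)
  qed (simp_all only: U[OF lt(2)] U[OF lt(3)] U[OF lt(4)], simp_all add: f_def)
qed

lemma tri3_right:
  assumes "k \<in> {1..9}"
  shows "tri3 1 1 1 (u \<circ> cell_map (r k)) (v \<circ> cell_map (r k)) =
    (u (cell_map (r k) (ea k)) - u (cell_map (r k) (eb k))) * (v (cell_map (r k) (ea k)) - v (cell_map (r k) (eb k)))
    + (u (cell_map (r k) (eb k)) - u (cell_map (r k) (eh k))) * (v (cell_map (r k) (eb k)) - v (cell_map (r k) (eh k)))
    + (u (cell_map (r k) (ea k)) - u (cell_map (r k) (eh k))) * (v (cell_map (r k) (ea k)) - v (cell_map (r k) (eh k)))"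
  using tri3_perm[of "ea k" "eb k" "eh k" "u \<circ> cell_map (r k)" "v \<circ> cell_map (r k)"] eh[OF assms] ea_eb[OF assms]
  by auto

end

section \<open>Hausdorff measure is a Borel measure\<close>

lemma ennreal_le_suminf: "f i \<le> suminf f" for f :: "nat \<Rightarrow> ennreal"
  using sum_le_suminf[of f "{i}"] by (simp add: summableI)

definition cover_set :: "real \<Rightarrow> 'a::metric_space set \<Rightarrow> (nat \<Rightarrow> 'a set) set" where
  "cover_set \<delta> A = {U. A \<subseteq> (\<Union>i. U i) \<and> (\<forall>i. bounded (U i) \<and> diameter (U i) \<le> \<delta>)}"

lemma hausdorff_pre_eq:
  "hausdorff_pre s \<delta> A = (INF U\<in>cover_set \<delta> A. \<Sum>i. ennreal (diameter (U i) powr s))"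
  by (simp add: hausdorff_pre_def cover_set_def)

lemma hausdorff_pre_mono: "A \<subseteq> B \<Longrightarrow> hausdorff_pre s \<delta> A \<le> hausdorff_pre s \<delta> B"
  unfolding hausdorff_pre_eq by (rule INF_superset_mono) (auto simp: cover_set_def)

lemma hausdorff_pre_antimono: "\<delta> \<le> \<delta>' \<Longrightarrow> hausdorff_pre s \<delta>' A \<le> hausdorff_pre s \<delta> A"
  unfolding hausdorff_pre_eq by (rule INF_superset_mono) (auto simp: cover_set_def intro: order_trans)

lemma hausdorff_pre_le_outer: "0 < \<delta> \<Longrightarrow> hausdorff_pre s \<delta> A \<le> hausdorff_outer s A"
  unfolding hausdorff_outer_def by (rule SUP_upper) auto

lemma hausdorff_outer_mono: "A \<subseteq> B \<Longrightarrow> hausdorff_outer s A \<le> hausdorff_outer s B"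
  unfolding hausdorff_outer_def by (intro SUP_mono) (auto intro: hausdorff_pre_mono)

lemma hausdorff_pre_empty: "0 < \<delta> \<Longrightarrow> hausdorff_pre s \<delta> ({} :: 'a::metric_space set) = 0"
proof -
  assume "0 < \<delta>"
  then have "(\<lambda>_::nat. {} :: 'a::metric_space set) \<in> cover_set \<delta> {}" by (simp add: cover_set_def)
  then have "hausdorff_pre s \<delta> ({} :: 'a set) \<le> (\<Sum>i::nat. ennreal (diameter ({} :: 'a set) powr s))"
    unfolding hausdorff_pre_eq by (rule INF_lower)
  then show ?thesis by simp
qed

lemma hausdorff_outer_empty: "hausdorff_outer s {} = 0"
  unfolding hausdorff_outer_def by (intro antisym SUP_least) (auto simp: hausdorff_pre_empty)

text \<open>Near-optimal covers of the \<open>A i\<close> are merged along a bijection between pairs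
  and naturals, with an error \<open>e / 2 ^ (i + 1)\<close> each.\<close>

lemma hausdorff_pre_Union:
  fixes A :: "nat \<Rightarrow> 'a::metric_space set"
  shows "hausdorff_pre s \<delta> (\<Union>i. A i) \<le> (\<Sum>i. hausdorff_pre s \<delta> (A i))"
proof (cases "(\<Sum>i. hausdorff_pre s \<delta> (A i)) = \<infinity>")
  case False
  then have fin: "hausdorff_pre s \<delta> (A i) \<noteq> \<infinity>" for i
    using ennreal_le_suminf[of "\<lambda>i. hausdorff_pre s \<delta> (A i)" i] by (auto simp: top_unique)
  show ?thesis
  proof (rule ennreal_le_epsilon)
    fix e :: real assume e: "0 < e"
    define c where "c U = (\<Sum>i. ennreal (diameter (U i) powr s))" for U :: "nat \<Rightarrow> 'a set"
    have "\<exists>U\<in>cover_set \<delta> (A i). c U < hausdorff_pre s \<delta> (A i) + ennreal (e * (1/2) ^ Suc i)" for i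
    proof -
      have "hausdorff_pre s \<delta> (A i) < hausdorff_pre s \<delta> (A i) + ennreal (e * (1/2) ^ Suc i)"
        using fin[of i] e
        by (cases "hausdorff_pre s \<delta> (A i)") (auto simp flip: ennreal_plus simp: ennreal_less_iff)
      then show ?thesis unfolding hausdorff_pre_eq c_def INF_less_iff .
    qed
    then obtain U where U: "\<And>i. U i \<in> cover_set \<delta> (A i)"
      "\<And>i. c (U i) < hausdorff_pre s \<delta> (A i) + ennreal (e * (1/2) ^ Suc i)"
      by metis
    define W where "W n = U (fst (prod_decode n)) (snd (prod_decode n))" for n
    have "(\<Union>i. A i) \<subseteq> (\<Union>n. W n)"
    proof
      fix x assume "x \<in> (\<Union>i. A i)"
      then obtain i where "x \<in> A i" by blast
      then obtain j where "x \<in> U i j" using U(1)[of i] by (auto simp: cover_set_def)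
      then have "x \<in> W (prod_encode (i, j))" by (simp add: W_def)
      then show "x \<in> (\<Union>n. W n)" by blast
    qed
    then have "W \<in> cover_set \<delta> (\<Union>i. A i)"
      using U(1) by (auto simp: cover_set_def W_def)
    then have "hausdorff_pre s \<delta> (\<Union>i. A i) \<le> c W"
      unfolding hausdorff_pre_eq c_def by (rule INF_lower)
    also have "c W = (\<Sum>i. c (U i))"
    proof -
      have "(\<Sum>n. (\<lambda>(i, j). ennreal (diameter (U i j) powr s)) (prod_decode n)) = (\<Sum>i. c (U i))"
        by (rule suminf_ennreal_2dimen) (simp add: c_def)
      then show ?thesis by (simp only: c_def W_def case_prod_unfold)
    qed
    also have "\<dots> \<le> (\<Sum>i. hausdorff_pre s \<delta> (A i) + ennreal (e * (1/2) ^ Suc i))"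
      by (intro suminf_le summableI less_imp_le U(2))
    also have "\<dots> = (\<Sum>i. hausdorff_pre s \<delta> (A i)) + (\<Sum>i. ennreal (e * (1/2) ^ Suc i))"
      by (intro suminf_add[symmetric] summableI)
    also have "(\<Sum>i. ennreal (e * (1/2) ^ Suc i)) = ennreal e"
    proof -
      have "(\<lambda>i. e * (1/2) ^ Suc i) sums (e * 1)"
        using power_half_series by (intro sums_mult)
      then show ?thesis using e by (intro suminf_ennreal_eq) auto
    qed
    finally show "hausdorff_pre s \<delta> (\<Union>i. A i) \<le> (\<Sum>i. hausdorff_pre s \<delta> (A i)) + ennreal e" .
  qed
qed simp

lemma hausdorff_outer_Union:
  "hausdorff_outer s (\<Union>i. A i) \<le> (\<Sum>i. hausdorff_outer s (A i))" for A :: "nat \<Rightarrow> 'a::metric_space set"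
  unfolding hausdorff_outer_def[of s "\<Union>i. A i"]
proof (rule SUP_least)
  fix \<delta> :: real assume "\<delta> \<in> {0<..}"
  then have "hausdorff_pre s \<delta> (A i) \<le> hausdorff_outer s (A i)" for i
    by (intro hausdorff_pre_le_outer) auto
  then show "hausdorff_pre s \<delta> (\<Union>i. A i) \<le> (\<Sum>i. hausdorff_outer s (A i))"
    by (intro order_trans[OF hausdorff_pre_Union] suminf_le summableI)
qed

lemma hausdorff_outer_Un:
  fixes A B :: "'a::metric_space set"
  shows
  "hausdorff_outer s (A \<union> B) \<le> hausdorff_outer s A + hausdorff_outer s B"
proof -
  define f where "f = (\<lambda>i::nat. if i = 0 then A else if i = 1 then B else {})"
  have "(\<Union>i. f i) = A \<union> B" 
  proof (intro set_eqI iffI)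
    fix x assume "x \<in> A \<union> B"
    then have "x \<in> f 0 \<or> x \<in> f 1" by (auto simp: f_def)
    then show "x \<in> (\<Union>i. f i)" by blast
  qed (auto simp: f_def split: if_splits)
  moreover have "(\<Sum>i. hausdorff_outer s (f i)) = (\<Sum>i\<in>{0,1}. hausdorff_outer s (f i))"
    by (rule suminf_finite) (auto simp: f_def hausdorff_outer_empty)
  ultimately show ?thesis using hausdorff_outer_Union[of s f] by (simp add: f_def)
qed

text \<open>Sets of small diameter cannot meet both of two sets at positive distance, so covers of the
  union split.\<close>

lemma hausdorff_pre_separated:
  fixes A B :: "'a::metric_space set"
  assumes d: "\<And>x y. x \<in> A \<Longrightarrow> y \<in> B \<Longrightarrow> d \<le> dist x y" and "\<delta> < d" "0 < \<delta>"
  shows "hausdorff_pre s \<delta> A + hausdorff_pre s \<delta> B \<le> hausdorff_pre s \<delta> (A \<union> B)"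
  unfolding hausdorff_pre_eq[of s \<delta> "A \<union> B"]
proof (rule INF_greatest)
  fix U :: "nat \<Rightarrow> 'a set" assume U: "U \<in> cover_set \<delta> (A \<union> B)"
  define f where "f C i = (if U i \<inter> C = {} then {} else U i)" for C i
  have f: "f C \<in> cover_set \<delta> C" if C: "C \<subseteq> A \<union> B" for C
  proof -
    have "C \<subseteq> (\<Union>i. f C i)"
    proof
      fix x assume "x \<in> C"
      moreover from this obtain i where "x \<in> U i" using U C unfolding cover_set_def by blast
      ultimately have "x \<in> f C i" by (auto simp: f_def)
      then show "x \<in> (\<Union>i. f C i)" by blast
    qed
    moreover have "bounded (f C i) \<and> diameter (f C i) \<le> \<delta>" for i
      using U \<open>0 < \<delta>\<close> by (simp add: f_def cover_set_def)
    ultimately show ?thesis by (simp add: cover_set_def)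
  qed
  have "f A \<in> cover_set \<delta> A" "f B \<in> cover_set \<delta> B" by (auto intro: f)
  then have "hausdorff_pre s \<delta> A + hausdorff_pre s \<delta> B
      \<le> (\<Sum>i. ennreal (diameter (f A i) powr s)) + (\<Sum>i. ennreal (diameter (f B i) powr s))"
    unfolding hausdorff_pre_eq by (intro add_mono INF_lower)
  also have "\<dots> = (\<Sum>i. ennreal (diameter (f A i) powr s) + ennreal (diameter (f B i) powr s))"
    by (intro suminf_add summableI)
  also have "\<dots> \<le> (\<Sum>i. ennreal (diameter (U i) powr s))"
  proof (intro suminf_le summableI)
    fix i
    have "U i \<inter> A = {} \<or> U i \<inter> B = {}"
    proof (rule ccontr)
      assume "\<not> ?thesis"
      then obtain x y where "x \<in> U i" "x \<in> A" "y \<in> U i" "y \<in> B" by blast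
      moreover have "bounded (U i)" "diameter (U i) \<le> \<delta>" using U by (auto simp: cover_set_def)
      ultimately have "dist x y \<le> \<delta>" "d \<le> dist x y"
        using diameter_bounded_bound[of "U i" x y] d by auto
      with \<open>\<delta> < d\<close> show False by simp
    qed
    then show "ennreal (diameter (f A i) powr s) + ennreal (diameter (f B i) powr s)
        \<le> ennreal (diameter (U i) powr s)"
      by (auto simp: f_def)
  qed
  finally show "hausdorff_pre s \<delta> A + hausdorff_pre s \<delta> B \<le> (\<Sum>i. ennreal (diameter (U i) powr s))" .
qed

lemma hausdorff_outer_separated:
  fixes A B :: "'a::metric_space set"
  assumes d: "\<And>x y. x \<in> A \<Longrightarrow> y \<in> B \<Longrightarrow> d \<le> dist x y" and "0 < d"
  shows "hausdorff_outer s A + hausdorff_outer s B \<le> hausdorff_outer s (A \<union> B)"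
proof -
  have le: "hausdorff_pre s \<delta> A + hausdorff_pre s \<delta>' B \<le> hausdorff_outer s (A \<union> B)"
    if "0 < \<delta>" "0 < \<delta>'" for \<delta> \<delta>'
  proof -
    define e where "e = min (min \<delta> \<delta>') (d/2)"
    have e: "0 < e" "e < d" "e \<le> \<delta>" "e \<le> \<delta>'" using that \<open>0 < d\<close> by (auto simp: e_def)
    have "hausdorff_pre s \<delta> A + hausdorff_pre s \<delta>' B \<le> hausdorff_pre s e A + hausdorff_pre s e B"
      using e by (intro add_mono hausdorff_pre_antimono)
    also have "\<dots> \<le> hausdorff_pre s e (A \<union> B)" using d e by (intro hausdorff_pre_separated) auto
    also have "\<dots> \<le> hausdorff_outer s (A \<union> B)" using e by (intro hausdorff_pre_le_outer)
    finally show ?thesis .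
  qed
  have ne: "{0::real<..} \<noteq> {}" using gt_ex by auto
  have "hausdorff_outer s A + hausdorff_pre s \<delta>' B \<le> hausdorff_outer s (A \<union> B)" if "0 < \<delta>'" for \<delta>'
    unfolding hausdorff_outer_def[of s A] using le that ne
    by (subst ennreal_SUP_add_left[symmetric]) (auto intro!: SUP_least)
  then show ?thesis
    unfolding hausdorff_outer_def[of s B] using ne
    by (subst ennreal_SUP_add_right) (auto intro!: SUP_least)
qed

text \<open>Caratheodory's criterion: the shells around a closed set are separated from each other
  apart from neighbours, hence have summable outer measures.\<close>

lemma hausdorff_outer_closed_split:
  fixes C X :: "'a::metric_space set"
  assumes "closed C"
  shows "hausdorff_outer s (C \<inter> X) + hausdorff_outer s (X - C) \<le> hausdorff_outer s X"
proof (cases "C = {} \<or> hausdorff_outer s X = \<infinity>")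
  case True
  then show ?thesis by (auto simp: hausdorff_outer_empty)
next
  case False
  then have C: "C \<noteq> {}" and fin: "hausdorff_outer s X \<noteq> \<infinity>" by auto
  let ?H = "hausdorff_outer s :: 'a set \<Rightarrow> ennreal"
  define g where "g k = 1 / (real k + 1)" for k
  define R where "R n = {x \<in> X. g n \<le> infdist x C}" for n
  define D where "D k = {x \<in> X. g (Suc k) \<le> infdist x C \<and> infdist x C < g k}" for k
  have g_pos: "0 < g k" for k by (simp add: g_def)
  have g_mono: "j \<le> k \<Longrightarrow> g k \<le> g j" for j k by (simp add: g_def frac_le)
  have g_strict: "j < k \<Longrightarrow> g k < g j" for j k by (simp add: g_def frac_less2)
  have lip: "infdist x C \<le> infdist y C + dist x y" for x y by (rule infdist_triangle)
  have 1: "?H (C \<inter> X) + ?H (R n) \<le> ?H X" for n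
  proof -
    have "g n \<le> dist x y" if "x \<in> C \<inter> X" "y \<in> R n" for x y
      using that lip[of y x] by (simp add: R_def dist_commute infdist_zero)
    then have "?H (C \<inter> X) + ?H (R n) \<le> ?H (C \<inter> X \<union> R n)"
      by (rule hausdorff_outer_separated[OF _ g_pos])
    also have "\<dots> \<le> ?H X" by (intro hausdorff_outer_mono) (auto simp: R_def)
    finally show ?thesis .
  qed
  have half: "(\<Sum>k<m. ?H (D (2 * k + b))) \<le> ?H X" for m b
  proof -
    have "(\<Sum>k<m. ?H (D (2 * k + b))) \<le> ?H (\<Union>k<m. D (2 * k + b))"
    proof (induction m)
      case (Suc m)
      let ?E = "\<Union>k<m. D (2 * k + b)" and ?F = "D (2 * m + b)"
      have sep: "g (Suc (2 * m + b - 2)) - g (2 * m + b) \<le> dist x y" if x: "x \<in> ?E" and y: "y \<in> ?F" for x y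
      proof -
        obtain k where k: "k < m" "x \<in> D (2 * k + b)" using x by blast
        have "g (Suc (2 * m + b - 2)) \<le> g (Suc (2 * k + b))" using k(1) by (intro g_mono) linarith
        also have "\<dots> \<le> infdist x C" using k by (simp add: D_def)
        finally show ?thesis using lip[of x y] y by (simp add: D_def)
      qed
      have "?H ?E + ?H ?F \<le> ?H (?E \<union> ?F)"
      proof (cases "m = 0")
        case True then show ?thesis by (simp add: hausdorff_outer_empty)
      next
        case False
        then have "Suc (2 * m + b - 2) < 2 * m + b" by linarith
        then have "g (2 * m + b) < g (Suc (2 * m + b - 2))" by (rule g_strict)
        then show ?thesis by (intro hausdorff_outer_separated[OF sep]) auto
      qed
      note ab = this
      have eq: "?E \<union> ?F = (\<Union>k<Suc m. D (2 * k + b))" by (auto simp: lessThan_Suc)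
      have "(\<Sum>k<Suc m. ?H (D (2 * k + b))) \<le> ?H ?E + ?H ?F"
        using Suc by (simp add: add_right_mono)
      from order_trans[OF this ab] show ?case unfolding eq .
    qed simp
    also have "\<dots> \<le> ?H X" by (intro hausdorff_outer_mono) (auto simp: D_def)
    finally show ?thesis .
  qed
  have "(\<Sum>k<n. ?H (D k)) \<le> ?H X + ?H X" for n
  proof -
    have "(\<Sum>k<n. ?H (D k)) \<le> (\<Sum>k<2 * n. ?H (D k))" by (intro sum_mono2) auto
    also have "\<dots> = (\<Sum>k<n. ?H (D (2 * k + 0))) + (\<Sum>k<n. ?H (D (2 * k + 1)))"
      by (induction n) (auto simp: algebra_simps)
    also have "\<dots> \<le> ?H X + ?H X" by (intro add_mono half)
    finally show ?thesis .
  qed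
  then have "(\<Sum>k. ?H (D k)) \<le> ?H X + ?H X" by (intro suminf_le_const summableI)
  then have sumfin: "(\<Sum>k. ?H (D k)) \<noteq> \<infinity>" using fin
    by (auto simp: top_unique)
  define b where "b k = enn2real (?H (D k))" for k
  have "?H (D k) \<noteq> \<infinity>" for k
    using sumfin ennreal_le_suminf[of "\<lambda>k. ?H (D k)" k] by (auto simp: top_unique)
  then have b: "?H (D k) = ennreal (b k)" "0 \<le> b k" for k
    by (auto simp: b_def ennreal_enn2real_if)
  have summ: "summable b"
    using sumfin b by (intro summable_suminf_not_top) auto
  have tail: "?H (X - C) \<le> ?H (R n) + ennreal (\<Sum>k. b (k + n))" for n
  proof -
    have "X - C \<subseteq> R n \<union> (\<Union>k. D (k + n))"
    proof
      fix x assume x: "x \<in> X - C"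
      then have pos: "0 < infdist x C" using \<open>closed C\<close> C
        by (metis DiffD2 in_closed_iff_infdist_zero infdist_nonneg less_eq_real_def)
      obtain m where "g m < infdist x C"
        using reals_Archimedean[OF pos] by (auto simp: g_def inverse_eq_divide add.commute)
      then have "\<exists>m. g m \<le> infdist x C" by (intro exI[of _ m]) simp
      define l where "l = (LEAST m. g m \<le> infdist x C)"
      have l: "g l \<le> infdist x C" unfolding l_def using \<open>\<exists>m. g m \<le> infdist x C\<close> by (rule LeastI_ex)
      have l': "\<not> g m \<le> infdist x C" if "m < l" for m using that unfolding l_def by (rule not_less_Least)
      show "x \<in> R n \<union> (\<Union>k. D (k + n))"
      proof (cases "l \<le> n")
        case True
        then have "x \<in> R n" using x l g_mono[OF True] by (simp add: R_def)
        then show ?thesis by blast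
      next
        case False
        then obtain k where k: "l = Suc (k + n)" by (metis add.commute less_imp_Suc_add not_le)
        then have "x \<in> D (k + n)" using x l l'[of "k + n"] by (simp add: D_def)
        then show ?thesis by blast
      qed
    qed
    then have "?H (X - C) \<le> ?H (R n) + ?H (\<Union>k. D (k + n))"
      by (meson hausdorff_outer_Un hausdorff_outer_mono order_trans)
    also have "?H (\<Union>k. D (k + n)) \<le> (\<Sum>k. ?H (D (k + n)))" by (rule hausdorff_outer_Union)
    also have "(\<Sum>k. ?H (D (k + n))) = ennreal (\<Sum>k. b (k + n))"
      unfolding b(1) using b(2) summ by (intro suminf_ennreal2 summable_ignore_initial_segment)
    finally show ?thesis by (simp add: add_left_mono)
  qed
  show ?thesis
  proof (rule ennreal_le_epsilon)
    fix e :: real assume "0 < e"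
    then obtain n where n: "norm (\<Sum>k. b (k + n)) < e" using suminf_exist_split[OF _ summ] by blast
    have "?H (C \<inter> X) + ?H (X - C) \<le> ?H (C \<inter> X) + (?H (R n) + ennreal (\<Sum>k. b (k + n)))"
      by (intro add_left_mono tail)
    also have "\<dots> = (?H (C \<inter> X) + ?H (R n)) + ennreal (\<Sum>k. b (k + n))" by (simp add: add.assoc)
    also have "\<dots> \<le> ?H X + ennreal e"
      using n by (intro add_mono 1 ennreal_leI) auto
    finally show "?H (C \<inter> X) + ?H (X - C) \<le> ?H X + ennreal e" .
  qed
qed

text \<open>The outer measure is metric, so closed sets split all sets, and Caratheodory's extension
  applies to the Borel sets.\<close>

lemma hausdorff_measure_space: "measure_space UNIV (sets borel) (hausdorff_outer s :: 'a::metric_space set \<Rightarrow> ennreal)"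
proof -
  let ?H = "hausdorff_outer s :: 'a set \<Rightarrow> ennreal"
  interpret sigma_algebra "UNIV :: 'a set" "Pow UNIV" by (rule sigma_algebra_Pow)
  have "outer_measure_space (Pow UNIV) ?H"
    unfolding outer_measure_space_def positive_def increasing_def countably_subadditive_def
    by (auto simp: hausdorff_outer_empty intro: hausdorff_outer_mono hausdorff_outer_Union)
  then have ms: "measure_space UNIV (lambda_system UNIV (Pow UNIV) ?H) ?H"
    by (rule caratheodory_lemma)
  then interpret L: sigma_algebra UNIV "lambda_system UNIV (Pow UNIV) ?H"
    by (simp add: measure_space_def)
  have "C \<in> lambda_system UNIV (Pow UNIV) ?H" if "closed C" for C
  proof -
    have "?H (C \<inter> X) + ?H ((UNIV - C) \<inter> X) = ?H X" for X
    proof (rule antisym)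
      have eq: "(UNIV - C) \<inter> X = X - C" "(C \<inter> X) \<union> (X - C) = X" by auto
      show "?H (C \<inter> X) + ?H ((UNIV - C) \<inter> X) \<le> ?H X"
        unfolding eq by (rule hausdorff_outer_closed_split[OF that])
      show "?H X \<le> ?H (C \<inter> X) + ?H ((UNIV - C) \<inter> X)"
        unfolding eq using hausdorff_outer_Un[of s "C \<inter> X" "X - C"] by (simp add: eq)
    qed
    then show ?thesis by (simp add: lambda_system_def)
  qed
  then have "U \<in> lambda_system UNIV (Pow UNIV) ?H" if "open U" for U
    using L.compl_sets[of "- U"] that by (simp add: closed_Compl Compl_eq_Diff_UNIV[symmetric])
  then have "sigma_sets UNIV {U. open U} \<subseteq> lambda_system UNIV (Pow UNIV) ?H"
    by (intro L.sigma_sets_subset) auto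
  then have "sets borel \<subseteq> lambda_system UNIV (Pow UNIV) ?H"
    by (simp add: borel_def)
  moreover have "sigma_algebra UNIV (sets (borel :: 'a measure))"
    using sets.sigma_algebra_axioms[of "borel :: 'a measure"] by simp
  ultimately show ?thesis using measure_down[OF ms] by blast
qed

lemma sets_hausdorff_measure [simp, measurable_cong]: "sets (hausdorff_measure s) = sets borel"
  and space_hausdorff_measure [simp]: "space (hausdorff_measure s) = UNIV"
  using sets.sigma_sets_eq[of borel] by (simp_all add: hausdorff_measure_def)

lemma emeasure_hausdorff: "A \<in> sets borel \<Longrightarrow> emeasure (hausdorff_measure s) A = hausdorff_outer s A"
  unfolding hausdorff_measure_def
  using hausdorff_measure_space[of s]
  by (intro emeasure_measure_of_sigma) (auto simp: measure_space_def)

lemma hausdorff_outer_isometry_le: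
  fixes f :: "'a::real_normed_vector \<Rightarrow> 'a"
  assumes iso: "\<And>x y. dist (f x) (f y) = dist x y"
  shows "hausdorff_outer s (f ` A) \<le> hausdorff_outer s A"
proof -
  have "hausdorff_pre s \<delta> (f ` A) \<le> hausdorff_pre s \<delta> A" for \<delta>
    unfolding hausdorff_pre_eq[of s \<delta> A]
  proof (rule INF_greatest)
    fix U assume U: "U \<in> cover_set \<delta> A"
    have b: "bounded (f ` U i)" for i
    proof -
      obtain x e where "\<forall>y\<in>U i. dist x y \<le> e" using U unfolding cover_set_def bounded_def by blast
      then show ?thesis unfolding bounded_def by (intro exI[of _ "f x"] exI[of _ e]) (auto simp: iso)
    qed
    have d: "diameter (f ` U i) = diameter (U i)" for i
    proof -
      have "bounded (U i)" using U by (simp add: cover_set_def)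
      show ?thesis
      proof (cases "U i = {}")
        case False
        show ?thesis
        proof (rule antisym)
          show "diameter (f ` U i) \<le> diameter (U i)"
            using False diameter_bounded_bound[OF \<open>bounded (U i)\<close>]
            by (intro diameter_le) (auto simp flip: dist_norm simp: iso)
          show "diameter (U i) \<le> diameter (f ` U i)"
            using False diameter_bounded_bound[OF b[of i]]
            by (intro diameter_le) (auto simp flip: dist_norm, metis imageI iso)
        qed
      qed simp
    qed
    have "(\<lambda>i. f ` U i) \<in> cover_set \<delta> (f ` A)"
    proof -
      have "f ` A \<subseteq> (\<Union>i. f ` U i)" using U unfolding cover_set_def by blast
      then show ?thesis using U b by (simp add: cover_set_def d)
    qed
    then have "hausdorff_pre s \<delta> (f ` A) \<le> (\<Sum>i. ennreal (diameter (f ` U i) powr s))"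
      unfolding hausdorff_pre_eq by (rule INF_lower)
    then show "hausdorff_pre s \<delta> (f ` A) \<le> (\<Sum>i. ennreal (diameter (U i) powr s))" by (simp add: d)
  qed
  then show ?thesis unfolding hausdorff_outer_def by (intro SUP_mono) auto
qed

lemma hausdorff_outer_translate:
  "hausdorff_outer s ((\<lambda>x. x + a) ` A) = hausdorff_outer s A" for a :: "'a::real_normed_vector"
proof (rule antisym)
  show "hausdorff_outer s ((\<lambda>x. x + a) ` A) \<le> hausdorff_outer s A"
    by (rule hausdorff_outer_isometry_le) (simp add: dist_norm)
  have "hausdorff_outer s ((\<lambda>x. x - a) ` (\<lambda>x. x + a) ` A) \<le> hausdorff_outer s ((\<lambda>x. x + a) ` A)"
    by (rule hausdorff_outer_isometry_le) (simp add: dist_norm)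
  then show "hausdorff_outer s A \<le> hausdorff_outer s ((\<lambda>x. x + a) ` A)" by (simp add: image_comp)
qed

lemma hausdorff_outer_singleton: assumes "0 < s" shows "hausdorff_outer s {x} = 0"
proof -
  have "hausdorff_pre s \<delta> {x} = 0" if "0 < \<delta>" for \<delta>
  proof -
    have "(\<lambda>i::nat. {x}) \<in> cover_set \<delta> {x}" using that by (simp add: cover_set_def)
    then have "hausdorff_pre s \<delta> {x} \<le> (\<Sum>i::nat. ennreal (diameter {x} powr s))"
      unfolding hausdorff_pre_eq by (rule INF_lower)
    then show ?thesis by simp
  qed
  then show ?thesis unfolding hausdorff_outer_def by (intro antisym SUP_least) auto
qed

section \<open>The normalized Hausdorff measure of the sickle\<close>

lemma word_map_affine: "word_map w x = (1 / 7 ^ length w) *\<^sub>R x + word_map w 0"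
proof (induction w)
  case (Cons i w)
  have lin: "cell_map i (a + b) = (1/7) *\<^sub>R a + cell_map i b" for a b
    by (simp add: cell_map_def scaleR_add_right)
  have "word_map (i # w) x = cell_map i ((1 / 7 ^ length w) *\<^sub>R x + word_map w 0)"
    unfolding word_map_Cons comp_apply by (rule arg_cong[OF Cons])
  then show ?case unfolding lin by simp
qed simp

context sickle
begin

definition \<alpha> :: real where "\<alpha> = ln 17 / ln 7"

definition \<mu> :: "plane measure" where "\<mu> = normalized_hausdorff \<alpha> K"

lemma alpha_pos: "0 < \<alpha>" by (simp add: \<alpha>_def)

lemma seven_powr_alpha: "7 powr \<alpha> = 17"
  by (simp add: \<alpha>_def powr_def)

lemma seven_power_powr: "(1 / 7 ^ n) powr \<alpha> = 1 / 17 ^ n"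
proof -
  have "(7 ^ n) powr \<alpha> = (7 powr real n) powr \<alpha>" by (simp add: powr_realpow)
  also have "\<dots> = 17 powr real n" by (subst powr_powr_swap) (simp add: seven_powr_alpha)
  also have "\<dots> = 17 ^ n" by (simp add: powr_realpow)
  finally show ?thesis by (simp add: powr_divide)
qed

lemma cells_compact: "compact (word_map w ` K)"
  by (intro compact_continuous_image continuous_on_word_map compact_K)

lemma cells_borel [measurable, simp]: "word_map w ` K \<in> sets borel"
  using cells_compact compact_imp_closed borel_closed by blast

text \<open>Cells of the same level are translates of each other.\<close>

lemma outer_cell_eq:
  assumes "length v = length w"
  shows "hausdorff_outer s (word_map v ` K) = hausdorff_outer s (word_map w ` K)"
proof -
  define c where "c = word_map v 0 - word_map w 0"
  have "word_map v x = word_map w x + c" for x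
    unfolding c_def by (subst word_map_affine[of v x], subst word_map_affine[of w x]) (simp add: assms)
  then have "word_map v ` K = (\<lambda>x. x + c) ` (word_map w ` K)"
    unfolding image_image by (intro image_cong refl)
  then show ?thesis by (simp only: hausdorff_outer_translate)
qed

lemma diameter_cell: assumes "w \<in> words I n" shows "diameter (word_map w ` K) \<le> 5/4 / 7 ^ n"
proof (rule diameter_le)
  show "norm (x - y) \<le> 5/4 / 7 ^ n" if x: "x \<in> word_map w ` K" and y: "y \<in> word_map w ` K" for x y
  proof -
    obtain a b where ab: "a \<in> K" "b \<in> K" "x = word_map w a" "y = word_map w b" using x y by blast
    have "dist x y = dist a b / 7 ^ n" using ab assms by (simp add: dist_word_map words_def)
    also have "\<dots> \<le> 5/4 / 7 ^ n" using dist_K_le[OF ab(1,2)] by (intro divide_right_mono) auto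
    finally show ?thesis by (simp add: dist_norm)
  qed
qed (simp add: K_nonempty)

text \<open>Upper bound from the natural covers by the cells of one level.\<close>

lemma outer_K_finite: "hausdorff_outer \<alpha> K \<le> ennreal ((5/4) powr \<alpha>)"
  unfolding hausdorff_outer_def
proof (rule SUP_least)
  fix \<delta> :: real assume "\<delta> \<in> {0<..}"
  then have "0 < \<delta> / (5/4)" by simp
  then obtain n where n: "(1/7) ^ n < \<delta> / (5/4)" using real_arch_pow_inv[of "\<delta> / (5/4)" "1/7"] by auto
  have "finite (words I n)" by (simp add: finite_words)
  from ex_bij_betw_nat_finite[OF this] obtain e :: "nat \<Rightarrow> cell list" where e: "bij_betw e {0..<17 ^ n} (words I n)"
    by (auto simp: card_words card_I)
  define U where "U i = (if i < 17 ^ n then word_map (e i) ` K else {})" for i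
  have ei: "e i \<in> words I n" if "i < 17 ^ n" for i using e that by (auto simp: bij_betw_def)
  have small: "5/4 / 7 ^ n \<le> \<delta>" using n by (simp add: power_divide field_simps)
  have dU: "diameter (U i) \<le> 5/4 / 7 ^ n" for i
    using diameter_cell[OF ei] by (auto simp: U_def)
  have "K \<subseteq> (\<Union>i. U i)"
  proof
    fix x assume "x \<in> K"
    then obtain w y where w: "w \<in> words I n" "y \<in> K" "x = word_map w y" using K_words by blast
    then obtain i where "i < 17 ^ n" "e i = w"
      using e unfolding bij_betw_def by (metis imageE atLeastLessThan_iff)
    then have "x \<in> U i" using w by (simp add: U_def)
    then show "x \<in> (\<Union>i. U i)" by blast
  qed
  moreover have "bounded (U i) \<and> diameter (U i) \<le> \<delta>" for i
    using dU[of i] small cells_compact compact_imp_bounded by (auto simp: U_def)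
  ultimately have "U \<in> cover_set \<delta> K" by (simp add: cover_set_def)
  then have "hausdorff_pre \<alpha> \<delta> K \<le> (\<Sum>i. ennreal (diameter (U i) powr \<alpha>))"
    unfolding hausdorff_pre_eq by (rule INF_lower)
  also have "\<dots> = (\<Sum>i<17 ^ n. ennreal (diameter (U i) powr \<alpha>))"
    by (rule suminf_finite) (auto simp: U_def)
  also have "\<dots> \<le> (\<Sum>i<(17::nat) ^ n. ennreal ((5/4) powr \<alpha> / 17 ^ n))"
  proof (intro sum_mono ennreal_leI)
    fix i
    have "0 \<le> diameter (U i)" using cells_compact compact_imp_bounded diameter_ge_0 by (auto simp: U_def)
    then have "diameter (U i) powr \<alpha> \<le> (5/4 * (1 / 7 ^ n)) powr \<alpha>"
      using dU[of i] alpha_pos by (intro powr_mono2) auto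
    also have "\<dots> = (5/4) powr \<alpha> * (1 / 17 ^ n)" by (subst powr_mult) (auto simp: seven_power_powr)
    finally show "diameter (U i) powr \<alpha> \<le> (5/4) powr \<alpha> / 17 ^ n" by simp
  qed
  also have "\<dots> = ennreal ((5/4) powr \<alpha>)"
    by (simp add: ennreal_of_nat_eq_real_of_nat flip: ennreal_mult)
  finally show "hausdorff_pre \<alpha> \<delta> K \<le> ennreal ((5/4) powr \<alpha>)" .
qed

text \<open>Positions of cells are lattice points, so only few of them are close to a given point.\<close>

lemma card_cells_near:
  "card {v \<in> words I n. \<exists>y\<in>K. dist x (word_map v y) < 1 / 7 ^ n} \<le> 25" (is "card ?S \<le> _")
proof -
  define X Y where "X = 7 ^ n * cx x" "Y = 7 ^ n * cy x"
  note XY = this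
  define B where "B = {\<lfloor>X\<rfloor> - 2 .. \<lfloor>X\<rfloor> + 2} \<times> {\<lfloor>Y\<rfloor> - 2 .. \<lfloor>Y\<rfloor> + 2}"
  define f where "f v = (int (posx v), int (posy v))" for v
  have "f ` ?S \<subseteq> B"
  proof (rule image_subsetI)
    fix v assume "v \<in> ?S"
    then obtain y where v: "v \<in> words I n" and y: "y \<in> K" and d: "dist x (word_map v y) < 1 / 7 ^ n"
      by blast
    have len: "length v = n" using v by (simp add: words_def)
    define D where "D = x - word_map v y"
    have "norm D < 1 / 7 ^ n" using d by (simp add: D_def dist_norm)
    then have b: "\<bar>7 ^ n * t\<bar> < 2" if "\<bar>t\<bar> \<le> 2 * norm D" for t
    proof -
      have "\<bar>7 ^ n * t\<bar> = 7 ^ n * \<bar>t\<bar>" by (simp add: abs_mult)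
      also have "\<dots> \<le> 7 ^ n * (2 * norm D)" using that by simp
      also have "\<dots> < 2" using \<open>norm D < 1 / 7 ^ n\<close> by (simp add: field_simps)
      finally show ?thesis .
    qed
    have "7 ^ n * cx D = X - cx y - real (posx v)" "7 ^ n * cy D = Y - cy y - real (posy v)"
      by (simp_all add: D_def cx_diff cy_diff cx_word_map cy_word_map len XY field_simps)
    then have "\<bar>X - cx y - real (posx v)\<bar> < 2" "\<bar>Y - cy y - real (posy v)\<bar> < 2"
      using b[OF abs_lattice_le(1)[of D]] b[OF abs_lattice_le(2)[of D]] by simp_all
    then show "f v \<in> B"
      using K_coords[OF y] unfolding f_def B_def mem_Times_iff by simp linarith
  qed
  moreover have "inj_on f ?S"
  proof (rule inj_onI)
    fix v w assume "v \<in> ?S" "w \<in> ?S" "f v = f w"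
    then show "v = w" using pos_inj[of v w] words_lattice by (auto simp: f_def words_def)
  qed
  moreover have "finite B" "card B = 25" by (auto simp: B_def card_cartesian_product)
  ultimately show ?thesis using card_inj_on_le[of f ?S B] by simp
qed

text \<open>A set of diameter between two consecutive powers of \<open>1/7\<close> lies in a ball of
  the larger radius.  The extra \<open>e\<close> serves the sets of diameter
  \<open>0\<close>.\<close>

lemma cover_radius:
  assumes "bounded U" "diameter U \<le> 1/7" "0 < (e::real)"
  shows "\<exists>x n. U \<inter> K \<subseteq> ball x (1 / 7 ^ n) \<and> 1 / 17 ^ n \<le> 17 * diameter U powr \<alpha> + e"
proof -
  obtain N where N: "(1/17) ^ N < e" using real_arch_pow_inv[OF assms(3), of "1/17"] by auto
  define d where "d = diameter U"
  have d0: "0 \<le> d" using assms(1) by (simp add: d_def diameter_ge_0)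
  show ?thesis
  proof (cases "U \<inter> K = {}")
    case True
    have "1 / 17 ^ N \<le> 17 * diameter U powr \<alpha> + e" using N by (simp add: power_divide add_increasing)
    then show ?thesis using True by blast
  next
    case False
    then obtain x where x: "x \<in> U" by blast
    have dx: "dist x y \<le> d" if "y \<in> U" for y
      using diameter_bounded_bound[OF assms(1) x that] by (simp add: d_def)
    show ?thesis
    proof (cases "d = 0")
      case True
      then have "U \<subseteq> {x}" using dx by auto
      then have "U \<inter> K \<subseteq> ball x (1 / 7 ^ N)" by auto
      moreover have "1 / 17 ^ N \<le> 17 * diameter U powr \<alpha> + e" using N by (simp add: power_divide add_increasing)
      ultimately show ?thesis by blast
    next
      case False
      then have d: "0 < d" using d0 by simp
      obtain m where "(1/7) ^ m < d" using real_arch_pow_inv[OF d, of "1/7"] by auto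
      then have "1 / 7 ^ Suc m \<le> d" by (simp add: power_divide field_simps)
      then have ex: "\<exists>m. 1 / 7 ^ Suc m \<le> d" by blast
      define n where "n = (LEAST m. 1 / 7 ^ Suc m \<le> d)"
      have n1: "1 / 7 ^ Suc n \<le> d" unfolding n_def using ex by (rule LeastI_ex)
      have n2: "d < 1 / 7 ^ n"
      proof (cases n)
        case 0 then show ?thesis using assms(2) by (simp add: d_def)
      next
        case (Suc k)
        then have "k < n" by simp
        from not_less_Least[OF this[unfolded n_def]] show ?thesis using Suc by simp
      qed
      have "U \<inter> K \<subseteq> ball x (1 / 7 ^ n)"
      proof
        fix y assume "y \<in> U \<inter> K"
        then have "dist x y < 1 / 7 ^ n" using dx[of y] n2 by simp
        then show "y \<in> ball x (1 / 7 ^ n)" by simp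
      qed
      moreover have "1 / 17 ^ n = 17 * (1 / 7 ^ Suc n) powr \<alpha>" unfolding seven_power_powr by simp
      moreover have "(1 / 7 ^ Suc n) powr \<alpha> \<le> d powr \<alpha>" using n1 alpha_pos by (intro powr_mono2) auto
      ultimately show ?thesis using assms(3) unfolding d_def by (intro exI[of _ x] exI[of _ n]) auto
    qed
  qed
qed

text \<open>Mass distribution by counting cells: a cover with a small sum would contain too few cells of
  a common level.\<close>

lemma outer_K_pos: "hausdorff_outer \<alpha> K > 0"
proof -
  have "ennreal (1/1000) \<le> hausdorff_pre \<alpha> (1/7) K"
    unfolding hausdorff_pre_eq
  proof (rule INF_greatest)
    fix U assume "U \<in> cover_set (1/7) K"
    then have cov: "K \<subseteq> (\<Union>i. U i)" and bd: "\<And>i. bounded (U i)" "\<And>i. diameter (U i) \<le> 1/7"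
      by (auto simp: cover_set_def)
    show "ennreal (1/1000) \<le> (\<Sum>i. ennreal (diameter (U i) powr \<alpha>))"
    proof (rule ccontr)
      assume "\<not> ?thesis"
      then have small: "(\<Sum>i. ennreal (diameter (U i) powr \<alpha>)) < ennreal (1/1000)" by simp
      have "\<forall>i. \<exists>xn. U i \<inter> K \<subseteq> ball (fst xn) (1 / 7 ^ (snd xn)) \<and>
          1 / 17 ^ (snd xn) \<le> 17 * diameter (U i) powr \<alpha> + 1/1000 * (1/2) ^ Suc i"
      proof
        fix i
        have "(0::real) < 1/1000 * (1/2) ^ Suc i" by simp
        from cover_radius[OF bd this] obtain x n where "U i \<inter> K \<subseteq> ball x (1 / 7 ^ n)"
          "1 / 17 ^ n \<le> 17 * diameter (U i) powr \<alpha> + 1/1000 * (1/2) ^ Suc i" by blast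
        then show "\<exists>xn. U i \<inter> K \<subseteq> ball (fst xn) (1 / 7 ^ (snd xn)) \<and>
          1 / 17 ^ (snd xn) \<le> 17 * diameter (U i) powr \<alpha> + 1/1000 * (1/2) ^ Suc i"
          by (intro exI[of _ "(x, n)"]) simp
      qed
      then obtain xn where xn: "\<And>i. U i \<inter> K \<subseteq> ball (fst (xn i)) (1 / 7 ^ (snd (xn i)))"
        "\<And>i. 1 / 17 ^ (snd (xn i)) \<le> 17 * diameter (U i) powr \<alpha> + 1/1000 * (1/2) ^ Suc i"
        by metis
      define x where "x i = fst (xn i)" for i
      define m where "m i = snd (xn i)" for i
      have "K \<subseteq> (\<Union>i\<in>UNIV. ball (x i) (1 / 7 ^ m i))" using cov xn(1) unfolding x_def m_def by blast
      from compactE_image[OF compact_K open_ball this]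
      obtain J where J: "finite J" "K \<subseteq> (\<Union>i\<in>J. ball (x i) (1 / 7 ^ m i))" .
      define N where "N = Max (insert 0 (m ` J))"
      have mN: "m i \<le> N" if "i \<in> J" for i using J that by (auto simp: N_def)
      define S where "S i = {v \<in> words I (m i). \<exists>y\<in>K. dist (x i) (word_map v y) < 1 / 7 ^ m i}" for i
      have finS: "finite (S i)" for i by (auto simp: S_def finite_words)
      have "words I N \<subseteq> (\<Union>i\<in>J. (\<lambda>(v, t). v @ t) ` (S i \<times> words I (N - m i)))"
      proof
        fix w assume w: "w \<in> words I N"
        have "word_map w p1 \<in> K" using word_map_K[OF w] by simp
        then obtain i where i: "i \<in> J" "word_map w p1 \<in> ball (x i) (1 / 7 ^ m i)" using J(2) by blast
        have "w \<in> words I (m i + (N - m i))" using w mN[OF i(1)] by simp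
        then obtain v t where vt: "w = v @ t" "v \<in> words I (m i)" "t \<in> words I (N - m i)"
          by (rule words_add_split)
        have "dist (x i) (word_map v (word_map t p1)) < 1 / 7 ^ m i"
          using i(2) vt(1) by (simp add: word_map_append)
        then have "v \<in> S i" using vt(2) word_map_K[OF vt(3) p_K(1)] unfolding S_def by blast
        with vt i(1) show "w \<in> (\<Union>i\<in>J. (\<lambda>(v, t). v @ t) ` (S i \<times> words I (N - m i)))" by blast
      qed
      then have "card (words I N) \<le> card (\<Union>i\<in>J. (\<lambda>(v, t). v @ t) ` (S i \<times> words I (N - m i)))"
        using J finS by (intro card_mono) (auto simp: finite_words)
      also have "\<dots> \<le> (\<Sum>i\<in>J. card ((\<lambda>(v, t). v @ t) ` (S i \<times> words I (N - m i))))"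
        by (rule card_UN_le[OF J(1)])
      also have "\<dots> \<le> (\<Sum>i\<in>J. 25 * 17 ^ (N - m i))"
      proof (rule sum_mono)
        fix i
        have "card ((\<lambda>(v, t). v @ t) ` (S i \<times> words I (N - m i))) \<le> card (S i \<times> words I (N - m i))"
          using finS by (intro card_image_le) (auto simp: finite_words)
        also have "\<dots> = card (S i) * 17 ^ (N - m i)" by (simp add: card_cartesian_product card_words card_I)
        also have "\<dots> \<le> 25 * 17 ^ (N - m i)"
          using card_cells_near[of "m i" "x i"] by (simp add: S_def)
        finally show "card ((\<lambda>(v, t). v @ t) ` (S i \<times> words I (N - m i))) \<le> 25 * 17 ^ (N - m i)" .
      qed
      finally have "(17::nat) ^ N \<le> (\<Sum>i\<in>J. 25 * 17 ^ (N - m i))" by (simp add: card_words card_I)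
      then have "real (17 ^ N) \<le> real (\<Sum>i\<in>J. 25 * 17 ^ (N - m i))" by (rule of_nat_mono)
      then have "17 ^ N \<le> (\<Sum>i\<in>J. 25 * (17::real) ^ (N - m i))" by simp
      also have "\<dots> = (\<Sum>i\<in>J. 25 * (17 ^ N * (1 / 17 ^ m i)))"
        using mN by (intro sum.cong refl) (simp add: power_diff)
      also have "\<dots> = 17 ^ N * (25 * (\<Sum>i\<in>J. 1 / 17 ^ m i))" by (simp add: sum_distrib_left mult_ac)
      finally have "1 \<le> 25 * (\<Sum>i\<in>J. 1 / (17::real) ^ m i)" by simp
      note c1 = this
      have "(\<Sum>i\<in>J. 1 / (17::real) ^ m i) \<le> (\<Sum>i\<in>J. 17 * diameter (U i) powr \<alpha> + 1/1000 * (1/2) ^ Suc i)"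
        using xn(2) by (intro sum_mono) (simp add: m_def)
      also have "\<dots> = 17 * (\<Sum>i\<in>J. diameter (U i) powr \<alpha>) + 1/1000 * (\<Sum>i\<in>J. (1/2) ^ Suc i)"
        by (simp add: sum.distrib sum_distrib_left)
      finally have c2: "(\<Sum>i\<in>J. 1 / (17::real) ^ m i)
         \<le> 17 * (\<Sum>i\<in>J. diameter (U i) powr \<alpha>) + 1/1000 * (\<Sum>i\<in>J. (1/2) ^ Suc i)" .
      have c3: "(\<Sum>i\<in>J. (1/2::real) ^ Suc i) \<le> 1"
        using sum_le_suminf[of "\<lambda>i. (1/2::real) ^ Suc i" J] power_half_series J(1)
        by (simp add: sums_iff del: power_Suc)
      have c4: "(\<Sum>i\<in>J. diameter (U i) powr \<alpha>) \<le> 1/1000"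
      proof -
        have "ennreal (\<Sum>i\<in>J. diameter (U i) powr \<alpha>) = (\<Sum>i\<in>J. ennreal (diameter (U i) powr \<alpha>))"
          by (simp add: sum_ennreal)
        also have "\<dots> \<le> (\<Sum>i. ennreal (diameter (U i) powr \<alpha>))" by (intro sum_le_suminf summableI J(1)) auto
        also have "\<dots> < ennreal (1/1000)" by (rule small)
        finally show ?thesis by (simp add: ennreal_less_iff sum_nonneg)
      qed
      from c1 c2 c3 c4 show False by linarith
    qed
  qed
  also have "\<dots> \<le> hausdorff_outer \<alpha> K" by (rule hausdorff_pre_le_outer) simp
  finally show ?thesis by (metis ennreal_less_zero_iff less_le_trans zero_less_divide_1_iff zero_less_numeral)
qed

lemma space_mu [simp]: "space \<mu> = K" and sets_mu: "sets \<mu> = sets (restrict_space borel K)"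
  by (simp_all add: \<mu>_def normalized_hausdorff_def space_restrict_space sets_restrict_space)

lemma in_sets_mu: "A \<in> sets borel \<Longrightarrow> A \<subseteq> K \<Longrightarrow> A \<in> sets \<mu>"
  unfolding sets_mu sets_restrict_space by (rule image_eqI[of _ _ A]) auto

lemma K_sets_mu [simp, measurable]: "K \<in> sets \<mu>" by (simp add: in_sets_mu)

lemma cells_mu [simp]: "w \<in> words I n \<Longrightarrow> word_map w ` K \<in> sets \<mu>"
  using word_map_K by (intro in_sets_mu) auto

lemma emeasure_mu: "A \<in> sets borel \<Longrightarrow> A \<subseteq> K \<Longrightarrow> emeasure \<mu> A = hausdorff_outer \<alpha> A / hausdorff_outer \<alpha> K"
proof -
  assume A: "A \<in> sets borel" "A \<subseteq> K"
  define N where "N = restrict_space (hausdorff_measure \<alpha>) K"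
  have e: "emeasure N B = hausdorff_outer \<alpha> B" if "B \<in> sets borel" "B \<subseteq> K" for B
    using that by (simp add: N_def emeasure_restrict_space emeasure_hausdorff)
  have "K \<in> sets N" "A \<in> sets N"
    using in_sets_mu[OF A] in_sets_mu[OF K_borel] by (simp_all add: sets_mu N_def sets_restrict_space)
  then have "emeasure \<mu> A = emeasure N (K \<inter> A) / emeasure N K"
    unfolding \<mu>_def normalized_hausdorff_def N_def[symmetric] by (rule emeasure_uniform_measure)
  also have "K \<inter> A = A" using A by auto
  finally show ?thesis using A by (simp add: e)
qed

lemma emeasure_mu_K: "emeasure \<mu> K = 1"
proof -
  have "hausdorff_outer \<alpha> K \<noteq> 0" "hausdorff_outer \<alpha> K \<noteq> top"
    using outer_K_pos outer_K_finite by (auto simp: top_unique)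
  then show ?thesis by (simp add: emeasure_mu ennreal_divide_self less_top)
qed

lemma finite_measure_mu: "finite_measure \<mu>"
  by (intro finite_measureI) (simp add: emeasure_mu_K)

sublocale M: finite_measure \<mu> by (rule finite_measure_mu)

lemma emeasure_mu_singleton: "x \<in> K \<Longrightarrow> emeasure \<mu> {x} = 0"
  by (simp add: emeasure_mu hausdorff_outer_singleton alpha_pos)

lemma finite_null: "finite A \<Longrightarrow> A \<subseteq> K \<Longrightarrow> A \<in> null_sets \<mu>"
proof (induction A rule: finite_induct)
  case (insert x A)
  then have "{x} \<in> null_sets \<mu>" by (intro null_setsI in_sets_mu emeasure_mu_singleton) auto
  then have "{x} \<union> A \<in> null_sets \<mu>" using insert by (intro null_sets.Un) auto
  then show ?case by simp
qed simp

text \<open>Overlaps of cells consist of corners, hence are null sets.\<close>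

lemma AE_one_cell: "AE x in \<mu>. (\<Sum>w\<in>words I n. indicator (word_map w ` K) x) = (1 :: ennreal)"
proof (rule AE_I')
  let ?N = "\<Union>w\<in>words I n. word_map w ` V0"
  show "?N \<in> null_sets \<mu>"
    using word_map_K V0_K by (intro finite_null) (auto simp: finite_words)
  show "{x \<in> space \<mu>. (\<Sum>w\<in>words I n. indicator (word_map w ` K) x) \<noteq> (1 :: ennreal)} \<subseteq> ?N"
  proof clarsimp
    fix x assume x: "x \<in> K" and ne: "(\<Sum>w\<in>words I n. indicator (word_map w ` K) x) \<noteq> (1 :: ennreal)"
    show "\<exists>w\<in>words I n. x \<in> word_map w ` V0"
    proof (rule ccontr)
      assume no: "\<not> ?thesis"
      obtain w y where w: "w \<in> words I n" "y \<in> K" "x = word_map w y" using K_words[OF x] by blast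
      have "indicator (word_map v ` K) x = (if v = w then 1 else 0 :: ennreal)" if v: "v \<in> words I n" for v
      proof (cases "v = w")
        case False
        have "x \<notin> word_map v ` K"
        proof
          assume "x \<in> word_map v ` K"
          then obtain y' where "y' \<in> K" "word_map v y' = word_map w y" using w by auto
          from cell_overlap[OF v w(1) False this(1) w(2) this(2)] show False using no w by blast
        qed
        then show ?thesis using False by simp
      qed (use w in auto)
      then have "(\<Sum>v\<in>words I n. indicator (word_map v ` K) x) = (\<Sum>v\<in>words I n. if v = w then 1 else 0 :: ennreal)"
        by (rule sum.cong[OF refl])
      also have "\<dots> = 1" using w by (simp add: finite_words)
      finally show False using ne by simp
    qed
  qed
qed

lemma nn_integral_cells:
  assumes "f \<in> borel_measurable \<mu>"
  shows "(\<integral>\<^sup>+x. f x \<partial>\<mu>) = (\<Sum>w\<in>words I n. \<integral>\<^sup>+x\<in>word_map w ` K. f x \<partial>\<mu>)"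
proof -
  have "(\<Sum>w\<in>words I n. \<integral>\<^sup>+x\<in>word_map w ` K. f x \<partial>\<mu>) = (\<integral>\<^sup>+x. (\<Sum>w\<in>words I n. f x * indicator (word_map w ` K) x) \<partial>\<mu>)"
    using assms by (intro nn_integral_sum[symmetric] borel_measurable_times_ennreal borel_measurable_indicator) auto
  also have "\<dots> = (\<integral>\<^sup>+x. f x \<partial>\<mu>)"
    by (rule nn_integral_cong_AE, rule AE_mp[OF AE_one_cell[of n]]) (simp flip: sum_distrib_left)
  finally show ?thesis by simp
qed

text \<open>The \<open>17 ^ n\<close> cells of level \<open>n\<close> are translates of each other
  and overlap in null sets, so each takes an equal share.\<close>

lemma emeasure_cell: assumes w: "w \<in> words I n" shows "emeasure \<mu> (word_map w ` K) = ennreal (1 / 17 ^ n)"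
proof -
  have eq: "emeasure \<mu> (word_map v ` K) = emeasure \<mu> (word_map w ` K)" if "v \<in> words I n" for v
  proof -
    have "word_map v ` K \<subseteq> K" "word_map w ` K \<subseteq> K" using that w word_map_K by auto
    then show ?thesis using outer_cell_eq[of v w \<alpha>] that w by (simp add: emeasure_mu words_def)
  qed
  have "1 = (\<integral>\<^sup>+x. 1 \<partial>\<mu>)" by (simp add: emeasure_mu_K)
  also have "\<dots> = (\<Sum>v\<in>words I n. emeasure \<mu> (word_map v ` K))"
    by (subst nn_integral_cells[of _ n]) (auto intro!: sum.cong)
  also have "\<dots> = (\<Sum>v\<in>words I n. emeasure \<mu> (word_map w ` K))" by (intro sum.cong refl eq)
  also have "\<dots> = ennreal (17 ^ n) * emeasure \<mu> (word_map w ` K)"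
    by (simp add: card_words card_I ennreal_of_nat_eq_real_of_nat)
  finally have *: "1 = ennreal (17 ^ n) * emeasure \<mu> (word_map w ` K)" .
  obtain c where c: "0 \<le> c" "emeasure \<mu> (word_map w ` K) = ennreal c"
    using M.emeasure_eq_measure measure_nonneg by blast
  have "ennreal (17 ^ n * c) = ennreal 1" using * c by (simp add: ennreal_mult)
  then have "17 ^ n * c = 1" using c by (subst (asm) ennreal_inj) auto
  then have "c = 1 / 17 ^ n" by (simp add: field_simps)
  then show ?thesis using c by simp
qed

lemma measure_cell: "w \<in> words I n \<Longrightarrow> measure \<mu> (word_map w ` K) = 1 / 17 ^ n"
  by (simp add: measure_def emeasure_cell)

end

section \<open>Square integrable functions on the sickle\<close>

context sickle
begin

lemma borel_mu_continuous [simp]: "continuous_on K f \<Longrightarrow> f \<in> borel_measurable \<mu>" for f :: "plane \<Rightarrow> real"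
  using borel_measurable_continuous_on_restrict[of K f] measurable_cong_sets[OF sets_mu refl] by blast

lemma borel_mu_diff:
  fixes f h :: "plane \<Rightarrow> real"
  shows "f \<in> borel_measurable \<mu> \<Longrightarrow> continuous_on K h \<Longrightarrow> (\<lambda>x. f x - h x) \<in> borel_measurable \<mu>"
    "f \<in> borel_measurable \<mu> \<Longrightarrow> continuous_on K h \<Longrightarrow> (\<lambda>x. h x - f x) \<in> borel_measurable \<mu>"
  by (simp_all add: borel_measurable_diff)

text \<open>The diameters of the cells containing \<open>x\<close> shrink to zero.\<close>

lemma small_cell:
  assumes "open U" "x \<in> U" "x \<in> K"
  obtains n w where "w \<in> words I n" "x \<in> word_map w ` K" "word_map w ` K \<subseteq> U"
proof -
  obtain e where e: "0 < e" "ball x e \<subseteq> U" using assms(1,2) openE by blast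
  obtain n where n: "(1/7) ^ n < e / 2" using real_arch_pow_inv[of "e/2" "1/7"] e by auto
  obtain w y where w: "w \<in> words I n" "y \<in> K" "x = word_map w y" using K_words[OF assms(3)] by blast
  have "word_map w ` K \<subseteq> ball x e"
  proof (rule image_subsetI)
    fix y' assume "y' \<in> K"
    then have "dist y y' \<le> 5/4" using dist_K_le w(2) by blast
    then have "dist x (word_map w y') \<le> 5/4 / 7 ^ n"
      using w divide_right_mono[of "dist y y'" "5/4" "7 ^ n"] by (simp add: dist_word_map words_def)
    also have "\<dots> < e" using n by (simp add: power_divide field_simps)
    finally show "word_map w y' \<in> ball x e" by simp
  qed
  with w e show ?thesis by (intro that[of w n]) auto
qed

text \<open>A nonempty relatively open set contains a cell and thus is not a null set.\<close>

lemma AE_eq_imp_eq: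
  fixes u v :: "plane \<Rightarrow> real"
  assumes u: "continuous_on K u" and v: "continuous_on K v" and ae: "AE x in \<mu>. u x = v x" and x: "x \<in> K"
  shows "u x = v x"
proof (rule ccontr)
  assume ne: "u x \<noteq> v x"
  have "continuous_on K (\<lambda>x. u x - v x)" using u v by (intro continuous_intros)
  then have "open (- {0::real}) \<Longrightarrow> \<exists>A. open A \<and> A \<inter> K = (\<lambda>x. u x - v x) -` (- {0}) \<inter> K"
    unfolding continuous_on_open_invariant by blast
  then obtain A where A: "open A" "A \<inter> K = (\<lambda>x. u x - v x) -` (- {0}) \<inter> K" by auto
  then have "x \<in> A" using ne x by auto
  from small_cell[OF A(1) this x] obtain n w where w: "w \<in> words I n" "word_map w ` K \<subseteq> A" by metis
  have sub: "word_map w ` K \<subseteq> {x \<in> space \<mu>. \<not> u x = v x}"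
  proof
    fix y assume y: "y \<in> word_map w ` K"
    then have "y \<in> K" using word_map_K[OF w(1)] by blast
    moreover have "y \<in> A \<inter> K" using y w(2) \<open>y \<in> K\<close> by blast
    ultimately show "y \<in> {x \<in> space \<mu>. \<not> u x = v x}" unfolding A(2) by simp
  qed
  obtain N where "{x \<in> space \<mu>. \<not> u x = v x} \<subseteq> N" "emeasure \<mu> N = 0" "N \<in> sets \<mu>"
    using AE_E[OF ae] by blast
  then have "emeasure \<mu> (word_map w ` K) \<le> 0" using sub by (metis emeasure_mono order_trans)
  then show False using emeasure_cell[OF w(1)] by simp
qed

text \<open>Regularity is available for Borel measures on the whole plane, so the measure is pushed
  forward along the inclusion.\<close>

lemma distr_mu_borel:
  "sets (distr \<mu> borel (\<lambda>x. x)) = sets borel" "A \<in> sets borel \<Longrightarrow> emeasure (distr \<mu> borel (\<lambda>x. x)) A = emeasure \<mu> (A \<inter> K)"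
proof -
  have "measurable \<mu> (borel :: plane measure) = measurable (restrict_space borel K) borel"
    by (rule measurable_cong_sets[OF sets_mu refl])
  moreover have "(\<lambda>x. x) \<in> measurable (restrict_space borel K) (borel :: plane measure)"
    using measurable_restrict_space1[OF measurable_ident, of "borel :: plane measure" K] by (simp add: id_def)
  ultimately have "(\<lambda>x. x) \<in> measurable \<mu> (borel :: plane measure)" by simp
  then show "A \<in> sets borel \<Longrightarrow> emeasure (distr \<mu> borel (\<lambda>x. x)) A = emeasure \<mu> (A \<inter> K)"
    by (simp add: emeasure_distr)
qed simp

lemma sets_mu_borel: assumes "A \<in> sets \<mu>" shows "A \<in> sets borel" "A \<subseteq> K"
proof -
  obtain B where "B \<in> sets borel" "A = K \<inter> B" using assms by (auto simp: sets_mu sets_restrict_space)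
  then show "A \<in> sets borel" "A \<subseteq> K" by auto
qed

lemma inner_regular_mu:
  assumes "A \<in> sets \<mu>"
  shows "emeasure \<mu> A = (SUP C\<in>{C. C \<subseteq> A \<and> compact C}. emeasure \<mu> C)"
proof -
  note A = sets_mu_borel[OF assms]
  let ?N = "distr \<mu> borel (\<lambda>x. x)"
  have "emeasure ?N A = (SUP C\<in>{C. C \<subseteq> A \<and> compact C}. emeasure ?N C)"
    using distr_mu_borel emeasure_mu_K A
    by (intro inner_regular) (auto simp: space_distr)
  moreover have "emeasure ?N C = emeasure \<mu> C" if "C \<subseteq> A" "compact C" for C
    using that A distr_mu_borel(2)[of C] by (simp add: Int_absorb2 borel_compact)
  moreover have "emeasure ?N A = emeasure \<mu> A" using A distr_mu_borel(2)[of A] by (simp add: Int_absorb2)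
  ultimately show ?thesis by (simp cong: SUP_cong_simp)
qed

lemma radon_mu: "radon_full_support K \<mu>"
  unfolding radon_full_support_def
proof (intro conjI allI impI ballI)
  show "sets \<mu> = sets (restrict_space borel K)" by (rule sets_mu)
  show "emeasure \<mu> C < \<infinity>" for C by (simp add: M.emeasure_eq_measure)
  show "emeasure \<mu> A = (SUP C\<in>{C. C \<subseteq> A \<and> compact C}. emeasure \<mu> C)" if "A \<in> sets \<mu>" for A
    by (rule inner_regular_mu[OF that])
  fix U :: "plane set" assume U: "open U \<and> U \<inter> K \<noteq> {}"
  then obtain x where "x \<in> U" "x \<in> K" by blast
  then obtain n w where w: "w \<in> words I n" "word_map w ` K \<subseteq> U" using U small_cell by metis
  have "U \<inter> K \<in> sets \<mu>" using U by (intro in_sets_mu) auto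
  then have "emeasure \<mu> (word_map w ` K) \<le> emeasure \<mu> (U \<inter> K)"
    using w word_map_K[OF w(1)] by (intro emeasure_mono) auto
  then show "0 < emeasure \<mu> (U \<inter> K)" using emeasure_cell[OF w(1)]
    by (metis ennreal_less_zero_iff less_le_trans zero_less_divide_1_iff zero_less_numeral zero_less_power)
qed

definition sq_norm :: "(plane \<Rightarrow> real) \<Rightarrow> ennreal" where
  "sq_norm f = (\<integral>\<^sup>+x. ennreal ((f x)\<^sup>2) \<partial>\<mu>)"

lemma sq_norm_add:
  assumes [measurable]: "f \<in> borel_measurable \<mu>" "g \<in> borel_measurable \<mu>"
  shows "sq_norm (\<lambda>x. f x + g x) \<le> 2 * sq_norm f + 2 * sq_norm g"
proof -
  have "ennreal ((f x + g x)\<^sup>2) \<le> 2 * ennreal ((f x)\<^sup>2) + 2 * ennreal ((g x)\<^sup>2)" for x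
  proof -
    have "(f x + g x)\<^sup>2 \<le> 2 * (f x)\<^sup>2 + 2 * (g x)\<^sup>2"
      using zero_le_power2[of "f x - g x"] by (simp add: power2_sum power2_diff)
    then have "ennreal ((f x + g x)\<^sup>2) \<le> ennreal (2 * (f x)\<^sup>2 + 2 * (g x)\<^sup>2)" by (rule ennreal_leI)
    then show ?thesis by (simp add: ennreal_plus ennreal_mult)
  qed
  then have "sq_norm (\<lambda>x. f x + g x) \<le> (\<integral>\<^sup>+x. 2 * ennreal ((f x)\<^sup>2) + 2 * ennreal ((g x)\<^sup>2) \<partial>\<mu>)"
    unfolding sq_norm_def by (intro nn_integral_mono)
  also have "\<dots> = 2 * sq_norm f + 2 * sq_norm g"
    unfolding sq_norm_def by (subst nn_integral_add) (auto simp: nn_integral_cmult)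
  finally show ?thesis .
qed

lemma sq_norm_cmult: "f \<in> borel_measurable \<mu> \<Longrightarrow> sq_norm (\<lambda>x. c * f x) = ennreal (c\<^sup>2) * sq_norm f"
  unfolding sq_norm_def by (simp add: power_mult_distrib ennreal_mult nn_integral_cmult)

lemma sq_norm_bounded:
  assumes "\<And>x. x \<in> K \<Longrightarrow> \<bar>f x\<bar> \<le> c"
  shows "sq_norm f \<le> ennreal (c\<^sup>2)"
proof -
  have "sq_norm f \<le> (\<integral>\<^sup>+x. ennreal (c\<^sup>2) \<partial>\<mu>)"
    unfolding sq_norm_def
    by (intro nn_integral_mono ennreal_leI) (metis abs_ge_zero abs_le_square_iff abs_of_nonneg assms order_trans space_mu)
  also have "\<dots> = ennreal (c\<^sup>2)" by (simp add: emeasure_mu_K)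
  finally show ?thesis .
qed

lemma L2_iff: "f \<in> L2 \<mu> \<longleftrightarrow> f \<in> borel_measurable \<mu> \<and> sq_norm f < \<infinity>"
  by (simp add: L2_def sq_norm_def)

lemma continuous_bounded:
  fixes f :: "plane \<Rightarrow> real"
  assumes "continuous_on K f"
  obtains c where "0 \<le> c" "\<And>x. x \<in> K \<Longrightarrow> \<bar>f x\<bar> \<le> c"
proof -
  have "bounded (f ` K)" using compact_continuous_image[OF assms compact_K] compact_imp_bounded by blast
  then obtain c where c: "\<forall>y\<in>f ` K. norm y \<le> c" unfolding bounded_iff by blast
  then have "\<bar>f x\<bar> \<le> c" if "x \<in> K" for x using that by auto
  moreover from this[of p1] have "0 \<le> c" by simp
  ultimately show ?thesis using that by blast
qed

lemma continuous_L2: assumes "continuous_on K f" shows "f \<in> L2 \<mu>"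
proof -
  obtain c where "\<And>x. x \<in> K \<Longrightarrow> \<bar>f x\<bar> \<le> c" using continuous_bounded[OF assms] by blast
  then have "sq_norm f \<le> ennreal (c\<^sup>2)" by (rule sq_norm_bounded)
  then show ?thesis using assms by (auto simp: L2_iff intro: le_less_trans ennreal_less_top)
qed

lemma quarters: "0 < e \<Longrightarrow> 2 * ennreal (e/4) + 2 * ennreal (e/4) = ennreal e"
  using ennreal_mult[of 2 "e/4"] ennreal_plus[of "e/2" "e/2"] by simp

definition approx :: "(plane \<Rightarrow> real) \<Rightarrow> bool" where
  "approx f \<longleftrightarrow> (\<forall>e>0. \<exists>g. continuous_on K g \<and> sq_norm (\<lambda>x. f x - g x) < ennreal e)"

lemma approx_limit:
  assumes f: "f \<in> borel_measurable \<mu>"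
    and "\<And>e. 0 < e \<Longrightarrow> \<exists>g. g \<in> borel_measurable \<mu> \<and> approx g \<and> sq_norm (\<lambda>x. f x - g x) < ennreal e"
  shows "approx f"
  unfolding approx_def
proof (intro allI impI)
  fix e :: real assume "0 < e"
  then obtain g where g: "g \<in> borel_measurable \<mu>" "approx g" "sq_norm (\<lambda>x. f x - g x) < ennreal (e/4)"
    using assms(2)[of "e/4"] by auto
  obtain h where h: "continuous_on K h" "sq_norm (\<lambda>x. g x - h x) < ennreal (e/4)"
    using g(2) \<open>0 < e\<close> unfolding approx_def by (metis zero_less_divide_iff zero_less_numeral)
  have "sq_norm (\<lambda>x. f x - h x) = sq_norm (\<lambda>x. (f x - g x) + (g x - h x))" by simp
  also have "\<dots> \<le> 2 * sq_norm (\<lambda>x. f x - g x) + 2 * sq_norm (\<lambda>x. g x - h x)"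
    by (rule sq_norm_add[OF borel_measurable_diff[OF f g(1)] borel_mu_diff(1)[OF g(1) h(1)]])
  also have "\<dots> < 2 * ennreal (e/4) + 2 * ennreal (e/4)"
    using g(3) h(2) by (intro add_strict_mono ennreal_mult_strict_left_mono) auto
  also have "\<dots> = ennreal e" by (rule quarters[OF \<open>0 < e\<close>])
  finally show "\<exists>g. continuous_on K g \<and> sq_norm (\<lambda>x. f x - g x) < ennreal e" using h by blast
qed

lemma approx_add:
  assumes f: "f \<in> borel_measurable \<mu>" "approx f" and g: "g \<in> borel_measurable \<mu>" "approx g"
  shows "approx (\<lambda>x. f x + g x)"
  unfolding approx_def
proof (intro allI impI)
  fix e :: real assume "0 < e"
  then have e4: "0 < e / 4" by simp
  obtain h where h: "continuous_on K h" "sq_norm (\<lambda>x. f x - h x) < ennreal (e/4)"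
    using f(2) e4 unfolding approx_def by blast
  obtain k where k: "continuous_on K k" "sq_norm (\<lambda>x. g x - k x) < ennreal (e/4)"
    using g(2) e4 unfolding approx_def by blast
  have "sq_norm (\<lambda>x. f x + g x - (h x + k x)) = sq_norm (\<lambda>x. (f x - h x) + (g x - k x))"
    by (rule arg_cong[of _ _ sq_norm]) auto
  also have "\<dots> \<le> 2 * sq_norm (\<lambda>x. f x - h x) + 2 * sq_norm (\<lambda>x. g x - k x)"
    by (rule sq_norm_add[OF borel_mu_diff(1)[OF f(1) h(1)] borel_mu_diff(1)[OF g(1) k(1)]])
  also have "\<dots> < 2 * ennreal (e/4) + 2 * ennreal (e/4)"
    using k(2) h(2) by (intro add_strict_mono ennreal_mult_strict_left_mono) auto
  also have "\<dots> = ennreal e" by (rule quarters[OF \<open>0 < e\<close>])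
  finally show "\<exists>g'. continuous_on K g' \<and> sq_norm (\<lambda>x. f x + g x - g' x) < ennreal e"
    using continuous_on_add[OF h(1) k(1)] by blast
qed

lemma approx_cmult:
  assumes f: "f \<in> borel_measurable \<mu>" "approx f"
  shows "approx (\<lambda>x. c * f x)"
  unfolding approx_def
proof (intro allI impI)
  fix e :: real assume "0 < e"
  then have "0 < e / (c\<^sup>2 + 1)" by (simp add: add_nonneg_pos)
  then obtain h where h: "continuous_on K h" "sq_norm (\<lambda>x. f x - h x) < ennreal (e / (c\<^sup>2 + 1))"
    using f(2) unfolding approx_def by blast
  have "sq_norm (\<lambda>x. c * f x - c * h x) = ennreal (c\<^sup>2) * sq_norm (\<lambda>x. f x - h x)"
    using sq_norm_cmult[OF borel_mu_diff(1)[OF f(1) h(1)], of c] by (simp add: right_diff_distrib)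
  also have "\<dots> \<le> ennreal (c\<^sup>2) * ennreal (e / (c\<^sup>2 + 1))" using h(2) by (intro mult_left_mono) auto
  also have "\<dots> = ennreal (c\<^sup>2 * (e / (c\<^sup>2 + 1)))"
    using \<open>0 < e\<close> by (intro ennreal_mult[symmetric]) auto
  also have "\<dots> < ennreal e"
  proof (rule ennreal_lessI[OF \<open>0 < e\<close>])
    have "c\<^sup>2 * e < e * (c\<^sup>2 + 1)" using \<open>0 < e\<close> by (simp add: algebra_simps)
    then show "c\<^sup>2 * (e / (c\<^sup>2 + 1)) < e" by (simp add: divide_less_eq add_nonneg_pos)
  qed
  finally show "\<exists>g. continuous_on K g \<and> sq_norm (\<lambda>x. c * f x - g x) < ennreal e"
    using continuous_on_mult_left[OF h(1), of c] by blast
qed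

text \<open>The functions \<open>max 0 (1 - k * infdist x C)\<close> decrease to the indicator of
  \<open>C\<close>.\<close>

lemma approx_compact:
  assumes "compact C" "C \<subseteq> K"
  shows "approx (indicator C)"
proof (cases "C = {}")
  case True
  show ?thesis unfolding approx_def True
    by (intro allI impI exI[of _ "\<lambda>_. 0"]) (auto simp: sq_norm_def)
next
  case False
  define \<phi> where "\<phi> k x = max 0 (1 - real k * infdist x C)" for k :: nat and x
  have cont: "continuous_on K (\<phi> k)" for k unfolding \<phi>_def by (intro continuous_intros)
  have C: "indicator C \<in> borel_measurable \<mu>"
    using assms by (intro borel_measurable_indicator in_sets_mu) (auto simp: borel_compact)
  have "(\<lambda>k. sq_norm (\<lambda>x. indicator C x - \<phi> k x)) \<longlonglongrightarrow> (\<integral>\<^sup>+x. 0 \<partial>\<mu>)"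
    unfolding sq_norm_def
  proof (rule nn_integral_dominated_convergence[where w = "\<lambda>_. 1"])
    show "AE x in \<mu>. ennreal ((indicator C x - \<phi> j x)\<^sup>2) \<le> 1" for j
    proof (rule AE_I2)
      fix x
      have "0 \<le> \<phi> j x" "\<phi> j x \<le> 1" by (auto simp: \<phi>_def infdist_nonneg)
      then have "\<bar>indicator C x - \<phi> j x\<bar> \<le> 1" by (auto simp: indicator_def)
      then have "(indicator C x - \<phi> j x)\<^sup>2 \<le> 1" by (simp add: abs_square_le_1)
      then show "ennreal ((indicator C x - \<phi> j x)\<^sup>2) \<le> 1" using ennreal_leI by fastforce
    qed
    show "AE x in \<mu>. (\<lambda>i. ennreal ((indicator C x - \<phi> i x)\<^sup>2)) \<longlonglongrightarrow> 0"
    proof (rule AE_I2)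
      fix x
      have "\<forall>\<^sub>F i in sequentially. ennreal ((indicator C x - \<phi> i x)\<^sup>2) = 0"
      proof (cases "x \<in> C")
        case True
        then show ?thesis by (simp add: \<phi>_def infdist_zero)
      next
        case x: False
        then have pos: "0 < infdist x C"
          using False assms(1) compact_imp_closed by (metis in_closed_iff_infdist_zero infdist_nonneg less_eq_real_def)
        obtain N :: nat where N: "1 < real N * infdist x C" using ex_less_of_nat_mult[OF pos] by blast
        show ?thesis
        proof (rule eventually_sequentiallyI[of N])
          fix i assume "N \<le> i"
          then have "real N * infdist x C \<le> real i * infdist x C" using pos by (intro mult_right_mono) auto
          then have "\<phi> i x = 0" using N by (simp add: \<phi>_def)
          then show "ennreal ((indicator C x - \<phi> i x)\<^sup>2) = 0" using x by simp
        qed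
      qed
      then show "(\<lambda>i. ennreal ((indicator C x - \<phi> i x)\<^sup>2)) \<longlonglongrightarrow> 0" by (rule tendsto_eventually)
    qed
    show "(\<lambda>x. ennreal ((indicator C x - \<phi> k x)\<^sup>2)) \<in> borel_measurable \<mu>" for k
      using borel_mu_diff(1)[OF C cont] by measurable
  qed (auto simp: emeasure_mu_K)
  then have lim: "(\<lambda>k. sq_norm (\<lambda>x. indicator C x - \<phi> k x)) \<longlonglongrightarrow> 0" by simp
  show ?thesis unfolding approx_def
  proof (intro allI impI)
    fix e :: real assume "0 < e"
    then have "\<forall>\<^sub>F k in sequentially. sq_norm (\<lambda>x. indicator C x - \<phi> k x) < ennreal e"
      using lim by (intro order_tendstoD) auto
    then obtain k where "sq_norm (\<lambda>x. indicator C x - \<phi> k x) < ennreal e"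
      using eventually_happens by fastforce
    then show "\<exists>g. continuous_on K g \<and> sq_norm (\<lambda>x. indicator C x - g x) < ennreal e" using cont by blast
  qed
qed

lemma approx_indicator:
  assumes A: "A \<in> sets \<mu>" shows "approx (indicator A)"
proof (rule approx_limit)
  show "indicator A \<in> borel_measurable \<mu>" using A by simp
  fix e :: real assume e: "0 < e"
  have "\<exists>C. C \<subseteq> A \<and> compact C \<and> emeasure \<mu> A < emeasure \<mu> C + ennreal e"
  proof (cases "emeasure \<mu> A = 0")
    case True then show ?thesis using e by (intro exI[of _ "{}"]) auto
  next
    case False
    define a where "a = measure \<mu> A"
    have a: "emeasure \<mu> A = ennreal a" by (simp add: a_def M.emeasure_eq_measure)
    then have "0 < a" using False by (metis a_def ennreal_eq_0_iff linorder_not_less)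
    then have "ennreal (a - e) < emeasure \<mu> A" unfolding a using e by (intro ennreal_lessI) auto
    then obtain C where C: "C \<subseteq> A" "compact C" "ennreal (a - e) < emeasure \<mu> C"
      using inner_regular_mu[OF A] by (metis (no_types, lifting) less_SUP_iff mem_Collect_eq)
    have "a - e < measure \<mu> C"
      using C(3) by (simp add: M.emeasure_eq_measure ennreal_less_iff linorder_not_less)
        (metis ennreal_leI leD linorder_not_less)
    then have "ennreal a < ennreal (measure \<mu> C + e)" using e \<open>0 < a\<close> by (intro ennreal_lessI) auto
    then have "emeasure \<mu> A < emeasure \<mu> C + ennreal e"
      using e by (simp add: a M.emeasure_eq_measure[of C])
    then show ?thesis using C by blast
  qed
  then obtain C where C: "C \<subseteq> A" "compact C" "emeasure \<mu> A < emeasure \<mu> C + ennreal e" by blast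
  have AK: "A \<subseteq> K" using sets_mu_borel(2)[OF A] .
  have Cm: "C \<in> sets \<mu>" using C AK by (intro in_sets_mu) (auto simp: borel_compact)
  have "sq_norm (\<lambda>x. indicator A x - indicator C x) = emeasure \<mu> (A - C)"
  proof -
    have "ennreal ((indicator A x - indicator C x)\<^sup>2) = indicator (A - C) x" for x
      using C(1) by (auto simp: indicator_def)
    then show ?thesis unfolding sq_norm_def using A Cm by simp
  qed
  also have "\<dots> = emeasure \<mu> A - emeasure \<mu> C"
    using A Cm C(1) by (intro emeasure_Diff) (auto simp: M.emeasure_finite)
  also have "\<dots> < ennreal e"
    using C(3) M.emeasure_finite[of C] M.emeasure_finite[of A] e
    by (cases "emeasure \<mu> A"; cases "emeasure \<mu> C") (auto simp: ennreal_minus ennreal_less_iff simp flip: ennreal_plus intro!: ennreal_lessI)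
  finally show "\<exists>g. g \<in> borel_measurable \<mu> \<and> approx g \<and> sq_norm (\<lambda>x. indicator A x - g x) < ennreal e"
    using approx_compact[of C] C AK Cm by (intro exI[of _ "indicator C"]) auto
qed

text \<open>Nonnegative functions are increasing limits of simple functions, and dominated
  convergence makes this a limit in \<open>L\<^sup>2\<close>.\<close>

lemma approx_L2:
  assumes "f \<in> L2 \<mu>" shows "approx f"
proof -
  have nonneg: "sq_norm u < \<infinity> \<longrightarrow> approx u" if "u \<in> borel_measurable \<mu>" "\<And>x. 0 \<le> u x" for u
    using that
  proof (induction rule: borel_measurable_induct_real)
    case (set A) then show ?case by (simp add: approx_indicator)
  next
    case (mult u c)
    show ?case
    proof (cases "c = 0")
      case True
      then show ?thesis unfolding approx_def by (auto intro!: exI[of _ "\<lambda>_. 0"] simp: sq_norm_def)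
    next
      case False
      then have "sq_norm (\<lambda>x. c * u x) < \<infinity> \<Longrightarrow> sq_norm u < \<infinity>"
        using mult by (auto simp: sq_norm_cmult ennreal_mult_less_top)
      then show ?thesis using mult approx_cmult by blast
    qed
  next
    case (add u v)
    have "sq_norm u \<le> sq_norm (\<lambda>x. v x + u x)" "sq_norm v \<le> sq_norm (\<lambda>x. v x + u x)"
      unfolding sq_norm_def using add by (auto intro!: nn_integral_mono ennreal_leI power_mono)
    then show ?case using add approx_add by (meson le_less_trans)
  next
    case (seq U)
    show ?case
    proof
      assume fin: "sq_norm u < \<infinity>"
      have Ule: "U i x \<le> u x" if "x \<in> K" for i x
      proof (rule incseq_le)
        show "incseq (\<lambda>i. U i x)" 
          using le_funD[OF incseqD[OF seq.hyps(3)]] by (intro incseq_SucI) simp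
        show "(\<lambda>i. U i x) \<longlonglongrightarrow> u x" using seq.hyps(4) that by simp
      qed
      have um: "u \<in> borel_measurable \<mu>" using that(1) .
      have "(\<lambda>i. sq_norm (\<lambda>x. u x - U i x)) \<longlonglongrightarrow> (\<integral>\<^sup>+x. 0 \<partial>\<mu>)"
        unfolding sq_norm_def
      proof (rule nn_integral_dominated_convergence[where w = "\<lambda>x. ennreal ((u x)\<^sup>2)"])
        show "AE x in \<mu>. ennreal ((u x - U j x)\<^sup>2) \<le> ennreal ((u x)\<^sup>2)" for j
          using Ule seq.hyps(2) by (intro AE_I2 ennreal_leI power_mono) auto
        show "AE x in \<mu>. (\<lambda>i. ennreal ((u x - U i x)\<^sup>2)) \<longlonglongrightarrow> 0"
        proof (rule AE_I2)
          fix x assume "x \<in> space \<mu>"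
          then have "(\<lambda>i. U i x) \<longlonglongrightarrow> u x" by (rule seq.hyps(4))
          then have "(\<lambda>i. ennreal ((u x - U i x)\<^sup>2)) \<longlonglongrightarrow> ennreal ((u x - u x)\<^sup>2)"
            by (intro tendsto_ennrealI tendsto_power tendsto_diff tendsto_const)
          then show "(\<lambda>i. ennreal ((u x - U i x)\<^sup>2)) \<longlonglongrightarrow> 0" by simp
        qed
      qed (use seq.hyps(1) um fin in \<open>auto simp: sq_norm_def\<close>)
      then have lim: "(\<lambda>i. sq_norm (\<lambda>x. u x - U i x)) \<longlonglongrightarrow> 0" by simp
      show "approx u"
      proof (rule approx_limit[OF um])
        fix e :: real assume "0 < e"
        then have "\<forall>\<^sub>F k in sequentially. sq_norm (\<lambda>x. u x - U k x) < ennreal e"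
          using lim by (intro order_tendstoD) auto
        then obtain k where k: "sq_norm (\<lambda>x. u x - U k x) < ennreal e" using eventually_happens by fastforce
        have "sq_norm (U k) \<le> sq_norm u"
          unfolding sq_norm_def using Ule seq.hyps(2) by (intro nn_integral_mono ennreal_leI power_mono) auto
        then have "approx (U k)" using seq.IH fin by (meson le_less_trans)
        then show "\<exists>g. g \<in> borel_measurable \<mu> \<and> approx g \<and> sq_norm (\<lambda>x. u x - g x) < ennreal e"
          using k seq.hyps(1) by blast
      qed
    qed
  qed
  have m: "f \<in> borel_measurable \<mu>" and fin: "sq_norm f < \<infinity>" using assms by (auto simp: L2_iff)
  have "sq_norm (\<lambda>x. max 0 (f x)) \<le> sq_norm f" "sq_norm (\<lambda>x. max 0 (- f x)) \<le> sq_norm f"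
    unfolding sq_norm_def
    by (intro nn_integral_mono ennreal_leI; simp add: max_def)+
  then have "approx (\<lambda>x. max 0 (f x))" "approx (\<lambda>x. max 0 (- f x))"
    using nonneg[of "\<lambda>x. max 0 (f x)"] nonneg[of "\<lambda>x. max 0 (- f x)"] m fin by (auto intro: le_less_trans)
  then have "approx (\<lambda>x. max 0 (f x) + (-1) * max 0 (- f x))"
    using m by (intro approx_add approx_cmult) auto
  moreover have "(\<lambda>x. max 0 (f x) + (-1) * max 0 (- f x)) = f" by (auto simp: max_def)
  ultimately show ?thesis by simp
qed

lemma dense_in_L2_I:
  assumes "\<And>g e. continuous_on K g \<Longrightarrow> 0 < e \<Longrightarrow> \<exists>u\<in>A. u \<in> L2 \<mu> \<and> sq_norm (\<lambda>x. g x - u x) < ennreal e"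
  shows "dense_in_L2 \<mu> A"
  unfolding dense_in_L2_def
proof (intro ballI allI impI)
  fix f and e :: real assume f: "f \<in> L2 \<mu>" and e: "0 < e"
  then have e4: "0 < e / 4" by simp
  obtain g where g: "continuous_on K g" "sq_norm (\<lambda>x. f x - g x) < ennreal (e/4)"
    using approx_L2[OF f] e4 unfolding approx_def by blast
  obtain u where u: "u \<in> A" "u \<in> L2 \<mu>" "sq_norm (\<lambda>x. g x - u x) < ennreal (e/4)"
    using assms[OF g(1) e4] by blast
  have "sq_norm (\<lambda>x. f x - u x) = sq_norm (\<lambda>x. (f x - g x) + (g x - u x))" by simp
  also have "\<dots> \<le> 2 * sq_norm (\<lambda>x. f x - g x) + 2 * sq_norm (\<lambda>x. g x - u x)"
    using f g(1) u(2) by (intro sq_norm_add borel_mu_diff) (auto simp: L2_iff)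
  also have "\<dots> < 2 * ennreal (e/4) + 2 * ennreal (e/4)"
    using g(2) u(3) by (intro add_strict_mono ennreal_mult_strict_left_mono) auto
  also have "\<dots> = ennreal e" by (rule quarters[OF e])
  finally show "\<exists>u\<in>A \<inter> L2 \<mu>. (\<integral>\<^sup>+x. ennreal ((f x - u x)\<^sup>2) \<partial>\<mu>) < ennreal e"
    using u by (auto simp: sq_norm_def)
qed

end

section \<open>Self-similar functions\<close>

definition osc :: "(plane \<Rightarrow> real) \<Rightarrow> real" where
  "osc a = max \<bar>a p1 - a p2\<bar> (max \<bar>a p2 - a p3\<bar> \<bar>a p1 - a p3\<bar>)"

lemma osc_bounds: "\<bar>a p1 - a p2\<bar> \<le> osc a" "\<bar>a p2 - a p3\<bar> \<le> osc a" "\<bar>a p1 - a p3\<bar> \<le> osc a" "0 \<le> osc a"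
  by (auto simp: osc_def)

lemma osc_leI: "\<bar>a p1 - a p2\<bar> \<le> c \<Longrightarrow> \<bar>a p2 - a p3\<bar> \<le> c \<Longrightarrow> \<bar>a p1 - a p3\<bar> \<le> c \<Longrightarrow> osc a \<le> c"
  by (simp add: osc_def)

definition affine3 :: "(plane \<Rightarrow> real) \<Rightarrow> plane \<Rightarrow> real" where
  "affine3 a x = a p1 + cx x * (a p2 - a p1) + cy x * (a p3 - a p1)"

context sickle
begin

lemma affine3_bound: assumes "x \<in> K" shows "\<bar>affine3 a x - a p1\<bar> \<le> osc a"
proof -
  have "\<bar>affine3 a x - a p1\<bar> \<le> \<bar>cx x * (a p2 - a p1)\<bar> + \<bar>cy x * (a p3 - a p1)\<bar>"
    by (simp add: affine3_def)
  also have "\<dots> \<le> cx x * osc a + cy x * osc a"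
    using osc_bounds[of a] K_coords[OF assms]
    by (intro add_mono) (auto simp: abs_mult abs_minus_commute intro!: mult_left_mono)
  also have "\<dots> \<le> 1 * osc a" unfolding distrib_right[symmetric]
    using K_coords[OF assms] osc_bounds[of a] by (intro mult_right_mono) auto
  finally show ?thesis by simp
qed

lemma K_cell_cases: assumes "x \<in> K" obtains i y where "i \<in> I" "y \<in> K" "x = cell_map i y"
  using assms K_eq by blast

text \<open>\<open>U a\<close> prescribes the values at the vertices of level one from the corner
  values \<open>a\<close>.  As it contracts oscillations, iterating it from an affine function
  converges uniformly, and the limit reproduces itself in each cell.\<close>

lemma selfsimilar_functions:
  fixes U :: "(plane \<Rightarrow> real) \<Rightarrow> plane \<Rightarrow> real"
  assumes U: "\<And>a p. p \<in> V0 \<Longrightarrow> U a p = a p"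
    and contr: "\<And>a i. i \<in> I \<Longrightarrow> osc (U a \<circ> cell_map i) \<le> c * osc a" and c: "0 \<le> c" "c < 1"
    and near: "\<And>a i. i \<in> I \<Longrightarrow> \<bar>U a (cell_map i p1) - a p1\<bar> \<le> 3 * osc a"
  obtains H C where
    "\<And>a. continuous_on K (H a)" "\<And>a p. p \<in> V0 \<Longrightarrow> H a p = a p"
    "\<And>a i x. i \<in> I \<Longrightarrow> x \<in> K \<Longrightarrow> H a (cell_map i x) = H (U a \<circ> cell_map i) x"
    "\<And>a x. x \<in> K \<Longrightarrow> \<bar>H a x - a p1\<bar> \<le> C * osc a" "0 \<le> C"
proof -
  define step where "step G a = (SOME v. \<forall>i\<in>I. \<forall>x\<in>K. v (cell_map i x) = G (U a \<circ> cell_map i) x)"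
    for G :: "(plane \<Rightarrow> real) \<Rightarrow> plane \<Rightarrow> real" and a
  define Hs where "Hs n = (step ^^ n) affine3" for n
  have H0: "Hs 0 = affine3" by (simp add: Hs_def)
  have Hs_step: "Hs (Suc n) a (cell_map i x) = Hs n (U a \<circ> cell_map i) x"
    if G: "\<And>a p. p \<in> V0 \<Longrightarrow> Hs n a p = a p" and "i \<in> I" "x \<in> K" for n a i x
  proof -
    have "\<exists>v. \<forall>i\<in>I. \<forall>x\<in>K. v (cell_map i x) = Hs n (U a \<circ> cell_map i) x"
      using glue1[of "\<lambda>i. Hs n (U a \<circ> cell_map i)" "U a"] G by (metis comp_apply)
    from someI_ex[OF this] have "\<forall>i\<in>I. \<forall>x\<in>K. step (Hs n) a (cell_map i x) = Hs n (U a \<circ> cell_map i) x"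
      unfolding step_def .
    with that show ?thesis by (simp add: Hs_def)
  qed
  have bd: "Hs n a p = a p" if "p \<in> V0" for n a p
    using that
  proof (induction n arbitrary: a p)
    case 0 then show ?case by (auto simp: H0 affine3_def V0_def)
  next
    case (Suc n)
    have "Hs (Suc n) a p = a p" if i: "i \<in> I" "cell_map i p = p" for i
    proof -
      have "p \<in> K" using Suc.prems V0_K by blast
      have "Hs (Suc n) a p = Hs n (U a \<circ> cell_map i) p"
        using Hs_step[OF Suc.IH i(1) \<open>p \<in> K\<close>, of a] i(2) by simp
      also have "\<dots> = U a p" using Suc i(2) by simp
      finally show ?thesis using U Suc.prems by simp
    qed
    note this[OF corner_I(1)] this[OF corner_I(2)] this[OF corner_I(3)]
    moreover have "p = p1 \<or> p = p2 \<or> p = p3" using Suc.prems by (auto simp: V0_def)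
    ultimately show ?case using corner_fixed by fastforce
  qed
  have st: "Hs (Suc n) a (cell_map i x) = Hs n (U a \<circ> cell_map i) x" if "i \<in> I" "x \<in> K" for n a i x
    using Hs_step[OF bd] that by blast
  have cont: "continuous_on K (Hs n a)" for n a
  proof (induction n arbitrary: a)
    case 0
    show ?case unfolding H0 affine3_def[abs_def]
      by (intro continuous_intros continuous_on_cx continuous_on_cy)
  next
    case (Suc n)
    show ?case
    proof (rule continuous_on_cells1)
      fix i assume "i \<in> I"
      show "continuous_on K (Hs (Suc n) a \<circ> cell_map i)"
      proof (rule continuous_on_eq[OF Suc[of "U a \<circ> cell_map i"]])
        fix x assume "x \<in> K"
        show "Hs n (U a \<circ> cell_map i) x = (Hs (Suc n) a \<circ> cell_map i) x"
          unfolding comp_apply[of "Hs (Suc n) a"] by (rule st[OF \<open>i \<in> I\<close> \<open>x \<in> K\<close>, symmetric])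
      qed
    qed
  qed
  have diff: "\<bar>Hs (Suc n) a x - Hs n a x\<bar> \<le> 5 * c ^ n * osc a" if "x \<in> K" for n a x
    using that
  proof (induction n arbitrary: a x)
    case 0
    obtain i y where i: "i \<in> I" "y \<in> K" "x = cell_map i y" using 0 by (rule K_cell_cases)
    let ?b = "U a \<circ> cell_map i"
    have "\<bar>affine3 ?b y - ?b p1\<bar> \<le> osc ?b" by (rule affine3_bound[OF i(2)])
    moreover have "osc ?b \<le> osc a"
    proof -
      have "c * osc a \<le> 1 * osc a" using c osc_bounds(4)[of a] by (intro mult_right_mono) auto
      then show ?thesis using contr[OF i(1), of a] by linarith
    qed
    moreover have "\<bar>affine3 a x - a p1\<bar> \<le> osc a" by (rule affine3_bound[OF 0])
    moreover have "Hs (Suc 0) a x = affine3 ?b y" using st[OF i(1,2), of 0 a] i(3) by (simp add: H0)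
    ultimately show ?case using near[OF i(1), of a] by (simp add: H0)
  next
    case (Suc n)
    obtain i y where i: "i \<in> I" "y \<in> K" "x = cell_map i y" using Suc.prems by (rule K_cell_cases)
    let ?b = "U a \<circ> cell_map i"
    have "\<bar>Hs (Suc (Suc n)) a x - Hs (Suc n) a x\<bar> = \<bar>Hs (Suc n) ?b y - Hs n ?b y\<bar>"
      using st[OF i(1,2)] i(3) by simp
    also have "\<dots> \<le> 5 * c ^ n * osc ?b" by (rule Suc.IH[OF i(2)])
    also have "\<dots> \<le> 5 * c ^ n * (c * osc a)" using contr[OF i(1)] c by (intro mult_left_mono) auto
    finally show ?case by (simp add: algebra_simps)
  qed
  define D where "D n a x = Hs (Suc n) a x - Hs n a x" for n a x
  have Hs_sum: "Hs n a x = affine3 a x + (\<Sum>k<n. D k a x)" for n a x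
    by (induction n) (auto simp: H0 D_def)
  define H where "H a x = affine3 a x + (\<Sum>k. D k a x)" for a x
  define Q where "Q = 5 / (1 - c)"
  have geo: "(\<lambda>n. 5 * c ^ n * osc a) sums (Q * osc a)" for a
    using sums_mult[OF geometric_sums[of c], of "5 * osc a"] c by (simp add: Q_def mult_ac)
  have unif: "uniform_limit K (\<lambda>n. Hs n a) (H a) sequentially" for a
  proof -
    have "uniform_limit K (\<lambda>n x. \<Sum>k<n. D k a x) (\<lambda>x. \<Sum>k. D k a x) sequentially"
    proof (rule Weierstrass_m_test)
      show "summable (\<lambda>n. 5 * c ^ n * osc a)" using geo sums_summable by blast
      show "norm (D n a x) \<le> 5 * c ^ n * osc a" if "x \<in> K" for n x using diff[OF that] by (simp add: D_def)
    qed
    from uniform_limit_add[OF uniform_limit_const this, of "affine3 a"]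
    show ?thesis unfolding H_def[abs_def] Hs_sum[abs_def] .
  qed
  have lim: "(\<lambda>n. Hs n a x) \<longlonglongrightarrow> H a x" if "x \<in> K" for a x
    using tendsto_uniform_limitI[OF unif that] .
  show ?thesis
  proof (rule that[of H "1 + Q"])
    show "continuous_on K (H a)" for a
      by (rule uniform_limit_theorem[OF _ unif]) (auto simp: cont)
    show "H a p = a p" if "p \<in> V0" for a p
    proof -
      have "p \<in> K" using V0_K that by blast
      from lim[OF this, of a] show ?thesis by (simp add: bd[OF that] LIMSEQ_const_iff)
    qed
    show "H a (cell_map i x) = H (U a \<circ> cell_map i) x" if "i \<in> I" "x \<in> K" for a i x
    proof (rule LIMSEQ_unique)
      show "(\<lambda>n. Hs (Suc n) a (cell_map i x)) \<longlonglongrightarrow> H a (cell_map i x)"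
        using lim[OF cell_map_K[OF that]] by (rule LIMSEQ_Suc)
      show "(\<lambda>n. Hs (Suc n) a (cell_map i x)) \<longlonglongrightarrow> H (U a \<circ> cell_map i) x"
        unfolding st[OF that] by (rule lim[OF that(2)])
    qed
    show "\<bar>H a x - a p1\<bar> \<le> (1 + Q) * osc a" if x: "x \<in> K" for a x
    proof -
      have "norm (\<Sum>k. D k a x) \<le> (\<Sum>k. 5 * c ^ k * osc a)"
        using diff[OF x, of _ a] geo[of a] sums_summable by (intro norm_suminf_le) (auto simp: D_def)
      also have "\<dots> = Q * osc a" using geo sums_unique by metis
      finally show ?thesis using affine3_bound[OF x, of a] by (simp add: H_def algebra_simps)
    qed
    show "0 \<le> 1 + Q" using c by (simp add: Q_def)
  qed
qed

subsection \<open>Types of the right cells\<close>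

lemma edge_iff: "k \<in> {1..9} \<Longrightarrow> {z (k - 1), z k} = cell_map (r k) ` A \<longleftrightarrow> {ea k, eb k} = A"
proof -
  assume k: "k \<in> {1..9}"
  have "{z (k - 1), z k} = cell_map (r k) ` {ea k, eb k}" using ea(2)[OF k] eb(2)[OF k] by simp
  then show ?thesis using inj_image_eq_iff[OF inj_cell_map] by metis
qed

text \<open>Flat functions, with equal values at the images of \<open>p1\<close> and
  \<open>p3\<close>, can change only across right cells that are not crossed from \<open>p3\<close>
  to \<open>p1\<close>.\<close>

definition vary :: "nat \<Rightarrow> real" where "vary k = (if {ea k, eb k} = {p3, p1} then 0 else 1)"

lemma sum_vary: "(\<Sum>k=1..9. vary k) = 7"
proof -
  have "{k\<in>{1..9}. {ea k, eb k} = {p3, p1}} = {k\<in>{1..9}. {z (k - 1), z k} = cell_map (r k) ` {p3, p1}}"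
    by (intro Collect_cong conj_cong refl) (simp only: edge_iff)
  then have 2: "card {k\<in>{1..9}. {ea k, eb k} = {p3, p1}} = 2" using card_31 by simp
  have "(\<Sum>k=1..9. vary k) = (\<Sum>k=1..9. 1 - (if {ea k, eb k} = {p3, p1} then 1 else 0))"
    by (rule sum.cong) (auto simp: vary_def)
  also have "\<dots> = 9 - (\<Sum>k=1..9. if {ea k, eb k} = {p3, p1} then 1 else 0)" by (simp add: sum_subtractf)
  also have "(\<Sum>k=1..9. if {ea k, eb k} = {p3, p1} then 1 else 0) = real (card {k\<in>{1..9}. {ea k, eb k} = {p3, p1}})"
    by (simp add: sum.If_cases Int_def)
  finally show ?thesis using 2 by simp
qed

lemma ex_edge: "\<exists>k\<in>{1..9}. {ea k, eb k} = {p1, p2}" "\<exists>k\<in>{1..9}. {ea k, eb k} = {p2, p3}"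
proof -
  have ne: "\<exists>k. k \<in> A" if "card A = n" "n \<noteq> 0" for A :: "nat set" and n using that by (metis card.empty ex_in_conv)
  obtain k where "k \<in> {1..9}" "{z (k - 1), z k} = cell_map (r k) ` {p1, p2}"
    using ne[OF card_12] by auto
  then show "\<exists>k\<in>{1..9}. {ea k, eb k} = {p1, p2}" using edge_iff by metis
  obtain k where "k \<in> {1..9}" "{z (k - 1), z k} = cell_map (r k) ` {p2, p3}"
    using ne[OF card_23] by auto
  then show "\<exists>k\<in>{1..9}. {ea k, eb k} = {p2, p3}" using edge_iff by metis
qed

lemma edge_cases: assumes "k \<in> {1..9}"
  obtains "ea k = p1" "eb k = p2" "eh k = p3" | "ea k = p2" "eb k = p1" "eh k = p3"
  | "ea k = p2" "eb k = p3" "eh k = p1" | "ea k = p3" "eb k = p2" "eh k = p1"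
  | "ea k = p1" "eb k = p3" "eh k = p2" | "ea k = p3" "eb k = p1" "eh k = p2"
proof -
  have "ea k = p1 \<or> ea k = p2 \<or> ea k = p3" "eb k = p1 \<or> eb k = p2 \<or> eb k = p3" "eh k = p1 \<or> eh k = p2 \<or> eh k = p3"
    using ea(1)[OF assms] eb(1)[OF assms] eh(1)[OF assms] by (auto simp: V0_def)
  moreover note ea_eb[OF assms] eh(2,3)[OF assms]
  ultimately have "(ea k = p1 \<and> eb k = p2 \<and> eh k = p3) \<or> (ea k = p2 \<and> eb k = p1 \<and> eh k = p3)
    \<or> (ea k = p2 \<and> eb k = p3 \<and> eh k = p1) \<or> (ea k = p3 \<and> eb k = p2 \<and> eh k = p1)
    \<or> (ea k = p1 \<and> eb k = p3 \<and> eh k = p2) \<or> (ea k = p3 \<and> eb k = p1 \<and> eh k = p2)"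
    by (elim disjE) simp_all
  then show ?thesis by (elim disjE conjE) (fact that)+
qed


lemma I_cases:
  assumes "i \<in> I"
  obtains j where "j < 5" "i = (0, j)" | "i = (0, 5)" | "i = (Suc 0, 5)" | "i = (0, 6)"
    | k where "k \<in> {1..9}" "i = r k"
proof -
  have "i \<in> left_cells \<or> i \<in> top_cells \<or> i \<in> r ` {1..9}" using assms by (auto simp: sickle_cells_def)
  moreover have "\<exists>j<5. i = (0, j)" if "i \<in> left_cells"
    using that unfolding left_cells_def
    by (elim insertE) (rule exI[of _ 0] exI[of _ 1] exI[of _ 2] exI[of _ 3] exI[of _ 4], simp)+
  moreover have "i = (0, 5) \<or> i = (Suc 0, 5) \<or> i = (0, 6)" if "i \<in> top_cells"
    using that by (auto simp: top_cells_def)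
  ultimately show ?thesis using that by blast
qed

subsection \<open>Functions of critical smoothness\<close>

definition qA :: "nat \<Rightarrow> real" where "qA n = 262/63 * (1/7) ^ n - 17/63 * (2/119) ^ n - 17/9 * (2/17) ^ n"
definition qB :: "nat \<Rightarrow> real" where "qB n = 5/3 * (2/119) ^ n + 1/3 * (2/17) ^ n"
definition qG :: "nat \<Rightarrow> real" where "qG n = 2 * (2/17) ^ n"

text \<open>With \<open>d = a p3 - a p1\<close> and \<open>b = a p2 - a p3\<close>, the energy at
  level \<open>n\<close> is a quadratic form \<open>qA d\<^sup>2 + qB d b + qG b\<^sup>2\<close>;
  one subdivision step maps its coefficients linearly.\<close>

lemma q_rec:
  "qA (Suc n) = qA n / 7 + qB n / 49 + qG n / 49"
  "qB (Suc n) = 2 / 119 * qB n + 2 / 119 * qG n"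
  "qG (Suc n) = 2 / 17 * qG n"
  by (simp_all add: qA_def qB_def qG_def field_simps)

text \<open>The increment \<open>d = a p3 - a p1\<close> is spread evenly over the straight chain of
  seven left and top cells.  The increment \<open>b = a p2 - a p3\<close> is spread over the top
  cells and the seven varying right cells like a current of resistance \<open>17/2\<close>: shares
  \<open>1/17\<close> twice in parallel over the two flat cells on the left, \<open>2/17\<close>
  over the cell \<open>(1,5)\<close>, and \<open>2/17\<close> for each right cell.\<close>

definition besov_spec :: "(plane \<Rightarrow> real) \<Rightarrow> (plane \<Rightarrow> real) \<Rightarrow> bool" where
  "besov_spec a u \<longleftrightarrow> (\<forall>p\<in>V0. u p = a p) \<and>
     (\<forall>j<5. u (cell_map (0, j) p1) = a p1 + real j / 7 * (a p3 - a p1) \<and>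
        u (cell_map (0, j) p3) - u (cell_map (0, j) p1) = (a p3 - a p1) / 7 \<and>
        u (cell_map (0, j) p2) - u (cell_map (0, j) p3) = 0) \<and>
     u (cell_map (0, 5) p1) = a p1 + 5/7 * (a p3 - a p1) \<and>
     u (cell_map (0, 5) p3) - u (cell_map (0, 5) p1) = (a p3 - a p1) / 7 \<and>
     u (cell_map (0, 5) p2) - u (cell_map (0, 5) p3) = (a p3 - a p1) / 7 + (a p2 - a p3) / 17 \<and>
     u (cell_map (Suc 0, 5) p1) = a p3 + (a p2 - a p3) / 17 \<and>
     u (cell_map (Suc 0, 5) p3) - u (cell_map (Suc 0, 5) p1) = 0 \<and>
     u (cell_map (Suc 0, 5) p2) - u (cell_map (Suc 0, 5) p3) = 2 / 17 * (a p2 - a p3) \<and>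
     u (cell_map (0, 6) p1) = a p1 + 6/7 * (a p3 - a p1) \<and>
     u (cell_map (0, 6) p3) - u (cell_map (0, 6) p1) = (a p3 - a p1) / 7 \<and>
     u (cell_map (0, 6) p2) - u (cell_map (0, 6) p3) = (a p2 - a p3) / 17 \<and>
     (\<forall>k\<in>{1..9}. \<bar>u (cell_map (r k) p1) - a p3\<bar> \<le> \<bar>a p2 - a p3\<bar> \<and>
        u (cell_map (r k) p3) - u (cell_map (r k) p1) = 0 \<and>
        \<bar>u (cell_map (r k) p2) - u (cell_map (r k) p3)\<bar> = 2 / 17 * \<bar>a p2 - a p3\<bar> * vary k)"

lemma besov_spec_exists: "\<exists>u. besov_spec a u"
proof -
  define d b where "d = a p3 - a p1" "b = a p2 - a p3"
  note db = this
  define s where "s k = (\<Sum>j=1..k. vary j)" for k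
  have vary01: "0 \<le> vary k" "vary k \<le> 1" for k by (auto simp: vary_def)
  have s9: "s 9 = 7" unfolding s_def by (rule sum_vary)
  have s_le: "0 \<le> s k" "s k \<le> 7" if "k \<le> 9" for k
  proof -
    show "0 \<le> s k" unfolding s_def using vary01 by (intro sum_nonneg) auto
    show "s k \<le> 7" unfolding s9[symmetric] s_def using vary01 that by (intro sum_mono2) auto
  qed
  have s_Suc: "s k = s (k - 1) + vary k" if "k \<in> {1..9}" for k
    using that by (cases k) (auto simp: s_def)
  define Z where "Z k = a p3 + b / 17 * (3 + 2 * s k)" for k
  define Zh where "Zh k = (if ea k = p2 then Z k else Z (k - 1))" for k
  obtain u where u:
    "\<And>j. j < 5 \<Longrightarrow> u (cell_map (0, j) p1) = a p1 + real j / 7 * d \<and> u (cell_map (0, j) p2) = a p1 + real (Suc j) / 7 * d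
        \<and> u (cell_map (0, j) p3) = a p1 + real (Suc j) / 7 * d"
    "u (cell_map (0, 5) p1) = a p1 + real 5 / 7 * d" "u (cell_map (0, 5) p2) = a p3 + b/17" "u (cell_map (0, 5) p3) = a p1 + 6/7 * d"
    "u (cell_map (Suc 0, 5) p1) = a p3 + b/17" "u (cell_map (Suc 0, 5) p2) = Z 0" "u (cell_map (Suc 0, 5) p3) = a p3 + b/17"
    "u (cell_map (0, 6) p1) = a p1 + 6/7 * d" "u (cell_map (0, 6) p2) = a p3 + b/17" "u (cell_map (0, 6) p3) = a p3"
    "\<And>k. k \<in> {1..9} \<Longrightarrow> u (cell_map (r k) (ea k)) = Z (k - 1) \<and> u (cell_map (r k) (eb k)) = Z k
        \<and> u (cell_map (r k) (eh k)) = Zh k"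
    "u p1 = a p1 + real 0 / 7 * d" "u p2 = Z 9" "u p3 = a p3"
    using level1_function[of "\<lambda>j. a p1 + real j / 7 * d" "\<lambda>j. a p1 + real (Suc j) / 7 * d" "a p3 + b/17"
        "a p1 + 6/7 * d" Z "a p3 + b/17" "a p3" Zh] by metis
  have right: "\<bar>u (cell_map (r k) p1) - a p3\<bar> \<le> \<bar>b\<bar> \<and>
        u (cell_map (r k) p3) - u (cell_map (r k) p1) = 0 \<and>
        \<bar>u (cell_map (r k) p2) - u (cell_map (r k) p3)\<bar> = 2 / 17 * \<bar>b\<bar> * vary k" if k: "k \<in> {1..9}" for k
  proof -
    have le: "\<bar>Z l - a p3\<bar> \<le> \<bar>b\<bar>" if "l \<le> 9" for l
    proof -
      have "\<bar>Z l - a p3\<bar> = \<bar>b\<bar> * ((3 + 2 * s l) / 17)" using s_le[OF that] by (simp add: Z_def abs_mult)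
      also have "\<dots> \<le> \<bar>b\<bar> * 1" using s_le[OF that] by (intro mult_left_mono) auto
      finally show ?thesis by simp
    qed
    have dZ: "Z k - Z (k - 1) = 2 / 17 * b * vary k" using s_Suc[OF k] by (simp add: Z_def field_simps)
    have a: "\<bar>Z k - Z (k - 1)\<bar> = 2 / 17 * \<bar>b\<bar> * vary k" "\<bar>Z (k - 1) - Z k\<bar> = 2 / 17 * \<bar>b\<bar> * vary k"
      unfolding abs_minus_commute[of "Z (k - 1)"] dZ using vary01[of k] by (simp_all add: abs_mult)
    have l: "\<bar>Z k - a p3\<bar> \<le> \<bar>b\<bar>" "\<bar>Z (k - 1) - a p3\<bar> \<le> \<bar>b\<bar>" using le[of k] le[of "k - 1"] k by auto
    note uk = u(11)[OF k]
    show ?thesis using k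
    proof (cases rule: edge_cases)
      case 1 then show ?thesis using uk a l by (simp add: Zh_def)
    next
      case 2 then show ?thesis using uk a l by (simp add: Zh_def)
    next
      case 3 then show ?thesis using uk a l by (simp add: Zh_def)
    next
      case 4 then show ?thesis using uk a l by (simp add: Zh_def)
    next
      case 5
      then have "vary k = 0" by (auto simp: vary_def)
      then show ?thesis using 5 uk a l by (simp add: Zh_def)
    next
      case 6
      then have "vary k = 0" by (auto simp: vary_def)
      then show ?thesis using 6 uk a l by (simp add: Zh_def)
    qed
  qed
  have "besov_spec a u"
    unfolding besov_spec_def db(1)[symmetric] db(2)[symmetric]
  proof (intro conjI)
    show "\<forall>p\<in>V0. u p = a p" unfolding V0_def using u(12-14) s9 by (simp add: Z_def db field_simps)
    show "\<forall>k\<in>{1..9}. \<bar>u (cell_map (r k) p1) - a p3\<bar> \<le> \<bar>b\<bar> \<and> u (cell_map (r k) p3) - u (cell_map (r k) p1) = 0 \<and>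
        \<bar>u (cell_map (r k) p2) - u (cell_map (r k) p3)\<bar> = 2 / 17 * \<bar>b\<bar> * vary k" using right by blast
    show "\<forall>j<5. u (cell_map (0, j) p1) = a p1 + real j / 7 * d \<and>
        u (cell_map (0, j) p3) - u (cell_map (0, j) p1) = d / 7 \<and>
        u (cell_map (0, j) p2) - u (cell_map (0, j) p3) = 0"
    proof (intro allI impI)
      fix j :: nat assume j: "j < 5"
      note uj = u(1)[OF j, THEN conjunct1] u(1)[OF j, THEN conjunct2, THEN conjunct1]
        u(1)[OF j, THEN conjunct2, THEN conjunct2]
      show "u (cell_map (0, j) p1) = a p1 + real j / 7 * d \<and>
        u (cell_map (0, j) p3) - u (cell_map (0, j) p1) = d / 7 \<and>
        u (cell_map (0, j) p2) - u (cell_map (0, j) p3) = 0"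
        unfolding uj by (simp add: field_simps)
    qed
  qed (simp_all only: u(2-10), simp_all add: db Z_def s_def field_simps)
  then show ?thesis by blast
qed

text \<open>Flat corner values (\<open>d = 0\<close>) lead to flat corner values in all cells and
  the rate \<open>2/17\<close>; in general the increments along the straight chains give the rate
  \<open>1/7\<close>.\<close>

lemma besov_functions_exist:
  "\<exists>H C. 0 \<le> C \<and> (\<forall>a. continuous_on K (H a)) \<and> (\<forall>a. \<forall>p\<in>V0. H a p = a p) \<and>
     (\<forall>a. \<forall>x\<in>K. \<bar>H a x - a p1\<bar> \<le> C * osc a) \<and>
     (\<forall>n a. PE n (H a) = qA n * (a p3 - a p1)\<^sup>2 + qB n * (a p3 - a p1) * (a p2 - a p3) + qG n * (a p2 - a p3)\<^sup>2) \<and>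
     (\<forall>n w a. a p1 = a p3 \<longrightarrow> w \<in> words I n \<longrightarrow> H a (word_map w p1) = H a (word_map w p3))"
proof -
  define U where "U a = (SOME u. besov_spec a u)" for a
  have U: "besov_spec a (U a)" for a unfolding U_def using besov_spec_exists by (rule someI_ex)
  have UV: "U a p = a p" if "p \<in> V0" for a p using U[of a] that by (simp add: besov_spec_def)
  have cell: "osc (U a \<circ> cell_map i) \<le> 1/2 * osc a \<and> \<bar>U a (cell_map i p1) - a p1\<bar> \<le> 3 * osc a" if i: "i \<in> I" for a i
  proof -
    define o' where "o' = osc a"
    have ob: "\<bar>a p1 - a p2\<bar> \<le> o'" "\<bar>a p2 - a p3\<bar> \<le> o'" "\<bar>a p1 - a p3\<bar> \<le> o'" "0 \<le> o'"
      unfolding o'_def by (rule osc_bounds)+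
    define d b where "d = a p3 - a p1" "b = a p2 - a p3"
    note db = this
    have ob': "\<bar>d\<bar> \<le> o'" "\<bar>b\<bar> \<le> o'" "a p3 = a p1 + d" using ob by (simp_all add: db abs_minus_commute)
    note Ua = U[of a, unfolded besov_spec_def, folded db]
    have oscI: "osc (U a \<circ> cell_map i) \<le> 1/2 * o'"
      if "\<bar>U a (cell_map i p3) - U a (cell_map i p1)\<bar> + \<bar>U a (cell_map i p2) - U a (cell_map i p3)\<bar> \<le> 1/2 * o'"
      using that by (intro osc_leI; unfold comp_apply; linarith)
    have "osc (U a \<circ> cell_map i) \<le> 1/2 * o' \<and> \<bar>U a (cell_map i p1) - a p1\<bar> \<le> 3 * o'" using i
    proof (cases rule: I_cases)
      case (1 j)
      have j: "U a (cell_map (0, j) p1) = a p1 + real j / 7 * d"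
        "U a (cell_map (0, j) p3) - U a (cell_map (0, j) p1) = d / 7"
        "U a (cell_map (0, j) p2) - U a (cell_map (0, j) p3) = 0"
        using Ua 1(1) by blast+
      have "\<bar>real j / 7 * d\<bar> = real j / 7 * \<bar>d\<bar>" by (simp add: abs_mult)
      also have "\<dots> \<le> 1 * o'" using 1(1) ob' by (intro mult_mono) auto
      finally have "\<bar>U a (cell_map (0, j) p1) - a p1\<bar> \<le> o'" unfolding j(1) by simp
      then show ?thesis using j(2,3) ob' ob(4) unfolding 1(2) by (intro conjI oscI[unfolded 1(2)]; linarith)
    next
      case 2
      show ?thesis using Ua ob' ob(4) unfolding 2 by (elim conjE) (intro conjI oscI[unfolded 2]; linarith)
    next
      case 3
      show ?thesis using Ua ob' ob(4) unfolding 3 by (elim conjE) (intro conjI oscI[unfolded 3]; linarith)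
    next
      case 4
      show ?thesis using Ua ob' ob(4) unfolding 4 by (elim conjE) (intro conjI oscI[unfolded 4]; linarith)
    next
      case (5 k)
      have k: "\<bar>U a (cell_map (r k) p1) - a p3\<bar> \<le> \<bar>b\<bar>"
        "U a (cell_map (r k) p3) - U a (cell_map (r k) p1) = 0"
        "\<bar>U a (cell_map (r k) p2) - U a (cell_map (r k) p3)\<bar> = 2 / 17 * \<bar>b\<bar> * vary k"
        using Ua 5(1) by blast+
      have "2 / 17 * \<bar>b\<bar> * vary k \<le> 2 / 17 * \<bar>b\<bar>" by (simp add: vary_def)
      then show ?thesis using k ob' ob(4) unfolding 5(2) by (intro conjI oscI[unfolded 5(2)]; linarith)
    qed
    then show ?thesis unfolding o'_def .
  qed
  obtain H C where H: "\<And>a. continuous_on K (H a)" "\<And>a p. p \<in> V0 \<Longrightarrow> H a p = a p"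
    "\<And>a i x. i \<in> I \<Longrightarrow> x \<in> K \<Longrightarrow> H a (cell_map i x) = H (U a \<circ> cell_map i) x"
    "\<And>a x. x \<in> K \<Longrightarrow> \<bar>H a x - a p1\<bar> \<le> C * osc a" "0 \<le> C"
    by (rule selfsimilar_functions[of U "1/2"]) (use UV cell in auto)
  have PE_step: "PE (Suc n) (H a) = (\<Sum>i\<in>I. PE n (H (U a \<circ> cell_map i)))" for n a
    unfolding wform_Suc mult_1
    by (intro sum.cong refl wform_cong) (simp_all add: H(3))
  have energy: "PE n (H a) = qA n * (a p3 - a p1)\<^sup>2 + qB n * (a p3 - a p1) * (a p2 - a p3) + qG n * (a p2 - a p3)\<^sup>2" for n a
  proof (induction n arbitrary: a)
    case 0
    show ?case by (simp add: tri3_def H(2) qA_def qB_def qG_def power2_eq_square algebra_simps)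
  next
    case (Suc n)
    define d b where "d = a p3 - a p1" "b = a p2 - a p3"
    note Ua = U[of a, unfolded besov_spec_def, folded d_b_def]
    define f where "f i = qA n * (U a (cell_map i p3) - U a (cell_map i p1))\<^sup>2
       + qB n * (U a (cell_map i p3) - U a (cell_map i p1)) * (U a (cell_map i p2) - U a (cell_map i p3))
       + qG n * (U a (cell_map i p2) - U a (cell_map i p3))\<^sup>2" for i
    have "PE (Suc n) (H a) = (\<Sum>i\<in>I. f i)" unfolding PE_step Suc f_def by simp
    also have "\<dots> = (\<Sum>j<5. f (0, j)) + f (0, 5) + f (Suc 0, 5) + f (0, 6) + (\<Sum>k=1..9. f (r k))"
      by (rule sum_I)
    also have "(\<Sum>j<5. f (0, j)) = (\<Sum>j<(5::nat). qA n * (d / 7)\<^sup>2)"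
    proof (rule sum.cong[OF refl])
      fix j :: nat assume "j \<in> {..<5}"
      then have "U a (cell_map (0, j) p3) - U a (cell_map (0, j) p1) = d / 7"
        "U a (cell_map (0, j) p2) - U a (cell_map (0, j) p3) = 0"
        using Ua by blast+
      note e = this
      show "f (0, j) = qA n * (d / 7)\<^sup>2" unfolding f_def e by simp
    qed
    also have "f (0, 5) = qA n * (d / 7)\<^sup>2 + qB n * (d/7) * (d/7 + b/17) + qG n * (d/7 + b/17)\<^sup>2"
    proof -
      have e: "U a (cell_map (0, 5) p3) - U a (cell_map (0, 5) p1) = d / 7"
        "U a (cell_map (0, 5) p2) - U a (cell_map (0, 5) p3) = d / 7 + b / 17" using Ua by blast+
      show ?thesis unfolding f_def e ..
    qed
    also have "f (Suc 0, 5) = qG n * (2 / 17 * b)\<^sup>2"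
    proof -
      have e: "U a (cell_map (Suc 0, 5) p3) - U a (cell_map (Suc 0, 5) p1) = 0"
        "U a (cell_map (Suc 0, 5) p2) - U a (cell_map (Suc 0, 5) p3) = 2 / 17 * b" using Ua by blast+
      show ?thesis unfolding f_def e by simp
    qed
    also have "f (0, 6) = qA n * (d / 7)\<^sup>2 + qB n * (d/7) * (b/17) + qG n * (b/17)\<^sup>2"
    proof -
      have e: "U a (cell_map (0, 6) p3) - U a (cell_map (0, 6) p1) = d / 7"
        "U a (cell_map (0, 6) p2) - U a (cell_map (0, 6) p3) = b / 17" using Ua by blast+
      show ?thesis unfolding f_def e ..
    qed
    also have "(\<Sum>k=1..9. f (r k)) = (\<Sum>k=1..9. qG n * (2 / 17 * b)\<^sup>2 * vary k)"
    proof (rule sum.cong[OF refl])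
      fix k :: nat assume "k \<in> {1..9}"
      then have k: "U a (cell_map (r k) p3) - U a (cell_map (r k) p1) = 0"
        "\<bar>U a (cell_map (r k) p2) - U a (cell_map (r k) p3)\<bar> = 2 / 17 * \<bar>a p2 - a p3\<bar> * vary k"
        using U[of a] unfolding besov_spec_def by blast+
      have "(U a (cell_map (r k) p2) - U a (cell_map (r k) p3))\<^sup>2 = (2 / 17 * \<bar>b\<bar> * vary k)\<^sup>2"
        using k(2) unfolding d_b_def by (metis power2_abs)
      then show "f (r k) = qG n * (2 / 17 * b)\<^sup>2 * vary k"
      proof -
        have "(2 / 17 * \<bar>b\<bar> * vary k)\<^sup>2 = (2 / 17 * b)\<^sup>2 * vary k"
          by (simp add: vary_def power_mult_distrib power_divide)
        moreover have "f (r k) = qG n * (U a (cell_map (r k) p2) - U a (cell_map (r k) p3))\<^sup>2"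
          unfolding f_def k(1) by simp
        ultimately show ?thesis unfolding \<open>(U a (cell_map (r k) p2) - U a (cell_map (r k) p3))\<^sup>2 = _\<close>
          by simp
      qed
    qed
    also have "\<dots> = qG n * (2 / 17 * b)\<^sup>2 * 7" unfolding sum_vary[symmetric] by (simp add: sum_distrib_left)
    finally show ?case
      unfolding d_b_def(1)[symmetric] d_b_def(2)[symmetric] q_rec
      by (simp add: power2_eq_square field_simps)
  qed
  have flat: "H a (word_map w p1) = H a (word_map w p3)" if "a p1 = a p3" "w \<in> words I n" for n w a
    using that
  proof (induction n arbitrary: w a)
    case 0 then show ?case by (simp add: H(2))
  next
    case (Suc n)
    then obtain i v where w: "w = i # v" "i \<in> I" "v \<in> words I n" by (auto simp: words_Suc)
    have "(U a \<circ> cell_map i) p1 = (U a \<circ> cell_map i) p3" using w(2)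
      by (cases rule: I_cases) (use U[of a] Suc.prems(1) in \<open>auto simp: besov_spec_def\<close>)
    from Suc.IH[OF this w(3)] show ?case
      unfolding w(1) word_map_Cons comp_apply[of "cell_map i"]
        H(3)[OF w(2) word_map_K[OF w(3) p_K(1)]] H(3)[OF w(2) word_map_K[OF w(3) p_K(3)]] .
  qed
  show ?thesis by (intro exI[of _ H] exI[of _ C] conjI allI ballI impI H energy flat) auto
qed

subsection \<open>Harmonic functions of a self-similar energy\<close>

text \<open>Resistances making one subdivision step exact.  The unit triangle is a star with three
  branches of resistance \<open>1/3\<close>.  The five left cells, each passed through two branches
  of their stars, have total resistance \<open>5 * 2/3 * 11/250 = 11/25 * 1/3\<close>, and the nine
  right cells \<open>9 * 2/3 * 11/450 = 11/25 * 1/3\<close>; the three top cells supply the rest of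
  each branch.\<close>

definition \<tau> :: "cell \<Rightarrow> real" where
  "\<tau> i = (if i \<in> left_cells then 11/250 else if i = (0, 6) then 16/25 else if i \<in> top_cells then 8/25 else 11/450)"

definition \<rho> :: "cell \<Rightarrow> real" where "\<rho> i = 1 / \<tau> i"

lemma tau_bounds: "0 < \<tau> i" "\<tau> i \<le> 16/25" by (auto simp: \<tau>_def)

lemma rho_values: "j < 5 \<Longrightarrow> \<rho> (0, j) = 250/11" "\<rho> (0, 5) = 25/8" "\<rho> (Suc 0, 5) = 25/8" "\<rho> (0, 6) = 25/16"
  "k \<in> {1..9} \<Longrightarrow> \<rho> (r k) = 450/11"
proof -
  show "\<rho> (0, j) = 250/11" if "j < 5"
  proof -
    have "j = 0 \<or> j = 1 \<or> j = 2 \<or> j = 3 \<or> j = 4" using that by linarith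
    then show ?thesis by (auto simp: \<rho>_def \<tau>_def left_cells_def)
  qed
  show "k \<in> {1..9} \<Longrightarrow> \<rho> (r k) = 450/11"
    using r_not_left_top[of k] by (auto simp: \<rho>_def \<tau>_def top_cells_def)
qed (simp_all add: \<rho>_def \<tau>_def left_cells_def top_cells_def)

lemma sum_telescope9: "(\<Sum>k=1..9. f (k - 1) - f k) = f 0 - f (9::nat)" for f :: "nat \<Rightarrow> real"
  by (simp add: eval_nat_numeral)

text \<open>In the star with centre potential \<open>s\<close> the left cells take the fraction
  \<open>11/25\<close> of the drop from \<open>a p1\<close> to \<open>s\<close>, the right cells the
  same fraction of the drop from \<open>a p2\<close>, and loose vertices take the mean of their
  neighbours.  Green's formula says that the resulting level one function has no net current at
  inner vertices.\<close>

lemma harmonic_functions_exist: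
  "\<exists>H C. 0 \<le> C \<and> (\<forall>a. continuous_on K (H a)) \<and> (\<forall>a. \<forall>p\<in>V0. H a p = a p) \<and>
     (\<forall>a. \<forall>x\<in>K. \<bar>H a x - a p1\<bar> \<le> C * osc a) \<and>
     (\<forall>a v. wform \<rho> 1 1 1 1 (H a) v = tri3 1 1 1 a v) \<and>
     (\<forall>n a. wform \<rho> 1 1 1 n (H a) (H a) = tri3 1 1 1 a a)"
proof -
  define s where "s a = (a p1 + a p2 + a p3) / 3" for a :: "plane \<Rightarrow> real"
  define L where "L a j = a p1 - real j * (11/125) * (a p1 - s a)" for a :: "plane \<Rightarrow> real" and j :: nat
  define Lh where "Lh a j = (L a j + L a (Suc j)) / 2" for a j
  define Z where "Z a k = a p2 - (11/25) * (1 - real k / 9) * (a p2 - s a)" for a :: "plane \<Rightarrow> real" and k :: nat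
  define Zh where "Zh a k = (Z a (k - 1) + Z a k) / 2" for a k
  define x where "x a = (s a + 6/25 * (a p1 - s a) + s a + 6/25 * (a p2 - s a)) / 2" for a :: "plane \<Rightarrow> real"
  define y where "y a = 2/3 * (s a + 6/25 * (a p1 - s a)) + 1/3 * (s a + 9/25 * (a p3 - s a))" for a :: "plane \<Rightarrow> real"
  define w where "w a = 2/3 * (s a + 6/25 * (a p2 - s a)) + 1/3 * (s a + 9/25 * (a p3 - s a))" for a :: "plane \<Rightarrow> real"
  define spec where "spec a u \<longleftrightarrow>
    (\<forall>j<5. u (cell_map (0, j) p1) = L a j \<and> u (cell_map (0, j) p2) = Lh a j \<and> u (cell_map (0, j) p3) = L a (Suc j)) \<and>
    u (cell_map (0, 5) p1) = L a 5 \<and> u (cell_map (0, 5) p2) = x a \<and> u (cell_map (0, 5) p3) = y a \<and>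
    u (cell_map (Suc 0, 5) p1) = x a \<and> u (cell_map (Suc 0, 5) p2) = Z a 0 \<and> u (cell_map (Suc 0, 5) p3) = w a \<and>
    u (cell_map (0, 6) p1) = y a \<and> u (cell_map (0, 6) p2) = w a \<and> u (cell_map (0, 6) p3) = a p3 \<and>
    (\<forall>k\<in>{1..9}. u (cell_map (r k) (ea k)) = Z a (k - 1) \<and> u (cell_map (r k) (eb k)) = Z a k
        \<and> u (cell_map (r k) (eh k)) = Zh a k) \<and>
    (\<forall>p\<in>V0. u p = a p)" for a u
  have ex: "\<exists>u. spec a u" for a
  proof -
    obtain u where u: "\<And>j. j < 5 \<Longrightarrow> u (cell_map (0, j) p1) = L a j \<and> u (cell_map (0, j) p2) = Lh a j \<and> u (cell_map (0, j) p3) = L a (Suc j)"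
    "u (cell_map (0, 5) p1) = L a 5" "u (cell_map (0, 5) p2) = x a" "u (cell_map (0, 5) p3) = y a"
    "u (cell_map (Suc 0, 5) p1) = x a" "u (cell_map (Suc 0, 5) p2) = Z a 0" "u (cell_map (Suc 0, 5) p3) = w a"
    "u (cell_map (0, 6) p1) = y a" "u (cell_map (0, 6) p2) = w a" "u (cell_map (0, 6) p3) = a p3"
    "\<And>k. k \<in> {1..9} \<Longrightarrow> u (cell_map (r k) (ea k)) = Z a (k - 1) \<and> u (cell_map (r k) (eb k)) = Z a k
        \<and> u (cell_map (r k) (eh k)) = Zh a k"
    "u p1 = L a 0" "u p2 = Z a 9" "u p3 = a p3"
      using level1_function[of "L a" "Lh a" "x a" "y a" "Z a" "w a" "a p3" "Zh a"] by metis
    have "\<forall>p\<in>V0. u p = a p" unfolding V0_def using u(12-14) by (simp add: L_def Z_def)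
    then show ?thesis unfolding spec_def using u by blast
  qed
  define U where "U a = (SOME u. spec a u)" for a
  have U: "spec a (U a)" for a unfolding U_def using ex by (rule someI_ex)
  have UV: "U a p = a p" if "p \<in> V0" for a p using U[of a] that by (simp add: spec_def)
  have UL: "U a (cell_map (0, j) p1) = L a j" "U a (cell_map (0, j) p2) = Lh a j" "U a (cell_map (0, j) p3) = L a (Suc j)"
    if "j < 5" for a j using U[of a] that unfolding spec_def by blast+
  have UT: "U a (cell_map (0, 5) p1) = L a 5" "U a (cell_map (0, 5) p2) = x a" "U a (cell_map (0, 5) p3) = y a"
    "U a (cell_map (Suc 0, 5) p1) = x a" "U a (cell_map (Suc 0, 5) p2) = Z a 0" "U a (cell_map (Suc 0, 5) p3) = w a"
    "U a (cell_map (0, 6) p1) = y a" "U a (cell_map (0, 6) p2) = w a" "U a (cell_map (0, 6) p3) = a p3" for a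
    using U[of a] unfolding spec_def by blast+
  have UR: "U a (cell_map (r k) (ea k)) = Z a (k - 1)" "U a (cell_map (r k) (eb k)) = Z a k"
    "U a (cell_map (r k) (eh k)) = Zh a k" if "k \<in> {1..9}" for a k
    using U[of a] that unfolding spec_def by blast+
  have dL: "L a j - L a (Suc j) = 11/125 * (a p1 - s a)" for a j by (simp add: L_def field_simps)
  have dZ: "Z a (k - 1) - Z a k = - (11/225) * (a p2 - s a)" if k1: "k \<in> {1..9}" for a k
  proof -
    obtain m where k: "k = Suc m" using k1 by (cases k) auto
    show ?thesis unfolding k by (simp add: Z_def field_simps)
  qed
  have cell: "osc (U a \<circ> cell_map i) \<le> 9/10 * osc a \<and> \<bar>U a (cell_map i p1) - a p1\<bar> \<le> 3 * osc a" if i: "i \<in> I" for a i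
  proof -
    define o' where "o' = osc a"
    have ob: "\<bar>a p1 - a p2\<bar> \<le> o'" "\<bar>a p2 - a p3\<bar> \<le> o'" "\<bar>a p1 - a p3\<bar> \<le> o'" "0 \<le> o'"
      unfolding o'_def by (rule osc_bounds)+
    define A B C where "A = a p1 - s a" "B = a p2 - s a" "C = a p3 - s a"
    note ABC = this
    have V: "a p1 = s a + A" "a p2 = s a + B" "a p3 = s a + C" "A + B + C = 0"
      "L a 5 = a p1 - 11/25 * A" "Z a 0 = a p2 - 11/25 * B"
      "x a = s a + 3/25 * A + 3/25 * B" "y a = s a + 4/25 * A + 3/25 * C" "w a = s a + 4/25 * B + 3/25 * C"
      by (simp_all add: ABC L_def Z_def x_def y_def w_def s_def field_simps)
    have J: "\<bar>A\<bar> \<le> 2/3 * o'" "\<bar>B\<bar> \<le> 2/3 * o'" "\<bar>C\<bar> \<le> 2/3 * o'" using ob V(1-4) by linarith+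
    have W: "L a 5 - x a = 11/25 * A - 3/25 * B" "x a - y a = - (1/25 * A) + 3/25 * B - 3/25 * C"
      "L a 5 - y a = 2/5 * A - 3/25 * C" "x a - Z a 0 = 3/25 * A - 11/25 * B"
      "Z a 0 - w a = 2/5 * B - 3/25 * C" "x a - w a = 3/25 * A - 1/25 * B - 3/25 * C"
      "y a - w a = 4/25 * A - 4/25 * B" "w a - a p3 = 4/25 * B - 22/25 * C" "y a - a p3 = 4/25 * A - 22/25 * C"
      "L a 5 - a p1 = - (11/25 * A)" "x a - a p1 = 3/25 * B - 22/25 * A" "y a - a p1 = 3/25 * C - 21/25 * A"
      by (simp_all add: ABC L_def Z_def x_def y_def w_def field_simps)
    have Lh2: "2 * Lh a j = L a j + L a (Suc j)" "2 * Zh a j = Z a (j - 1) + Z a j" for j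
      by (simp_all add: Lh_def Zh_def)
    have "osc (U a \<circ> cell_map i) \<le> 9/10 * o' \<and> \<bar>U a (cell_map i p1) - a p1\<bar> \<le> 3 * o'" using i
    proof (cases rule: I_cases)
      case (1 j)
      have "\<bar>real j * (11/125) * A\<bar> = real j * (11/125) * \<bar>A\<bar>" by (simp add: abs_mult)
      also have "\<dots> \<le> 1 * (2/3 * o')" using 1(1) J by (intro mult_mono) auto
      finally have "\<bar>L a j - a p1\<bar> \<le> 2/3 * o'" by (simp add: L_def ABC)
      moreover have "osc (U a \<circ> cell_map (0, j)) \<le> 9/10 * o'"
        using J dL[of a j, folded ABC] ob(4) Lh2(1)[of j] by (intro osc_leI; unfold comp_apply UL[OF 1(1)]; linarith)
      ultimately show ?thesis using ob unfolding 1(2) UL[OF 1(1)] by simp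
    next
      case 2
      have "osc (U a \<circ> cell_map (0, 5)) \<le> 9/10 * o'"
        using J ob(4) by (intro osc_leI; unfold comp_apply UT W; linarith)
      moreover have "\<bar>L a 5 - a p1\<bar> \<le> 3 * o'" unfolding W using J ob(4) by linarith
      ultimately show ?thesis unfolding 2 UT by simp
    next
      case 3
      have "osc (U a \<circ> cell_map (Suc 0, 5)) \<le> 9/10 * o'"
        using J ob(4) by (intro osc_leI; unfold comp_apply UT W; linarith)
      moreover have "\<bar>x a - a p1\<bar> \<le> 3 * o'" unfolding W using J ob(4) by linarith
      ultimately show ?thesis unfolding 3 UT by simp
    next
      case 4
      have "osc (U a \<circ> cell_map (0, 6)) \<le> 9/10 * o'"
        using J ob(4) by (intro osc_leI; unfold comp_apply UT W; linarith)
      moreover have "\<bar>y a - a p1\<bar> \<le> 3 * o'" unfolding W using J ob(4) by linarith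
      ultimately show ?thesis unfolding 4 UT by simp
    next
      case (5 k)
      have lin: "\<bar>Z a l - a p1\<bar> \<le> 2 * o'" if "l \<le> 9" for l
      proof -
        have "real l \<le> 9" using that by simp
        then have "\<bar>(11/25) * (1 - real l / 9)\<bar> \<le> 1" by (simp add: abs_le_iff field_simps)
        then have "\<bar>(11/25) * (1 - real l / 9) * B\<bar> \<le> 1 * (2/3 * o')"
          unfolding abs_mult[of "(11/25) * (1 - real l / 9)"] using J by (intro mult_mono) auto
        then show ?thesis using ob unfolding Z_def ABC(2)[symmetric] by linarith
      qed
      have le: "\<bar>Z a (k - 1) - a p1\<bar> \<le> 2 * o'" "\<bar>Z a k - a p1\<bar> \<le> 2 * o'" using lin[of "k - 1"] lin[of k] 5(1) by auto
      then have leh: "\<bar>Zh a k - a p1\<bar> \<le> 2 * o'" using Lh2(2)[of k] by linarith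
      have d: "\<bar>Z a (k - 1) - Z a k\<bar> \<le> 9/10 * o'" "\<bar>Z a (k - 1) - Zh a k\<bar> \<le> 9/10 * o'" "\<bar>Z a k - Zh a k\<bar> \<le> 9/10 * o'"
        "\<bar>Z a k - Z a (k - 1)\<bar> \<le> 9/10 * o'" "\<bar>Zh a k - Z a (k - 1)\<bar> \<le> 9/10 * o'" "\<bar>Zh a k - Z a k\<bar> \<le> 9/10 * o'"
        using dZ[OF 5(1), of a, folded ABC] J ob(4) Lh2(2)[of k] by linarith+
      define t where "t = 9/10 * o'"
      show ?thesis unfolding 5(2) t_def[symmetric] using 5(1)
        by (cases rule: edge_cases)
          (use UR[OF 5(1), of a] d[folded t_def] le leh ob in \<open>auto simp: osc_def\<close>)
    qed
    then show ?thesis unfolding o'_def .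
  qed
  obtain H C where H: "\<And>a. continuous_on K (H a)" "\<And>a p. p \<in> V0 \<Longrightarrow> H a p = a p"
    "\<And>a i x. i \<in> I \<Longrightarrow> x \<in> K \<Longrightarrow> H a (cell_map i x) = H (U a \<circ> cell_map i) x"
    "\<And>a x. x \<in> K \<Longrightarrow> \<bar>H a x - a p1\<bar> \<le> C * osc a" "0 \<le> C"
    by (rule selfsimilar_functions[of U "9/10"]) (use UV cell in auto)
  have bd: "H a (cell_map i p) = U a (cell_map i p)" if "i \<in> I" "p \<in> V0" for a i p
  proof -
    have "p \<in> K" using V0_K that(2) by blast
    show ?thesis unfolding H(3)[OF that(1) \<open>p \<in> K\<close>] H(2)[OF that(2)] by simp
  qed
  have green: "wform \<rho> 1 1 1 1 (H a) v = tri3 1 1 1 a v" for a v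
  proof -
    have "wform \<rho> 1 1 1 1 (H a) v = (\<Sum>i\<in>I. \<rho> i * tri3 1 1 1 (U a \<circ> cell_map i) (v \<circ> cell_map i))"
      unfolding wform_1
    proof (intro sum.cong refl arg_cong2[of _ _ _ _ times] tri3_cong)
      fix i p assume "i \<in> I" "p \<in> V0"
      then show "(H a \<circ> cell_map i) p = (U a \<circ> cell_map i) p" by (simp add: bd)
    qed
    also have "\<dots> = (\<Sum>j<5. 3 * (a p1 - s a) * (v (q 0 j) - v (q 0 (Suc j))))
      + 25/8 * tri3 1 1 1 (U a \<circ> cell_map (0, 5)) (v \<circ> cell_map (0, 5))
      + 25/8 * tri3 1 1 1 (U a \<circ> cell_map (Suc 0, 5)) (v \<circ> cell_map (Suc 0, 5))
      + 25/16 * tri3 1 1 1 (U a \<circ> cell_map (0, 6)) (v \<circ> cell_map (0, 6))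
      + (\<Sum>k=1..9. - 3 * (a p2 - s a) * (v (z (k - 1)) - v (z k)))"
      unfolding sum_I rho_values(2-4)
    proof (intro arg_cong2[of _ _ _ _ "(+)"] refl sum.cong)
      fix j :: nat assume "j \<in> {..<5}"
      then have j: "j < 5" by simp
      have e: "L a j = L a (Suc j) + 11/125 * (a p1 - s a)" using dL[of a j] by linarith
      then show "\<rho> (0, j) * tri3 1 1 1 (U a \<circ> cell_map (0, j)) (v \<circ> cell_map (0, j))
         = 3 * (a p1 - s a) * (v (q 0 j) - v (q 0 (Suc j)))"
        unfolding rho_values(1)[OF j] tri3_def comp_apply UL[OF j] Lh_def
        unfolding cell_map_V0 e by (simp add: field_simps)
    next
      fix k :: nat assume k: "k \<in> {1..9}"
      have e: "Z a (k - 1) = Z a k - (11/225) * (a p2 - s a)" using dZ[OF k, of a] by linarith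
      then show "\<rho> (r k) * tri3 1 1 1 (U a \<circ> cell_map (r k)) (v \<circ> cell_map (r k))
         = - 3 * (a p2 - s a) * (v (z (k - 1)) - v (z k))"
        unfolding rho_values(5)[OF k] tri3_right[OF k] UR[OF k] Zh_def
        unfolding comp_apply ea(2)[OF k] eb(2)[OF k] e by (simp add: field_simps)
    qed
    also have "(\<Sum>j<5. 3 * (a p1 - s a) * (v (q 0 j) - v (q 0 (Suc j)))) = 3 * (a p1 - s a) * (v p1 - v (q 0 5))"
      unfolding sum_distrib_left[symmetric] by (simp add: eval_nat_numeral q_corners)
    also have "(\<Sum>k=1..9. - 3 * (a p2 - s a) * (v (z (k - 1)) - v (z k))) = - 3 * (a p2 - s a) * (v (q 2 5) - v p2)"
      unfolding sum_distrib_left[symmetric] sum_telescope9[of "\<lambda>k. v (z k)"] z_ends q_corners ..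
    also have "3 * (a p1 - s a) * (v p1 - v (q 0 5))
      + 25/8 * tri3 1 1 1 (U a \<circ> cell_map (0, 5)) (v \<circ> cell_map (0, 5))
      + 25/8 * tri3 1 1 1 (U a \<circ> cell_map (Suc 0, 5)) (v \<circ> cell_map (Suc 0, 5))
      + 25/16 * tri3 1 1 1 (U a \<circ> cell_map (0, 6)) (v \<circ> cell_map (0, 6))
      + - 3 * (a p2 - s a) * (v (q 2 5) - v p2) = tri3 1 1 1 a v"
    proof -
      have qs: "cell_map (0, 5) p1 = q 0 5" "cell_map (0, 5) p2 = q 1 5" "cell_map (0, 5) p3 = q 0 6"
        "cell_map (Suc 0, 5) p1 = q 1 5" "cell_map (Suc 0, 5) p2 = q 2 5" "cell_map (Suc 0, 5) p3 = q 1 6"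
        "cell_map (0, 6) p1 = q 0 6" "cell_map (0, 6) p2 = q 1 6" "cell_map (0, 6) p3 = p3"
        by (simp_all add: q_corners)
      show ?thesis
        unfolding tri3_def comp_apply UT unfolding qs L_def Z_def x_def y_def w_def s_def by (simp add: field_simps)
    qed
    finally show ?thesis .
  qed
  have energy: "wform \<rho> 1 1 1 n (H a) (H a) = tri3 1 1 1 a a" for n a
  proof (induction n arbitrary: a)
    case 0 show ?case by (simp add: tri3_def H(2))
  next
    case (Suc n)
    have "wform \<rho> 1 1 1 (Suc n) (H a) (H a) = (\<Sum>i\<in>I. \<rho> i * wform \<rho> 1 1 1 n (H (U a \<circ> cell_map i)) (H (U a \<circ> cell_map i)))"
      unfolding wform_Suc by (intro sum.cong refl arg_cong2[of _ _ _ _ times] wform_cong) (simp_all add: H(3))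
    also have "\<dots> = (\<Sum>i\<in>I. \<rho> i * tri3 1 1 1 (H a \<circ> cell_map i) (H a \<circ> cell_map i))"
      unfolding Suc by (intro sum.cong refl arg_cong2[of _ _ _ _ times] tri3_cong) (simp_all add: bd)
    also have "\<dots> = wform \<rho> 1 1 1 1 (H a) (H a)" unfolding wform_1 ..
    also have "\<dots> = tri3 1 1 1 a (H a)" by (rule green)
    finally show ?case by (simp add: tri3_def H(2))
  qed
  show ?thesis by (intro exI[of _ H] exI[of _ C] conjI allI ballI H green energy)
qed

end

section \<open>Discrete energies and Besov norms\<close>

text \<open>Iterating gives \<open>a 0 \<le> 2 ^ k * a k + B * (\<Sum>j<k. (2 * \<theta>) ^
  j)\<close>, and the prior bound makes the first term vanish.\<close>

lemma doubling_ennreal: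
  fixes a :: "nat \<Rightarrow> ennreal" and B D \<theta> :: real
  assumes step: "\<And>k. a k \<le> 2 * a (Suc k) + ennreal (B * \<theta> ^ k)"
    and prior: "\<And>k. a k \<le> ennreal (D * \<theta> ^ k)"
    and "0 \<le> B" "0 \<le> D" "0 \<le> \<theta>" "2 * \<theta> < 1"
  shows "a 0 \<le> ennreal (B / (1 - 2 * \<theta>))"
proof -
  have fin: "a k \<noteq> top" for k using prior[of k] by (auto simp: top_unique)
  define r where "r k = enn2real (a k)" for k
  have r: "a k = ennreal (r k)" "0 \<le> r k" for k using fin[of k] by (auto simp: r_def ennreal_enn2real_if)
  have step': "r k \<le> 2 * r (Suc k) + B * \<theta> ^ k" for k
  proof -
    have nn: "0 \<le> 2 * r (Suc k) + B * \<theta> ^ k" using assms(3,5) r(2) by simp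
    have "2 * ennreal (r (Suc k)) + ennreal (B * \<theta> ^ k) = ennreal (2 * r (Suc k) + B * \<theta> ^ k)"
      using assms(3,5) r(2) by (simp add: ennreal_plus ennreal_mult)
    then show ?thesis using step[of k] unfolding r(1) by (simp only: ennreal_le_iff[OF nn])
  qed
  have prior': "r k \<le> D * \<theta> ^ k" for k
    using prior[of k] assms(4,5) r[of k] by (simp add: ennreal_le_iff)
  have "r 0 \<le> (2 * \<theta>) ^ m * D + B * (\<Sum>k<m. (2 * \<theta>) ^ k)" for m
  proof -
    have "r 0 \<le> 2 ^ m * r m + B * (\<Sum>k<m. (2 * \<theta>) ^ k)"
    proof (induction m)
      case (Suc m)
      have "2 ^ m * r m \<le> 2 ^ m * (2 * r (Suc m) + B * \<theta> ^ m)" by (intro mult_left_mono step') auto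
      with Suc show ?case by (simp add: algebra_simps power_mult_distrib)
    qed simp
    also have "2 ^ m * r m \<le> 2 ^ m * (D * \<theta> ^ m)" by (intro mult_left_mono prior') auto
    finally show ?thesis by (simp add: power_mult_distrib mult_ac)
  qed
  moreover have "(\<lambda>m. (2 * \<theta>) ^ m * D + B * (\<Sum>k<m. (2 * \<theta>) ^ k)) \<longlonglongrightarrow> 0 * D + B * (1 / (1 - 2 * \<theta>))"
    using assms(5,6) geometric_sums[of "2 * \<theta>"] unfolding sums_def
    by (intro tendsto_intros LIMSEQ_realpow_zero) auto
  ultimately have "r 0 \<le> B / (1 - 2 * \<theta>)"
    using LIMSEQ_le_const by (metis (no_types, lifting) add_0 mult.right_neutral mult_zero_left times_divide_eq_right)
  then show ?thesis unfolding r(1) by (rule ennreal_leI)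
qed

context sickle
begin

text \<open>Every vertex of a cell of level one is reached from \<open>p1\<close> through the left,
  top and right cells, crossing at most \<open>20\<close> edges.\<close>

lemma level1_path:
  fixes v :: "plane \<Rightarrow> real"
  assumes e: "\<And>i p p'. i \<in> I \<Longrightarrow> p \<in> V0 \<Longrightarrow> p' \<in> V0 \<Longrightarrow> \<bar>v (cell_map i p) - v (cell_map i p')\<bar> \<le> e"
    and i: "i \<in> I" and p: "p \<in> V0"
  shows "\<bar>v (cell_map i p) - v p1\<bar> \<le> 20 * e"
proof -
  have e0: "0 \<le> e" using e[OF i p p] by simp
  have left: "\<bar>v (q 0 j) - v p1\<bar> \<le> real j * e" if "j \<le> 7" for j
    using that
  proof (induction j)
    case 0 then show ?case by (simp add: q_corners)
  next
    case (Suc j)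
    have "(0, j) \<in> I" using Suc.prems left_top_I(1)[of j] left_top_I(2,4)
      by (cases "j \<le> 4"; cases "j = 5"; cases "j = 6") auto
    from e[OF this V0_mem(3) V0_mem(1)] have "\<bar>v (q 0 (Suc j)) - v (q 0 j)\<bar> \<le> e" by simp
    with Suc show ?case by (simp add: algebra_simps)
  qed
  have x: "\<bar>v (q 1 5) - v p1\<bar> \<le> 6 * e"
    using e[OF left_top_I(2) V0_mem(2) V0_mem(1)] left[of 5] by simp
  have z: "\<bar>v (z k) - v p1\<bar> \<le> (real k + 7) * e" if "k \<le> 9" for k
    using that
  proof (induction k)
    case 0
    have "\<bar>v (q 2 5) - v (q 1 5)\<bar> \<le> e"
      using e[OF left_top_I(3) V0_mem(2) V0_mem(1)] by (simp add: numeral_2_eq_2)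
    then show ?case using x by (simp add: z_ends)
  next
    case (Suc k)
    then have k: "Suc k \<in> {1..9}" by auto
    have "\<bar>v (z (Suc k)) - v (z k)\<bar> \<le> e"
      using e[OF r_I[OF k] eb(1)[OF k] ea(1)[OF k]] eb(2)[OF k] ea(2)[OF k] by simp
    with Suc show ?case by (simp add: algebra_simps)
  qed
  have step: "\<bar>v (cell_map i p) - v p1\<bar> \<le> 20 * e" if "i \<in> I" "p \<in> V0" "p' \<in> V0" "\<bar>v (cell_map i p') - v p1\<bar> \<le> 19 * e" for i p p'
    using e[OF that(1,2,3)] that(4) by linarith
  show ?thesis using i
  proof (cases rule: I_cases)
    case (1 j)
    have "real j * e \<le> 19 * e" using 1 e0 by (intro mult_right_mono) auto
    then show ?thesis using left[of j] 1 by (intro step[OF i p V0_mem(1)]) auto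
  next
    case 2 then show ?thesis using left[of 5] e0 by (intro step[OF i p V0_mem(1)]) auto
  next
    case 3 then show ?thesis using x e0 by (intro step[OF i p V0_mem(1)]) auto
  next
    case 4 then show ?thesis using left[of 6] e0 by (intro step[OF i p V0_mem(1)]) auto
  next
    case (5 k)
    have "(real k + 7) * e \<le> 19 * e" using 5 e0 by (intro mult_right_mono) auto
    then show ?thesis using z[of k] 5 eb[OF 5(1)] by (intro step[OF i p eb(1)[OF 5(1)]]) auto
  qed
qed

lemma tri3_edge: "p \<in> V0 \<Longrightarrow> p' \<in> V0 \<Longrightarrow> (u p - u p')\<^sup>2 \<le> tri3 1 1 1 u u"
proof -
  have "0 \<le> (u p1 - u p2)\<^sup>2" "0 \<le> (u p2 - u p3)\<^sup>2" "0 \<le> (u p1 - u p3)\<^sup>2" by simp_all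
  moreover have "tri3 1 1 1 u u = (u p1 - u p2)\<^sup>2 + (u p2 - u p3)\<^sup>2 + (u p1 - u p3)\<^sup>2"
    by (simp add: tri3_def power2_eq_square)
  moreover assume "p \<in> V0" "p' \<in> V0"
  ultimately show ?thesis unfolding V0_def by (auto simp: power2_commute)
qed

text \<open>A path to the vertex crosses at most \<open>20\<close> edges, each with increment at
  most the root of the energy; \<open>20\<^sup>2 = 400\<close>.\<close>

lemma vertex_bound:
  assumes "\<And>i. i \<in> I \<Longrightarrow> 1 \<le> c i" "i \<in> I" "p \<in> V0"
  shows "(v (cell_map i p) - v p1)\<^sup>2 \<le> 400 * wform c 1 1 1 1 v v"
proof -
  define E where "E = wform c 1 1 1 1 v v"
  have cell: "tri3 1 1 1 (v \<circ> cell_map i) (v \<circ> cell_map i) \<le> E" if i: "i \<in> I" for i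
  proof -
    have nn: "0 \<le> tri3 1 1 1 (v \<circ> cell_map j) (v \<circ> cell_map j)" for j by (rule tri3_nonneg) auto
    have "tri3 1 1 1 (v \<circ> cell_map i) (v \<circ> cell_map i) \<le> c i * tri3 1 1 1 (v \<circ> cell_map i) (v \<circ> cell_map i)"
      using assms(1)[OF i] nn[of i] mult_right_mono by fastforce
    also have "\<dots> \<le> E" unfolding E_def wform_1
    proof (rule member_le_sum[OF i])
      show "0 \<le> c j * tri3 1 1 1 (v \<circ> cell_map j) (v \<circ> cell_map j)" if "j \<in> I - {i}" for j
        using assms(1)[of j] that nn[of j] by (intro mult_nonneg_nonneg) auto
    qed simp
    finally show ?thesis .
  qed
  have "\<bar>v (cell_map i p) - v (cell_map i p')\<bar> \<le> sqrt E" if "i \<in> I" "p \<in> V0" "p' \<in> V0" for i p p'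
  proof -
    have "(v (cell_map i p) - v (cell_map i p'))\<^sup>2 \<le> E"
      using order_trans[OF tri3_edge[OF that(2,3), of "v \<circ> cell_map i"] cell[OF that(1)]] by simp
    then show ?thesis using real_le_rsqrt[of "\<bar>v (cell_map i p) - v (cell_map i p')\<bar>" E] by simp
  qed
  from level1_path[of v, OF this assms(2,3)] have "\<bar>v (cell_map i p) - v p1\<bar> \<le> 20 * sqrt E" .
  then have "(v (cell_map i p) - v p1)\<^sup>2 \<le> (20 * sqrt E)\<^sup>2" by (metis abs_ge_zero power2_abs power_mono)
  also have "\<dots> = 400 * E"
  proof -
    have "0 \<le> E" using order_trans[OF tri3_nonneg cell[OF assms(2)]] by simp
    then show ?thesis by (simp add: power_mult_distrib)
  qed
  finally show ?thesis unfolding E_def .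
qed

text \<open>Any point is the limit of the \<open>p1\<close>-corners of a decreasing sequence of
  cells.\<close>

lemma chain_bound:
  fixes u :: "plane \<Rightarrow> real"
  assumes u: "continuous_on K u" and \<kappa>: "0 \<le> \<kappa>" "\<kappa> < 1" and b: "0 \<le> b"
    and step: "\<And>m w i. w \<in> words I m \<Longrightarrow> i \<in> I \<Longrightarrow> \<bar>u (word_map (w @ [i]) p1) - u (word_map w p1)\<bar> \<le> b * \<kappa> ^ m"
    and w: "w \<in> words I n" and x: "x \<in> K"
  shows "\<bar>u (word_map w x) - u (word_map w p1)\<bar> \<le> b * \<kappa> ^ n / (1 - \<kappa>)"
proof -
  have part: "\<bar>u (word_map (w @ v) p1) - u (word_map w p1)\<bar> \<le> b * \<kappa> ^ n * (\<Sum>j<k. \<kappa> ^ j)" if "v \<in> words I k" for k v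
    using that
  proof (induction k arbitrary: v)
    case (Suc k)
    have "v \<in> words I (k + 1)" using Suc.prems by simp
    then obtain v' t where vt: "v = v' @ t" "v' \<in> words I k" "t \<in> words I 1" by (rule words_add_split)
    then obtain i where i: "v = v' @ [i]" "i \<in> I" by (auto simp: words_1)
    have "\<bar>u (word_map ((w @ v') @ [i]) p1) - u (word_map (w @ v') p1)\<bar> \<le> b * \<kappa> ^ (n + k)"
      using step[OF words_append[OF w vt(2)] i(2)] .
    with Suc.IH[OF vt(2)] i(1) show ?case by (simp add: algebra_simps power_add)
  qed simp
  have le: "\<bar>u (word_map (w @ v) p1) - u (word_map w p1)\<bar> \<le> b * \<kappa> ^ n / (1 - \<kappa>)" if "v \<in> words I k" for k v
  proof -
    have "(\<Sum>j<k. \<kappa> ^ j) \<le> 1 / (1 - \<kappa>)"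
      using sum_le_suminf[of "\<lambda>j. \<kappa> ^ j" "{..<k}"] \<kappa> geometric_sums[of \<kappa>] by (simp add: sums_iff summable_geometric)
    then have "b * \<kappa> ^ n * (\<Sum>j<k. \<kappa> ^ j) \<le> b * \<kappa> ^ n * (1 / (1 - \<kappa>))" using b \<kappa> by (intro mult_left_mono) auto
    then show ?thesis using part[OF that] by simp
  qed
  have "\<exists>w y. w \<in> words I k \<and> y \<in> K \<and> x = word_map w y" for k using K_words[OF x] by blast
  then obtain vw vk where vy: "\<And>k. vw k \<in> words I k" "\<And>k. vk k \<in> K" "\<And>k. x = word_map (vw k) (vk k)"
    by metis
  define y where "y k = word_map (vw k) p1" for k
  have "dist (y k) x \<le> 5/4 * (1/7) ^ k" for k
  proof -
    have "dist (y k) x = dist p1 (vk k) / 7 ^ k"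
      using vy(1)[of k] by (subst vy(3)[of k]) (simp add: y_def dist_word_map words_def)
    also have "\<dots> \<le> 5/4 / 7 ^ k" using dist_K_le[OF p_K(1) vy(2)[of k]] by (intro divide_right_mono) auto
    finally show ?thesis by (simp add: power_divide)
  qed
  moreover have "(\<lambda>k. 5/4 * (1/7::real) ^ k) \<longlonglongrightarrow> 5/4 * 0"
    by (intro tendsto_mult tendsto_const LIMSEQ_realpow_zero) auto
  ultimately have "(\<lambda>k. dist (y k) x) \<longlonglongrightarrow> 0"
    by (intro tendsto_sandwich[of "\<lambda>_. 0" "\<lambda>k. dist (y k) x" sequentially "\<lambda>k. 5/4 * (1/7) ^ k"]) auto
  then have "y \<longlonglongrightarrow> x" using tendsto_dist_iff by blast
  moreover have yK: "y k \<in> K" for k unfolding y_def using word_map_K[OF vy(1) p_K(1)] .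
  moreover have "continuous_on K (u \<circ> word_map w)"
    using u word_map_K[OF w] continuous_on_word_map
    by (intro continuous_on_compose) (auto elim!: continuous_on_subset)
  ultimately have "(\<lambda>k. (u \<circ> word_map w) (y k)) \<longlonglongrightarrow> (u \<circ> word_map w) x"
    using x unfolding continuous_on_sequentially comp_def by blast
  then have lim: "(\<lambda>k. \<bar>u (word_map w (y k)) - u (word_map w p1)\<bar>) \<longlonglongrightarrow> \<bar>u (word_map w x) - u (word_map w p1)\<bar>"
    by (intro tendsto_rabs tendsto_diff tendsto_const) simp
  have "\<bar>u (word_map w (y k)) - u (word_map w p1)\<bar> \<le> b * \<kappa> ^ n / (1 - \<kappa>)" for k
    using le[OF vy(1)[of k]] by (simp add: y_def word_map_append)
  then show ?thesis by (intro LIMSEQ_le_const2[OF lim]) blast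
qed

lemma wform_cell_le:
  assumes "\<And>i. i \<in> I \<Longrightarrow> 0 \<le> c i" "w \<in> words I m"
  shows "prod_list (map c w) * wform c 1 1 1 n (v \<circ> word_map w) (v \<circ> word_map w) \<le> wform c 1 1 1 (m + n) v v"
proof -
  have pos: "0 \<le> prod_list (map c w)" if "w \<in> words I k" for w k
  proof (rule prod_list_nonneg)
    fix x assume "x \<in> set (map c w)"
    then obtain i where "i \<in> set w" "x = c i" by auto
    then show "0 \<le> x" using assms(1)[of i] that by (auto simp: words_def)
  qed
  have nn: "0 \<le> wform c 1 1 1 n f f" for f
    unfolding wform_def using pos by (intro sum_nonneg mult_nonneg_nonneg tri3_nonneg) auto
  show ?thesis unfolding wform_add
    using pos nn by (intro member_le_sum[OF assms(2)] mult_nonneg_nonneg) (auto simp: finite_words)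
qed

lemma PE_cell_le: "w \<in> words I m \<Longrightarrow> PE n (v \<circ> word_map w) \<le> PE (m + n) v"
  using wform_cell_le[of "\<lambda>_. 1" w m n v] by simp

lemma step_bound:
  assumes "w \<in> words I m" "i \<in> I"
  shows "(u (word_map (w @ [i]) p1) - u (word_map w p1))\<^sup>2 \<le> 400 * PE 1 (u \<circ> word_map w)"
  using vertex_bound[of "\<lambda>_. 1" i p1 "u \<circ> word_map w"] assms(2) by (simp add: word_map_append)

definition decay :: "real \<Rightarrow> (plane \<Rightarrow> real) \<Rightarrow> bool" where
  "decay \<theta> u \<longleftrightarrow> continuous_on K u \<and> (\<exists>C. \<forall>n. PE n u \<le> C * \<theta> ^ n)"

definition cell_var :: "(plane \<Rightarrow> real) \<Rightarrow> cell list \<Rightarrow> ennreal" where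
  "cell_var u w = (\<integral>\<^sup>+x\<in>word_map w ` K. ennreal ((u x - u (word_map w p1))\<^sup>2) \<partial>\<mu>)"

lemma cell_subset_split: "w \<in> words I n \<Longrightarrow> word_map w ` K = (\<Union>i\<in>I. word_map (w @ [i]) ` K)"
  by (subst K_eq) (auto simp: word_map_append image_UN image_image)

lemma measurable_cell_ind:
  fixes f :: "plane \<Rightarrow> ennreal"
  assumes "f \<in> borel_measurable \<mu>" "w \<in> words I n"
  shows "(\<lambda>x. f x * indicator (word_map w ` K) x) \<in> borel_measurable \<mu>"
  using assms by (intro borel_measurable_times_ennreal borel_measurable_indicator cells_mu)

lemma nn_integral_cell_const: "w \<in> words I n \<Longrightarrow> (\<integral>\<^sup>+x\<in>word_map w ` K. c \<partial>\<mu>) = c * ennreal (1 / 17 ^ n)"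
  using nn_integral_cmult_indicator[OF cells_mu] emeasure_cell by metis

text \<open>Passing from the \<open>p1\<close>-corner of a cell to those of its subcells costs
  discrete energies of the next level.  The factor \<open>2\<close> from \<open>(x + y)\<^sup>2
  \<le> 2 * x\<^sup>2 + 2 * y\<^sup>2\<close> is absorbed because \<open>2 * \<theta> <
  1\<close>.\<close>

lemma cell_var_sum:
  assumes u: "continuous_on K u" and \<theta>: "0 < \<theta>" "2 * \<theta> < 1" and C: "\<And>n. PE n u \<le> C * \<theta> ^ n"
  shows "(\<Sum>w\<in>words I n. cell_var u w) \<le> ennreal (13600 * C / (1 - 2 * \<theta>) * (\<theta> / 17) ^ n)"
proof -
  have C0: "0 \<le> C" using C[of 0] PE_nonneg[of 0 u] by simp
  define \<kappa> where "\<kappa> = sqrt \<theta>"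
  have \<kappa>: "0 \<le> \<kappa>" "\<kappa> < 1" "\<kappa>\<^sup>2 = \<theta>" using \<theta> by (auto simp: \<kappa>_def)
  have pm: "(\<kappa> ^ m)\<^sup>2 = \<theta> ^ m" for m unfolding \<kappa>(3)[symmetric] by (simp flip: power_mult add: mult.commute)
  define b where "b = sqrt (400 * C)"
  have b: "0 \<le> b" "b\<^sup>2 = 400 * C" using C0 by (auto simp: b_def)
  have step2: "400 * PE 1 (u \<circ> word_map w) \<le> 400 * C * \<theta> ^ m" if "w \<in> words I m" for w m
  proof -
    have "PE 1 (u \<circ> word_map w) \<le> C * \<theta> ^ (m + 1)" using PE_cell_le[OF that, of 1 u] C[of "m + 1"] by linarith
    also have "\<dots> \<le> C * \<theta> ^ m" using C0 \<theta> by (intro mult_left_mono power_decreasing) auto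
    finally show ?thesis by simp
  qed
  have step1: "\<bar>u (word_map (w @ [i]) p1) - u (word_map w p1)\<bar> \<le> b * \<kappa> ^ m" if "w \<in> words I m" "i \<in> I" for w m i
  proof (rule power2_le_imp_le)
    show "\<bar>u (word_map (w @ [i]) p1) - u (word_map w p1)\<bar>\<^sup>2 \<le> (b * \<kappa> ^ m)\<^sup>2"
      using order_trans[OF step_bound[OF that, of u] step2[OF that(1)]] b
      by (simp add: power_mult_distrib pm)
  qed (use b \<kappa> in simp)
  define a where "a k = (\<Sum>w\<in>words I (n + k). cell_var u w)" for k
  define D where "D = (b / (1 - \<kappa>))\<^sup>2 * \<theta> ^ n"
  have prior: "a k \<le> ennreal (D * \<theta> ^ k)" for k
  proof -
    have "cell_var u w \<le> ennreal (D * \<theta> ^ k) * ennreal (1 / 17 ^ (n + k))" if w: "w \<in> words I (n + k)" for w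
    proof -
      have "cell_var u w \<le> (\<integral>\<^sup>+x\<in>word_map w ` K. ennreal (D * \<theta> ^ k) \<partial>\<mu>)"
        unfolding cell_var_def
      proof (intro nn_integral_mono)
        fix x
        show "ennreal ((u x - u (word_map w p1))\<^sup>2) * indicator (word_map w ` K) x
           \<le> ennreal (D * \<theta> ^ k) * indicator (word_map w ` K) x"
        proof (cases "x \<in> word_map w ` K")
          case True
          then obtain y where y: "y \<in> K" "x = word_map w y" by blast
          have "\<bar>u x - u (word_map w p1)\<bar> \<le> b * \<kappa> ^ (n + k) / (1 - \<kappa>)"
            unfolding y(2) by (rule chain_bound[OF u \<kappa>(1,2) b(1) step1 w y(1)])
          then have "(u x - u (word_map w p1))\<^sup>2 \<le> (b * \<kappa> ^ (n + k) / (1 - \<kappa>))\<^sup>2"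
            using b \<kappa> by (intro abs_le_square_iff[THEN iffD1]) auto
          also have "\<dots> = D * \<theta> ^ k"
            unfolding D_def by (simp add: power_divide power_mult_distrib pm power_add)
          finally show ?thesis using True by (simp add: ennreal_leI)
        qed simp
      qed
      then show ?thesis by (simp only: nn_integral_cell_const[OF w])
    qed
    then have "a k \<le> (\<Sum>w\<in>words I (n + k). ennreal (D * \<theta> ^ k) * ennreal (1 / 17 ^ (n + k)))"
      unfolding a_def by (rule sum_mono)
    also have "\<dots> = ennreal (D * \<theta> ^ k)"
      using \<theta> by (simp add: card_words card_I D_def ennreal_of_nat_eq_real_of_nat flip: ennreal_mult)
    finally show ?thesis .
  qed
  define B where "B = 13600 * C * (\<theta> / 17) ^ n"
  have rec: "a k \<le> 2 * a (Suc k) + ennreal (B * \<theta> ^ k)" for k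
  proof -
    have one: "cell_var u w \<le> (\<Sum>i\<in>I. 2 * cell_var u (w @ [i])) + ennreal (17 * (800 * PE 1 (u \<circ> word_map w)) / 17 ^ (n + k + 1))"
      if w: "w \<in> words I (n + k)" for w
    proof -
      have wi: "w @ [i] \<in> words I (n + k + 1)" if "i \<in> I" for i
        using words_append[OF w, of "[i]" 1] that by (simp add: words_1)
      have meas: "(\<lambda>x. ennreal ((u x - c)\<^sup>2)) \<in> borel_measurable \<mu>" for c
        using u by (intro measurable_compose[OF _ measurable_ennreal] borel_measurable_power borel_measurable_diff) auto
      have "cell_var u w \<le> (\<integral>\<^sup>+x. (\<Sum>i\<in>I. ennreal ((u x - u (word_map w p1))\<^sup>2) * indicator (word_map (w @ [i]) ` K) x) \<partial>\<mu>)"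
        unfolding cell_var_def
      proof (intro nn_integral_mono)
        fix x
        have "indicator (word_map w ` K) x \<le> (\<Sum>i\<in>I. indicator (word_map (w @ [i]) ` K) x :: ennreal)"
        proof (cases "x \<in> word_map w ` K")
          case True
          then obtain i where i: "i \<in> I" "x \<in> word_map (w @ [i]) ` K" unfolding cell_subset_split[OF w] by blast
          have "indicator (word_map (w @ [i]) ` K) x \<le> (\<Sum>i\<in>I. indicator (word_map (w @ [i]) ` K) x :: ennreal)"
            by (rule member_le_sum[OF i(1)]) auto
          then show ?thesis using i True by simp
        qed simp
        then show "ennreal ((u x - u (word_map w p1))\<^sup>2) * indicator (word_map w ` K) x
          \<le> (\<Sum>i\<in>I. ennreal ((u x - u (word_map w p1))\<^sup>2) * indicator (word_map (w @ [i]) ` K) x)"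
          unfolding sum_distrib_left[symmetric] by (rule mult_left_mono) simp
      qed
      also have "\<dots> = (\<Sum>i\<in>I. \<integral>\<^sup>+x\<in>word_map (w @ [i]) ` K. ennreal ((u x - u (word_map w p1))\<^sup>2) \<partial>\<mu>)"
        using measurable_cell_ind[OF meas wi] by (intro nn_integral_sum) auto
      also have "\<dots> \<le> (\<Sum>i\<in>I. 2 * cell_var u (w @ [i]) + ennreal (800 * PE 1 (u \<circ> word_map w) / 17 ^ (n + k + 1)))"
      proof (rule sum_mono)
        fix i assume i: "i \<in> I"
        let ?A = "word_map (w @ [i]) ` K" and ?c = "u (word_map (w @ [i]) p1)" and ?d = "u (word_map w p1)"
        have "ennreal ((u x - ?d)\<^sup>2) \<le> 2 * ennreal ((u x - ?c)\<^sup>2) + ennreal (800 * PE 1 (u \<circ> word_map w))" for x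
        proof -
          have "(u x - ?d)\<^sup>2 \<le> 2 * (u x - ?c)\<^sup>2 + 2 * (?c - ?d)\<^sup>2"
            using zero_le_power2[of "(u x - ?c) - (?c - ?d)"] by (simp add: power2_eq_square algebra_simps)
          also have "\<dots> \<le> 2 * (u x - ?c)\<^sup>2 + 800 * PE 1 (u \<circ> word_map w)"
            using step_bound[OF w i, of u] by simp
          finally show ?thesis using PE_nonneg[of 1]
            by (simp add: ennreal_leI flip: ennreal_plus ennreal_mult ennreal_numeral)
        qed
        then have "(\<integral>\<^sup>+x\<in>?A. ennreal ((u x - ?d)\<^sup>2) \<partial>\<mu>)
          \<le> (\<integral>\<^sup>+x. 2 * (ennreal ((u x - ?c)\<^sup>2) * indicator ?A x) + ennreal (800 * PE 1 (u \<circ> word_map w)) * indicator ?A x \<partial>\<mu>)"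
          by (intro nn_integral_mono) (auto simp: indicator_def)
        also have "\<dots> = 2 * cell_var u (w @ [i]) + ennreal (800 * PE 1 (u \<circ> word_map w)) * ennreal (1 / 17 ^ (n + k + 1))"
          unfolding cell_var_def nn_integral_cell_const[OF wi[OF i], symmetric]
          using measurable_cell_ind[OF meas wi[OF i]] measurable_cell_ind[OF borel_measurable_const wi[OF i]]
          by (subst nn_integral_add) (auto simp: nn_integral_cmult)
        also have "\<dots> = 2 * cell_var u (w @ [i]) + ennreal (800 * PE 1 (u \<circ> word_map w) / 17 ^ (n + k + 1))"
          using PE_nonneg[of 1] by (simp flip: ennreal_mult)
        finally show "(\<integral>\<^sup>+x\<in>?A. ennreal ((u x - ?d)\<^sup>2) \<partial>\<mu>) \<le> 2 * cell_var u (w @ [i]) + ennreal (800 * PE 1 (u \<circ> word_map w) / 17 ^ (n + k + 1))" .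
      qed
      also have "\<dots> = (\<Sum>i\<in>I. 2 * cell_var u (w @ [i])) + ennreal (17 * (800 * PE 1 (u \<circ> word_map w)) / 17 ^ (n + k + 1))"
        using PE_nonneg[of 1] by (simp add: sum.distrib card_I flip: ennreal_mult ennreal_numeral)
      finally show ?thesis .
    qed
    have "a k \<le> (\<Sum>w\<in>words I (n + k). (\<Sum>i\<in>I. 2 * cell_var u (w @ [i])) + ennreal (17 * (800 * PE 1 (u \<circ> word_map w)) / 17 ^ (n + k + 1)))"
      unfolding a_def by (intro sum_mono one)
    also have "\<dots> = 2 * a (Suc k) + ennreal (\<Sum>w\<in>words I (n + k). 17 * (800 * PE 1 (u \<circ> word_map w)) / 17 ^ (n + k + 1))"
    proof -
      have "a (Suc k) = (\<Sum>w\<in>words I ((n + k) + 1). cell_var u w)" by (simp add: a_def)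
      also have "\<dots> = (\<Sum>w\<in>words I (n + k). \<Sum>i\<in>I. cell_var u (w @ [i]))"
        unfolding sum_words_add[OF finite_I] words_1 by (simp add: sum.reindex inj_on_def)
      finally show ?thesis using PE_nonneg[of 1]
        by (simp add: sum.distrib sum_distrib_left sum_nonneg flip: sum_ennreal)
    qed
    also have "(\<Sum>w\<in>words I (n + k). 17 * (800 * PE 1 (u \<circ> word_map w)) / 17 ^ (n + k + 1)) = 800 * PE (Suc (n + k)) u / 17 ^ (n + k)"
      unfolding wform_Suc'[of _ _ _ _ "n + k"] by (simp add: sum_distrib_left sum_divide_distrib)
    also have "ennreal (800 * PE (Suc (n + k)) u / 17 ^ (n + k)) \<le> ennreal (B * \<theta> ^ k)"
    proof (rule ennreal_leI)
      have "PE (Suc (n + k)) u \<le> C * \<theta> ^ (n + k)"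
      proof -
        have "C * \<theta> ^ Suc (n + k) \<le> C * \<theta> ^ (n + k)" using C0 \<theta> by (intro mult_left_mono power_decreasing) auto
        then show ?thesis using C[of "Suc (n + k)"] by linarith
      qed
      then have "800 * PE (Suc (n + k)) u / 17 ^ (n + k) \<le> 800 * (C * \<theta> ^ (n + k)) / 17 ^ (n + k)"
        by (intro divide_right_mono mult_left_mono) auto
      also have "\<dots> \<le> 800 * (C * \<theta> ^ (n + k)) / 17 ^ n"
        using C0 \<theta> by (intro divide_left_mono power_increasing mult_nonneg_nonneg) auto
      also have "\<dots> \<le> 13600 * (C * \<theta> ^ (n + k)) / 17 ^ n"
        using C0 \<theta> by (intro divide_right_mono mult_right_mono mult_nonneg_nonneg) auto
      also have "\<dots> = B * \<theta> ^ k" by (simp add: B_def power_add power_divide)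
      finally show "800 * PE (Suc (n + k)) u / 17 ^ (n + k) \<le> B * \<theta> ^ k" .
    qed
    finally show ?thesis by (simp add: add_left_mono)
  qed
  have "a 0 \<le> ennreal (B / (1 - 2 * \<theta>))"
    by (rule doubling_ennreal[OF rec prior]) (use C0 \<theta> b in \<open>auto simp: B_def D_def\<close>)
  then show ?thesis by (simp add: a_def B_def mult_ac)
qed


text \<open>The bound on the lattice positions keeps the number of neighbours finite, the common
  corner links the values of a function on the two cells.\<close>

definition adj :: "cell list \<Rightarrow> cell list \<Rightarrow> bool" where
  "adj v w \<longleftrightarrow> (\<exists>p\<in>V0. \<exists>p'\<in>V0. word_map v p = word_map w p') \<and>
     \<bar>int (posx v) - int (posx w)\<bar> \<le> 1 \<and> \<bar>int (posy v) - int (posy w)\<bar> \<le> 1"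

lemma adj_sym: "adj v w \<Longrightarrow> adj w v"
  unfolding adj_def by (metis abs_minus_commute)

lemma card_adj: "card {w \<in> words I n. adj v w} \<le> 9"
proof -
  define B where "B = {int (posx v) - 1 .. int (posx v) + 1} \<times> {int (posy v) - 1 .. int (posy v) + 1}"
  define f where "f w = (int (posx w), int (posy w))" for w
  have "f ` {w \<in> words I n. adj v w} \<subseteq> B"
  proof (rule image_subsetI)
    fix w assume "w \<in> {w \<in> words I n. adj v w}"
    then have "\<bar>int (posx v) - int (posx w)\<bar> \<le> 1" "\<bar>int (posy v) - int (posy w)\<bar> \<le> 1" by (auto simp: adj_def)
    then show "f w \<in> B" unfolding f_def B_def by auto
  qed
  moreover have "inj_on f {w \<in> words I n. adj v w}"
  proof (rule inj_onI)
    fix v' w assume "v' \<in> {w \<in> words I n. adj v w}" "w \<in> {w \<in> words I n. adj v w}" "f v' = f w"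
    then show "v' = w" using pos_inj[of v' w] words_lattice by (auto simp: f_def words_def)
  qed
  moreover have "finite B" "card B = 9" by (auto simp: B_def card_cartesian_product)
  ultimately show ?thesis using card_inj_on_le[of f _ B] by simp
qed

lemma sum_adj:
  fixes f :: "cell list \<Rightarrow> ennreal"
  shows "(\<Sum>v\<in>words I n. \<Sum>w\<in>{w \<in> words I n. adj v w}. f v + f w) \<le> 18 * (\<Sum>w\<in>words I n. f w)"
proof -
  have nine: "of_nat (card {w \<in> words I n. adj v w}) * f v \<le> 9 * f v" for v
    using card_adj[of n v] by (intro mult_right_mono) (metis of_nat_le_iff of_nat_numeral, simp)
  have "(\<Sum>v\<in>words I n. \<Sum>w\<in>{w \<in> words I n. adj v w}. f w) = (\<Sum>v\<in>words I n. \<Sum>w\<in>words I n. if adj v w then f w else 0)"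
    by (rule sum.cong[OF refl], rule sum.inter_filter) (simp add: finite_words)
  also have "\<dots> = (\<Sum>w\<in>words I n. \<Sum>v\<in>words I n. if adj v w then f w else 0)" by (rule sum.swap)
  also have "\<dots> = (\<Sum>w\<in>words I n. \<Sum>v\<in>words I n. if adj w v then f w else 0)"
    using adj_sym by (intro sum.cong refl) auto
  also have "\<dots> = (\<Sum>w\<in>words I n. \<Sum>v\<in>{v \<in> words I n. adj w v}. f w)"
    by (rule sum.cong[OF refl], rule sum.inter_filter[symmetric]) (simp add: finite_words)
  finally have "(\<Sum>v\<in>words I n. \<Sum>w\<in>{w \<in> words I n. adj v w}. f v + f w)
      = (\<Sum>v\<in>words I n. of_nat (card {w \<in> words I n. adj v w}) * f v) + (\<Sum>v\<in>words I n. of_nat (card {w \<in> words I n. adj v w}) * f v)"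
    by (simp add: sum.distrib)
  also have "\<dots> \<le> (\<Sum>v\<in>words I n. 9 * f v) + (\<Sum>v\<in>words I n. 9 * f v)"
    by (intro add_mono sum_mono nine)
  also have "\<dots> = 9 * (\<Sum>w\<in>words I n. f w) + 9 * (\<Sum>w\<in>words I n. f w)" by (simp add: sum_distrib_left)
  also have "\<dots> = 18 * (\<Sum>w\<in>words I n. f w)" by (simp flip: distrib_right)
  finally show ?thesis .
qed

lemma measurable_sq: "u \<in> borel_measurable \<mu> \<Longrightarrow> (\<lambda>x. ennreal ((u x - c)\<^sup>2)) \<in> borel_measurable \<mu>"
  by (intro measurable_compose[OF _ measurable_ennreal] borel_measurable_power borel_measurable_diff) auto

text \<open>Points at distance below half the cell size lie in adjacent cells.  The increment is
  split at the \<open>p1\<close>-corners of both cells and at a common corner.\<close>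

lemma pair_integral_le:
  fixes t :: real
  assumes u: "continuous_on K u" and t: "n = 0 \<or> t \<le> 1 / (2 * 7 ^ n)"
  shows "(\<integral>\<^sup>+x. (\<integral>\<^sup>+y\<in>ball x t. ennreal (\<bar>u x - u y\<bar>\<^sup>2) \<partial>\<mu>) \<partial>\<mu>)
     \<le> 72 * ennreal (1 / 17 ^ n) * ((\<Sum>w\<in>words I n. cell_var u w) + ennreal (PE n u / 17 ^ n))"
proof -
  have um: "u \<in> borel_measurable \<mu>" using u by simp
  define e where "e w = ennreal (tri3 1 1 1 (u \<circ> word_map w) (u \<circ> word_map w))" for w
  define h where "h w x = ennreal ((u x - u (word_map w p1))\<^sup>2)" for w x
  define c where "c = ennreal (1 / 17 ^ n)"
  define N where "N v = {w \<in> words I n. adj v w}" for v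
  have finN: "finite (N v)" for v by (simp add: N_def finite_words)
  have hm: "h w \<in> borel_measurable \<mu>" for w unfolding h_def by (rule measurable_sq[OF um])
  define T where "T v w x y = indicator (word_map v ` K) x * 4 *
     ((h v x + e v + e w + h w y) * indicator (word_map w ` K) y)" for v w x y
  have point: "ennreal (\<bar>u x - u y\<bar>\<^sup>2) * indicator (ball x t) y \<le> (\<Sum>v\<in>words I n. \<Sum>w\<in>N v. T v w x y)"
    if x: "x \<in> K" and y: "y \<in> K" for x y
  proof (cases "y \<in> ball x t")
    case True
    obtain v x' where v: "v \<in> words I n" "x' \<in> K" "x = word_map v x'" using K_words[OF x] by blast
    obtain w y' where w: "w \<in> words I n" "y' \<in> K" "y = word_map w y'" using K_words[OF y] by blast
    have "adj v w"
    proof (cases "n = 0")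
      case True
      then have "v = w" using v w by simp
      have "\<exists>p\<in>V0. \<exists>p'\<in>V0. word_map w p = word_map w p'" using V0_mem(1) by blast
      then show ?thesis unfolding \<open>v = w\<close> by (simp add: adj_def)
    next
      case False
      then have "dist (word_map v x') (word_map w y') < 1 / (2 * 7 ^ n)" using \<open>y \<in> ball x t\<close> t v w by auto
      from near_cells[OF v(1) w(1) v(2) w(2) this] show ?thesis by (simp add: adj_def)
    qed
    then have wN: "w \<in> N v" using w by (simp add: N_def)
    obtain p p' where p: "p \<in> V0" "p' \<in> V0" "word_map v p = word_map w p'" using \<open>adj v w\<close> by (auto simp: adj_def)
    define a b k l where "a = u x - u (word_map v p1)" "b = u (word_map v p1) - u (word_map v p)"
      "k = u (word_map w p') - u (word_map w p1)" "l = u (word_map w p1) - u y"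
    note abkl = this
    have "u x - u y = a + b + k + l" using p(3) by (simp add: abkl)
    have "(a + b + k + l)\<^sup>2 \<le> 4 * (a\<^sup>2 + b\<^sup>2 + k\<^sup>2 + l\<^sup>2)"
    proof -
      have "4 * (a\<^sup>2 + b\<^sup>2 + k\<^sup>2 + l\<^sup>2) - (a + b + k + l)\<^sup>2
         = (a - b)\<^sup>2 + (a - k)\<^sup>2 + (a - l)\<^sup>2 + (b - k)\<^sup>2 + (b - l)\<^sup>2 + (k - l)\<^sup>2"
        by (simp add: power2_eq_square algebra_simps)
      moreover have "0 \<le> (a - b)\<^sup>2 + (a - k)\<^sup>2 + (a - l)\<^sup>2 + (b - k)\<^sup>2 + (b - l)\<^sup>2 + (k - l)\<^sup>2" by simp
      ultimately show ?thesis by linarith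
    qed
    moreover have "b\<^sup>2 \<le> tri3 1 1 1 (u \<circ> word_map v) (u \<circ> word_map v)" "k\<^sup>2 \<le> tri3 1 1 1 (u \<circ> word_map w) (u \<circ> word_map w)"
      using tri3_edge[OF V0_mem(1) p(1), of "u \<circ> word_map v"] tri3_edge[OF p(2) V0_mem(1), of "u \<circ> word_map w"]
      by (simp_all add: abkl)
    moreover have "\<bar>u x - u y\<bar>\<^sup>2 = (a + b + k + l)\<^sup>2" using \<open>u x - u y = _\<close> by simp
    ultimately have "(a + b + k + l)\<^sup>2 \<le> 4 * (a\<^sup>2 + b\<^sup>2 + k\<^sup>2 + l\<^sup>2)"
      and le: "4 * (a\<^sup>2 + b\<^sup>2 + k\<^sup>2 + l\<^sup>2) \<le> 4 * (a\<^sup>2 + tri3 1 1 1 (u \<circ> word_map v) (u \<circ> word_map v)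
        + tri3 1 1 1 (u \<circ> word_map w) (u \<circ> word_map w) + l\<^sup>2)" and eq: "\<bar>u x - u y\<bar>\<^sup>2 = (a + b + k + l)\<^sup>2"
      by auto
    from order_trans[OF this(1,2), folded eq]
    have "\<bar>u x - u y\<bar>\<^sup>2 \<le> 4 * (a\<^sup>2 + tri3 1 1 1 (u \<circ> word_map v) (u \<circ> word_map v)
        + tri3 1 1 1 (u \<circ> word_map w) (u \<circ> word_map w) + l\<^sup>2)" .
    then have "ennreal (\<bar>u x - u y\<bar>\<^sup>2) \<le> 4 * (h v x + e v + e w + h w y)"
      unfolding h_def e_def
      by (simp add: abkl power2_commute[of "u y"] tri3_nonneg ennreal_leI flip: ennreal_plus ennreal_mult ennreal_numeral)
    also have "\<dots> = T v w x y" using v w by (simp add: T_def)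
    also have "\<dots> \<le> (\<Sum>w\<in>N v. T v w x y)" by (rule member_le_sum[OF wN]) (auto simp: finN)
    also have "\<dots> \<le> (\<Sum>v\<in>words I n. \<Sum>w\<in>N v. T v w x y)"
      by (rule member_le_sum[OF v(1)]) (auto simp: finite_words)
    finally show ?thesis using True by simp
  qed simp
  have inner: "(\<integral>\<^sup>+y. T v w x y \<partial>\<mu>) = indicator (word_map v ` K) x * 4 * ((h v x + e v + e w) * c + cell_var u w)"
    if w: "w \<in> words I n" for v w x
  proof -
    have "(\<integral>\<^sup>+y. T v w x y \<partial>\<mu>) = indicator (word_map v ` K) x * 4 *
       (\<integral>\<^sup>+y. (h v x + e v + e w) * indicator (word_map w ` K) y + h w y * indicator (word_map w ` K) y \<partial>\<mu>)"
      unfolding T_def using measurable_cell_ind[OF hm w] measurable_cell_ind[OF borel_measurable_const w]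
      by (subst nn_integral_cmult) (auto simp: distrib_right intro!: borel_measurable_add)
    also have "(\<integral>\<^sup>+y. (h v x + e v + e w) * indicator (word_map w ` K) y + h w y * indicator (word_map w ` K) y \<partial>\<mu>)
       = (h v x + e v + e w) * c + cell_var u w"
      using measurable_cell_ind[OF hm w] measurable_cell_ind[OF borel_measurable_const w]
      by (subst nn_integral_add) (auto simp: nn_integral_cell_const[OF w] c_def cell_var_def h_def)
    finally show ?thesis .
  qed
  have Tm: "T v w x \<in> borel_measurable \<mu>" if "w \<in> words I n" for v w x
    unfolding T_def using measurable_cell_ind[OF borel_measurable_add[OF borel_measurable_const hm] that]
    by (rule borel_measurable_times_ennreal[OF borel_measurable_const])
  have outer: "(\<integral>\<^sup>+x. indicator (word_map v ` K) x * 4 * ((h v x + e v + e w) * c + cell_var u w) \<partial>\<mu>)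
      = 4 * c * ((cell_var u v + e v * c) + (cell_var u w + e w * c))" if v: "v \<in> words I n" for v w
  proof -
    have "(\<integral>\<^sup>+x. indicator (word_map v ` K) x * 4 * ((h v x + e v + e w) * c + cell_var u w) \<partial>\<mu>)
      = (\<integral>\<^sup>+x. 4 * c * (h v x * indicator (word_map v ` K) x) + 4 * ((e v + e w) * c + cell_var u w) * indicator (word_map v ` K) x \<partial>\<mu>)"
      by (intro nn_integral_cong) (simp add: algebra_simps)
    also have "\<dots> = 4 * c * cell_var u v + 4 * ((e v + e w) * c + cell_var u w) * c"
      using measurable_cell_ind[OF hm v] measurable_cell_ind[OF borel_measurable_const v]
      by (subst nn_integral_add)
        (auto simp: nn_integral_cmult nn_integral_cell_const[OF v] c_def cell_var_def h_def intro!: borel_measurable_times_ennreal)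
    also have "\<dots> = 4 * c * ((cell_var u v + e v * c) + (cell_var u w + e w * c))" by (simp add: algebra_simps)
    finally show ?thesis .
  qed
  have "(\<integral>\<^sup>+x. (\<integral>\<^sup>+y\<in>ball x t. ennreal (\<bar>u x - u y\<bar>\<^sup>2) \<partial>\<mu>) \<partial>\<mu>)
      \<le> (\<integral>\<^sup>+x. (\<integral>\<^sup>+y. (\<Sum>v\<in>words I n. \<Sum>w\<in>N v. T v w x y) \<partial>\<mu>) \<partial>\<mu>)"
    using point by (intro nn_integral_mono) auto
  also have "\<dots> = (\<integral>\<^sup>+x. (\<Sum>v\<in>words I n. \<Sum>w\<in>N v. indicator (word_map v ` K) x * 4 * ((h v x + e v + e w) * c + cell_var u w)) \<partial>\<mu>)"
  proof (rule nn_integral_cong)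
    fix x
    have "(\<lambda>y. \<Sum>w\<in>N v. T v w x y) \<in> borel_measurable \<mu>" for v
      by (intro borel_measurable_sum Tm) (simp add: N_def)
    then have "(\<integral>\<^sup>+y. (\<Sum>v\<in>words I n. \<Sum>w\<in>N v. T v w x y) \<partial>\<mu>)
        = (\<Sum>v\<in>words I n. \<integral>\<^sup>+y. (\<Sum>w\<in>N v. T v w x y) \<partial>\<mu>)"
      by (rule nn_integral_sum)
    also have "\<dots> = (\<Sum>v\<in>words I n. \<Sum>w\<in>N v. (\<integral>\<^sup>+y. T v w x y \<partial>\<mu>))"
      by (intro sum.cong refl nn_integral_sum Tm) (simp add: N_def)
    finally have "(\<integral>\<^sup>+y. (\<Sum>v\<in>words I n. \<Sum>w\<in>N v. T v w x y) \<partial>\<mu>)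
        = (\<Sum>v\<in>words I n. \<Sum>w\<in>N v. (\<integral>\<^sup>+y. T v w x y \<partial>\<mu>))" .
    then show "(\<integral>\<^sup>+y. (\<Sum>v\<in>words I n. \<Sum>w\<in>N v. T v w x y) \<partial>\<mu>)
      = (\<Sum>v\<in>words I n. \<Sum>w\<in>N v. indicator (word_map v ` K) x * 4 * ((h v x + e v + e w) * c + cell_var u w))"
      by (simp add: inner N_def)
  qed
  also have "\<dots> = (\<Sum>v\<in>words I n. \<Sum>w\<in>N v. \<integral>\<^sup>+x. indicator (word_map v ` K) x * 4 * ((h v x + e v + e w) * c + cell_var u w) \<partial>\<mu>)"
  proof -
    have m: "(\<lambda>x. indicator (word_map v ` K) x * 4 * ((h v x + e v + e w) * c + cell_var u w)) \<in> borel_measurable \<mu>"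
      if "v \<in> words I n" for v w
      using that hm by (intro borel_measurable_times_ennreal borel_measurable_add borel_measurable_indicator borel_measurable_const cells_mu)
    then show ?thesis
      by (subst nn_integral_sum) (auto intro!: sum.cong nn_integral_sum borel_measurable_sum)
  qed
  also have "\<dots> = (\<Sum>v\<in>words I n. \<Sum>w\<in>N v. 4 * c * ((cell_var u v + e v * c) + (cell_var u w + e w * c)))"
    by (intro sum.cong refl outer)
  also have "\<dots> = 4 * c * (\<Sum>v\<in>words I n. \<Sum>w\<in>N v. (cell_var u v + e v * c) + (cell_var u w + e w * c))"
    by (simp only: sum_distrib_left)
  also have "\<dots> \<le> 4 * c * (18 * (\<Sum>w\<in>words I n. cell_var u w + e w * c))"
    unfolding N_def by (intro mult_left_mono sum_adj) auto
  also have "(\<Sum>w\<in>words I n. cell_var u w + e w * c) = (\<Sum>w\<in>words I n. cell_var u w) + ennreal (PE n u / 17 ^ n)"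
  proof -
    have "(\<Sum>w\<in>words I n. e w * c) = (\<Sum>w\<in>words I n. e w) * c" by (simp add: sum_distrib_right)
    also have "(\<Sum>w\<in>words I n. e w) = ennreal (PE n u)"
      unfolding e_def wform_def by (simp add: sum_ennreal tri3_nonneg)
    also have "ennreal (PE n u) * c = ennreal (PE n u / 17 ^ n)"
      unfolding c_def using PE_nonneg by (simp flip: ennreal_mult)
    finally show ?thesis by (simp add: sum.distrib)
  qed
  also have "4 * c * (18 * X) = 72 * c * X" for X
  proof -
    have "4 * c * (18 * X) = (4 * 18) * (c * X)" by (simp only: mult_ac)
    also have "(4 * 18 :: ennreal) = 72" by simp
    finally show ?thesis by (simp only: mult.assoc)
  qed
  finally show ?thesis unfolding c_def .
qed

lemma scale_powr: "(1 / 7 ^ n) powr (\<alpha> + 2 * \<sigma>) = (7 powr (\<alpha> - 2 * \<sigma>) / 289) ^ n"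
proof -
  have "7 powr (- (\<alpha> + 2 * \<sigma>)) = 7 powr (\<alpha> - 2 * \<sigma>) / (7 powr \<alpha> * 7 powr \<alpha>)"
    by (simp add: powr_diff powr_minus powr_add field_simps)
  then have 1: "7 powr (- (\<alpha> + 2 * \<sigma>)) = 7 powr (\<alpha> - 2 * \<sigma>) / 289" by (simp add: seven_powr_alpha)
  have "(1 / 7 ^ n) powr (\<alpha> + 2 * \<sigma>) = (7 powr (- real n)) powr (\<alpha> + 2 * \<sigma>)"
    by (simp add: powr_minus powr_realpow divide_inverse)
  also have "\<dots> = (7 powr (- (\<alpha> + 2 * \<sigma>))) powr real n" by (simp add: powr_powr algebra_simps)
  also have "\<dots> = (7 powr (- (\<alpha> + 2 * \<sigma>))) ^ n" by (simp add: powr_realpow)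
  finally show ?thesis unfolding 1 .
qed

text \<open>At a radius of order \<open>7 ^ (- n)\<close> the variation inside the cells and the increments between their
  corners both have the order of the \<open>n\<close>-th discrete energy, and \<open>\<theta>\<close> is the scaling exponent that
  matches.\<close>

lemma decay_imp_besov:
  assumes "decay \<theta> u" and \<theta>: "\<theta> = 7 powr (\<alpha> - 2 * \<sigma>)" "2 * \<theta> < 1"
  shows "u \<in> besov \<mu> \<alpha> \<sigma>"
proof -
  obtain C where u: "continuous_on K u" and C: "\<And>n. PE n u \<le> C * \<theta> ^ n" using assms(1) by (auto simp: decay_def)
  have \<theta>0: "0 < \<theta>" using \<theta> by simp
  have C0: "0 \<le> C" using C[of 0] PE_nonneg[of 0 u] by simp
  define s where "s = \<alpha> + 2 * \<sigma>"
  have s0: "0 < s"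
  proof -
    have "7 powr (\<alpha> - 2 * \<sigma>) < 7 powr 0" using \<theta> by simp
    then have "\<alpha> - 2 * \<sigma> < 0" by (subst (asm) powr_less_cancel_iff) auto
    then show ?thesis using alpha_pos by (simp add: s_def)
  qed
  (* The first summand bounds the variation inside the cells, the second one the increments between corners. *)
  define D where "D = 13600 * C / (1 - 2 * \<theta>) + C"
  have D0: "0 \<le> D" using C0 \<theta> by (simp add: D_def)
  have "ennreal (r powr (- \<alpha> - 2 * \<sigma>)) * (\<integral>\<^sup>+x. (\<integral>\<^sup>+y\<in>ball x r. ennreal (\<bar>u x - u y\<bar>\<^sup>2) \<partial>\<mu>) \<partial>\<mu>) \<le> ennreal (14 powr s * 72 * D)"
    if r: "0 < r" "r < 1" for r
  proof -
    obtain m where "(1/7) ^ m < r" using real_arch_pow_inv[OF r(1), of "1/7"] by auto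
    then have "1 / (2 * 7 ^ Suc m) \<le> r" using r(1) by (simp add: power_divide field_simps)
    then have ex: "\<exists>m. 1 / (2 * 7 ^ Suc m) \<le> r" by blast
    define n where "n = (LEAST m. 1 / (2 * 7 ^ Suc m) \<le> r)"
    have n1: "1 / (2 * 7 ^ Suc n) \<le> r" unfolding n_def using ex by (rule LeastI_ex)
    have n2: "n = 0 \<or> r \<le> 1 / (2 * 7 ^ n)"
    proof (cases n)
      case (Suc k)
      then have "k < n" by simp
      from not_less_Least[OF this[unfolded n_def]] show ?thesis using Suc by simp
    qed simp
    have "r powr (- s) \<le> (1 / 14 * (1 / 7 ^ n)) powr (- s)"
      using n1 s0 by (intro powr_mono2') auto
    also have "\<dots> = 14 powr s * (289 / \<theta>) ^ n"
    proof -
      have "(1 / 14 * (1 / 7 ^ n)) powr (- s) = (1 / 14) powr (- s) * (1 / 7 ^ n) powr (- s)" by (rule powr_mult)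
      also have "(1 / 14) powr (- s) = 14 powr s" by (simp add: powr_minus powr_divide)
      also have "(1 / 7 ^ n) powr (- s) = (289 / \<theta>) ^ n"
        unfolding powr_minus s_def scale_powr \<theta>(1)[symmetric] by (simp add: power_divide)
      finally show ?thesis .
    qed
    finally have rs: "r powr (- \<alpha> - 2 * \<sigma>) \<le> 14 powr s * (289 / \<theta>) ^ n" by (simp add: s_def)
    have "(\<integral>\<^sup>+x. (\<integral>\<^sup>+y\<in>ball x r. ennreal (\<bar>u x - u y\<bar>\<^sup>2) \<partial>\<mu>) \<partial>\<mu>)
       \<le> 72 * ennreal (1 / 17 ^ n) * ((\<Sum>w\<in>words I n. cell_var u w) + ennreal (PE n u / 17 ^ n))"
      by (rule pair_integral_le[OF u n2])
    also have "\<dots> \<le> 72 * ennreal (1 / 17 ^ n) * (ennreal (13600 * C / (1 - 2 * \<theta>) * (\<theta> / 17) ^ n) + ennreal (C * (\<theta> / 17) ^ n))"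
      using C[of n] cell_var_sum[OF u \<theta>0 \<theta>(2) C]
      by (intro mult_left_mono add_mono ennreal_leI) (auto simp: power_divide divide_right_mono)
    also have "\<dots> = ennreal (72 * (1 / 17 ^ n) * (13600 * C / (1 - 2 * \<theta>) * (\<theta> / 17) ^ n + C * (\<theta> / 17) ^ n))"
      using C0 \<theta>0 \<theta>(2) by (simp flip: ennreal_plus ennreal_mult ennreal_numeral)
    also have "72 * (1 / 17 ^ n) * (13600 * C / (1 - 2 * \<theta>) * (\<theta> / 17) ^ n + C * (\<theta> / 17) ^ n) = 72 * D * (\<theta> / 289) ^ n"
    proof -
      have "(1 / 17 ^ n) * (\<theta> / 17) ^ n = (\<theta> / 289) ^ n"
        by (simp add: power_divide flip: power_mult_distrib)
      then have "(\<theta> / 289) ^ n = (1 / 17 ^ n) * (\<theta> / 17) ^ n" ..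
      then show ?thesis unfolding D_def by (simp only: distrib_right distrib_left mult_ac)
    qed
    finally have I: "(\<integral>\<^sup>+x. (\<integral>\<^sup>+y\<in>ball x r. ennreal (\<bar>u x - u y\<bar>\<^sup>2) \<partial>\<mu>) \<partial>\<mu>) \<le> ennreal (72 * D * (\<theta> / 289) ^ n)" .
    have "ennreal (r powr (- \<alpha> - 2 * \<sigma>)) * (\<integral>\<^sup>+x. (\<integral>\<^sup>+y\<in>ball x r. ennreal (\<bar>u x - u y\<bar>\<^sup>2) \<partial>\<mu>) \<partial>\<mu>)
      \<le> ennreal (14 powr s * (289 / \<theta>) ^ n) * ennreal (72 * D * (\<theta> / 289) ^ n)"
      by (intro mult_mono ennreal_leI rs I) auto
    also have "\<dots> = ennreal (14 powr s * (289 / \<theta>) ^ n * (72 * D * (\<theta> / 289) ^ n))"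
      using \<theta>0 D0 by (intro ennreal_mult[symmetric]) auto
    also have "14 powr s * (289 / \<theta>) ^ n * (72 * D * (\<theta> / 289) ^ n) = 14 powr s * 72 * D * ((289 / \<theta>) * (\<theta> / 289)) ^ n"
      by (simp only: power_mult_distrib mult_ac)
    also have "\<dots> = 14 powr s * 72 * D" using \<theta>0 by simp
    finally show ?thesis .
  qed
  then have "besov_seminorm_sq \<mu> \<alpha> \<sigma> u \<le> ennreal (14 powr s * 72 * D)"
    unfolding besov_seminorm_sq_def by (intro SUP_least) auto
  then have "besov_seminorm_sq \<mu> \<alpha> \<sigma> u < \<infinity>" by (simp add: le_less_trans)
  then show ?thesis using continuous_L2[OF u] by (simp add: besov_def)
qed

subsection \<open>Besov functions have decaying discrete energies\<close>

definition cell_mean :: "(plane \<Rightarrow> real) \<Rightarrow> cell list \<Rightarrow> real" where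
  "cell_mean u w = 17 ^ length w * (\<integral>x. u x * indicator (word_map w ` K) x \<partial>\<mu>)"

text \<open>Jensen's inequality, from integrating \<open>(x - a)\<^sup>2 \<ge> 2 * (m - a) * (x - a)
  - (m - a)\<^sup>2\<close> with the mean \<open>m\<close>.\<close>

lemma cell_mean_jensen:
  assumes u: "u \<in> L2 \<mu>" and w: "w \<in> words I n"
  shows "ennreal ((cell_mean u w - a)\<^sup>2) \<le> 17 ^ n * (\<integral>\<^sup>+x\<in>word_map w ` K. ennreal ((u x - a)\<^sup>2) \<partial>\<mu>)"
proof -
  let ?A = "word_map w ` K" and ?m = "cell_mean u w"
  have len: "length w = n" using w by (simp add: words_def)
  have um: "u \<in> borel_measurable \<mu>" using u by (simp add: L2_iff)
  have "integrable \<mu> (\<lambda>x. (u x)\<^sup>2)"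
    using u um by (intro integrableI_nonneg) (auto simp: L2_def)
  then have ui: "integrable \<mu> u" by (rule M.square_integrable_imp_integrable[OF um])
  have "integrable \<mu> (\<lambda>x. (u x)\<^sup>2 - 2 * a * u x + a\<^sup>2)"
    using ui \<open>integrable \<mu> (\<lambda>x. (u x)\<^sup>2)\<close> by simp
  then have sq: "integrable \<mu> (\<lambda>x. (u x - a)\<^sup>2)" by (simp add: power2_diff algebra_simps)
  have A: "?A \<in> sets \<mu>" using w by simp
  have sqA: "integrable \<mu> (\<lambda>x. (u x - a)\<^sup>2 * indicator ?A x)" and uA: "integrable \<mu> (\<lambda>x. u x * indicator ?A x)"
    using integrable_mult_indicator[OF A sq] integrable_mult_indicator[OF A ui] by (simp_all add: mult.commute)
  have indA: "integrable \<mu> (indicator ?A :: plane \<Rightarrow> real)" 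
    by (rule integrable_real_indicator[OF A]) (simp add: M.emeasure_eq_measure)
  have uAint: "(\<integral>x. u x * indicator ?A x \<partial>\<mu>) = ?m / 17 ^ n" by (simp add: cell_mean_def len)
  have "(\<integral>x. 2 * (?m - a) * (u x * indicator ?A x) - (2 * (?m - a) * a + (?m - a)\<^sup>2) * indicator ?A x \<partial>\<mu>)
     \<le> (\<integral>x. (u x - a)\<^sup>2 * indicator ?A x \<partial>\<mu>)"
  proof (rule integral_mono)
    show "2 * (?m - a) * (u x * indicator ?A x) - (2 * (?m - a) * a + (?m - a)\<^sup>2) * indicator ?A x \<le> (u x - a)\<^sup>2 * indicator ?A x" for x
      using zero_le_power2[of "(u x - a) - (?m - a)"] by (cases "x \<in> ?A") (simp_all add: power2_eq_square algebra_simps)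
  qed (use uA indA sqA in simp_all)
  also have "(\<integral>x. 2 * (?m - a) * (u x * indicator ?A x) - (2 * (?m - a) * a + (?m - a)\<^sup>2) * indicator ?A x \<partial>\<mu>)
      = 2 * (?m - a) * (?m / 17 ^ n) - (2 * (?m - a) * a + (?m - a)\<^sup>2) * (1 / 17 ^ n)"
  proof -
    have "?A \<inter> K = ?A" using word_map_K[OF w] by blast
    then show ?thesis using uA indA A by (simp add: uAint measure_cell[OF w])
  qed
  also have "\<dots> = (?m - a)\<^sup>2 / 17 ^ n" by (simp add: power2_eq_square field_simps)
  finally have "(?m - a)\<^sup>2 \<le> 17 ^ n * (\<integral>x. (u x - a)\<^sup>2 * indicator ?A x \<partial>\<mu>)" by (simp add: field_simps)
  then have "ennreal ((?m - a)\<^sup>2) \<le> ennreal (17 ^ n) * ennreal (\<integral>x. (u x - a)\<^sup>2 * indicator ?A x \<partial>\<mu>)"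
    by (subst ennreal_mult[symmetric]) (auto intro: ennreal_leI)
  also have "ennreal (\<integral>x. (u x - a)\<^sup>2 * indicator ?A x \<partial>\<mu>) = (\<integral>\<^sup>+x. ennreal ((u x - a)\<^sup>2 * indicator ?A x) \<partial>\<mu>)"
    using sqA by (intro nn_integral_eq_integral[symmetric]) auto
  also have "\<dots> = (\<integral>\<^sup>+x\<in>?A. ennreal ((u x - a)\<^sup>2) \<partial>\<mu>)"
    by (intro nn_integral_cong) (auto simp: indicator_def)
  finally show ?thesis by (simp flip: ennreal_power)
qed

definition cell_pair :: "(plane \<Rightarrow> real) \<Rightarrow> cell list \<Rightarrow> cell list \<Rightarrow> ennreal" where
  "cell_pair u v w = (\<integral>\<^sup>+x\<in>word_map v ` K. (\<integral>\<^sup>+y\<in>word_map w ` K. ennreal ((u x - u y)\<^sup>2) \<partial>\<mu>) \<partial>\<mu>)"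

lemma measurable_inner:
  assumes [measurable]: "u \<in> borel_measurable \<mu>" and "w \<in> words I n"
  shows "(\<lambda>x. \<integral>\<^sup>+y\<in>word_map w ` K. ennreal ((u x - u y)\<^sup>2) \<partial>\<mu>) \<in> borel_measurable \<mu>"
proof -
  have [measurable]: "word_map w ` K \<in> sets \<mu>" using assms(2) by simp
  show ?thesis by measurable
qed

lemma cell_mean_diff:
  assumes u: "u \<in> L2 \<mu>" and v: "v \<in> words I m" and w: "w \<in> words I n"
  shows "ennreal ((cell_mean u v - cell_mean u w)\<^sup>2) \<le> 17 ^ m * 17 ^ n * cell_pair u v w"
proof -
  have um: "u \<in> borel_measurable \<mu>" using u by (simp add: L2_iff)
  have "ennreal ((cell_mean u v - cell_mean u w)\<^sup>2) \<le> 17 ^ m * (\<integral>\<^sup>+x\<in>word_map v ` K. ennreal ((u x - cell_mean u w)\<^sup>2) \<partial>\<mu>)"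
    by (rule cell_mean_jensen[OF u v])
  also have "\<dots> \<le> 17 ^ m * (\<integral>\<^sup>+x\<in>word_map v ` K. (17 ^ n * (\<integral>\<^sup>+y\<in>word_map w ` K. ennreal ((u x - u y)\<^sup>2) \<partial>\<mu>)) \<partial>\<mu>)"
  proof (intro mult_left_mono nn_integral_mono mult_right_mono)
    fix x
    show "ennreal ((u x - cell_mean u w)\<^sup>2) \<le> 17 ^ n * (\<integral>\<^sup>+y\<in>word_map w ` K. ennreal ((u x - u y)\<^sup>2) \<partial>\<mu>)"
      using cell_mean_jensen[OF u w, of "u x"] by (simp add: power2_commute)
  qed auto
  also have "\<dots> = 17 ^ m * (17 ^ n * cell_pair u v w)"
    unfolding cell_pair_def using measurable_cell_ind[OF measurable_inner[OF um w] v]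
    by (simp add: nn_integral_cmult mult.assoc)
  finally show ?thesis by (simp add: mult.assoc)
qed


lemma cell_pair_le:
  assumes v: "v \<in> words I n" and near: "\<And>x y. x \<in> word_map v ` K \<Longrightarrow> y \<in> word_map w ` K \<Longrightarrow> dist x y < t"
  shows "cell_pair u v w \<le> (\<integral>\<^sup>+x\<in>word_map v ` K. (\<integral>\<^sup>+y\<in>ball x t. ennreal (\<bar>u x - u y\<bar>\<^sup>2) \<partial>\<mu>) \<partial>\<mu>)"
  unfolding cell_pair_def
proof (intro nn_integral_mono)
  fix x
  show "(\<integral>\<^sup>+y\<in>word_map w ` K. ennreal ((u x - u y)\<^sup>2) \<partial>\<mu>) * indicator (word_map v ` K) x
     \<le> (\<integral>\<^sup>+y\<in>ball x t. ennreal (\<bar>u x - u y\<bar>\<^sup>2) \<partial>\<mu>) * indicator (word_map v ` K) x"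
  proof (cases "x \<in> word_map v ` K")
    case True
    have "(\<integral>\<^sup>+y\<in>word_map w ` K. ennreal ((u x - u y)\<^sup>2) \<partial>\<mu>) \<le> (\<integral>\<^sup>+y\<in>ball x t. ennreal (\<bar>u x - u y\<bar>\<^sup>2) \<partial>\<mu>)"
      using near[OF True] by (intro nn_integral_mono) (auto simp: indicator_def)
    then show ?thesis using True by simp
  qed simp
qed

lemma set_nn_integral_le_all: "(\<integral>\<^sup>+x\<in>A. f x \<partial>\<mu>) \<le> (\<integral>\<^sup>+x. f x \<partial>\<mu>)"
  by (intro nn_integral_mono) (auto simp: indicator_def)

lemma sum_cell_pair_le:
  assumes u: "u \<in> borel_measurable \<mu>" and t: "\<And>w x y. w \<in> words I n \<Longrightarrow> x \<in> word_map w ` K \<Longrightarrow> y \<in> word_map w ` K \<Longrightarrow> dist x y < t"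
  shows "(\<Sum>w\<in>words I n. cell_pair u w w) \<le> (\<integral>\<^sup>+x. (\<integral>\<^sup>+y\<in>ball x t. ennreal (\<bar>u x - u y\<bar>\<^sup>2) \<partial>\<mu>) \<partial>\<mu>)"
proof -
  let ?g = "\<lambda>w x. (\<integral>\<^sup>+y\<in>word_map w ` K. ennreal ((u x - u y)\<^sup>2) \<partial>\<mu>)"
  have "(\<Sum>w\<in>words I n. cell_pair u w w) = (\<integral>\<^sup>+x. (\<Sum>w\<in>words I n. ?g w x * indicator (word_map w ` K) x) \<partial>\<mu>)"
    unfolding cell_pair_def using measurable_cell_ind[OF measurable_inner[OF u]]
    by (intro nn_integral_sum[symmetric]) auto
  also have "\<dots> \<le> (\<integral>\<^sup>+x. (\<integral>\<^sup>+y\<in>ball x t. ennreal (\<bar>u x - u y\<bar>\<^sup>2) \<partial>\<mu>) \<partial>\<mu>)"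
  proof (rule nn_integral_mono_AE, rule AE_mp[OF AE_one_cell[of n]], intro AE_I2 impI)
    fix x assume one: "(\<Sum>w\<in>words I n. indicator (word_map w ` K) x) = (1 :: ennreal)"
    have "(\<Sum>w\<in>words I n. ?g w x * indicator (word_map w ` K) x)
       \<le> (\<Sum>w\<in>words I n. (\<integral>\<^sup>+y\<in>ball x t. ennreal (\<bar>u x - u y\<bar>\<^sup>2) \<partial>\<mu>) * indicator (word_map w ` K) x)"
    proof (rule sum_mono)
      fix w assume w: "w \<in> words I n"
      show "?g w x * indicator (word_map w ` K) x \<le> (\<integral>\<^sup>+y\<in>ball x t. ennreal (\<bar>u x - u y\<bar>\<^sup>2) \<partial>\<mu>) * indicator (word_map w ` K) x"
      proof (cases "x \<in> word_map w ` K")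
        case True
        have "?g w x \<le> (\<integral>\<^sup>+y\<in>ball x t. ennreal (\<bar>u x - u y\<bar>\<^sup>2) \<partial>\<mu>)"
          using t[OF w True] by (intro nn_integral_mono) (auto simp: indicator_def)
        then show ?thesis using True by simp
      qed simp
    qed
    also have "\<dots> = (\<integral>\<^sup>+y\<in>ball x t. ennreal (\<bar>u x - u y\<bar>\<^sup>2) \<partial>\<mu>)"
      unfolding sum_distrib_left[symmetric] one by simp
    finally show "(\<Sum>w\<in>words I n. ?g w x * indicator (word_map w ` K) x) \<le> (\<integral>\<^sup>+y\<in>ball x t. ennreal (\<bar>u x - u y\<bar>\<^sup>2) \<partial>\<mu>)" .
  qed
  finally show ?thesis .
qed

lemma dist_same_cell:
  assumes w: "w \<in> words I n" and x: "x \<in> word_map w ` K" and y: "y \<in> word_map w ` K"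
  shows "dist x y \<le> 5/4 / 7 ^ n"
proof -
  obtain a b where ab: "a \<in> K" "b \<in> K" "x = word_map w a" "y = word_map w b" using x y by blast
  have "dist a b / 7 ^ n \<le> 5/4 / 7 ^ n" using dist_K_le[OF ab(1,2)] by (rule divide_right_mono) simp
  then show ?thesis using w ab by (simp add: dist_word_map words_def)
qed

text \<open>Cell means of a Besov function converge geometrically along nested cells, uniformly and in a
  summed sense.  The continuous representative is their limit.\<close>

lemma besov_continuous_rep:
  assumes u: "u \<in> besov \<mu> \<alpha> \<sigma>" and \<theta>: "\<theta> = 7 powr (\<alpha> - 2 * \<sigma>)" "2 * \<theta> < 1"
  obtains v C where "continuous_on K v" "AE x in \<mu>. u x = v x" "\<And>n. 1 \<le> n \<Longrightarrow> PE n v \<le> C * \<theta> ^ n"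
proof -
  have \<theta>0: "0 < \<theta>" using \<theta> by simp
  have uL: "u \<in> L2 \<mu>" using u by (simp add: besov_def)
  have um: "u \<in> borel_measurable \<mu>" using uL by (simp add: L2_iff)
  define N where "N t = (\<integral>\<^sup>+x. (\<integral>\<^sup>+y\<in>ball x t. ennreal (\<bar>u x - u y\<bar>\<^sup>2) \<partial>\<mu>) \<partial>\<mu>)" for t
  define s where "s = \<alpha> + 2 * \<sigma>"
  have fin: "besov_seminorm_sq \<mu> \<alpha> \<sigma> u < \<infinity>" using u by (simp add: besov_def)
  define S where "S = enn2real (besov_seminorm_sq \<mu> \<alpha> \<sigma> u)"
  have S: "besov_seminorm_sq \<mu> \<alpha> \<sigma> u = ennreal S" "0 \<le> S" using fin by (auto simp: S_def)
  define B where "B = S * 3 powr s"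
  have B0: "0 \<le> B" using S by (simp add: B_def)
  (* The radius accounts for 3 = 5/4 + 1/2 + 5/4: two cells of diameter at most 5/4 / 7 ^ n
     with points at distance below 1 / (2 * 7 ^ n). *)
  have NB: "N (3 / 7 ^ n) \<le> ennreal (B * (\<theta> / 289) ^ n)" if n: "1 \<le> n" for n
  proof -
    define t where "t = 3 / (7::real) ^ n"
    have "(7::real) ^ 1 \<le> 7 ^ n" using n by (intro power_increasing) auto
    then have t: "0 < t" "t < 1" by (auto simp: t_def)
    have "ennreal (t powr (- \<alpha> - 2 * \<sigma>)) * N t \<le> ennreal S"
      unfolding S(1)[symmetric] besov_seminorm_sq_def N_def using t by (intro SUP_upper) auto
    then have "ennreal (t powr s) * (ennreal (t powr (- \<alpha> - 2 * \<sigma>)) * N t) \<le> ennreal (t powr s) * ennreal S"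
      by (intro mult_left_mono) auto
    moreover have "ennreal (t powr s) * ennreal (t powr (- \<alpha> - 2 * \<sigma>)) = 1"
    proof -
      have "t powr s * t powr (- \<alpha> - 2 * \<sigma>) = 1" using t by (simp add: s_def flip: powr_add)
      then show ?thesis by (simp flip: ennreal_mult)
    qed
    ultimately have "N t \<le> ennreal (t powr s) * ennreal S" by (simp flip: mult.assoc)
    also have "\<dots> = ennreal (t powr s * S)" using S by (simp add: ennreal_mult)
    also have "t powr s = 3 powr s * (\<theta> / 289) ^ n"
    proof -
      have "t powr s = (3 * (1 / 7 ^ n)) powr s" by (simp add: t_def)
      also have "\<dots> = 3 powr s * (1 / 7 ^ n) powr s" by (rule powr_mult)
      finally show ?thesis by (simp add: s_def scale_powr \<theta>(1))
    qed
    finally show ?thesis by (simp add: t_def B_def mult_ac)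
  qed
  define m where "m = cell_mean u"
  define \<kappa> where "\<kappa> = sqrt \<theta>"
  have \<kappa>: "0 < \<kappa>" "\<kappa> < 1" "\<kappa>\<^sup>2 = \<theta>" using \<theta> \<theta>0 by (auto simp: \<kappa>_def)
  have pm: "(\<kappa> ^ k)\<^sup>2 = \<theta> ^ k" for k unfolding \<kappa>(3)[symmetric] by (simp flip: power_mult add: mult.commute)
  define b where "b = sqrt (17 * B)"
  have b: "0 \<le> b" "b\<^sup>2 = 17 * B" using B0 by (auto simp: b_def)
  have root: "\<bar>c\<bar> \<le> b * \<kappa> ^ n" if "ennreal (c\<^sup>2) \<le> ennreal (17 * B * \<theta> ^ n)" for c n
  proof -
    have "c\<^sup>2 \<le> 17 * B * \<theta> ^ n" using that B0 \<theta>0 by (simp add: ennreal_le_iff)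
    then have "c\<^sup>2 \<le> (b * \<kappa> ^ n)\<^sup>2" by (simp add: power_mult_distrib pm b)
    then have "\<bar>c\<bar> \<le> \<bar>b * \<kappa> ^ n\<bar>" by (simp only: abs_le_square_iff)
    then show ?thesis using b \<kappa> by simp
  qed
  have scale: "17 ^ n * 17 ^ n * ennreal (B * (\<theta> / 289) ^ n) = ennreal (B * \<theta> ^ n)" for n
  proof -
    have "17 ^ n * 17 ^ n * ennreal (B * (\<theta> / 289) ^ n) = ennreal (17 ^ n * 17 ^ n * (B * (\<theta> / 289) ^ n))"
      using B0 \<theta>0 by (simp add: ennreal_mult flip: ennreal_power)
    also have "17 ^ n * 17 ^ n * (B * (\<theta> / 289) ^ n) = B * (17 * 17 * (\<theta> / 289)) ^ n"
      by (simp only: power_mult_distrib mult_ac)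
    finally show ?thesis by simp
  qed
  have pair_near: "ennreal ((m v - m w)\<^sup>2) \<le> ennreal (B * \<theta> ^ n)"
    if n: "1 \<le> n" and v: "v \<in> words I n" and w: "w \<in> words I n"
      and xy: "x \<in> word_map v ` K" "y \<in> word_map w ` K" "dist x y < 1 / (2 * 7 ^ n)" for n v w x y
  proof -
    have d: "dist x' y' < 3 / 7 ^ n" if "x' \<in> word_map v ` K" "y' \<in> word_map w ` K" for x' y'
    proof -
      have "dist x' y' \<le> dist x' x + dist x y + dist y y'"
        using dist_triangle[of x' y' x] dist_triangle[of x y' y] by linarith
      also have "\<dots> < 5/4 / 7 ^ n + 1 / (2 * 7 ^ n) + 5/4 / 7 ^ n"
        using dist_same_cell[OF v that(1) xy(1)] dist_same_cell[OF w xy(2) that(2)] xy(3) by linarith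
      also have "\<dots> = 3 / 7 ^ n" by (simp add: field_simps)
      finally show ?thesis .
    qed
    have "ennreal ((m v - m w)\<^sup>2) \<le> 17 ^ n * 17 ^ n * cell_pair u v w" unfolding m_def by (rule cell_mean_diff[OF uL v w])
    also have "\<dots> \<le> 17 ^ n * 17 ^ n * N (3 / 7 ^ n)"
      unfolding N_def by (intro mult_left_mono order_trans[OF cell_pair_le[OF v d] set_nn_integral_le_all]) auto
    also have "\<dots> \<le> 17 ^ n * 17 ^ n * ennreal (B * (\<theta> / 289) ^ n)" by (intro mult_left_mono NB n) auto
    finally show ?thesis unfolding scale .
  qed
  have pair_near': "\<bar>m v - m w\<bar> \<le> b * \<kappa> ^ n"
    if "1 \<le> n" "v \<in> words I n" "w \<in> words I n" "x \<in> word_map v ` K" "y \<in> word_map w ` K" "dist x y < 1 / (2 * 7 ^ n)" for n v w x y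
  proof (rule root)
    have "B * \<theta> ^ n \<le> 17 * B * \<theta> ^ n" using B0 \<theta>0 by simp
    then show "ennreal ((m v - m w)\<^sup>2) \<le> ennreal (17 * B * \<theta> ^ n)"
      by (intro order_trans[OF pair_near[OF that]] ennreal_leI)
  qed
  have same_lt: "dist x y < 3 / 7 ^ n" if "w \<in> words I n" "x \<in> word_map w ` K" "y \<in> word_map w ` K" for w n x y
    using dist_same_cell[OF that] by (rule le_less_trans) (simp add: field_simps)
  have sum_same: "17 ^ n * 17 ^ n * (\<Sum>w\<in>words I n. cell_pair u w w) \<le> ennreal (B * \<theta> ^ n)" if n: "1 \<le> n" for n
  proof -
    have "(\<Sum>w\<in>words I n. cell_pair u w w) \<le> N (3 / 7 ^ n)"
      unfolding N_def by (rule sum_cell_pair_le[OF um same_lt])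
    also have "\<dots> \<le> ennreal (B * (\<theta> / 289) ^ n)" by (rule NB[OF n])
    finally show ?thesis unfolding scale[symmetric] by (intro mult_left_mono) auto
  qed
  have nested: "ennreal ((m (w @ [i]) - m w)\<^sup>2) \<le> 17 * (17 ^ n * 17 ^ n * cell_pair u w w)"
    if w: "w \<in> words I n" and i: "i \<in> I" for w n i
  proof -
    have wi: "w @ [i] \<in> words I (n + 1)" using words_append[OF w, of "[i]" 1] i by (simp add: words_1)
    have sub: "word_map (w @ [i]) ` K \<subseteq> word_map w ` K" unfolding cell_subset_split[OF w] using i by blast
    have "ennreal ((m (w @ [i]) - m w)\<^sup>2) = ennreal ((m w - m (w @ [i]))\<^sup>2)" by (simp add: power2_commute)
    also have "\<dots> \<le> 17 ^ n * 17 ^ (n + 1) * cell_pair u w (w @ [i])" unfolding m_def by (rule cell_mean_diff[OF uL w wi])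
    also have "cell_pair u w (w @ [i]) \<le> cell_pair u w w"
      unfolding cell_pair_def using sub
      by (intro nn_integral_mono mult_right_mono) (auto simp: indicator_def intro!: nn_integral_mono)
    finally show ?thesis by (simp add: mult_left_mono mult.assoc mult.left_commute)
  qed
  have nested': "\<bar>m (w @ [i]) - m w\<bar> \<le> b * \<kappa> ^ n" if n: "1 \<le> n" and w: "w \<in> words I n" and i: "i \<in> I" for w n i
  proof (rule root)
    have "cell_pair u w w \<le> (\<Sum>w\<in>words I n. cell_pair u w w)"
      by (rule member_le_sum[OF w]) (auto simp: finite_words)
    then have "17 * (17 ^ n * 17 ^ n * cell_pair u w w) \<le> 17 * (17 ^ n * 17 ^ n * (\<Sum>w\<in>words I n. cell_pair u w w))"
      by (intro mult_left_mono) auto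
    also have "\<dots> \<le> 17 * ennreal (B * \<theta> ^ n)" by (intro mult_left_mono sum_same n) auto
    also have "\<dots> = ennreal (17 * B * \<theta> ^ n)" using B0 \<theta>0 by (simp add: ennreal_mult mult.assoc)
    finally show "ennreal ((m (w @ [i]) - m w)\<^sup>2) \<le> ennreal (17 * B * \<theta> ^ n)"
      using nested[OF w i] by (rule order_trans[rotated])
  qed
  define addr where "addr x n = (SOME w. w \<in> words I n \<and> x \<in> word_map w ` K)" for x n
  have addr: "addr x n \<in> words I n" "x \<in> word_map (addr x n) ` K" if "x \<in> K" for x n
  proof -
    have "\<exists>w. w \<in> words I n \<and> x \<in> word_map w ` K" using K_words[OF that, of n] by blast
    from someI_ex[OF this] show "addr x n \<in> words I n" "x \<in> word_map (addr x n) ` K" by (auto simp: addr_def)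
  qed
  define M where "M n x = m (addr x (Suc n))" for n x
  have common: "\<bar>m v - m w\<bar> \<le> b * \<kappa> ^ n" if "1 \<le> n" "v \<in> words I n" "w \<in> words I n" "x \<in> word_map v ` K" "x \<in> word_map w ` K" for n v w x
    using pair_near'[OF that] by simp
  have Mstep: "\<bar>M (Suc n) x - M n x\<bar> \<le> 2 * b * \<kappa> * \<kappa> ^ n" if x: "x \<in> K" for n x
  proof -
    have "addr x (Suc (Suc n)) \<in> words I (Suc n + 1)" using addr(1)[OF x, of "Suc (Suc n)"] by simp
    then obtain v t where vt: "addr x (Suc (Suc n)) = v @ t" "v \<in> words I (Suc n)" "t \<in> words I 1" by (rule words_add_split)
    then obtain i where i: "t = [i]" "i \<in> I" by (auto simp: words_1)
    have "x \<in> word_map (v @ [i]) ` K" using addr(2)[OF x, of "Suc (Suc n)"] vt i by simp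
    then have xv: "x \<in> word_map v ` K" unfolding cell_subset_split[OF vt(2)] using i by blast
    have "\<bar>m (v @ [i]) - m v\<bar> \<le> b * \<kappa> ^ Suc n" by (rule nested'[OF _ vt(2) i(2)]) simp
    moreover have "\<bar>m v - m (addr x (Suc n))\<bar> \<le> b * \<kappa> ^ Suc n"
      by (rule common[OF _ vt(2) addr(1)[OF x] xv addr(2)[OF x]]) simp
    ultimately have "\<bar>m (v @ [i]) - m (addr x (Suc n))\<bar> \<le> 2 * (b * \<kappa> ^ Suc n)" by linarith
    then show ?thesis unfolding M_def vt(1) i(1) by simp
  qed
  define b' where "b' = 2 * b / (1 - \<kappa>) + b"
  have b'0: "0 \<le> b'" using b \<kappa> by (simp add: b'_def)
  (* The candidate is the limit of the cell means along any choice of nested addresses of x. *)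
  define v where "v x = lim (\<lambda>n. M n x)" for x
  have vlim: "(\<lambda>n. M n x) \<longlonglongrightarrow> v x" and vM: "\<bar>v x - M n x\<bar> \<le> 2 * b / (1 - \<kappa>) * \<kappa> ^ Suc n" if x: "x \<in> K" for x n
  proof -
    have tele: "\<bar>M (n + k) x - M n x\<bar> \<le> 2 * b / (1 - \<kappa>) * \<kappa> ^ Suc n" for n k
    proof -
      have "\<bar>M (n + k) x - M n x\<bar> \<le> 2 * b * \<kappa> * \<kappa> ^ n * (\<Sum>j<k. \<kappa> ^ j)"
      proof (induction k)
        case (Suc k)
        then show ?case using Mstep[OF x, of "n + k"] by (simp add: algebra_simps power_add)
      qed simp
      also have "\<dots> \<le> 2 * b * \<kappa> * \<kappa> ^ n * (1 / (1 - \<kappa>))"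
      proof (rule mult_left_mono)
        show "(\<Sum>j<k. \<kappa> ^ j) \<le> 1 / (1 - \<kappa>)"
          using sum_le_suminf[of "\<lambda>j. \<kappa> ^ j" "{..<k}"] \<kappa> geometric_sums[of \<kappa>] by (simp add: sums_iff summable_geometric)
      qed (use b \<kappa> in simp)
      finally show ?thesis by (simp add: mult_ac)
    qed
    have "Cauchy (\<lambda>n. M n x)"
    proof (rule metric_CauchyI)
      fix e :: real assume "0 < e"
      have "(\<lambda>n. 2 * b / (1 - \<kappa>) * \<kappa> ^ Suc n) \<longlonglongrightarrow> 2 * b / (1 - \<kappa>) * 0"
        using \<kappa> by (intro tendsto_mult tendsto_const LIMSEQ_Suc LIMSEQ_realpow_zero) auto
      then have "\<forall>\<^sub>F n in sequentially. 2 * b / (1 - \<kappa>) * \<kappa> ^ Suc n < e / 2"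
        using \<open>0 < e\<close> by (intro order_tendstoD(2)) auto
      then obtain n0 where n0: "2 * b / (1 - \<kappa>) * \<kappa> ^ Suc n0 < e / 2" by (auto simp: eventually_sequentially)
      have "dist (M p x) (M q x) < e" if "n0 \<le> p" "n0 \<le> q" for p q
        using tele[of n0 "p - n0"] tele[of n0 "q - n0"] n0 that by (simp add: dist_real_def)
      then show "\<exists>n0. \<forall>p\<ge>n0. \<forall>q\<ge>n0. dist (M p x) (M q x) < e" by blast
    qed
    then show l: "(\<lambda>n. M n x) \<longlonglongrightarrow> v x" unfolding v_def by (simp add: Cauchy_convergent_iff convergent_LIMSEQ_iff)
    have "(\<lambda>k. \<bar>M (k + n) x - M n x\<bar>) \<longlonglongrightarrow> \<bar>v x - M n x\<bar>"
      using LIMSEQ_ignore_initial_segment[OF l, of n] by (intro tendsto_rabs tendsto_diff tendsto_const)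
    then show "\<bar>v x - M n x\<bar> \<le> 2 * b / (1 - \<kappa>) * \<kappa> ^ Suc n"
      using tele[of n] by (intro LIMSEQ_le_const2) (auto simp: add.commute)
  qed
  have vm: "\<bar>v x - m w\<bar> \<le> b' * \<kappa> ^ n" if n: "1 \<le> n" and w: "w \<in> words I n" and x: "x \<in> word_map w ` K" for x w n
  proof -
    obtain k where k: "n = Suc k" using n by (cases n) auto
    have xK: "x \<in> K" using x word_map_K[OF w] by blast
    have "\<bar>M k x - m w\<bar> \<le> b * \<kappa> ^ n"
      unfolding M_def using w x addr[OF xK] k by (intro common[OF n]) auto
    then show ?thesis using vM[OF xK, of k] k by (simp add: b'_def algebra_simps)
  qed
  have v_cont: "continuous_on K v"
  proof (rule continuous_onI)
    fix x e assume x: "x \<in> K" and e: "(0::real) < e"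
    have "(\<lambda>n. (2 * b' + b) * \<kappa> ^ n) \<longlonglongrightarrow> (2 * b' + b) * 0"
      using \<kappa> by (intro tendsto_mult tendsto_const LIMSEQ_realpow_zero) auto
    then have "\<forall>\<^sub>F n in sequentially. (2 * b' + b) * \<kappa> ^ n < e" using e by (intro order_tendstoD(2)) auto
    then have "\<forall>\<^sub>F n in sequentially. (2 * b' + b) * \<kappa> ^ n < e \<and> 1 \<le> n"
      using eventually_ge_at_top by (rule eventually_conj)
    then obtain n where n: "(2 * b' + b) * \<kappa> ^ n < e" "1 \<le> n" by (auto simp: eventually_sequentially)
    have "dist (v y) (v x) \<le> e" if y: "y \<in> K" "dist y x < 1 / (2 * 7 ^ n)" for y
    proof -
      have "\<bar>m (addr y n) - m (addr x n)\<bar> \<le> b * \<kappa> ^ n"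
        by (rule pair_near'[OF n(2) addr(1)[OF y(1)] addr(1)[OF x] addr(2)[OF y(1)] addr(2)[OF x] y(2)])
      moreover have "\<bar>v y - m (addr y n)\<bar> \<le> b' * \<kappa> ^ n" "\<bar>v x - m (addr x n)\<bar> \<le> b' * \<kappa> ^ n"
        using vm[OF n(2)] addr x y(1) by blast+
      ultimately have "\<bar>v y - v x\<bar> \<le> (2 * b' + b) * \<kappa> ^ n" by (simp add: algebra_simps)
      then show ?thesis using n by (simp add: dist_real_def)
    qed
    then show "\<exists>d>0. \<forall>x'\<in>K. dist x' x < d \<longrightarrow> dist (v x') (v x) \<le> e"
      by (intro exI[of _ "1 / (2 * 7 ^ n)"]) simp
  qed
  have ae: "AE x in \<mu>. u x = v x"
  proof -
    have vmeas: "v \<in> borel_measurable \<mu>" using v_cont by simp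
    have dm: "(\<lambda>x. ennreal ((u x - v x)\<^sup>2)) \<in> borel_measurable \<mu>"
      using um vmeas by (intro measurable_compose[OF _ measurable_ennreal] borel_measurable_power borel_measurable_diff) auto
    have bound: "(\<integral>\<^sup>+x. ennreal ((u x - v x)\<^sup>2) \<partial>\<mu>) \<le> ennreal ((2 * B + 2 * b'\<^sup>2) * \<theta> ^ n)" if n: "1 \<le> n" for n
    proof -
      have "(\<integral>\<^sup>+x. ennreal ((u x - v x)\<^sup>2) \<partial>\<mu>) = (\<Sum>w\<in>words I n. \<integral>\<^sup>+x\<in>word_map w ` K. ennreal ((u x - v x)\<^sup>2) \<partial>\<mu>)"
        by (rule nn_integral_cells[OF dm])
      also have "\<dots> \<le> (\<Sum>w\<in>words I n. 2 * 17 ^ n * cell_pair u w w + ennreal (2 * b'\<^sup>2 * \<theta> ^ n) * ennreal (1 / 17 ^ n))"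
      proof (rule sum_mono)
        fix w assume w: "w \<in> words I n"
        let ?A = "word_map w ` K"
        let ?g = "\<lambda>x. (\<integral>\<^sup>+y\<in>?A. ennreal ((u x - u y)\<^sup>2) \<partial>\<mu>)"
        have "ennreal ((u x - v x)\<^sup>2) \<le> 2 * 17 ^ n * ?g x + ennreal (2 * b'\<^sup>2 * \<theta> ^ n)" if "x \<in> ?A" for x
        proof -
          have "(v x - m w)\<^sup>2 \<le> (b' * \<kappa> ^ n)\<^sup>2"
            using vm[OF n w that] b'0 \<kappa> by (intro abs_le_square_iff[THEN iffD1]) simp
          then have vm2: "(v x - m w)\<^sup>2 \<le> b'\<^sup>2 * \<theta> ^ n" by (simp add: power_mult_distrib pm)
          have "(u x - v x)\<^sup>2 \<le> 2 * (m w - u x)\<^sup>2 + 2 * (v x - m w)\<^sup>2"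
            using zero_le_power2[of "(m w - u x) - (v x - m w)"] by (simp add: power2_eq_square algebra_simps)
          also have "\<dots> \<le> 2 * (m w - u x)\<^sup>2 + 2 * b'\<^sup>2 * \<theta> ^ n" using vm2 by simp
          finally have "ennreal ((u x - v x)\<^sup>2) \<le> ennreal (2 * (m w - u x)\<^sup>2 + 2 * b'\<^sup>2 * \<theta> ^ n)" by (rule ennreal_leI)
          also have "\<dots> = 2 * ennreal ((m w - u x)\<^sup>2) + ennreal (2 * b'\<^sup>2 * \<theta> ^ n)"
            using \<theta>0 by (simp add: ennreal_plus ennreal_mult)
          also have "ennreal ((m w - u x)\<^sup>2) \<le> 17 ^ n * (\<integral>\<^sup>+y\<in>?A. ennreal ((u y - u x)\<^sup>2) \<partial>\<mu>)"
            unfolding m_def by (rule cell_mean_jensen[OF uL w])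
          finally show ?thesis by (simp add: mult_left_mono add_right_mono mult.assoc power2_commute[of _ "u x"])
        qed
        then have "(\<integral>\<^sup>+x\<in>?A. ennreal ((u x - v x)\<^sup>2) \<partial>\<mu>) \<le> (\<integral>\<^sup>+x. 2 * 17 ^ n * (?g x * indicator ?A x) + ennreal (2 * b'\<^sup>2 * \<theta> ^ n) * indicator ?A x \<partial>\<mu>)"
          by (intro nn_integral_mono) (auto simp: indicator_def)
        also have "\<dots> = 2 * 17 ^ n * cell_pair u w w + ennreal (2 * b'\<^sup>2 * \<theta> ^ n) * ennreal (1 / 17 ^ n)"
          unfolding cell_pair_def nn_integral_cell_const[OF w, symmetric]
          using measurable_cell_ind[OF measurable_inner[OF um w] w] measurable_cell_ind[OF borel_measurable_const w]
          by (subst nn_integral_add) (auto simp: nn_integral_cmult)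
        finally show "(\<integral>\<^sup>+x\<in>?A. ennreal ((u x - v x)\<^sup>2) \<partial>\<mu>) \<le> 2 * 17 ^ n * cell_pair u w w + ennreal (2 * b'\<^sup>2 * \<theta> ^ n) * ennreal (1 / 17 ^ n)" .
      qed
      also have "\<dots> = 2 * (17 ^ n * (\<Sum>w\<in>words I n. cell_pair u w w)) + ennreal (2 * b'\<^sup>2 * \<theta> ^ n)"
        using \<theta>0 by (simp add: sum.distrib sum_distrib_left mult.assoc card_words card_I ennreal_of_nat_eq_real_of_nat flip: ennreal_mult)
      also have "17 ^ n * (\<Sum>w\<in>words I n. cell_pair u w w) \<le> 17 ^ n * 17 ^ n * (\<Sum>w\<in>words I n. cell_pair u w w)"
      proof -
        have "(1::ennreal) \<le> 17 ^ n" by (rule one_le_power) simp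
        then have "1 * (17 ^ n * (\<Sum>w\<in>words I n. cell_pair u w w)) \<le> 17 ^ n * (17 ^ n * (\<Sum>w\<in>words I n. cell_pair u w w))"
          by (rule mult_right_mono) simp
        then show ?thesis by (simp add: mult.assoc)
      qed
      also have "\<dots> \<le> ennreal (B * \<theta> ^ n)" by (rule sum_same[OF n])
      also have "2 * ennreal (B * \<theta> ^ n) + ennreal (2 * b'\<^sup>2 * \<theta> ^ n) = ennreal ((2 * B + 2 * b'\<^sup>2) * \<theta> ^ n)"
        using B0 \<theta>0 by (simp add: distrib_right ennreal_plus ennreal_mult mult.assoc)
      finally show ?thesis by (simp add: add_right_mono mult_left_mono)
    qed
    have "(\<integral>\<^sup>+x. ennreal ((u x - v x)\<^sup>2) \<partial>\<mu>) \<le> ennreal 0"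
    proof (rule LIMSEQ_le_const)
      have "(\<lambda>n. (2 * B + 2 * b'\<^sup>2) * \<theta> ^ n) \<longlonglongrightarrow> (2 * B + 2 * b'\<^sup>2) * 0"
        using \<theta> \<theta>0 by (intro tendsto_mult tendsto_const LIMSEQ_realpow_zero) auto
      then show "(\<lambda>n. ennreal ((2 * B + 2 * b'\<^sup>2) * \<theta> ^ n)) \<longlonglongrightarrow> ennreal 0" by (intro tendsto_ennrealI) simp
    qed (use bound in blast)
    then have "(\<integral>\<^sup>+x. ennreal ((u x - v x)\<^sup>2) \<partial>\<mu>) = 0" by simp
    then have "AE x in \<mu>. ennreal ((u x - v x)\<^sup>2) = 0" using nn_integral_0_iff_AE[OF dm] by simp
    then show ?thesis by (rule AE_mp) (auto simp: ennreal_eq_0_iff intro!: AE_I2)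
  qed
  (* Pointwise bounds would lose the number of cells.  Summed over all cells, the deviation of v at the
     corner p from the cell mean is telescoped along the cells shrinking to p. *)
  have vertex: "(\<Sum>w\<in>words I n. (v (word_map w p) - m w)\<^sup>2) \<le> 34 * B / (1 - 2 * \<theta>) * \<theta> ^ n"
    if n: "1 \<le> n" and p: "p \<in> V0" for n p
  proof -
    obtain i where i: "i \<in> I" "cell_map i p = p" using p corner_I corner_fixed unfolding V0_def by blast
    have pK: "p \<in> K" using p V0_K by blast
    define R where "R k = replicate k i" for k
    have R: "R k \<in> words I k" for k using i by (auto simp: R_def words_def)
    have Rp: "word_map (R k) p = p" for k by (induction k) (auto simp: R_def i)
    have RS: "R (Suc k) = R k @ [i]" for k by (simp add: R_def replicate_append_same)
    have pin: "word_map w p \<in> word_map (w @ R k) ` K" for w k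
      using Rp[of k] pK by (metis comp_apply imageI word_map_append)
    define a where "a k = ennreal (\<Sum>w\<in>words I n. (v (word_map w p) - m (w @ R k))\<^sup>2)" for k
    have prior: "a k \<le> ennreal (17 ^ n * b'\<^sup>2 * \<theta> ^ n * \<theta> ^ k)" for k
      unfolding a_def
    proof (rule ennreal_leI)
      have "(\<Sum>w\<in>words I n. (v (word_map w p) - m (w @ R k))\<^sup>2) \<le> (\<Sum>w\<in>words I n. b'\<^sup>2 * \<theta> ^ (n + k))"
      proof (rule sum_mono)
        fix w assume w: "w \<in> words I n"
        have "\<bar>v (word_map w p) - m (w @ R k)\<bar> \<le> b' * \<kappa> ^ (n + k)"
          by (rule vm[OF _ words_append[OF w R] pin]) (use n in simp)
        then have "(v (word_map w p) - m (w @ R k))\<^sup>2 \<le> (b' * \<kappa> ^ (n + k))\<^sup>2"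
          using b'0 \<kappa> by (intro abs_le_square_iff[THEN iffD1]) simp
        then show "(v (word_map w p) - m (w @ R k))\<^sup>2 \<le> b'\<^sup>2 * \<theta> ^ (n + k)" by (simp add: power_mult_distrib pm)
      qed
      also have "\<dots> = 17 ^ n * b'\<^sup>2 * \<theta> ^ n * \<theta> ^ k" by (simp add: card_words card_I power_add)
      finally show "(\<Sum>w\<in>words I n. (v (word_map w p) - m (w @ R k))\<^sup>2) \<le> 17 ^ n * b'\<^sup>2 * \<theta> ^ n * \<theta> ^ k" .
    qed
    have rec: "a k \<le> 2 * a (Suc k) + ennreal (34 * B * \<theta> ^ n * \<theta> ^ k)" for k
    proof -
      have "(\<Sum>w\<in>words I n. (m (w @ R (Suc k)) - m (w @ R k))\<^sup>2) \<le> 17 * B * \<theta> ^ (n + k)"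
      proof -
        have "ennreal (\<Sum>w\<in>words I n. (m (w @ R (Suc k)) - m (w @ R k))\<^sup>2) = (\<Sum>w\<in>words I n. ennreal ((m ((w @ R k) @ [i]) - m (w @ R k))\<^sup>2))"
          by (simp add: RS sum_ennreal)
        also have "\<dots> \<le> (\<Sum>w\<in>words I n. 17 * (17 ^ (n + k) * 17 ^ (n + k) * cell_pair u (w @ R k) (w @ R k)))"
          by (intro sum_mono nested words_append R i(1))
        also have "\<dots> = 17 * (17 ^ (n + k) * 17 ^ (n + k) * (\<Sum>w\<in>words I n. cell_pair u (w @ R k) (w @ R k)))"
          by (simp only: sum_distrib_left)
        also have "(\<Sum>w\<in>words I n. cell_pair u (w @ R k) (w @ R k)) \<le> (\<Sum>w\<in>words I n. \<Sum>t\<in>words I k. cell_pair u (w @ t) (w @ t))"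
          by (intro sum_mono member_le_sum[OF R]) (auto simp: finite_words)
        also have "\<dots> = (\<Sum>w\<in>words I (n + k). cell_pair u w w)" by (rule sum_words_add[OF finite_I, symmetric])
        also have "17 ^ (n + k) * 17 ^ (n + k) * (\<Sum>w\<in>words I (n + k). cell_pair u w w) \<le> ennreal (B * \<theta> ^ (n + k))"
          by (rule sum_same) (use n in simp)
        finally have "ennreal (\<Sum>w\<in>words I n. (m (w @ R (Suc k)) - m (w @ R k))\<^sup>2) \<le> 17 * ennreal (B * \<theta> ^ (n + k))"
          by (simp add: mult_left_mono)
        also have "\<dots> = ennreal (17 * B * \<theta> ^ (n + k))" using B0 \<theta>0 by (simp add: ennreal_mult mult.assoc)
        finally show ?thesis using B0 \<theta>0 by (simp add: ennreal_le_iff)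
      qed
      moreover have "(\<Sum>w\<in>words I n. (v (word_map w p) - m (w @ R k))\<^sup>2)
          \<le> 2 * (\<Sum>w\<in>words I n. (v (word_map w p) - m (w @ R (Suc k)))\<^sup>2) + 2 * (\<Sum>w\<in>words I n. (m (w @ R (Suc k)) - m (w @ R k))\<^sup>2)"
        unfolding sum_distrib_left sum.distrib[symmetric]
      proof (rule sum_mono)
        fix w
        show "(v (word_map w p) - m (w @ R k))\<^sup>2 \<le> 2 * (v (word_map w p) - m (w @ R (Suc k)))\<^sup>2 + 2 * (m (w @ R (Suc k)) - m (w @ R k))\<^sup>2"
          using zero_le_power2[of "(v (word_map w p) - m (w @ R (Suc k))) - (m (w @ R (Suc k)) - m (w @ R k))"]
          by (simp add: power2_eq_square algebra_simps)
      qed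
      ultimately have "(\<Sum>w\<in>words I n. (v (word_map w p) - m (w @ R k))\<^sup>2)
          \<le> 2 * (\<Sum>w\<in>words I n. (v (word_map w p) - m (w @ R (Suc k)))\<^sup>2) + 34 * B * \<theta> ^ n * \<theta> ^ k"
        by (simp add: power_add)
      then have "a k \<le> ennreal (2 * (\<Sum>w\<in>words I n. (v (word_map w p) - m (w @ R (Suc k)))\<^sup>2) + 34 * B * \<theta> ^ n * \<theta> ^ k)"
        unfolding a_def by (rule ennreal_leI)
      then show ?thesis unfolding a_def using B0 \<theta>0 by (simp add: ennreal_plus ennreal_mult sum_nonneg)
    qed
    have "a 0 \<le> ennreal (34 * B * \<theta> ^ n / (1 - 2 * \<theta>))"
      by (rule doubling_ennreal[OF rec prior]) (use B0 \<theta> \<theta>0 in auto)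
    then have "(\<Sum>w\<in>words I n. (v (word_map w p) - m (w @ R 0))\<^sup>2) \<le> 34 * B * \<theta> ^ n / (1 - 2 * \<theta>)"
      unfolding a_def using B0 \<theta> \<theta>0 by (subst (asm) ennreal_le_iff) auto
    then show ?thesis by (simp add: R_def)
  qed
  have PEv: "PE n v \<le> 12 * (34 * B / (1 - 2 * \<theta>)) * \<theta> ^ n" if n: "1 \<le> n" for n
  proof -
    have "PE n v \<le> (\<Sum>w\<in>words I n. 4 * (v (word_map w p1) - m w)\<^sup>2 + 4 * (v (word_map w p2) - m w)\<^sup>2 + 4 * (v (word_map w p3) - m w)\<^sup>2)"
      unfolding wform_def prod_list_one mult_1
    proof (rule sum_mono)
      fix w
      define x y t where "x = v (word_map w p1) - m w" "y = v (word_map w p2) - m w" "t = v (word_map w p3) - m w"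
      note d = this
      have "tri3 1 1 1 (v \<circ> word_map w) (v \<circ> word_map w) = (x - y)\<^sup>2 + (y - t)\<^sup>2 + (x - t)\<^sup>2"
        by (simp add: tri3_def d power2_eq_square)
      also have "\<dots> \<le> 4 * x\<^sup>2 + 4 * y\<^sup>2 + 4 * t\<^sup>2"
        using zero_le_power2[of "x + y"] zero_le_power2[of "y + t"] zero_le_power2[of "x + t"]
        by (simp add: power2_sum power2_diff)
      finally show "tri3 1 1 1 (v \<circ> word_map w) (v \<circ> word_map w) \<le> 4 * (v (word_map w p1) - m w)\<^sup>2 + 4 * (v (word_map w p2) - m w)\<^sup>2 + 4 * (v (word_map w p3) - m w)\<^sup>2"
        by (simp add: d)
    qed
    also have "\<dots> = 4 * (\<Sum>w\<in>words I n. (v (word_map w p1) - m w)\<^sup>2) + 4 * (\<Sum>w\<in>words I n. (v (word_map w p2) - m w)\<^sup>2)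
        + 4 * (\<Sum>w\<in>words I n. (v (word_map w p3) - m w)\<^sup>2)"
      by (simp add: sum.distrib sum_distrib_left)
    also have "\<dots> \<le> 12 * (34 * B / (1 - 2 * \<theta>) * \<theta> ^ n)"
      using vertex[OF n V0_mem(1)] vertex[OF n V0_mem(2)] vertex[OF n V0_mem(3)] by linarith
    finally show ?thesis by simp
  qed
  show ?thesis by (rule that[OF v_cont ae PEv])
qed

subsection \<open>Obstructions above the critical exponents\<close>

text \<open>The seven left and top cells \<open>(0, j)\<close> join \<open>p1\<close> to
  \<open>p3\<close>; Cauchy-Schwarz over them gives the factor \<open>7\<close> per level.\<close>

lemma path13:
  fixes v :: "plane \<Rightarrow> real"
  shows "(v p1 - v p3)\<^sup>2 \<le> 7 ^ n * (\<Sum>w\<in>words I n. (v (word_map w p1) - v (word_map w p3))\<^sup>2)"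
proof (induction n arbitrary: v)
  case (Suc n)
  have left: "(0, j) \<in> I" if "j < 7" for j
    using left_top_I(1)[of j] left_top_I(2,4) that by (cases "j \<le> 4"; cases "j = 5"; cases "j = 6") auto
  have "v p1 - v p3 = (\<Sum>j<7. v (cell_map (0, j) p1) - v (cell_map (0, j) p3))"
    using sum_lessThan_telescope'[of "\<lambda>j. v (q 0 j)" 7] by (simp add: q_corners)
  then have "(v p1 - v p3)\<^sup>2 \<le> (\<Sum>j<7. (v (cell_map (0, j) p1) - v (cell_map (0, j) p3))\<^sup>2) * real (card {..<7::nat})"
    using sum_squared_le_sum_of_squares[of "\<lambda>j. v (cell_map (0, j) p1) - v (cell_map (0, j) p3)" "{..<7::nat}"] by simp
  also have "(\<Sum>j<7. (v (cell_map (0, j) p1) - v (cell_map (0, j) p3))\<^sup>2) = (\<Sum>i\<in>(\<lambda>j. (0, j)) ` {..<7}. (v (cell_map i p1) - v (cell_map i p3))\<^sup>2)"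
    by (subst sum.reindex) (auto simp: inj_on_def)
  also have "\<dots> \<le> (\<Sum>i\<in>I. (v (cell_map i p1) - v (cell_map i p3))\<^sup>2)"
    using left by (intro sum_mono2) auto
  also have "\<dots> \<le> (\<Sum>i\<in>I. 7 ^ n * (\<Sum>w\<in>words I n. (v (cell_map i (word_map w p1)) - v (cell_map i (word_map w p3)))\<^sup>2))"
    using Suc.IH[of "v \<circ> cell_map _"] by (intro sum_mono) simp
  finally show ?case by (simp add: sum_words_Suc sum_distrib_left mult_ac)
qed simp

text \<open>Applies the previous bound inside the cell \<open>w\<close>, where the factor \<open>7 ^
  n\<close> is beaten by \<open>\<theta> ^ n\<close>.\<close>

lemma flat_of_decay:
  fixes v :: "plane \<Rightarrow> real"
  assumes C: "\<And>n. 1 \<le> n \<Longrightarrow> PE n v \<le> C * \<theta> ^ n" and \<theta>: "0 < \<theta>" "7 * \<theta> < 1" and w: "w \<in> words I m"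
  shows "v (word_map w p1) = v (word_map w p3)"
proof -
  have "(v (word_map w p1) - v (word_map w p3))\<^sup>2 \<le> C * \<theta> ^ m * (7 * \<theta>) ^ n" if n: "1 \<le> n" for n
  proof -
    have "(v (word_map w p1) - v (word_map w p3))\<^sup>2 \<le> 7 ^ n * (\<Sum>t\<in>words I n. (v (word_map w (word_map t p1)) - v (word_map w (word_map t p3)))\<^sup>2)"
      using path13[of "v \<circ> word_map w" n] by simp
    also have "\<dots> \<le> 7 ^ n * PE n (v \<circ> word_map w)"
      unfolding wform_def prod_list_one mult_1
      using tri3_edge[OF V0_mem(1,3), of "v \<circ> word_map w \<circ> word_map _"] by (intro mult_left_mono sum_mono) auto
    also have "\<dots> \<le> 7 ^ n * (C * \<theta> ^ (m + n))"
      using PE_cell_le[OF w, of n v] C[of "m + n"] n by (intro mult_left_mono) auto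
    finally show ?thesis by (simp add: power_add power_mult_distrib mult_ac)
  qed
  moreover have "(\<lambda>n. C * \<theta> ^ m * (7 * \<theta>) ^ n) \<longlonglongrightarrow> C * \<theta> ^ m * 0"
    using \<theta> by (intro tendsto_mult tendsto_const LIMSEQ_realpow_zero) auto
  ultimately have "(v (word_map w p1) - v (word_map w p3))\<^sup>2 \<le> C * \<theta> ^ m * 0"
    by (intro LIMSEQ_le_const) blast+
  then show ?thesis by simp
qed

text \<open>For a flat function the increment from \<open>p1\<close> to \<open>p2\<close> is
  \<open>e + f + g\<close>: the increment \<open>e\<close> occurs in two top cells, \<open>f\<close>
  in one, and \<open>g\<close> is spread over seven right cells.  The optimal constant in \<open>(e
  + f + g)\<^sup>2 \<le> c * (2 * e\<^sup>2 + f\<^sup>2 + g\<^sup>2 / 7)\<close> is \<open>1/2 + 1 +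
  7 = 17/2\<close>.\<close>

lemma path12:
  fixes v :: "plane \<Rightarrow> real"
  assumes "\<And>n w. w \<in> words I n \<Longrightarrow> v (word_map w p1) = v (word_map w p3)"
  shows "(v p1 - v p2)\<^sup>2 \<le> (17/2) ^ n * (\<Sum>w\<in>words I n. (v (word_map w p1) - v (word_map w p2))\<^sup>2)"
  using assms
proof (induction n arbitrary: v)
  case (Suc n)
  have flat: "v (cell_map i p1) = v (cell_map i p3)" if "i \<in> I" for i
    using Suc.prems[of "[i]" 1] that by (simp add: words_1)
  define D where "D i = v (cell_map i p1) - v (cell_map i p2)" for i
  have fl: "v (q 0 5) = v (q 0 6)" "v (q 0 6) = v (q 0 7)" "v (q 1 5) = v (q 1 6)"
    using flat[OF left_top_I(2)] flat[OF left_top_I(4)] flat[OF left_top_I(3)] by simp_all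
  have v13: "v p1 = v p3" using Suc.prems[of "[]" 0] by simp
  define e f where "e = v (q 0 5) - v (q 1 5)" "f = v (q 1 5) - v (q 2 5)"
  note ef = this
  have De: "D (0, 5) = e" "D (0, 6) = e" "D (Suc 0, 5) = f"
    using fl by (simp_all add: D_def ef numeral_2_eq_2)
  define g where "g = v (q 2 5) - v p2"
  have "(v p1 - v p2)\<^sup>2 \<le> 17/2 * (\<Sum>i\<in>I. (D i)\<^sup>2)"
  proof -
  have "v p1 - v p2 = e + f + g" using v13 fl(1,2) unfolding ef g_def by (simp add: q_corners)
  moreover have "g\<^sup>2 \<le> 7 * (\<Sum>k=1..9. (D (r k))\<^sup>2)"
  proof -
    define d where "d k = v (z (k - 1)) - v (z k)" for k
    have dk: "d k = vary k * d k \<and> (d k)\<^sup>2 \<le> (D (r k))\<^sup>2" if k: "k \<in> {1..9}" for k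
    proof -
      have d: "d k = v (cell_map (r k) (ea k)) - v (cell_map (r k) (eb k))" using ea(2)[OF k] eb(2)[OF k] by (simp add: d_def)
      show ?thesis using k
        by (cases rule: edge_cases) (use flat[OF r_I[OF k]] d V0_distinct in \<open>auto simp: D_def vary_def power2_commute doubleton_eq_iff\<close>)
    qed
    have "g = (\<Sum>k=1..9. d k)" unfolding d_def sum_telescope9[of "\<lambda>k. v (z k)"] by (simp add: g_def z_ends q_corners)
    also have "\<dots> = (\<Sum>k=1..9. vary k * d k)" using dk by (intro sum.cong) auto
    finally have "g\<^sup>2 \<le> (\<Sum>k=1..9. (vary k)\<^sup>2) * (\<Sum>k=1..9. (d k)\<^sup>2)" by (simp only: Cauchy_Schwarz_ineq_sum)
    also have "(\<Sum>k=1..9. (vary k)\<^sup>2) = 7" unfolding sum_vary[symmetric] by (intro sum.cong) (auto simp: vary_def)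
    also have "(\<Sum>k=1..9. (d k)\<^sup>2) \<le> (\<Sum>k=1..9. (D (r k))\<^sup>2)" using dk by (intro sum_mono) auto
    finally show ?thesis by simp
  qed
  moreover have "(e + f + g)\<^sup>2 \<le> 17/2 * (2 * e\<^sup>2 + f\<^sup>2 + g\<^sup>2 / 7)"
  proof -
    have "17/2 * (2 * e\<^sup>2 + f\<^sup>2 + g\<^sup>2 / 7) - (e + f + g)\<^sup>2
        = 1/2 * (2 * e - f)\<^sup>2 + 7/2 * (2 * e - g / 7)\<^sup>2 + 7 * (f - g / 7)\<^sup>2"
      by (simp add: power2_eq_square field_simps)
    moreover have "0 \<le> 1/2 * (2 * e - f)\<^sup>2 + 7/2 * (2 * e - g / 7)\<^sup>2 + 7 * (f - g / 7)\<^sup>2" by simp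
    ultimately show ?thesis by linarith
  qed
  moreover have "(\<Sum>i\<in>I. (D i)\<^sup>2) = (\<Sum>j<5. (D (0, j))\<^sup>2) + e\<^sup>2 + f\<^sup>2 + e\<^sup>2 + (\<Sum>k=1..9. (D (r k))\<^sup>2)"
    unfolding sum_I De ..
  moreover have "0 \<le> (\<Sum>j<5. (D (0, j))\<^sup>2)" by (intro sum_nonneg) auto
  moreover note calc = calculation
  have last: "17/2 * (2 * e\<^sup>2 + f\<^sup>2 + g\<^sup>2 / 7) \<le> 17/2 * (\<Sum>i\<in>I. (D i)\<^sup>2)"
    using calc(2,4,5) by (intro mult_left_mono) linarith+
  show ?thesis using order_trans[OF calc(3) last] unfolding calc(1) .
  qed
  also have "(\<Sum>i\<in>I. (D i)\<^sup>2) \<le> (\<Sum>i\<in>I. (17/2) ^ n * (\<Sum>w\<in>words I n. (v (cell_map i (word_map w p1)) - v (cell_map i (word_map w p2)))\<^sup>2))"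
  proof (rule sum_mono)
    fix i assume i: "i \<in> I"
    have "(v \<circ> cell_map i) (word_map w p1) = (v \<circ> cell_map i) (word_map w p3)" if "w \<in> words I k" for k w
      using Suc.prems[of "i # w" "Suc k"] that i by (simp add: words_def)
    from Suc.IH[OF this] show "(D i)\<^sup>2 \<le> (17/2) ^ n * (\<Sum>w\<in>words I n. (v (cell_map i (word_map w p1)) - v (cell_map i (word_map w p2)))\<^sup>2)"
      by (simp add: D_def)
  qed
  finally show ?case by (simp add: sum_words_Suc mult.assoc flip: sum_distrib_left)
qed simp

text \<open>All corners of all cells carry the same value, and corners are dense.\<close>

lemma constant_of_decay:
  fixes v :: "plane \<Rightarrow> real"
  assumes v: "continuous_on K v" and C: "\<And>n. 1 \<le> n \<Longrightarrow> PE n v \<le> C * \<theta> ^ n" and \<theta>: "0 < \<theta>" "17/2 * \<theta> < 1" and x: "x \<in> K"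
  shows "v x = v p1"
proof -
  have flat: "v (word_map w p1) = v (word_map w p3)" if "w \<in> words I m" for w m
    using flat_of_decay[OF C \<theta>(1) _ that] \<theta> by simp
  have flat2: "v (word_map w p1) = v (word_map w p2)" if w: "w \<in> words I m" for w m
  proof -
    have "(v (word_map w p1) - v (word_map w p2))\<^sup>2 \<le> C * \<theta> ^ m * (17/2 * \<theta>) ^ n" if n: "1 \<le> n" for n
    proof -
      have fw: "(v \<circ> word_map w) (word_map t p1) = (v \<circ> word_map w) (word_map t p3)" if "t \<in> words I k" for t k
        using flat[OF words_append[OF w that]] by (simp add: word_map_append)
      have "(v (word_map w p1) - v (word_map w p2))\<^sup>2 \<le> (17/2) ^ n * (\<Sum>t\<in>words I n. (v (word_map w (word_map t p1)) - v (word_map w (word_map t p2)))\<^sup>2)"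
        using path12[of "v \<circ> word_map w" n, OF fw] by simp
      also have "\<dots> \<le> (17/2) ^ n * PE n (v \<circ> word_map w)"
        unfolding wform_def prod_list_one mult_1
        using tri3_edge[OF V0_mem(1,2), of "v \<circ> word_map w \<circ> word_map _"] by (intro mult_left_mono sum_mono) auto
      also have "\<dots> \<le> (17/2) ^ n * (C * \<theta> ^ (m + n))"
        using PE_cell_le[OF w, of n v] C[of "m + n"] n by (intro mult_left_mono) auto
      finally show ?thesis by (simp only: power_add power_mult_distrib mult_ac)
    qed
    moreover have "(\<lambda>n. C * \<theta> ^ m * (17/2 * \<theta>) ^ n) \<longlonglongrightarrow> C * \<theta> ^ m * 0"
      using \<theta> by (intro tendsto_mult tendsto_const LIMSEQ_realpow_zero) auto
    ultimately have "(v (word_map w p1) - v (word_map w p2))\<^sup>2 \<le> C * \<theta> ^ m * 0"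
      by (intro LIMSEQ_le_const) blast+
    then show ?thesis by simp
  qed
  have eqv: "v (word_map w p) = v (word_map w p1)" if "w \<in> words I m" "p \<in> V0" for w m p
    using flat[OF that(1)] flat2[OF that(1)] that(2) unfolding V0_def by auto
  have "\<bar>v (word_map [] x) - v (word_map [] p1)\<bar> \<le> 0 * (1/2) ^ 0 / (1 - 1/2)"
  proof (rule chain_bound[OF v])
    fix m w i assume w: "w \<in> words I m" and i: "i \<in> I"
    have "\<bar>(v \<circ> word_map w) (cell_map i p1) - (v \<circ> word_map w) p1\<bar> \<le> 20 * 0"
    proof (rule level1_path[OF _ i V0_mem(1)])
      fix j p p' assume j: "j \<in> I" "p \<in> V0" "p' \<in> V0"
      have "w @ [j] \<in> words I (m + 1)" using words_append[OF w, of "[j]" 1] j by (simp add: words_1)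
      from eqv[OF this j(2)] eqv[OF this j(3)]
      show "\<bar>(v \<circ> word_map w) (cell_map j p) - (v \<circ> word_map w) (cell_map j p')\<bar> \<le> 0" by (simp add: word_map_append)
    qed
    then show "\<bar>v (word_map (w @ [i]) p1) - v (word_map w p1)\<bar> \<le> 0 * (1/2) ^ m" by (simp add: word_map_append)
  qed (use x in auto)
  then show ?thesis by simp
qed


subsection \<open>Building functions with decaying energies\<close>

lemma tri3_square: "tri3 1 1 1 u u = (u p1 - u p2)\<^sup>2 + (u p2 - u p3)\<^sup>2 + (u p1 - u p3)\<^sup>2"
  by (simp add: tri3_def power2_eq_square)

lemma PE_eq: "PE n u = (\<Sum>w\<in>words I n. tri3 1 1 1 (u \<circ> word_map w) (u \<circ> word_map w))"
  by (simp add: wform_def prod_list_one)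

lemma decay_cell:
  assumes "decay \<theta> u" "w \<in> words I m"
  shows "decay \<theta> (u \<circ> word_map w)"
proof -
  obtain C where u: "continuous_on K u" and C: "\<And>n. PE n u \<le> C * \<theta> ^ n" using assms(1) by (auto simp: decay_def)
  have "continuous_on K (u \<circ> word_map w)"
    using u word_map_K[OF assms(2)] by (intro continuous_on_compose continuous_on_word_map) (auto elim: continuous_on_subset)
  moreover have "PE n (u \<circ> word_map w) \<le> C * \<theta> ^ m * \<theta> ^ n" for n
    using order_trans[OF PE_cell_le[OF assms(2)] C[of "m + n"]] by (simp add: power_add mult.assoc)
  ultimately show ?thesis unfolding decay_def by blast
qed

text \<open>Lipschitz operations act on the increments, so they preserve the decay rate.\<close>

lemma decay_combine:
  fixes f :: "real \<Rightarrow> real \<Rightarrow> real"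
  assumes u: "decay \<theta> u" and v: "decay \<theta> v"
    and f: "\<And>a b c d. (f a b - f c d)\<^sup>2 \<le> L * (a - c)\<^sup>2 + L * (b - d)\<^sup>2"
    and cont: "continuous_on K (\<lambda>x. f (u x) (v x))"
  shows "decay \<theta> (\<lambda>x. f (u x) (v x))"
proof -
  have L: "0 \<le> L" using f[of 0 0 1 0] order_trans[OF zero_le_power2 f[of 1 0 0 0]] by simp
  obtain C where C: "\<And>n. PE n u \<le> C * \<theta> ^ n" using u by (auto simp: decay_def)
  obtain D where D: "\<And>n. PE n v \<le> D * \<theta> ^ n" using v by (auto simp: decay_def)
  have "PE n (\<lambda>x. f (u x) (v x)) \<le> (L * C + L * D) * \<theta> ^ n" for n
  proof -
    have "PE n (\<lambda>x. f (u x) (v x)) \<le> (\<Sum>w\<in>words I n. L * tri3 1 1 1 (u \<circ> word_map w) (u \<circ> word_map w) + L * tri3 1 1 1 (v \<circ> word_map w) (v \<circ> word_map w))"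
      unfolding PE_eq
    proof (rule sum_mono)
      fix w
      show "tri3 1 1 1 ((\<lambda>x. f (u x) (v x)) \<circ> word_map w) ((\<lambda>x. f (u x) (v x)) \<circ> word_map w)
         \<le> L * tri3 1 1 1 (u \<circ> word_map w) (u \<circ> word_map w) + L * tri3 1 1 1 (v \<circ> word_map w) (v \<circ> word_map w)"
        using add_mono[OF add_mono[OF f[of "u (word_map w p1)" "v (word_map w p1)" "u (word_map w p2)" "v (word_map w p2)"]
          f[of "u (word_map w p2)" "v (word_map w p2)" "u (word_map w p3)" "v (word_map w p3)"]]
          f[of "u (word_map w p1)" "v (word_map w p1)" "u (word_map w p3)" "v (word_map w p3)"]]
        unfolding tri3_square by (simp add: distrib_left)
    qed
    also have "\<dots> = L * PE n u + L * PE n v" unfolding PE_eq by (simp add: sum.distrib sum_distrib_left)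
    also have "\<dots> \<le> L * (C * \<theta> ^ n) + L * (D * \<theta> ^ n)" using L C D by (intro add_mono mult_left_mono)
    finally show ?thesis by (simp add: algebra_simps)
  qed
  then show ?thesis using cont by (auto simp: decay_def)
qed

lemma decay_max:
  assumes u: "decay \<theta> u" and v: "decay \<theta> v"
  shows "decay \<theta> (\<lambda>x. max (u x) (v x))"
proof (rule decay_combine[OF u v, where f = max and L = 1])
  fix a b c d :: real
  have "\<bar>max a b - max c d\<bar> \<le> \<bar>a - c\<bar> \<or> \<bar>max a b - max c d\<bar> \<le> \<bar>b - d\<bar>" by (auto simp: max_def abs_if)
  then have "(max a b - max c d)\<^sup>2 \<le> (a - c)\<^sup>2 \<or> (max a b - max c d)\<^sup>2 \<le> (b - d)\<^sup>2" by (simp only: abs_le_square_iff)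
  then show "(max a b - max c d)\<^sup>2 \<le> 1 * (a - c)\<^sup>2 + 1 * (b - d)\<^sup>2"
    using zero_le_power2[of "a - c"] zero_le_power2[of "b - d"] by linarith
qed (use u v in \<open>auto simp: decay_def intro: continuous_on_max\<close>)

lemma decay_cmult: assumes "decay \<theta> u" shows "decay \<theta> (\<lambda>x. c * u x)"
proof (rule decay_combine[OF assms assms, where f = "\<lambda>a b. c * a" and L = "c\<^sup>2"])
  show "(c * a - c * a')\<^sup>2 \<le> c\<^sup>2 * (a - a')\<^sup>2 + c\<^sup>2 * (b - d)\<^sup>2" for a b a' d
  proof -
    have "(c * a - c * a')\<^sup>2 = c\<^sup>2 * (a - a')\<^sup>2" by (simp add: power2_eq_square algebra_simps)
    then show ?thesis by simp
  qed
  show "continuous_on K (\<lambda>x. c * u x)" using assms by (auto simp: decay_def intro: continuous_intros)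
qed

lemma decay_clamp: assumes "decay \<theta> u" shows "decay \<theta> (\<lambda>x. max 0 (min 1 (u x)))"
proof (rule decay_combine[OF assms assms, where f = "\<lambda>a b. max 0 (min 1 a)" and L = 1])
  fix a b a' d :: real
  have "\<bar>max 0 (min 1 a) - max 0 (min 1 a')\<bar> \<le> \<bar>a - a'\<bar>" by (auto simp: max_def min_def abs_if)
  then have "(max 0 (min 1 a) - max 0 (min 1 a'))\<^sup>2 \<le> (a - a')\<^sup>2" by (simp only: abs_le_square_iff)
  then show "(max 0 (min 1 a) - max 0 (min 1 a'))\<^sup>2 \<le> 1 * (a - a')\<^sup>2 + 1 * (b - d)\<^sup>2"
    using zero_le_power2[of "b - d"] by linarith
qed (use assms in \<open>auto simp: decay_def intro!: continuous_intros\<close>)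

lemma decay_const: "0 < \<theta> \<Longrightarrow> decay \<theta> (\<lambda>x. c)"
  unfolding decay_def by (auto simp: PE_eq tri3_def intro!: exI[of _ 0])

text \<open>Beyond the level \<open>N\<close> the energies add up over the pieces; the finitely many
  lower levels only affect the constant.\<close>

lemma glue_decay:
  fixes u :: "plane \<Rightarrow> real"
  assumes \<theta>: "0 < \<theta>" and h: "\<And>w. w \<in> words I N \<Longrightarrow> decay \<theta> (h w)"
    and hu: "\<And>w p. w \<in> words I N \<Longrightarrow> p \<in> V0 \<Longrightarrow> h w p = u (word_map w p)"
  obtains v where "decay \<theta> v" "\<And>w x. w \<in> words I N \<Longrightarrow> x \<in> K \<Longrightarrow> v (word_map w x) = h w x"
proof -
  obtain v where v: "\<And>w x. w \<in> words I N \<Longrightarrow> x \<in> K \<Longrightarrow> v (word_map w x) = h w x"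
    using glue[of N h u] hu by blast
  have "\<forall>w\<in>words I N. \<exists>C. \<forall>n. PE n (h w) \<le> C * \<theta> ^ n" using h by (simp add: decay_def)
  then obtain C where C: "\<And>w n. w \<in> words I N \<Longrightarrow> PE n (h w) \<le> C w * \<theta> ^ n" by metis
  define S where "S = (\<Sum>w\<in>words I N. C w)"
  have Cw: "0 \<le> C w" if "w \<in> words I N" for w
    using order_trans[OF PE_nonneg C[OF that, of 0]] by simp
  then have S: "0 \<le> S" by (simp add: S_def sum_nonneg)
  have big: "PE (N + k) v \<le> S * \<theta> ^ k" for k
  proof -
    have "PE (N + k) v = (\<Sum>w\<in>words I N. PE k (v \<circ> word_map w))" by (simp add: wform_add prod_list_one)
    also have "\<dots> = (\<Sum>w\<in>words I N. PE k (h w))" using v by (intro sum.cong refl wform_cong) auto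
    also have "\<dots> \<le> (\<Sum>w\<in>words I N. C w * \<theta> ^ k)" using C by (intro sum_mono)
    finally show ?thesis by (simp add: S_def sum_distrib_right)
  qed
  define D where "D = S / \<theta> ^ N + (\<Sum>n<N. PE n v / \<theta> ^ n)"
  have nn: "0 \<le> PE n v / \<theta> ^ n" for n using PE_nonneg \<theta> by (simp add: divide_nonneg_pos)
  have "PE n v \<le> D * \<theta> ^ n" for n
  proof (cases "n < N")
    case True
    have "PE n v / \<theta> ^ n \<le> (\<Sum>n<N. PE n v / \<theta> ^ n)" using True nn by (intro member_le_sum) auto
    also have "\<dots> \<le> D" using S \<theta> by (simp add: D_def)
    finally show ?thesis using \<theta> by (simp add: pos_divide_le_eq)
  next
    case False
    then obtain k where k: "n = N + k" using le_Suc_ex[of N n] by auto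
    have "S * \<theta> ^ k = S / \<theta> ^ N * \<theta> ^ n" using \<theta> by (simp add: k power_add)
    also have "\<dots> \<le> D * \<theta> ^ n" using \<theta> nn by (intro mult_right_mono) (auto simp: D_def sum_nonneg)
    finally show ?thesis using big[of k] k by simp
  qed
  moreover have "continuous_on K v"
  proof (rule continuous_on_cells)
    fix w assume w: "w \<in> words I N"
    have "continuous_on K (h w)" using h[OF w] by (simp add: decay_def)
    then show "continuous_on K (v \<circ> word_map w)"
      using v[OF w] by (simp cong: continuous_on_cong)
  qed
  ultimately have "decay \<theta> v" unfolding decay_def by blast
  then show ?thesis using v that by blast
qed

lemma uniform_cells:
  fixes g :: "plane \<Rightarrow> real"
  assumes g: "continuous_on K g" and e: "0 < e"
  obtains N where "\<And>w x. w \<in> words I N \<Longrightarrow> x \<in> K \<Longrightarrow> \<bar>g (word_map w x) - g (word_map w p1)\<bar> < e"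
proof -
  obtain d where d: "0 < d" "\<And>x y. x \<in> K \<Longrightarrow> y \<in> K \<Longrightarrow> dist y x < d \<Longrightarrow> dist (g y) (g x) < e"
    using compact_uniformly_continuous[OF g compact_K] e unfolding uniformly_continuous_on_def by metis
  obtain N where "(1/7) ^ N < d / 2" using real_arch_pow_inv[of "d/2" "1/7"] d by auto
  then have N: "5/4 / 7 ^ N < d" using d by (simp add: power_divide field_simps)
  show ?thesis
  proof (rule that[of N])
    fix w x assume w: "w \<in> words I N" and x: "x \<in> K"
    have "dist (word_map w x) (word_map w p1) < d"
      using dist_same_cell[OF w, of "word_map w x" "word_map w p1"] x p_K N by auto
    then show "\<bar>g (word_map w x) - g (word_map w p1)\<bar> < e"
      using d(2)[of "word_map w p1" "word_map w x"] word_map_K[OF w] x p_K by (simp add: dist_real_def)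
  qed
qed

definition flat_spec :: "((plane \<Rightarrow> real) \<Rightarrow> plane \<Rightarrow> real) \<Rightarrow> real \<Rightarrow> bool" where
  "flat_spec H C \<longleftrightarrow> 0 \<le> C \<and> (\<forall>a. \<forall>p\<in>V0. H a p = a p) \<and>
     (\<forall>a. \<forall>x\<in>K. \<bar>H a x - a p1\<bar> \<le> C * osc a) \<and> (\<forall>a. decay (1/7) (H a)) \<and>
     (\<forall>a. a p1 = a p3 \<longrightarrow> decay (2/17) (H a)) \<and>
     (\<forall>a n. a p1 = a p3 \<longrightarrow> PE n (H a) = 2 * (2/17) ^ n * (a p2 - a p1)\<^sup>2) \<and>
     (\<forall>a n w. a p1 = a p3 \<longrightarrow> w \<in> words I n \<longrightarrow> H a (word_map w p1) = H a (word_map w p3))"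

lemma flat_specD:
  assumes "flat_spec H C"
  shows "0 \<le> C"
    and "\<And>a p. p \<in> V0 \<Longrightarrow> H a p = a p"
    and "\<And>a x. x \<in> K \<Longrightarrow> \<bar>H a x - a p1\<bar> \<le> C * osc a"
    and "\<And>a. decay (1/7) (H a)"
    and "\<And>a. a p1 = a p3 \<Longrightarrow> decay (2/17) (H a)"
    and "\<And>a n. a p1 = a p3 \<Longrightarrow> PE n (H a) = 2 * (2/17) ^ n * (a p2 - a p1)\<^sup>2"
    and "\<And>a n w. a p1 = a p3 \<Longrightarrow> w \<in> words I n \<Longrightarrow> H a (word_map w p1) = H a (word_map w p3)"
proof -
  note * = assms[unfolded flat_spec_def]
  show "0 \<le> C"
    by (rule *[THEN conjunct1, rule_format])
  show "H a p = a p" if "p \<in> V0" for a p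
    using that
    by (rule *[THEN conjunct2, THEN conjunct1, rule_format])
  show "\<bar>H a x - a p1\<bar> \<le> C * osc a" if "x \<in> K" for a x
    using that
    by (rule *[THEN conjunct2, THEN conjunct2, THEN conjunct1, rule_format])
  show "decay (1/7) (H a)" for a
    by (rule *[THEN conjunct2, THEN conjunct2, THEN conjunct2, THEN conjunct1, rule_format])
  show "decay (2/17) (H a)" if "a p1 = a p3" for a
    using that
    by (rule *[THEN conjunct2, THEN conjunct2, THEN conjunct2, THEN conjunct2, THEN conjunct1, rule_format])
  show "PE n (H a) = 2 * (2/17) ^ n * (a p2 - a p1)\<^sup>2" if "a p1 = a p3" for a n
    using that
    by (rule *[THEN conjunct2, THEN conjunct2, THEN conjunct2, THEN conjunct2, THEN conjunct2, THEN conjunct1, rule_format])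
  show "H a (word_map w p1) = H a (word_map w p3)" if "a p1 = a p3" "w \<in> words I n" for a n w
    using that
    by (rule *[THEN conjunct2, THEN conjunct2, THEN conjunct2, THEN conjunct2, THEN conjunct2, THEN conjunct2, rule_format])
qed

lemma flat_decay_functions: "\<exists>H C. flat_spec H C"
proof -
  obtain H C where *: "0 \<le> C" "\<forall>a. continuous_on K (H a)" "\<forall>a. \<forall>p\<in>V0. H a p = a p"
    "\<forall>a. \<forall>x\<in>K. \<bar>H a x - a p1\<bar> \<le> C * osc a"
    "\<forall>n a. PE n (H a) = qA n * (a p3 - a p1)\<^sup>2 + qB n * (a p3 - a p1) * (a p2 - a p3) + qG n * (a p2 - a p3)\<^sup>2"
    "\<forall>n w a. a p1 = a p3 \<longrightarrow> w \<in> words I n \<longrightarrow> H a (word_map w p1) = H a (word_map w p3)"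
    using besov_functions_exist by (elim exE conjE) (rule that; assumption)
  note C = *(1) and cont = *(2)[rule_format] and bd = *(3)[rule_format] and near = *(4)[rule_format]
    and PEH = *(5)[rule_format] and flat = *(6)[rule_format]
  have "decay (1/7) (H a)" for a
  proof -
    define d b where "d = a p3 - a p1" "b = a p2 - a p3"
    have "PE n (H a) \<le> (262/63 * d\<^sup>2 + 2 * \<bar>d * b\<bar> + 2 * b\<^sup>2) * (1/7) ^ n" for n
    proof -
      have s: "(2/119 :: real) ^ n \<le> (1/7) ^ n" "(2/17 :: real) ^ n \<le> (1/7) ^ n" by (intro power_mono; simp)+
      have p: "0 \<le> (2/119 :: real) ^ n" "0 \<le> (2/17 :: real) ^ n" by simp_all
      have "qA n * d\<^sup>2 \<le> 262/63 * (1/7) ^ n * d\<^sup>2" unfolding qA_def using p by (intro mult_right_mono) (linarith, simp)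
      moreover have "qB n * (d * b) \<le> 2 * (1/7) ^ n * \<bar>d * b\<bar>"
      proof -
        have "qB n * (d * b) \<le> qB n * \<bar>d * b\<bar>" using p by (intro mult_left_mono) (auto simp: qB_def)
        also have "\<dots> \<le> 2 * (1/7) ^ n * \<bar>d * b\<bar>" using s unfolding qB_def by (intro mult_right_mono) (linarith, simp)
        finally show ?thesis .
      qed
      moreover have "qG n * b\<^sup>2 \<le> 2 * (1/7) ^ n * b\<^sup>2" unfolding qG_def using s by (intro mult_right_mono) auto
      ultimately show ?thesis unfolding PEH d_b_def[symmetric] by (simp add: algebra_simps)
    qed
    then show ?thesis unfolding decay_def using cont by blast
  qed
  note dec1 = this
  have eq: "PE n (H a) = 2 * (2/17) ^ n * (a p2 - a p1)\<^sup>2" if "a p1 = a p3" for a n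
    using that by (simp add: PEH qG_def)
  have dec2: "decay (2/17) (H a)" if "a p1 = a p3" for a
    unfolding decay_def using cont eq[OF that] by (auto intro!: exI[of _ "2 * (a p2 - a p1)\<^sup>2"])
  have "flat_spec H C"
    unfolding flat_spec_def by (intro conjI allI ballI impI C bd near dec1 dec2 eq flat)
  then show ?thesis by blast
qed

text \<open>On each small cell take the self-similar function with the corner values of
  \<open>g\<close>.\<close>

lemma decay_dense_C:
  fixes g :: "plane \<Rightarrow> real"
  assumes g: "continuous_on K g" and e: "0 < e"
  shows "\<exists>u. decay (1/7) u \<and> (\<forall>x\<in>K. \<bar>g x - u x\<bar> < e)"
proof -
  obtain H C where "flat_spec H C" using flat_decay_functions by blast
  note C = flat_specD(1)[OF this] and bd = flat_specD(2)[OF this] and near = flat_specD(3)[OF this]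
    and dec1 = flat_specD(4)[OF this] and dec = flat_specD(5)[OF this]
  (* Chosen such that e' from the oscillation of g and 2 * C * e' from H add up to less than e. *)
  define e' where "e' = e / (2 * C + 2)"
  have e': "0 < e'" using e C by (simp add: e'_def)
  obtain N where N: "\<And>w x. w \<in> words I N \<Longrightarrow> x \<in> K \<Longrightarrow> \<bar>g (word_map w x) - g (word_map w p1)\<bar> < e'"
    using uniform_cells[OF g e'] by blast
  obtain u where u: "decay (1/7) u" "\<And>w x. w \<in> words I N \<Longrightarrow> x \<in> K \<Longrightarrow> u (word_map w x) = H (g \<circ> word_map w) x"
    by (rule glue_decay[of "1/7" N "\<lambda>w. H (g \<circ> word_map w)" g]) (use dec1 bd in auto)
  have "\<bar>g x - u x\<bar> < e" if "x \<in> K" for x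
  proof -
    obtain w y where w: "w \<in> words I N" "y \<in> K" "x = word_map w y" using K_words[OF \<open>x \<in> K\<close>] by blast
    have "osc (g \<circ> word_map w) \<le> 2 * e'"
      using N[OF w(1) p_K(1)] N[OF w(1) p_K(2)] N[OF w(1) p_K(3)] by (intro osc_leI) auto
    then have "C * osc (g \<circ> word_map w) \<le> C * (2 * e')" using C by (rule mult_left_mono)
    then have "\<bar>H (g \<circ> word_map w) y - g (word_map w p1)\<bar> \<le> C * (2 * e')"
      using near[OF w(2), of "g \<circ> word_map w"] by simp
    then have "\<bar>g x - u x\<bar> < e' + C * (2 * e')" using N[OF w(1,2)] u(2)[OF w(1,2)] unfolding w(3) by linarith
    also have "\<dots> \<le> (2 * C + 2) * e'" using e' by (simp add: algebra_simps)
    also have "\<dots> = e" using C by (simp add: e'_def)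
    finally show ?thesis .
  qed
  then show ?thesis using u(1) by blast
qed

text \<open>Set the value \<open>1\<close> on the cell \<open>(1,5)\<close> and along the right
  chain until a cell crossed from \<open>p1\<close> to \<open>p2\<close>, and \<open>0\<close>
  afterwards and on the left.  The descent and the ascent happen in flat cells only, hence at the
  rate \<open>2/17\<close>.\<close>

lemma bump_function:
  obtains t where "decay (2/17) t" "\<And>x. x \<in> K \<Longrightarrow> 0 \<le> t x" "\<And>x. x \<in> K \<Longrightarrow> t x \<le> 1" "\<And>p. p \<in> V0 \<Longrightarrow> t p = 0"
    "\<And>x. x \<in> K \<Longrightarrow> t (cell_map (Suc 0, 5) x) = 1"
proof -
  obtain H C where "flat_spec H C" using flat_decay_functions by blast
  note C = flat_specD(1)[OF this] and bd = flat_specD(2)[OF this] and near = flat_specD(3)[OF this]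
    and dec1 = flat_specD(4)[OF this] and dec = flat_specD(5)[OF this]
  obtain k0 where k0: "k0 \<in> {1..9}" "{ea k0, eb k0} = {p1, p2}" using ex_edge(1) by blast
  define Z where "Z k = (if k < k0 then 1 else 0 :: real)" for k
  define Zh where "Zh k = (if k = k0 then if ea k0 = p1 then 1 else 0 else Z k)" for k
  obtain u where u: "\<And>j. j < 5 \<Longrightarrow> u (cell_map (0, j) p1) = 0 \<and> u (cell_map (0, j) p2) = 0 \<and> u (cell_map (0, j) p3) = 0"
    "u (cell_map (0, 5) p1) = 0" "u (cell_map (0, 5) p2) = 1" "u (cell_map (0, 5) p3) = 0"
    "u (cell_map (Suc 0, 5) p1) = 1" "u (cell_map (Suc 0, 5) p2) = Z 0" "u (cell_map (Suc 0, 5) p3) = 1"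
    "u (cell_map (0, 6) p1) = 0" "u (cell_map (0, 6) p2) = 1" "u (cell_map (0, 6) p3) = 0"
    "\<And>k. k \<in> {1..9} \<Longrightarrow> u (cell_map (r k) (ea k)) = Z (k - 1) \<and> u (cell_map (r k) (eb k)) = Z k
        \<and> u (cell_map (r k) (eh k)) = Zh k"
    "u p1 = 0" "u p2 = Z 9" "u p3 = 0"
    by (rule level1_function[of "\<lambda>_. 0" "\<lambda>_. 0" 1 0 Z 1 0 Zh]) blast
  have Z09: "Z 0 = 1" "Z 9 = 0" using k0(1) by (auto simp: Z_def)
  have flat: "u (cell_map i p1) = u (cell_map i p3)" if "i \<in> I" for i
    using that
  proof (cases rule: I_cases)
    case (5 k)
    note uk = u(11)[OF \<open>k \<in> {1..9}\<close>]
    show ?thesis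
    proof (cases "k = k0")
      case True
      show ?thesis using \<open>k \<in> {1..9}\<close>
        by (cases rule: edge_cases) (use uk True k0 5 in \<open>auto simp: Zh_def Z_def doubleton_eq_iff\<close>)
    next
      case False
      have "Z (k - 1) = Z k" using False 5(1) by (auto simp: Z_def)
      then have "u (cell_map (r k) p) = Z k" if "p \<in> V0" for p
      proof -
        have "p = ea k \<or> p = eb k \<or> p = eh k" using that eh(4)[OF \<open>k \<in> {1..9}\<close>] by blast
        then show ?thesis using uk False \<open>Z (k - 1) = Z k\<close> by (auto simp: Zh_def)
      qed
      then show ?thesis using 5 by simp
    qed
  qed (use u in auto)
  obtain v where v: "decay (2/17) v" "\<And>w x. w \<in> words I 1 \<Longrightarrow> x \<in> K \<Longrightarrow> v (word_map w x) = H (u \<circ> word_map w) x"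
  proof (rule glue_decay[of "2/17" 1 "\<lambda>w. H (u \<circ> word_map w)" u])
    fix w assume "w \<in> words I 1"
    then show "decay (2/17) (H (u \<circ> word_map w))" using flat by (intro dec) (auto simp: words_1)
  qed (use bd in auto)
  have v1: "v (cell_map i x) = H (u \<circ> cell_map i) x" if "i \<in> I" "x \<in> K" for i x
    using v(2)[of "[i]" x] that by (simp add: words_1)
  have vV0: "v p = 0" if pV: "p \<in> V0" for p
  proof -
    obtain i where i: "i \<in> I" "cell_map i p = p" using pV corner_I corner_fixed unfolding V0_def by blast
    have "p \<in> K" using that V0_K by blast
    from v1[OF i(1) this] have "v p = u p" using bd[OF that, of "u \<circ> cell_map i"] i by simp
    then show ?thesis using that u(12-14) Z09 unfolding V0_def by auto
  qed
  have vB: "v (cell_map (Suc 0, 5) x) = 1" if "x \<in> K" for x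
  proof -
    have "osc (u \<circ> cell_map (Suc 0, 5)) \<le> 0" using u(5-7) Z09 by (intro osc_leI) auto
    then have "C * osc (u \<circ> cell_map (Suc 0, 5)) \<le> C * 0" using C by (rule mult_left_mono)
    then show ?thesis using near[OF that, of "u \<circ> cell_map (Suc 0, 5)"] u(5) v1[OF left_top_I(3) that] by simp
  qed
  show ?thesis
    by (rule that[OF decay_clamp[OF v(1)]]) (use vV0 vB in auto)
qed

text \<open>Iterating the bump: the exceptional set of \<^term>\<open>w\<close> are the words of length \<^term>\<open>M\<close> avoiding one
  fixed cell, and these cover only a fraction \<open>(16/17)^M\<close> of the measure.\<close>

lemma cutoff_function:
  "\<exists>w. decay (2/17) w \<and> (\<forall>x\<in>K. 0 \<le> w x \<and> w x \<le> 1) \<and> (\<forall>p\<in>V0. w p = 0) \<and>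
     (\<forall>t\<in>words I M. (Suc 0, 5) \<in> set t \<longrightarrow> (\<forall>x\<in>K. w (word_map t x) = 1))"
proof (induction M)
  case 0
  have "decay (2/17) (\<lambda>x. 0)" by (rule decay_const) simp
  then show ?case by (intro exI[of _ "\<lambda>x. 0"]) auto
next
  case (Suc M)
  then obtain w where w: "decay (2/17) w" "\<And>x. x \<in> K \<Longrightarrow> 0 \<le> w x \<and> w x \<le> 1" "\<And>p. p \<in> V0 \<Longrightarrow> w p = 0"
    "\<And>t x. t \<in> words I M \<Longrightarrow> (Suc 0, 5) \<in> set t \<Longrightarrow> x \<in> K \<Longrightarrow> w (word_map t x) = 1" by blast
  obtain b where b: "decay (2/17) b" "\<And>x. x \<in> K \<Longrightarrow> 0 \<le> b x" "\<And>x. x \<in> K \<Longrightarrow> b x \<le> 1" "\<And>p. p \<in> V0 \<Longrightarrow> b p = 0"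
    "\<And>x. x \<in> K \<Longrightarrow> b (cell_map (Suc 0, 5) x) = 1" using bump_function by blast
  define h where "h s = (if s = [(Suc 0, 5)] then (\<lambda>x. 1) else (\<lambda>x. max ((b \<circ> word_map s) x) (w x)))" for s
  have V0K: "p \<in> K" if "p \<in> V0" for p using that V0_K by blast
  obtain v where v: "decay (2/17) v" "\<And>s x. s \<in> words I 1 \<Longrightarrow> x \<in> K \<Longrightarrow> v (word_map s x) = h s x"
  proof (rule glue_decay[of "2/17" 1 h b])
    fix s assume s: "s \<in> words I 1"
    show "decay (2/17) (h s)"
      unfolding h_def using decay_max[OF decay_cell[OF b(1) s] w(1)] by (simp add: decay_const)
    fix p assume p: "p \<in> V0"
    have "0 \<le> b (word_map s p)" using b(2) word_map_K[OF s V0K[OF p]] by blast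
    then show "h s p = b (word_map s p)" using w(3)[OF p] b(5)[OF V0K[OF p]] by (simp add: h_def)
  qed (simp, blast)
  have v1: "v (cell_map i x) = (if i = (Suc 0, 5) then 1 else max (b (cell_map i x)) (w x))" if "i \<in> I" "x \<in> K" for i x
    using v(2)[of "[i]" x] that by (simp add: words_1 h_def)
  have "0 \<le> v x \<and> v x \<le> 1" if xK: "x \<in> K" for x
  proof -
    obtain s y where s: "s \<in> words I 1" "y \<in> K" "x = word_map s y" using K_words[OF xK] by blast
    then obtain i where i: "i \<in> I" "x = cell_map i y" by (auto simp: words_1)
    have "cell_map i y \<in> K" using i xK by simp
    then show ?thesis unfolding i(2) v1[OF i(1) s(2)] using w(2)[OF s(2)] b(2,3) by auto
  qed
  moreover have "v p = 0" if pV: "p \<in> V0" for p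
  proof -
    obtain i where i: "i \<in> I" "cell_map i p = p" "i \<noteq> (Suc 0, 5)"
    proof -
      have "\<exists>i\<in>I. cell_map i p = p" using pV corner_I corner_fixed unfolding V0_def by blast
      then obtain i where i: "i \<in> I" "cell_map i p = p" by blast
      moreover have "i \<noteq> (Suc 0, 5)" using b(5)[OF V0K[OF pV]] b(4)[OF pV] i(2) by auto
      ultimately show ?thesis by (rule that)
    qed
    then show ?thesis using v1[OF i(1) V0K[OF that]] w(3)[OF that] b(4)[OF that] by simp
  qed
  moreover have "v (word_map t x) = 1" if t: "t \<in> words I (Suc M)" "(Suc 0, 5) \<in> set t" and x: "x \<in> K" for t x
  proof -
    obtain i s where s: "t = i # s" "i \<in> I" "s \<in> words I M" using t(1) by (cases t) (auto simp: words_def)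
    have sK: "word_map s x \<in> K" by (rule word_map_K[OF s(3) x])
    show ?thesis
    proof (cases "i = (Suc 0, 5)")
      case True
      then show ?thesis using v1[OF s(2) sK] s(1) by simp
    next
      case False
      then have "w (word_map s x) = 1" using w(4)[OF s(3) _ x] t(2) s(1) by simp
      moreover have "b (cell_map i (word_map s x)) \<le> 1" using b(3) word_map_K[OF t(1) x] s(1) by simp
      ultimately show ?thesis using v1[OF s(2) sK] s(1) False by simp
    qed
  qed
  ultimately show ?case using v(1) by blast
qed

text \<open>On each small cell the continuous function is nearly constant and is replaced by that
  constant times a cutoff.\<close>

lemma decay_dense_L2:
  fixes g :: "plane \<Rightarrow> real"
  assumes g: "continuous_on K g" and e: "0 < e"
  shows "\<exists>u. decay (2/17) u \<and> sq_norm (\<lambda>x. g x - u x) < ennreal e"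
proof -
  obtain c where c: "0 \<le> c" "\<And>x. x \<in> K \<Longrightarrow> \<bar>g x\<bar> \<le> c" using continuous_bounded[OF g] by blast
  define e' where "e' = sqrt (e / 4)"
  have e': "0 < e'" "e'\<^sup>2 = e / 4" using e by (auto simp: e'_def)
  obtain N where N: "\<And>w x. w \<in> words I N \<Longrightarrow> x \<in> K \<Longrightarrow> \<bar>g (word_map w x) - g (word_map w p1)\<bar> < e'"
    using uniform_cells[OF g e'(1)] by blast
  obtain M where "(16/17) ^ M < e / (4 * (4 * c\<^sup>2 + 1))"
    using real_arch_pow_inv[of "e / (4 * (4 * c\<^sup>2 + 1))" "16/17"] e by (auto simp: add_nonneg_pos)
  then have "(16/17) ^ M * (4 * (4 * c\<^sup>2 + 1)) < e" by (simp add: pos_less_divide_eq add_nonneg_pos)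
  then have "4 * ((4 * c\<^sup>2 + 1) * (16/17) ^ M) < e" by (simp only: mult_ac)
  then have "(4 * c\<^sup>2 + 1) * (16/17) ^ M < e / 4" by linarith
  moreover have "4 * c\<^sup>2 * (16/17) ^ M \<le> (4 * c\<^sup>2 + 1) * (16/17) ^ M" by (intro mult_right_mono) auto
  ultimately have M: "4 * c\<^sup>2 * (16/17) ^ M < e / 4" by linarith
  obtain b where b: "decay (2/17) b" "\<And>x. x \<in> K \<Longrightarrow> 0 \<le> b x \<and> b x \<le> 1" "\<And>p. p \<in> V0 \<Longrightarrow> b p = 0"
    "\<And>t x. t \<in> words I M \<Longrightarrow> (Suc 0, 5) \<in> set t \<Longrightarrow> x \<in> K \<Longrightarrow> b (word_map t x) = 1"
    using cutoff_function[of M] by blast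
  obtain u where u: "decay (2/17) u"
    "\<And>w x. w \<in> words I N \<Longrightarrow> x \<in> K \<Longrightarrow> u (word_map w x) = g (word_map w p1) * b x"
    by (rule glue_decay[of "2/17" N "\<lambda>w x. g (word_map w p1) * b x" "\<lambda>_. 0"]) (use b decay_cmult in auto)
  have um: "u \<in> borel_measurable \<mu>" "g \<in> borel_measurable \<mu>" using u(1) g by (auto simp: decay_def)
  define B where "B w t = (if (Suc 0, 5) \<in> set t then e / 4 else 4 * c\<^sup>2)" for w t :: "cell list"
  have point: "(g (word_map (w @ t) x) - u (word_map (w @ t) x))\<^sup>2 \<le> B w t"
    if w: "w \<in> words I N" and t: "t \<in> words I M" and x: "x \<in> K" for w t x
  proof -
    have tK: "word_map t x \<in> K" by (rule word_map_K[OF t x])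
    have uw: "u (word_map (w @ t) x) = g (word_map w p1) * b (word_map t x)"
      using u(2)[OF w tK] by (simp add: word_map_append)
    show ?thesis
    proof (cases "(Suc 0, 5) \<in> set t")
      case True
      have "\<bar>g (word_map (w @ t) x) - u (word_map (w @ t) x)\<bar> \<le> \<bar>e'\<bar>"
        unfolding uw b(4)[OF t True x] using N[OF w tK] by (simp add: word_map_append)
      then have "(g (word_map (w @ t) x) - u (word_map (w @ t) x))\<^sup>2 \<le> e'\<^sup>2" by (simp only: abs_le_square_iff)
      then show ?thesis unfolding B_def using True e' by simp
    next
      case False
      have "\<bar>g (word_map w p1) * b (word_map t x)\<bar> \<le> c * 1"
        unfolding abs_mult using c(2)[OF word_map_K[OF w p_K(1)]] b(2)[OF tK] c(1) by (intro mult_mono) auto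
      moreover have "\<bar>g (word_map (w @ t) x)\<bar> \<le> c" using c(2) word_map_K[OF w tK] by (simp add: word_map_append)
      ultimately have "\<bar>g (word_map (w @ t) x) - u (word_map (w @ t) x)\<bar> \<le> \<bar>2 * c\<bar>" unfolding uw by linarith
      then have "(g (word_map (w @ t) x) - u (word_map (w @ t) x))\<^sup>2 \<le> (2 * c)\<^sup>2" by (simp only: abs_le_square_iff)
      then show ?thesis using False by (simp add: B_def power_mult_distrib)
    qed
  qed
  have B0: "0 \<le> B w t" for w t using e by (simp add: B_def)
  have sqm: "(\<lambda>x. ennreal ((g x - u x)\<^sup>2)) \<in> borel_measurable \<mu>" using um by measurable
  have "sq_norm (\<lambda>x. g x - u x) = (\<Sum>s\<in>words I (N + M). \<integral>\<^sup>+x\<in>word_map s ` K. ennreal ((g x - u x)\<^sup>2) \<partial>\<mu>)"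
    unfolding sq_norm_def by (rule nn_integral_cells[OF sqm])
  also have "\<dots> = (\<Sum>w\<in>words I N. \<Sum>t\<in>words I M. \<integral>\<^sup>+x\<in>word_map (w @ t) ` K. ennreal ((g x - u x)\<^sup>2) \<partial>\<mu>)"
    by (rule sum_words_add[OF finite_I])
  also have "\<dots> \<le> (\<Sum>w\<in>words I N. \<Sum>t\<in>words I M. ennreal (B w t) * ennreal (1 / 17 ^ (N + M)))"
  proof (intro sum_mono)
    fix w t assume w: "w \<in> words I N" and t: "t \<in> words I M"
    have wt: "w @ t \<in> words I (N + M)" by (rule words_append[OF w t])
    have "(\<integral>\<^sup>+x\<in>word_map (w @ t) ` K. ennreal ((g x - u x)\<^sup>2) \<partial>\<mu>) \<le> (\<integral>\<^sup>+x. ennreal (B w t) * indicator (word_map (w @ t) ` K) x \<partial>\<mu>)"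
    proof (rule nn_integral_mono)
      fix x
      show "ennreal ((g x - u x)\<^sup>2) * indicator (word_map (w @ t) ` K) x \<le> ennreal (B w t) * indicator (word_map (w @ t) ` K) x"
      proof (cases "x \<in> word_map (w @ t) ` K")
        case True
        then obtain y where y: "y \<in> K" "x = word_map (w @ t) y" by blast
        show ?thesis unfolding y(2) by (intro mult_right_mono ennreal_leI point[OF w t y(1)]) simp
      qed simp
    qed
    also have "\<dots> = ennreal (B w t) * ennreal (1 / 17 ^ (N + M))" by (rule nn_integral_cell_const[OF wt])
    finally show "(\<integral>\<^sup>+x\<in>word_map (w @ t) ` K. ennreal ((g x - u x)\<^sup>2) \<partial>\<mu>) \<le> ennreal (B w t) * ennreal (1 / 17 ^ (N + M))" .
  qed
  also have "\<dots> = ennreal (\<Sum>w\<in>words I N. \<Sum>t\<in>words I M. B w t * (1 / 17 ^ (N + M)))"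
    using B0 by (simp add: sum_ennreal sum_nonneg flip: ennreal_mult)
  also have "\<dots> < ennreal e"
  proof (rule ennreal_lessI[OF e])
    have fin: "finite (words I M)" by (simp add: finite_words)
    have sub: "{t \<in> words I M. (Suc 0, 5) \<notin> set t} = words (I - {(Suc 0, 5)}) M" by (auto simp: words_def)
    have c16: "card {t \<in> words I M. (Suc 0, 5) \<notin> set t} = 16 ^ M"
      unfolding sub using card_I left_top_I(3) by (simp add: card_words)
    have "(\<Sum>t\<in>words I M. B w t) \<le> (\<Sum>t\<in>words I M. e / 4 + (if (Suc 0, 5) \<notin> set t then 4 * c\<^sup>2 else 0))" for w
      using e by (intro sum_mono) (auto simp: B_def)
    also have "(\<Sum>t\<in>words I M. e / 4 + (if (Suc 0, 5) \<notin> set t then 4 * c\<^sup>2 else 0)) = 17 ^ M * (e / 4) + 16 ^ M * (4 * c\<^sup>2)"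
      using c16 by (simp add: sum.distrib card_words card_I fin flip: sum.inter_filter)
    finally have Bt: "(\<Sum>t\<in>words I M. B w t) \<le> 17 ^ M * (e / 4) + 16 ^ M * (4 * c\<^sup>2)" for w .
    have "(\<Sum>w\<in>words I N. \<Sum>t\<in>words I M. B w t * (1 / 17 ^ (N + M))) = (\<Sum>w\<in>words I N. \<Sum>t\<in>words I M. B w t) * (1 / 17 ^ (N + M))"
      by (simp only: sum_distrib_right)
    also have "\<dots> \<le> (\<Sum>w\<in>words I N. 17 ^ M * (e / 4) + 16 ^ M * (4 * c\<^sup>2)) * (1 / 17 ^ (N + M))"
      using Bt by (intro mult_right_mono sum_mono) auto
    also have "\<dots> = e / 4 + 4 * c\<^sup>2 * (16/17) ^ M"
      by (simp add: card_words card_I power_add power_divide field_simps)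
    also have "\<dots> < e" using M e by linarith
    finally show "(\<Sum>w\<in>words I N. \<Sum>t\<in>words I M. B w t * (1 / 17 ^ (N + M))) < e" .
  qed
  finally show ?thesis using u(1) by (intro exI[of _ u] conjI)
qed

subsection \<open>The critical exponents\<close>

lemma exponent_star: "7 powr (\<alpha> - 2 * (1/2 * (1 + ln 17 / ln 7))) = 1/7"
proof -
  have "\<alpha> - 2 * (1/2 * (1 + ln 17 / ln 7)) = - 1" by (simp add: \<alpha>_def field_simps)
  then show ?thesis by (simp only:) (simp add: powr_minus)
qed

lemma exponent_sharp: "7 powr (\<alpha> - 2 * (1/2 * ((2 * ln 17 - ln 2) / ln 7))) = 2/17"
proof -
  have "(\<alpha> - 2 * (1/2 * ((2 * ln 17 - ln 2) / ln 7))) * ln 7 = ln (2/17)"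
    by (simp add: \<alpha>_def ln_div field_simps)
  then show ?thesis by (simp add: powr_def)
qed

lemma besov_star: "decay (1/7) u \<Longrightarrow> u \<in> besov \<mu> \<alpha> (1/2 * (1 + ln 17 / ln 7))"
  by (rule decay_imp_besov[of "1/7"]) (use exponent_star in auto)

lemma besov_sharp: "decay (2/17) u \<Longrightarrow> u \<in> besov \<mu> \<alpha> (1/2 * ((2 * ln 17 - ln 2) / ln 7))"
  by (rule decay_imp_besov[of "2/17"]) (use exponent_sharp in auto)

lemma exponent_less: "s < \<sigma> \<Longrightarrow> 7 powr (\<alpha> - 2 * \<sigma>) < 7 powr (\<alpha> - 2 * s)"
  by simp

lemma dense_C_star: "dense_in_C K (besov \<mu> \<alpha> (1/2 * (1 + ln 17 / ln 7)))"
  unfolding dense_in_C_def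
proof (intro allI impI)
  fix f :: "plane \<Rightarrow> real" and e :: real
  assume "continuous_on K f" "0 < e"
  then obtain u where "decay (1/7) u" "\<forall>x\<in>K. \<bar>f x - u x\<bar> < e" using decay_dense_C by blast
  then show "\<exists>u\<in>besov \<mu> \<alpha> (1/2 * (1 + ln 17 / ln 7)). continuous_on K u \<and> (\<forall>x\<in>K. \<bar>f x - u x\<bar> < e)"
    using besov_star[of u] by (auto simp: decay_def)
qed

lemma dense_L2_sharp: "dense_in_L2 \<mu> (besov \<mu> \<alpha> (1/2 * ((2 * ln 17 - ln 2) / ln 7)))"
proof (rule dense_in_L2_I)
  fix g :: "plane \<Rightarrow> real" and e :: real
  assume "continuous_on K g" "0 < e"
  then obtain u where u: "decay (2/17) u" "sq_norm (\<lambda>x. g x - u x) < ennreal e" using decay_dense_L2[of g e] by blast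
  then show "\<exists>u\<in>besov \<mu> \<alpha> (1/2 * ((2 * ln 17 - ln 2) / ln 7)). u \<in> L2 \<mu> \<and> sq_norm (\<lambda>x. g x - u x) < ennreal e"
    using besov_sharp[of u] continuous_L2[of u] by (auto simp: decay_def)
qed

text \<open>All Besov functions above the critical exponent agree at \<open>p1\<close> and
  \<open>p3\<close>.\<close>

lemma not_dense_above_star:
  assumes "1/2 * (1 + ln 17 / ln 7) < \<sigma>"
  shows "\<not> dense_in_C K (besov \<mu> \<alpha> \<sigma>)"
proof
  assume D: "dense_in_C K (besov \<mu> \<alpha> \<sigma>)"
  have "continuous_on K (snd :: plane \<Rightarrow> real)" by (intro continuous_intros)
  then obtain u where u: "u \<in> besov \<mu> \<alpha> \<sigma>" "continuous_on K u" "\<And>x. x \<in> K \<Longrightarrow> \<bar>snd x - u x\<bar> < 1/4"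
    using D[unfolded dense_in_C_def, rule_format, of snd "1/4"] by auto
  define \<theta> where "\<theta> = 7 powr (\<alpha> - 2 * \<sigma>)"
  have \<theta>: "0 < \<theta>" "\<theta> < 1/7" using exponent_less[OF assms] unfolding exponent_star \<theta>_def by simp_all
  obtain v C where v: "continuous_on K v" "AE x in \<mu>. u x = v x" "\<And>n. 1 \<le> n \<Longrightarrow> PE n v \<le> C * \<theta> ^ n"
    by (rule besov_continuous_rep[OF u(1) \<theta>_def]) (use \<theta> in \<open>simp, blast\<close>)
  have "v p1 = v p3" using flat_of_decay[OF v(3) \<theta>(1), of "[]" 0] \<theta> by simp
  then have "u p1 = u p3" using AE_eq_imp_eq[OF u(2) v(1,2)] p_K by simp
  then have "\<bar>snd p1 - snd p3\<bar> < 1/2" using u(3)[OF p_K(1)] u(3)[OF p_K(3)] by linarith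
  moreover have "1 < sqrt 3" by simp
  ultimately show False by (simp add: p1_def p3_def)
qed

lemma constant_above_sharp:
  assumes "1/2 * ((2 * ln 17 - ln 2) / ln 7) < \<sigma>" and u: "u \<in> besov \<mu> \<alpha> \<sigma>"
  shows "\<exists>c. AE x in \<mu>. u x = c"
proof -
  define \<theta> where "\<theta> = 7 powr (\<alpha> - 2 * \<sigma>)"
  have \<theta>: "0 < \<theta>" "\<theta> < 2/17" using exponent_less[OF assms(1)] unfolding exponent_sharp \<theta>_def by simp_all
  obtain v C where v: "continuous_on K v" "AE x in \<mu>. u x = v x" "\<And>n. 1 \<le> n \<Longrightarrow> PE n v \<le> C * \<theta> ^ n"
    by (rule besov_continuous_rep[OF u \<theta>_def]) (use \<theta> in \<open>simp, blast\<close>)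
  have c: "v x = v p1" if "x \<in> K" for x using constant_of_decay[OF v(1,3) \<theta>(1) _ that] \<theta> by simp
  have "AE x in \<mu>. x \<in> K" using AE_space[of \<mu>] by simp
  with v(2) have "AE x in \<mu>. u x = v p1" by eventually_elim (metis c)
  then show ?thesis by blast
qed

lemma nonconstant_sharp: "\<exists>u\<in>besov \<mu> \<alpha> (1/2 * ((2 * ln 17 - ln 2) / ln 7)). \<not> (\<exists>c. AE x in \<mu>. u x = c)"
proof -
  obtain H C where "flat_spec H C" using flat_decay_functions by blast
  note C = flat_specD(1)[OF this] and bd = flat_specD(2)[OF this] and near = flat_specD(3)[OF this]
    and dec1 = flat_specD(4)[OF this] and dec = flat_specD(5)[OF this]
  define u where "u = H (\<lambda>x. if x = p2 then 1 else 0)"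
  have u: "decay (2/17) u" unfolding u_def by (rule dec) simp
  have False if "AE x in \<mu>. u x = c" for c
  proof -
    have "u x = c" if "x \<in> K" for x
      using AE_eq_imp_eq[of u "\<lambda>_. c"] u \<open>AE x in \<mu>. u x = c\<close> that by (auto simp: decay_def)
    from this[OF p_K(1)] this[OF p_K(2)] show False by (simp add: u_def bd)
  qed
  then show ?thesis using besov_sharp[OF u] by blast
qed

lemma sigma_star_value: "sigma_star \<mu> K \<alpha> = ereal (1/2 * (1 + ln 17 / ln 7))"
  unfolding sigma_star_def
proof (rule antisym)
  show "Sup (ereal ` {\<sigma>. 0 < \<sigma> \<and> dense_in_C K (besov \<mu> \<alpha> \<sigma>)}) \<le> ereal (1/2 * (1 + ln 17 / ln 7))"
    using not_dense_above_star by (intro Sup_least) (auto simp: not_less[symmetric])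
  show "ereal (1/2 * (1 + ln 17 / ln 7)) \<le> Sup (ereal ` {\<sigma>. 0 < \<sigma> \<and> dense_in_C K (besov \<mu> \<alpha> \<sigma>)})"
  proof (intro Sup_upper imageI CollectI conjI)
    show "0 < 1/2 * (1 + ln 17 / ln (7::real))" by (intro mult_pos_pos add_pos_pos divide_pos_pos) auto
  qed (rule dense_C_star)
qed

lemma sigma_sharp_value: "sigma_sharp \<mu> \<alpha> = ereal (1/2 * ((2 * ln 17 - ln 2) / ln 7))"
  unfolding sigma_sharp_def
proof (rule antisym)
  show "Sup (ereal ` {\<sigma>. 0 < \<sigma> \<and> (\<exists>u\<in>besov \<mu> \<alpha> \<sigma>. \<not> (\<exists>c. AE x in \<mu>. u x = c))}) \<le> ereal (1/2 * ((2 * ln 17 - ln 2) / ln 7))"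
  proof (rule Sup_least)
    fix s assume "s \<in> ereal ` {\<sigma>. 0 < \<sigma> \<and> (\<exists>u\<in>besov \<mu> \<alpha> \<sigma>. \<not> (\<exists>c. AE x in \<mu>. u x = c))}"
    then obtain \<sigma> u where s: "s = ereal \<sigma>" "u \<in> besov \<mu> \<alpha> \<sigma>" "\<not> (\<exists>c. AE x in \<mu>. u x = c)" by blast
    have "\<not> 1/2 * ((2 * ln 17 - ln 2) / ln 7) < \<sigma>" using constant_above_sharp s(2,3) by blast
    then show "s \<le> ereal (1/2 * ((2 * ln 17 - ln 2) / ln 7))" unfolding s(1) by (simp only: ereal_less_eq not_less)
  qed
  show "ereal (1/2 * ((2 * ln 17 - ln 2) / ln 7)) \<le> Sup (ereal ` {\<sigma>. 0 < \<sigma> \<and> (\<exists>u\<in>besov \<mu> \<alpha> \<sigma>. \<not> (\<exists>c. AE x in \<mu>. u x = c))})"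
  proof (intro Sup_upper imageI CollectI conjI)
    have "ln 2 < (2 * ln 17 :: real)" using ln_less_cancel_iff[of 2 "17::real"] ln_gt_zero[of "17::real"] by linarith
    then show "0 < 1/2 * ((2 * ln 17 - ln 2) / ln (7::real))" by (intro mult_pos_pos divide_pos_pos) auto
  qed (rule nonconstant_sharp)
qed

lemma continuous_rep_star:
  assumes "u \<in> besov \<mu> \<alpha> (1/2 * (1 + ln 17 / ln 7))"
  shows "has_continuous_rep \<mu> K u"
proof -
  obtain v where "continuous_on K v" "AE x in \<mu>. u x = v x"
    by (rule besov_continuous_rep[OF assms exponent_star[symmetric]]) auto
  then show ?thesis unfolding has_continuous_rep_def by blast
qed


subsection \<open>A self-similar Dirichlet form\<close>

definition cond :: conductance where "cond w x y = prod_list (map \<rho> w)"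

abbreviation En :: "nat \<Rightarrow> (plane \<Rightarrow> real) \<Rightarrow> real" where "En n u \<equiv> wform \<rho> 1 1 1 n u u"

lemma rho_ge: "25/16 \<le> \<rho> i"
  using tau_bounds[of i] by (simp add: \<rho>_def field_simps)

lemma prod_rho: "(25/16) ^ length w \<le> prod_list (map \<rho> w)"
proof (induction w)
  case (Cons i w)
  have "25/16 * (25/16) ^ length w \<le> \<rho> i * prod_list (map \<rho> w)"
    using rho_ge[of i] Cons.IH by (intro mult_mono) auto
  then show ?case by simp
qed simp

lemma prod_rho_pos: "0 < prod_list (map \<rho> w)"
proof -
  have "(0::real) < (25/16) ^ length w" by simp
  then show ?thesis using prod_rho[of w] by (rule less_le_trans)
qed

lemma conductances_cond: "conductances I cond"
  by (simp add: conductances_def cond_def prod_rho_pos)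

lemma energy_form_cond: "energy_form I cond n u v = wform \<rho> 1 1 1 n u v"
  unfolding energy_form_eq[OF conductances_cond] wform_def
  by (intro sum.cong refl) (simp add: cond_def tri3_def algebra_simps)

lemma energy_cond: "energy I cond n u = En n u"
  by (simp add: energy_def energy_form_cond)

lemma primal_energy_eq: "primal_energy I n u = PE n u"
proof -
  have "conductances I (\<lambda>_ _ _. 1)" by (simp add: conductances_def)
  then show ?thesis by (simp add: primal_energy_def energy_def energy_form_eq PE_eq)
qed

lemma wform_sym: "wform \<rho> 1 1 1 n u v = wform \<rho> 1 1 1 n v u"
  unfolding wform_def tri3_def by (intro sum.cong refl) (simp add: algebra_simps)

lemma wform_lin:
  "wform \<rho> 1 1 1 n (\<lambda>x. u x + v x) f = wform \<rho> 1 1 1 n u f + wform \<rho> 1 1 1 n v f"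
  "wform \<rho> 1 1 1 n (\<lambda>x. a * u x) f = a * wform \<rho> 1 1 1 n u f"
  unfolding wform_def tri3_def
  by (simp_all add: algebra_simps sum.distrib sum_distrib_left sum_subtractf)

lemma En_nonneg: "0 \<le> En n u"
  unfolding wform_def by (intro sum_nonneg mult_nonneg_nonneg tri3_nonneg less_imp_le[OF prod_rho_pos]) auto

lemma En_add: "En n (\<lambda>x. u x + v x) = En n u + 2 * wform \<rho> 1 1 1 n u v + En n v"
proof -
  have "En n (\<lambda>x. u x + v x) = wform \<rho> 1 1 1 n u (\<lambda>x. u x + v x) + wform \<rho> 1 1 1 n v (\<lambda>x. u x + v x)"
    by (rule wform_lin(1))
  then show ?thesis
    unfolding wform_sym[of n u "\<lambda>x. u x + v x"] wform_sym[of n v "\<lambda>x. u x + v x"] wform_lin(1)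
    using wform_sym[of n u v] by linarith
qed

lemma En_cmult: "En n (\<lambda>x. a * u x) = a\<^sup>2 * En n u"
proof -
  have "En n (\<lambda>x. a * u x) = a * wform \<rho> 1 1 1 n (\<lambda>x. a * u x) u"
    unfolding wform_lin(2)[of n a u "\<lambda>x. a * u x"] wform_sym[of n u "\<lambda>x. a * u x"] ..
  then show ?thesis by (simp add: wform_lin(2) power2_eq_square)
qed

lemma En_diff: "En n (\<lambda>x. u x - v x) = En n u - 2 * wform \<rho> 1 1 1 n v u + En n v"
proof -
  have "En n (\<lambda>x. u x - v x) = En n (\<lambda>x. u x + (- 1) * v x)" by simp
  also have "\<dots> = En n u + 2 * wform \<rho> 1 1 1 n u (\<lambda>x. (- 1) * v x) + En n (\<lambda>x. (- 1) * v x)" by (rule En_add)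
  also have "\<dots> = En n u - 2 * wform \<rho> 1 1 1 n v u + En n v"
    unfolding En_cmult wform_sym[of n u "\<lambda>x. (- 1) * v x"] wform_lin(2) by simp
  finally show ?thesis .
qed

lemma En_add_le: "En n (\<lambda>x. u x + v x) \<le> 2 * En n u + 2 * En n v"
  using En_nonneg[of n "\<lambda>x. u x - v x"] wform_sym[of n u v] unfolding En_diff En_add by linarith

definition harmonic_spec :: "((plane \<Rightarrow> real) \<Rightarrow> plane \<Rightarrow> real) \<Rightarrow> real \<Rightarrow> bool" where
  "harmonic_spec H C \<longleftrightarrow> 0 \<le> C \<and> (\<forall>a. continuous_on K (H a)) \<and> (\<forall>a. \<forall>p\<in>V0. H a p = a p) \<and>
     (\<forall>a. \<forall>x\<in>K. \<bar>H a x - a p1\<bar> \<le> C * osc a) \<and>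
     (\<forall>a v. wform \<rho> 1 1 1 1 (H a) v = tri3 1 1 1 a v) \<and>
     (\<forall>n a. En n (H a) = tri3 1 1 1 a a)"

lemma harmonic_ex: "\<exists>H C. harmonic_spec H C"
  unfolding harmonic_spec_def by (rule harmonic_functions_exist)

lemma harmonic_specD:
  assumes "harmonic_spec H C"
  shows "0 \<le> C" and "continuous_on K (H a)" and "p \<in> V0 \<Longrightarrow> H a p = a p"
    and "x \<in> K \<Longrightarrow> \<bar>H a x - a p1\<bar> \<le> C * osc a"
    and "wform \<rho> 1 1 1 1 (H a) v = tri3 1 1 1 a v" and "En n (H a) = tri3 1 1 1 a a"
proof -
  note * = assms[unfolded harmonic_spec_def]
  show "0 \<le> C" by (rule *[THEN conjunct1])
  show "continuous_on K (H a)" by (rule *[THEN conjunct2, THEN conjunct1, rule_format])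
  show "p \<in> V0 \<Longrightarrow> H a p = a p" by (rule *[THEN conjunct2, THEN conjunct2, THEN conjunct1, rule_format])
  show "x \<in> K \<Longrightarrow> \<bar>H a x - a p1\<bar> \<le> C * osc a"
    by (rule *[THEN conjunct2, THEN conjunct2, THEN conjunct2, THEN conjunct1, rule_format])
  show "wform \<rho> 1 1 1 1 (H a) v = tri3 1 1 1 a v"
    by (rule *[THEN conjunct2, THEN conjunct2, THEN conjunct2, THEN conjunct2, THEN conjunct1, rule_format])
  show "En n (H a) = tri3 1 1 1 a a"
    by (rule *[THEN conjunct2, THEN conjunct2, THEN conjunct2, THEN conjunct2, THEN conjunct2, rule_format])
qed

text \<open>Nonnegativity of the energy of \<open>f\<close> minus its harmonic replacement, with
  Green's formula for the mixed term.\<close>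

lemma one_step: "tri3 1 1 1 f f \<le> En 1 f"
proof -
  obtain H C where S: "harmonic_spec H C" using harmonic_ex by blast
  have "0 \<le> En 1 (\<lambda>x. f x - H f x)" by (rule En_nonneg)
  then show ?thesis unfolding En_diff harmonic_specD(5,6)[OF S] by linarith
qed

lemma En_mono: "En n u \<le> En (Suc n) u"
  unfolding wform_Suc'[of _ _ _ _ n]
  unfolding wform_def[of _ _ _ _ n] using one_step[of "u \<circ> word_map _"] less_imp_le[OF prod_rho_pos]
  by (intro sum_mono mult_left_mono) auto

lemma En_incseq: "incseq (\<lambda>n. En n u)"
  by (intro incseq_SucI En_mono)

lemma En_V: assumes "\<And>x. x \<in> V I n \<Longrightarrow> v x = u x" shows "En n v = En n u"
  unfolding wform_def
proof (intro sum.cong refl arg_cong2[where f = times] tri3_cong)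
  fix w p assume "w \<in> words I n" "p \<in> V0"
  then have "word_map w p \<in> V I n" unfolding V_words by blast
  then show "(v \<circ> word_map w) p = (u \<circ> word_map w) p" "(v \<circ> word_map w) p = (u \<circ> word_map w) p" using assms by simp_all
qed

text \<open>The minimum is attained by harmonic interpolation in each cell, and the lower bound is
  the one-step inequality in each cell.\<close>

lemma compatible_cond: "compatible I cond"
  unfolding compatible_def Let_def
proof (intro allI conjI ballI)
  fix n and u :: "plane \<Rightarrow> real"
  show "energy I cond n u \<in> {energy I cond (Suc n) v |v. \<forall>x\<in>V I n. v x = u x}"
  proof -
    obtain H C where S: "harmonic_spec H C" using harmonic_ex by blast
    obtain v where v: "\<And>w x. w \<in> words I n \<Longrightarrow> x \<in> K \<Longrightarrow> v (word_map w x) = H (u \<circ> word_map w) x"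
      by (rule glue[of n "\<lambda>w. H (u \<circ> word_map w)" u]) (use harmonic_specD(3)[OF S] in auto)
    have "\<forall>x\<in>V I n. v x = u x"
    proof
      fix x assume "x \<in> V I n"
      then obtain w p where w: "w \<in> words I n" "p \<in> V0" "x = word_map w p" unfolding V_words by blast
      have "p \<in> K" using w(2) V0_K by blast
      then show "v x = u x" using v[OF w(1)] harmonic_specD(3)[OF S w(2), of "u \<circ> word_map w"] w(3) by simp
    qed
    moreover have "energy I cond n u = energy I cond (Suc n) v"
    proof -
      have "En (Suc n) v = (\<Sum>w\<in>words I n. prod_list (map \<rho> w) * En 1 (v \<circ> word_map w))" by (rule wform_Suc')
      also have "\<dots> = (\<Sum>w\<in>words I n. prod_list (map \<rho> w) * En 1 (H (u \<circ> word_map w)))"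
        using v by (intro sum.cong refl arg_cong2[where f = times] wform_cong) auto
      also have "\<dots> = En n u" by (simp only: harmonic_specD(6)[OF S] wform_def[of _ _ _ _ n])
      finally show ?thesis by (simp add: energy_cond)
    qed
    ultimately show ?thesis by blast
  qed
next
  fix n u e assume "e \<in> {energy I cond (Suc n) v |v. \<forall>x\<in>V I n. v x = u x}"
  then obtain v where v: "e = energy I cond (Suc n) v" "\<forall>x\<in>V I n. v x = u x" by blast
  then show "energy I cond n u \<le> e" using En_V[of n v u] En_mono[of n v] by (simp add: energy_cond)
qed

lemma limit_energy_tendsto: "(\<lambda>n. ennreal (En n u)) \<longlonglongrightarrow> limit_energy I cond u"
proof -
  have "(\<lambda>n. ennreal (En n u)) \<longlonglongrightarrow> (SUP n. ennreal (En n u))"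
    using En_incseq by (intro LIMSEQ_SUP) (auto simp: incseq_def intro: ennreal_leI)
  then show ?thesis unfolding limit_energy_def energy_cond using limI by metis
qed

lemma limit_energy_eq: "limit_energy I cond u = (SUP n. ennreal (En n u))"
proof -
  have "(\<lambda>n. ennreal (En n u)) \<longlonglongrightarrow> (SUP n. ennreal (En n u))"
    using En_incseq by (intro LIMSEQ_SUP) (auto simp: incseq_def intro: ennreal_leI)
  then show ?thesis using limit_energy_tendsto LIMSEQ_unique by blast
qed

abbreviation Dom :: "(plane \<Rightarrow> real) set" where "Dom \<equiv> limit_dom I K cond"
abbreviation EE :: "(plane \<Rightarrow> real) \<Rightarrow> (plane \<Rightarrow> real) \<Rightarrow> real" where "EE \<equiv> limit_form I cond"

lemma Dom_iff: "u \<in> Dom \<longleftrightarrow> continuous_on K u \<and> (\<exists>C. \<forall>n. En n u \<le> C)"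
proof (cases "continuous_on K u")
  case True
  have "limit_energy I cond u < \<infinity> \<longleftrightarrow> (\<exists>C. \<forall>n. En n u \<le> C)"
  proof
    assume "limit_energy I cond u < \<infinity>"
    then obtain C where C: "limit_energy I cond u = ennreal C" "0 \<le> C" by (cases "limit_energy I cond u") auto
    have "En n u \<le> C" for n
    proof -
      have "ennreal (En n u) \<le> ennreal C" unfolding C(1)[symmetric] limit_energy_eq by (intro SUP_upper) simp
      then show ?thesis using C(2) by (simp add: ennreal_le_iff)
    qed
    then show "\<exists>C. \<forall>n. En n u \<le> C" by blast
  next
    assume "\<exists>C. \<forall>n. En n u \<le> C"
    then obtain C where C: "\<And>n. En n u \<le> C" by blast
    have "limit_energy I cond u \<le> ennreal C" unfolding limit_energy_eq by (intro SUP_least ennreal_leI C)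
    then show "limit_energy I cond u < \<infinity>" by (simp add: le_less_trans)
  qed
  then show ?thesis using True by (simp add: limit_dom_def)
qed (simp add: limit_dom_def)

lemma DomI: "continuous_on K u \<Longrightarrow> (\<And>n. En n u \<le> C) \<Longrightarrow> u \<in> Dom"
  unfolding Dom_iff by blast

lemma Dom_cont: "u \<in> Dom \<Longrightarrow> continuous_on K u"
  by (simp add: Dom_iff)

lemma Dom_add: assumes "u \<in> Dom" "v \<in> Dom" shows "(\<lambda>x. u x + v x) \<in> Dom"
proof -
  obtain C where C: "\<And>n. En n u \<le> C" using assms(1) unfolding Dom_iff by blast
  obtain D where D: "\<And>n. En n v \<le> D" using assms(2) unfolding Dom_iff by blast
  show ?thesis
  proof (rule DomI)
    show "continuous_on K (\<lambda>x. u x + v x)" using assms by (intro continuous_intros Dom_cont)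
    show "En n (\<lambda>x. u x + v x) \<le> 2 * C + 2 * D" for n using En_add_le[of n u v] C[of n] D[of n] by linarith
  qed
qed

lemma Dom_cmult: assumes "u \<in> Dom" shows "(\<lambda>x. a * u x) \<in> Dom"
proof -
  obtain C where C: "\<And>n. En n u \<le> C" using assms(1) unfolding Dom_iff by blast
  show ?thesis
  proof (rule DomI)
    show "continuous_on K (\<lambda>x. a * u x)" using assms by (intro continuous_intros Dom_cont)
    show "En n (\<lambda>x. a * u x) \<le> a\<^sup>2 * C" for n unfolding En_cmult using C by (intro mult_left_mono) auto
  qed
qed

lemma Dom_diff: assumes "u \<in> Dom" "v \<in> Dom" shows "(\<lambda>x. u x - v x) \<in> Dom"
  using Dom_add[OF assms(1) Dom_cmult[OF assms(2), of "- 1"]] by simp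

lemma En_convergent: assumes "u \<in> Dom" shows "convergent (\<lambda>n. En n u)"
proof -
  obtain C where C: "\<And>n. En n u \<le> C" using assms(1) unfolding Dom_iff by blast
  have "Bseq (\<lambda>n. En n u)" using C En_nonneg by (intro BseqI'[of _ C]) simp
  then show ?thesis using En_incseq by (intro Bseq_monoseq_convergent incseq_imp_monoseq)
qed

lemma form_tendsto: assumes "u \<in> Dom" "v \<in> Dom" shows "(\<lambda>n. wform \<rho> 1 1 1 n u v) \<longlonglongrightarrow> EE u v"
proof -
  have eq: "(\<lambda>n. wform \<rho> 1 1 1 n u v) = (\<lambda>n. (En n (\<lambda>x. u x + v x) - En n u - En n v) / 2)"
    unfolding En_add by auto
  obtain A where A: "(\<lambda>n. En n u) \<longlonglongrightarrow> A" using En_convergent[OF assms(1)] by (auto simp: convergent_def)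
  obtain B where B: "(\<lambda>n. En n v) \<longlonglongrightarrow> B" using En_convergent[OF assms(2)] by (auto simp: convergent_def)
  obtain D where D: "(\<lambda>n. En n (\<lambda>x. u x + v x)) \<longlonglongrightarrow> D"
    using En_convergent[OF Dom_add[OF assms]] by (auto simp: convergent_def)
  have L: "(\<lambda>n. wform \<rho> 1 1 1 n u v) \<longlonglongrightarrow> (D - A - B) / 2"
    unfolding eq by (intro tendsto_divide tendsto_diff tendsto_const A B D) simp
  show ?thesis unfolding limit_form_def energy_form_cond limI[OF L] by (rule L)
qed

lemma En_le_EE: assumes "u \<in> Dom" shows "En n u \<le> EE u u"
  by (rule incseq_le[OF En_incseq form_tendsto[OF assms assms]])

lemma EE_le: assumes "u \<in> Dom" "\<And>n. En n u \<le> C" shows "EE u u \<le> C"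
  using assms(2) by (intro LIMSEQ_le_const2[OF form_tendsto[OF assms(1,1)]]) blast

lemma EE_nonneg: "u \<in> Dom \<Longrightarrow> 0 \<le> EE u u"
  using En_le_EE[of u 0] En_nonneg[of 0 u] by linarith

text \<open>Every resistance factor is at most \<open>16/25\<close>, so the oscillation over an \<open>m\<close>-cell is at most a
  multiple of \<open>(4/5)^m\<close> times the square root of the energy.\<close>

lemma Dom_osc: assumes u: "u \<in> Dom" and x: "x \<in> K" shows "(u x - u p1)\<^sup>2 \<le> 10000 * EE u u"
proof -
  define b where "b = 20 * sqrt (EE u u)"
  have E0: "0 \<le> EE u u" by (rule EE_nonneg[OF u])
  have b0: "0 \<le> b" using E0 by (simp add: b_def)
  have "\<bar>u (word_map [] x) - u (word_map [] p1)\<bar> \<le> b * (4/5) ^ 0 / (1 - 4/5)"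
  proof (rule chain_bound[OF Dom_cont[OF u]])
    fix m w i assume w: "w \<in> words I m" and i: "i \<in> I"
    let ?P = "prod_list (map \<rho> w)"
    have len: "length w = m" using w by (simp add: words_def)
    have ge1: "1 \<le> \<rho> i" for i using rho_ge[of i] by linarith
    have ge0: "0 \<le> \<rho> i" for i using rho_ge[of i] by linarith
    have "(25/16) ^ m * En 1 (u \<circ> word_map w) \<le> ?P * En 1 (u \<circ> word_map w)"
      using prod_rho[of w] len En_nonneg by (intro mult_right_mono) auto
    also have "\<dots> \<le> En (m + 1) u" by (rule wform_cell_le[OF ge0 w])
    also have "\<dots> \<le> EE u u" by (rule En_le_EE[OF u])
    finally have "En 1 (u \<circ> word_map w) \<le> EE u u * (16/25) ^ m" by (simp add: power_divide field_simps)
    moreover have "((u \<circ> word_map w) (cell_map i p1) - (u \<circ> word_map w) p1)\<^sup>2 \<le> 400 * En 1 (u \<circ> word_map w)"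
      by (rule vertex_bound[OF ge1 i V0_mem(1)])
    ultimately have "(u (word_map (w @ [i]) p1) - u (word_map w p1))\<^sup>2 \<le> 400 * (EE u u * (16/25) ^ m)"
      by (simp add: word_map_append)
    also have "\<dots> = (b * (4/5) ^ m)\<^sup>2"
    proof -
      have "((4/5 :: real) ^ m)\<^sup>2 = (16/25) ^ m" by (simp add: power2_eq_square flip: power_mult_distrib)
      then show ?thesis using E0 by (simp add: b_def power_mult_distrib)
    qed
    finally have "\<bar>u (word_map (w @ [i]) p1) - u (word_map w p1)\<bar> \<le> \<bar>b * (4/5) ^ m\<bar>" by (simp only: abs_le_square_iff)
    then show "\<bar>u (word_map (w @ [i]) p1) - u (word_map w p1)\<bar> \<le> b * (4/5) ^ m" using b0 by simp
  next
    show "[] \<in> words I 0" by simp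
  qed (use x b0 in auto)
  then have "\<bar>u x - u p1\<bar> \<le> \<bar>5 * b\<bar>" using b0 by simp
  then have "(u x - u p1)\<^sup>2 \<le> (5 * b)\<^sup>2" by (simp only: abs_le_square_iff)
  also have "\<dots> = 10000 * EE u u" using E0 by (simp add: b_def power_mult_distrib)
  finally show ?thesis .
qed

lemma integrable_bounded_mu:
  fixes f :: "plane \<Rightarrow> real" and c :: real
  assumes "f \<in> borel_measurable \<mu>" "\<And>x. x \<in> K \<Longrightarrow> \<bar>f x\<bar> \<le> c"
  shows "integrable \<mu> f"
  using assms by (intro M.integrable_const_bound[of _ c]) (auto intro: AE_I2)

lemma integrable_square:
  fixes u :: "plane \<Rightarrow> real"
  assumes "continuous_on K u" shows "integrable \<mu> (\<lambda>x. (u x)\<^sup>2)"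
proof -
  have "continuous_on K (\<lambda>x. (u x)\<^sup>2)" using assms by (intro continuous_intros)
  then obtain c where "\<And>x. x \<in> K \<Longrightarrow> \<bar>(u x)\<^sup>2\<bar> \<le> c" using continuous_bounded by blast
  moreover have "(\<lambda>x. (u x)\<^sup>2) \<in> borel_measurable \<mu>"
    using \<open>continuous_on K (\<lambda>x. (u x)\<^sup>2)\<close> by simp
  ultimately show ?thesis by (intro integrable_bounded_mu[of _ c])
qed

lemma measure_mu_space: "measure \<mu> (space \<mu>) = 1"
  using emeasure_mu_K by (simp add: measure_def)

lemma integral_le_bound:
  fixes u :: "plane \<Rightarrow> real" and c :: real
  assumes "continuous_on K u" "\<And>x. x \<in> K \<Longrightarrow> (u x)\<^sup>2 \<le> c"
  shows "(\<integral>x. (u x)\<^sup>2 \<partial>\<mu>) \<le> c"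
proof -
  have "(\<integral>x. (u x)\<^sup>2 \<partial>\<mu>) \<le> (\<integral>x. c \<partial>\<mu>)"
    using assms integrable_square[OF assms(1)] by (intro integral_mono) auto
  then show ?thesis using measure_mu_space by simp
qed

text \<open>The oscillation bound controls \<open>u\<close> by its value at any point, and some
  point has \<open>u\<^sup>2\<close> at most the mean; the latter is used in integrated
  form.\<close>

lemma Dom_sup: assumes u: "u \<in> Dom" and x: "x \<in> K" shows "(u x)\<^sup>2 \<le> 60000 * E1 \<mu> EE u"
proof -
  have E0: "0 \<le> EE u u" by (rule EE_nonneg[OF u])
  have int: "integrable \<mu> (\<lambda>x. (u x)\<^sup>2)" by (rule integrable_square[OF Dom_cont[OF u]])
  have sq: "(s + t)\<^sup>2 \<le> 2 * s\<^sup>2 + 2 * t\<^sup>2" for s t :: real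
    using zero_le_power2[of "s - t"] unfolding power2_sum power2_diff by linarith
  have "(\<integral>y. (u p1)\<^sup>2 \<partial>\<mu>) \<le> (\<integral>y. 2 * (u y)\<^sup>2 + 20000 * EE u u \<partial>\<mu>)"
  proof (rule integral_mono)
    fix y assume "y \<in> space \<mu>"
    then have "(u y - u p1)\<^sup>2 \<le> 10000 * EE u u" using Dom_osc[OF u] by simp
    moreover have "(u p1)\<^sup>2 \<le> 2 * (u y)\<^sup>2 + 2 * (u p1 - u y)\<^sup>2" using sq[of "u y" "u p1 - u y"] by simp
    ultimately show "(u p1)\<^sup>2 \<le> 2 * (u y)\<^sup>2 + 20000 * EE u u" by (simp add: power2_commute)
  qed (use int in auto)
  also have "\<dots> = 2 * (\<integral>y. (u y)\<^sup>2 \<partial>\<mu>) + 20000 * EE u u" using int measure_mu_space by simp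
  finally have "(u p1)\<^sup>2 \<le> 2 * (\<integral>y. (u y)\<^sup>2 \<partial>\<mu>) + 20000 * EE u u" using measure_mu_space by simp
  moreover have "(u x)\<^sup>2 \<le> 2 * (u p1)\<^sup>2 + 2 * (u x - u p1)\<^sup>2" using sq[of "u p1" "u x - u p1"] by simp
  moreover have "(u x - u p1)\<^sup>2 \<le> 10000 * EE u u" by (rule Dom_osc[OF u x])
  moreover have "0 \<le> (\<integral>y. (u y)\<^sup>2 \<partial>\<mu>)" by simp
  ultimately show ?thesis unfolding E1_def distrib_left using E0 by linarith
qed

lemma En_tendsto:
  assumes "\<And>x. x \<in> K \<Longrightarrow> (\<lambda>m. h m x) \<longlonglongrightarrow> h' x"
  shows "(\<lambda>m. En k (h m)) \<longlonglongrightarrow> En k h'"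
  unfolding wform_def tri3_def comp_def
  using word_map_K p_K assms by (intro tendsto_intros) blast+

text \<open>The sup norm is controlled by the form norm, so a Cauchy sequence converges uniformly;
  each discrete energy is continuous under pointwise limits, which passes the Cauchy estimate to the
  limit.\<close>

lemma Dom_complete:
  assumes f: "\<And>n. f n \<in> Dom"
    and cauchy: "\<And>e. 0 < e \<Longrightarrow> \<exists>N. \<forall>m\<ge>N. \<forall>n\<ge>N. E1 \<mu> EE (\<lambda>x. f m x - f n x) < e"
  shows "\<exists>g\<in>Dom. (\<lambda>n. E1 \<mu> EE (\<lambda>x. f n x - g x)) \<longlonglongrightarrow> 0"
proof -
  have fd: "(\<lambda>x. f m x - f n x) \<in> Dom" for m n by (rule Dom_diff[OF f f])
  have "uniformly_Cauchy_on K f"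
    unfolding uniformly_Cauchy_on_def
  proof (intro allI impI)
    fix e :: real assume e: "0 < e"
    then obtain N where N: "\<And>m n. N \<le> m \<Longrightarrow> N \<le> n \<Longrightarrow> E1 \<mu> EE (\<lambda>x. f m x - f n x) < e\<^sup>2 / 60000"
      using cauchy[of "e\<^sup>2 / 60000"] by auto
    have "dist (f m x) (f n x) < e" if "x \<in> K" "N \<le> m" "N \<le> n" for x m n
    proof -
      have "(f m x - f n x)\<^sup>2 < e\<^sup>2" using Dom_sup[OF fd that(1), of m n] N[OF that(2,3)] by linarith
      then show ?thesis using e power2_less_imp_less[of "\<bar>f m x - f n x\<bar>" e] by (simp add: dist_real_def)
    qed
    then show "\<exists>N. \<forall>x\<in>K. \<forall>m\<ge>N. \<forall>n\<ge>N. dist (f m x) (f n x) < e" by blast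
  qed
  then obtain g where g: "uniform_limit K f g sequentially"
    using Cauchy_uniformly_convergent uniformly_convergent_on_def by blast
  have gc: "continuous_on K g"
    by (rule uniform_limit_theorem[OF _ g]) (use Dom_cont[OF f] in auto)
  have pt: "(\<lambda>m. f m x) \<longlonglongrightarrow> g x" if "x \<in> K" for x by (rule tendsto_uniform_limitI[OF g that])
  have main: "\<exists>N. \<forall>n\<ge>N. (\<lambda>x. f n x - g x) \<in> Dom \<and> E1 \<mu> EE (\<lambda>x. f n x - g x) \<le> 60001 * e" if e: "0 < e" for e
  proof -
    obtain N where N: "\<And>m n. N \<le> m \<Longrightarrow> N \<le> n \<Longrightarrow> E1 \<mu> EE (\<lambda>x. f m x - f n x) < e" using cauchy[OF e] by blast
    have "(\<lambda>x. f n x - g x) \<in> Dom \<and> E1 \<mu> EE (\<lambda>x. f n x - g x) \<le> 60001 * e" if n: "N \<le> n" for n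
    proof -
      have cont: "continuous_on K (\<lambda>x. f n x - g x)" using Dom_cont[OF f] gc by (intro continuous_intros)
      have En: "En k (\<lambda>x. f n x - g x) \<le> e" for k
      proof (rule LIMSEQ_le_const2)
        show "(\<lambda>m. En k (\<lambda>x. f n x - f m x)) \<longlonglongrightarrow> En k (\<lambda>x. f n x - g x)"
          using pt by (intro En_tendsto tendsto_intros)
        have "En k (\<lambda>x. f n x - f m x) \<le> e" if "N \<le> m" for m
        proof -
          have "0 \<le> (\<integral>x. (f n x - f m x)\<^sup>2 \<partial>\<mu>)" by simp
          then show ?thesis using En_le_EE[OF fd, of k n m] N[OF n that] unfolding E1_def by linarith
        qed
        then show "\<exists>N. \<forall>m\<ge>N. En k (\<lambda>x. f n x - f m x) \<le> e" by blast
      qed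
      have dom: "(\<lambda>x. f n x - g x) \<in> Dom" by (rule DomI[OF cont En])
      have "(f n x - g x)\<^sup>2 \<le> 60000 * e" if x: "x \<in> K" for x
      proof (rule LIMSEQ_le_const2)
        show "(\<lambda>m. (f n x - f m x)\<^sup>2) \<longlonglongrightarrow> (f n x - g x)\<^sup>2" using pt[OF x] by (intro tendsto_intros)
        have "(f n x - f m x)\<^sup>2 \<le> 60000 * e" if "N \<le> m" for m
          using Dom_sup[OF fd x, of n m] N[OF n that] by linarith
        then show "\<exists>N. \<forall>m\<ge>N. (f n x - f m x)\<^sup>2 \<le> 60000 * e" by blast
      qed
      then have "(\<integral>x. (f n x - g x)\<^sup>2 \<partial>\<mu>) \<le> 60000 * e" by (rule integral_le_bound[OF cont])
      then show ?thesis using dom EE_le[OF dom En] unfolding E1_def by simp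
    qed
    then show ?thesis by blast
  qed
  obtain N where "(\<lambda>x. f N x - g x) \<in> Dom" using main[of 1] by auto
  then have "(\<lambda>x. f N x - (f N x - g x)) \<in> Dom" by (rule Dom_diff[OF f])
  then have gD: "g \<in> Dom" by simp
  have "(\<lambda>n. E1 \<mu> EE (\<lambda>x. f n x - g x)) \<longlonglongrightarrow> 0"
  proof (rule LIMSEQ_I)
    fix e :: real assume e: "0 < e"
    then obtain N where N: "\<And>n. N \<le> n \<Longrightarrow> E1 \<mu> EE (\<lambda>x. f n x - g x) \<le> 60001 * (e / 60002)" using main[of "e / 60002"] by auto
    have "norm (E1 \<mu> EE (\<lambda>x. f n x - g x) - 0) < e" if "N \<le> n" for n
    proof -
      have "0 \<le> E1 \<mu> EE (\<lambda>x. f n x - g x)" unfolding E1_def using EE_nonneg[OF Dom_diff[OF f gD]] by (intro add_nonneg_nonneg) auto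
      then show ?thesis using N[OF that] e by simp
    qed
    then show "\<exists>no. \<forall>n\<ge>no. norm (E1 \<mu> EE (\<lambda>x. f n x - g x) - 0) < e" by blast
  qed
  then show ?thesis using gD by blast
qed

lemma Dom_clamp:
  assumes u: "u \<in> Dom"
  shows "(\<lambda>x. min (max (u x) 0) 1) \<in> Dom" "EE (\<lambda>x. min (max (u x) 0) 1) (\<lambda>x. min (max (u x) 0) 1) \<le> EE u u"
proof -
  let ?v = "\<lambda>x. min (max (u x) 0) 1"
  have "En n ?v \<le> En n u" for n
    unfolding wform_def
  proof (intro sum_mono mult_left_mono)
    fix w
    have c: "(min (max a 0) 1 - min (max b 0) 1)\<^sup>2 \<le> (a - b)\<^sup>2" for a b :: real
    proof -
      have "\<bar>min (max a 0) 1 - min (max b 0) 1\<bar> \<le> \<bar>a - b\<bar>" by (auto simp: max_def min_def abs_if)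
      then show ?thesis by (simp only: abs_le_square_iff)
    qed
    show "tri3 1 1 1 (?v \<circ> word_map w) (?v \<circ> word_map w) \<le> tri3 1 1 1 (u \<circ> word_map w) (u \<circ> word_map w)"
      unfolding tri3_square comp_def by (intro add_mono c)
  qed (rule less_imp_le[OF prod_rho_pos])
  then have le: "En n ?v \<le> EE u u" for n using En_le_EE[OF u, of n] order_trans by blast
  have "continuous_on K ?v" using Dom_cont[OF u] by (intro continuous_intros)
  then show D: "?v \<in> Dom" by (rule DomI[OF _ le])
  show "EE ?v ?v \<le> EE u u" by (rule EE_le[OF D le])
qed

lemma Dom_dense: "dense_in_L2 \<mu> Dom"
proof (rule dense_in_L2_I)
  fix g :: "plane \<Rightarrow> real" and e :: real
  assume g: "continuous_on K g" and e: "0 < e"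
  obtain H C where S: "harmonic_spec H C" using harmonic_ex by blast
  note C = harmonic_specD(1)[OF S]
  define c where "c = sqrt (e / 2)"
  have c: "0 < c" "c\<^sup>2 = e / 2" using e by (auto simp: c_def)
  define e' where "e' = c / (2 * C + 2)"
  have e': "0 < e'" using c C by (simp add: e'_def)
  obtain N where N: "\<And>w x. w \<in> words I N \<Longrightarrow> x \<in> K \<Longrightarrow> \<bar>g (word_map w x) - g (word_map w p1)\<bar> < e'"
    using uniform_cells[OF g e'] by blast
  obtain u where u: "\<And>w x. w \<in> words I N \<Longrightarrow> x \<in> K \<Longrightarrow> u (word_map w x) = H (g \<circ> word_map w) x"
    by (rule glue[of N "\<lambda>w. H (g \<circ> word_map w)" g]) (use harmonic_specD(3)[OF S] in auto)
  have uc: "continuous_on K u"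
  proof (rule continuous_on_cells)
    fix w assume w: "w \<in> words I N"
    show "continuous_on K (u \<circ> word_map w)"
      using u[OF w] harmonic_specD(2)[OF S, of "g \<circ> word_map w"] by (simp cong: continuous_on_cong)
  qed
  have "En n u \<le> En N g" for n
  proof -
    have "En n u \<le> En (N + n) u" using En_incseq[of u] by (auto simp: incseq_def)
    also have "\<dots> = (\<Sum>w\<in>words I N. prod_list (map \<rho> w) * En n (u \<circ> word_map w))" by (rule wform_add)
    also have "\<dots> = (\<Sum>w\<in>words I N. prod_list (map \<rho> w) * En n (H (g \<circ> word_map w)))"
      using u by (intro sum.cong refl arg_cong2[where f = times] wform_cong) auto
    also have "\<dots> = En N g" by (simp only: harmonic_specD(6)[OF S] wform_def[of _ _ _ _ N])
    finally show ?thesis .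
  qed
  then have uD: "u \<in> Dom" by (rule DomI[OF uc])
  have "\<bar>g x - u x\<bar> \<le> c" if xK: "x \<in> K" for x
  proof -
    obtain w y where w: "w \<in> words I N" "y \<in> K" "x = word_map w y" using K_words[OF xK] by blast
    have "osc (g \<circ> word_map w) \<le> 2 * e'"
      using N[OF w(1) p_K(1)] N[OF w(1) p_K(2)] N[OF w(1) p_K(3)] by (intro osc_leI) auto
    then have "C * osc (g \<circ> word_map w) \<le> C * (2 * e')" using C by (rule mult_left_mono)
    then have "\<bar>H (g \<circ> word_map w) y - g (word_map w p1)\<bar> \<le> C * (2 * e')"
      using harmonic_specD(4)[OF S w(2), of "g \<circ> word_map w"] by simp
    then have "\<bar>g x - u x\<bar> \<le> e' + C * (2 * e')" using N[OF w(1,2)] u[OF w(1,2)] unfolding w(3) by linarith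
    also have "\<dots> \<le> (2 * C + 2) * e'" using e' by (simp add: algebra_simps)
    also have "\<dots> = c" using C by (simp add: e'_def)
    finally show ?thesis .
  qed
  then have "sq_norm (\<lambda>x. g x - u x) \<le> ennreal (c\<^sup>2)" by (rule sq_norm_bounded)
  also have "\<dots> < ennreal e" unfolding c(2) using e by (simp add: ennreal_less_iff)
  finally show "\<exists>u\<in>Dom. u \<in> L2 \<mu> \<and> sq_norm (\<lambda>x. g x - u x) < ennreal e"
    using uD continuous_L2[OF uc] by blast
qed

lemma dirichlet_EE: "dirichlet_form \<mu> EE Dom"
  unfolding dirichlet_form_def
proof (intro conjI ballI allI impI)
  show "Dom \<subseteq> L2 \<mu>" using continuous_L2 Dom_cont by blast
  have En0: "En n (\<lambda>x. 0) = 0" for n by (simp add: wform_def tri3_def)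
  then show "(\<lambda>x. 0) \<in> Dom" by (intro DomI[of _ 0]) auto
  show "EE u v = EE v u" for u v unfolding limit_form_def energy_form_cond wform_sym[of _ u v] ..
  show "EE (\<lambda>x. u x + v x) w = EE u w + EE v w" if "u \<in> Dom" "v \<in> Dom" "w \<in> Dom" for u v w
    using LIMSEQ_unique[OF form_tendsto[OF Dom_add[OF that(1,2)] that(3), unfolded wform_lin(1)]
      tendsto_add[OF form_tendsto[OF that(1,3)] form_tendsto[OF that(2,3)]]] .
  show "EE (\<lambda>x. a * u x) v = a * EE u v" if "u \<in> Dom" "v \<in> Dom" for a u v
    using LIMSEQ_unique[OF form_tendsto[OF Dom_cmult[OF that(1)] that(2), unfolded wform_lin(2)]
      tendsto_mult[OF tendsto_const form_tendsto[OF that]]] .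
  show "EE u u = 0" if u: "u \<in> Dom" and ae: "AE x in \<mu>. u x = 0" for u
  proof -
    have "u x = 0" if "x \<in> K" for x
      by (rule AE_eq_imp_eq[OF Dom_cont[OF u] continuous_on_const ae that])
    then have "En n u = En n (\<lambda>x. 0)" for n by (intro wform_cong)
    then have "(\<lambda>n. En n u) \<longlonglongrightarrow> 0" by (simp add: En0)
    then show ?thesis using form_tendsto[OF u u] LIMSEQ_unique by blast
  qed
  show "\<exists>g\<in>Dom. (\<lambda>n. E1 \<mu> EE (\<lambda>x. f n x - g x)) \<longlonglongrightarrow> 0"
    if "(\<forall>n. f n \<in> Dom) \<and> (\<forall>e>0. \<exists>N. \<forall>m\<ge>N. \<forall>n\<ge>N. E1 \<mu> EE (\<lambda>x. f m x - f n x) < e)" for f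
    using that by (intro Dom_complete) auto
qed (simp_all add: Dom_add Dom_cmult EE_nonneg Dom_dense Dom_clamp)

lemma self_similar_cond: "energy_self_similar I K cond"
  unfolding energy_self_similar_def
proof (intro exI[of _ \<tau>] conjI ballI)
  show "0 < \<tau> i" "\<tau> i < 1" for i using tau_bounds[of i] by linarith+
  fix u assume "u \<in> Dom"
  have "ennreal (En (Suc n) u) = (\<Sum>i\<in>I. ennreal (\<rho> i) * ennreal (En n (u \<circ> cell_map i)))" for n
  proof -
    have "0 \<le> \<rho> i" for i using rho_ge[of i] by linarith
    then show ?thesis unfolding wform_Suc[of _ _ _ _ n] using En_nonneg
      by (simp add: sum_ennreal flip: ennreal_mult)
  qed
  moreover have "(\<lambda>n. \<Sum>i\<in>I. ennreal (\<rho> i) * ennreal (En n (u \<circ> cell_map i)))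
      \<longlonglongrightarrow> (\<Sum>i\<in>I. ennreal (\<rho> i) * limit_energy I cond (u \<circ> cell_map i))"
    by (intro tendsto_sum ennreal_tendsto_cmult limit_energy_tendsto) simp
  ultimately have "(\<lambda>n. ennreal (En (Suc n) u)) \<longlonglongrightarrow> (\<Sum>i\<in>I. ennreal (\<rho> i) * limit_energy I cond (u \<circ> cell_map i))"
    by simp
  from LIMSEQ_unique[OF LIMSEQ_Suc[OF limit_energy_tendsto] this]
  show "limit_energy I cond u = (\<Sum>i\<in>I. ennreal (1 / \<tau> i) * limit_energy I cond (u \<circ> cell_map i))"
    by (simp only: \<rho>_def)
qed

text \<open>Indicators of a corner of \<open>K\<close> among the vertices of level one: a corner
  belongs to a single cell, whose weight they read off.\<close>

lemma single_cell_functions: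
  "\<exists>u. \<forall>c. wform c 1 1 1 1 u u = 2 * c (0, 0)" "\<exists>u. \<forall>c. wform c 1 1 1 1 u u = 2 * c (0, 6)"
proof -
  have *: "\<exists>u. \<forall>c. wform c 1 1 1 1 u u = 2 * s\<^sup>2 * c (0, 0) + 2 * t\<^sup>2 * c (0, 6)" for s t :: real
  proof -
    define L where "L j = (if j = 0 then s else 0)" for j :: nat
    obtain u where u: "\<And>j. j < 5 \<Longrightarrow> u (cell_map (0, j) p1) = L j \<and> u (cell_map (0, j) p2) = 0 \<and> u (cell_map (0, j) p3) = L (Suc j)"
      "u (cell_map (0, 5) p1) = L 5" "u (cell_map (0, 5) p2) = 0" "u (cell_map (0, 5) p3) = 0"
      "u (cell_map (Suc 0, 5) p1) = 0" "u (cell_map (Suc 0, 5) p2) = 0" "u (cell_map (Suc 0, 5) p3) = 0"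
      "u (cell_map (0, 6) p1) = 0" "u (cell_map (0, 6) p2) = 0" "u (cell_map (0, 6) p3) = t"
      "\<And>k. k \<in> {1..9} \<Longrightarrow> u (cell_map (r k) (ea k)) = 0 \<and> u (cell_map (r k) (eb k)) = 0 \<and> u (cell_map (r k) (eh k)) = 0"
      "u p1 = L 0" "u p2 = 0" "u p3 = t"
      by (rule level1_function[of L "\<lambda>_. 0" 0 0 "\<lambda>_. 0" 0 t "\<lambda>_. 0"]) blast
    have "wform c 1 1 1 1 u u = 2 * s\<^sup>2 * c (0, 0) + 2 * t\<^sup>2 * c (0, 6)" for c
    proof -
      have "(\<Sum>j<5. c (0, j) * tri3 1 1 1 (u \<circ> cell_map (0, j)) (u \<circ> cell_map (0, j))) = (\<Sum>j<(5::nat). if j = 0 then 2 * s\<^sup>2 * c (0, 0) else 0)"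
        using u(1) by (intro sum.cong refl) (simp add: tri3_square L_def)
      moreover have "(\<Sum>k=1..9. c (r k) * tri3 1 1 1 (u \<circ> cell_map (r k)) (u \<circ> cell_map (r k))) = 0"
        using u(11) by (intro sum.neutral ballI) (simp add: tri3_right)
      ultimately show ?thesis unfolding wform_1 sum_I using u(2-10) by (simp add: tri3_square L_def)
    qed
    then show ?thesis by blast
  qed
  show "\<exists>u. \<forall>c. wform c 1 1 1 1 u u = 2 * c (0, 0)" using *[of 1 0] by simp
  show "\<exists>u. \<forall>c. wform c 1 1 1 1 u u = 2 * c (0, 6)" using *[of 0 1] by simp
qed

lemma non_primal_cond: "non_primal I cond"
  unfolding non_primal_def
proof
  assume "\<forall>n. \<exists>a. \<forall>u. energy I cond n u = a * primal_energy I n u"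
  then obtain a where a: "\<And>u. En 1 u = a * PE 1 u" unfolding energy_cond primal_energy_eq by meson
  obtain u where u: "\<And>c. wform c 1 1 1 1 u u = 2 * c (0, 0)" using single_cell_functions(1) by blast
  obtain v where v: "\<And>c. wform c 1 1 1 1 v v = 2 * c (0, 6)" using single_cell_functions(2) by blast
  show False using a[of u] a[of v] rho_values(1)[of 0] rho_values(4) unfolding u v by simp
qed

lemma dirichlet_exists: "\<exists>c. dirichlet_form_on I K c \<and> non_primal I c \<and> energy_self_similar I K c"
  using conductances_cond compatible_cond radon_mu dirichlet_EE non_primal_cond self_similar_cond
  unfolding dirichlet_form_on_def by blast


subsection \<open>The reverse recursive method fails\<close>

lemma tri3_affine: "tri3 a b c (\<lambda>x. s + t * f x) (\<lambda>x. s + t * f x) = t\<^sup>2 * tri3 a b c f f"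
  by (simp add: tri3_def power2_eq_square algebra_simps)

lemma tri3_eq0: "(\<And>p. p \<in> V0 \<Longrightarrow> f p = s) \<Longrightarrow> tri3 a b c f f = 0"
  by (simp add: tri3_def)

text \<open>A unit jump across one right cell.  Giving the dangling vertex of this cell the value at the
  image of \<^term>\<open>p2\<close> makes the energy involve just one of the two conductances at \<^term>\<open>p2\<close>.\<close>

lemma jump_function:
  assumes k0: "k0 \<in> {1..9}" "{ea k0, eb k0} = {p, p2}" and p: "p = p1 \<or> p = p3"
  obtains s where "s p1 = 0" "s p2 = 1" "s p3 = 0"
    "\<And>a b c. wform (\<lambda>_. 1) a b c 1 s s = (if p = p1 then a else b) + c"
proof -
  define Z where "Z k = (if k < k0 then 0 else 1 :: real)" for k
  define Zh where "Zh k = (if k = k0 then if ea k0 = p2 then 0 else 1 else Z k)" for k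
  have Z09: "Z 0 = 0" "Z 9 = 1" using k0(1) by (auto simp: Z_def)
  obtain s where s: "\<And>j. j < 5 \<Longrightarrow> s (cell_map (0, j) p1) = 0 \<and> s (cell_map (0, j) p2) = 0 \<and> s (cell_map (0, j) p3) = 0"
    "s (cell_map (0, 5) p1) = 0" "s (cell_map (0, 5) p2) = 0" "s (cell_map (0, 5) p3) = 0"
    "s (cell_map (Suc 0, 5) p1) = 0" "s (cell_map (Suc 0, 5) p2) = Z 0" "s (cell_map (Suc 0, 5) p3) = 0"
    "s (cell_map (0, 6) p1) = 0" "s (cell_map (0, 6) p2) = 0" "s (cell_map (0, 6) p3) = 0"
    "\<And>k. k \<in> {1..9} \<Longrightarrow> s (cell_map (r k) (ea k)) = Z (k - 1) \<and> s (cell_map (r k) (eb k)) = Z k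
        \<and> s (cell_map (r k) (eh k)) = Zh k"
    "s p1 = 0" "s p2 = Z 9" "s p3 = 0"
    by (rule level1_function[of "\<lambda>_. 0" "\<lambda>_. 0" 0 0 Z 0 0 Zh]) blast
  have "wform (\<lambda>_. 1) a b c 1 s s = (if p = p1 then a else b) + c" for a b c
  proof -
    have right: "tri3 a b c (s \<circ> cell_map (r k)) (s \<circ> cell_map (r k)) = (if k = k0 then (if p = p1 then a else b) + c else 0)"
      if k: "k \<in> {1..9}" for k
    proof (cases "k = k0")
      case True
      show ?thesis using k
        by (cases rule: edge_cases) (use s(11)[OF k] True k0 p in \<open>auto simp: tri3_def Zh_def Z_def doubleton_eq_iff\<close>)
    next
      case False
      have "Z (k - 1) = Z k" using False k by (auto simp: Z_def)
      have "tri3 a b c (s \<circ> cell_map (r k)) (s \<circ> cell_map (r k)) = 0"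
      proof (rule tri3_eq0[of _ "Z k"])
        fix v assume "v \<in> V0"
        then have "v = ea k \<or> v = eb k \<or> v = eh k" using eh(4)[OF k] by blast
        then show "(s \<circ> cell_map (r k)) v = Z k"
          using s(11)[OF k] False \<open>Z (k - 1) = Z k\<close> by (elim disjE) (simp_all add: Zh_def)
      qed
      then show ?thesis using False by simp
    qed
    have "(\<Sum>j<5. tri3 a b c (s \<circ> cell_map (0, j)) (s \<circ> cell_map (0, j))) = 0"
      using s(1) by (intro sum.neutral ballI) (simp add: tri3_def)
    moreover have "(\<Sum>k=1..9. tri3 a b c (s \<circ> cell_map (r k)) (s \<circ> cell_map (r k))) = (if p = p1 then a else b) + c"
    proof -
      have "(\<Sum>k=1..9. tri3 a b c (s \<circ> cell_map (r k)) (s \<circ> cell_map (r k))) = (\<Sum>k=1..9. if k = k0 then (if p = p1 then a else b) + c else 0)"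
        by (rule sum.cong[OF refl right])
      also have "\<dots> = (if p = p1 then a else b) + c" using k0(1) by (simp only: sum.delta finite_atLeastAtMost if_True)
      finally show ?thesis .
    qed
    ultimately show ?thesis unfolding wform_1 mult_1 sum_I using s(2-10) Z09 by (simp add: tri3_def)
  qed
  then show ?thesis using that[of s] s(12-14) Z09 by simp
qed

lemma V0_subset_V: "p \<in> V0 \<Longrightarrow> p \<in> V I n"
proof (induction n)
  case (Suc n)
  obtain i where i: "i \<in> I" "cell_map i p = p" using Suc.prems corner_I corner_fixed unfolding V0_def by blast
  have "cell_map i p \<in> cell_map i ` V I n" using Suc by blast
  then show ?case using i by auto
qed simp

text \<open>Two resistances in series: \<open>x * y / (x + y)\<close> is the effective conductance
  of the path through the middle vertex.\<close>

lemma series_bound: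
  fixes x y t f1 f2 f3 :: real
  assumes "0 < x" "0 < y"
  shows "(t + x * y / (x + y)) * (f1 - f3)\<^sup>2 \<le> x * (f1 - f2)\<^sup>2 + y * (f2 - f3)\<^sup>2 + t * (f1 - f3)\<^sup>2"
proof -
  define d e where "d = f1 - f2" "e = f2 - f3"
  have "x * y * (d + e)\<^sup>2 \<le> (x * d\<^sup>2 + y * e\<^sup>2) * (x + y)"
    using zero_le_power2[of "x * d - y * e"] by (simp add: power2_eq_square algebra_simps)
  then have "x * y / (x + y) * (d + e)\<^sup>2 \<le> x * d\<^sup>2 + y * e\<^sup>2"
    using assms by (simp add: pos_divide_le_eq add_pos_pos)
  moreover have "f1 - f3 = d + e" by (simp add: d_e_def)
  ultimately show ?thesis unfolding d_e_def[symmetric] by (simp add: distrib_right)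
qed

text \<open>Writing \<open>X\<close>, \<open>Y\<close>, \<open>T\<close> for the conductances,
  compatibility preserves energies of minimizers, so \<open>path13\<close> bounds \<open>T + X * Y /
  (X + Y)\<close>, and with it \<open>min X Y + T\<close>, by a multiple of \<open>7 ^ n\<close>.
  On the other hand the flat self-similar function, refined on the last level by jumps across a
  single right cell, has energy \<open>(2/17) ^ (n - 1) * (min X Y + T)\<close> at level
  \<open>n\<close>, but its energy \<open>X 0 + Y 0\<close> at level \<open>0\<close> is a lower
  bound.\<close>

lemma no_reverse_recursion: "\<not> reverse_recursive I d c"
proof
  assume R: "reverse_recursive I d c"
  then have cond: "conductances I c" and comp: "compatible I c"
    and cd: "\<And>w x y. w \<in> lists I \<Longrightarrow> x \<in> V0 \<Longrightarrow> y \<in> V0 \<Longrightarrow> x \<noteq> y \<Longrightarrow> c w (word_map w x) (word_map w y) = d (length w) x y"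
    unfolding reverse_recursive_def by blast+
  define X Y T where "X n = d n p1 p2" and "Y n = d n p2 p3" and "T n = d n p1 p3" for n
  note XYT = this
  have pos: "0 < d n x y" if xy: "x \<in> V0" "y \<in> V0" "x \<noteq> y" for n x y
  proof -
    define w where "w = replicate n (0 :: nat, 0 :: nat)"
    have w: "w \<in> lists I" "length w = n" using left_top_I(1)[of 0] by (auto simp: w_def in_lists_conv_set)
    have "word_map w x \<noteq> word_map w y"
    proof
      assume "word_map w x = word_map w y"
      then have "dist (word_map w x) (word_map w y) = 0" by simp
      then show False using xy(3) by (simp add: dist_word_map)
    qed
    moreover have "word_map w x \<in> Vw w" "word_map w y \<in> Vw w" using xy by (auto simp: Vw_def)
    ultimately have "0 < c w (word_map w x) (word_map w y)" using cond w unfolding conductances_def by blast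
    then show ?thesis using cd[OF w(1) xy] w(2) by simp
  qed
  have XYT0: "0 < X n" "0 < Y n" "0 < T n" for n unfolding XYT by (intro pos; simp)+
  define RE where "RE n u = wform (\<lambda>_. 1) (X n) (Y n) (T n) n u u" for n u
  have energy: "energy I c n u = RE n u" for n u
    unfolding energy_def energy_form_eq[OF cond] RE_def wform_def prod_list_one mult_1
  proof (rule sum.cong[OF refl])
    fix w assume "w \<in> words I n"
    then have w: "w \<in> lists I" "length w = n" by (auto simp: words_def in_lists_conv_set)
    show "tri3 (c w (word_map w p1) (word_map w p2)) (c w (word_map w p2) (word_map w p3)) (c w (word_map w p1) (word_map w p3)) (u \<circ> word_map w) (u \<circ> word_map w)
      = tri3 (X n) (Y n) (T n) (u \<circ> word_map w) (u \<circ> word_map w)"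
      using cd[OF w(1), of p1 p2] cd[OF w(1), of p2 p3] cd[OF w(1), of p1 p3] w(2) by (simp add: XYT)
  qed
  have up: "RE n u \<le> RE (Suc n) v" if "\<forall>x\<in>V I n. v x = u x" for n u v
    using comp that unfolding compatible_def Let_def energy by blast
  have att: "\<exists>v. (\<forall>x\<in>V I n. v x = u x) \<and> RE (Suc n) v = RE n u" for n u
  proof -
    have "RE n u \<in> {RE (Suc n) v |v. \<forall>x\<in>V I n. v x = u x}" using comp unfolding compatible_def Let_def energy by blast
    then show ?thesis by auto
  qed
  have RE_le: "RE 0 u \<le> RE n u" for n u
  proof (induction n)
    case (Suc n)
    then show ?case using up[of n u u] by simp
  qed simp
  have RE_att: "\<exists>v. (\<forall>x\<in>V0. v x = u x) \<and> RE n v = RE 0 u" for n u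
  proof (induction n)
    case (Suc n)
    then obtain v where v: "\<forall>x\<in>V0. v x = u x" "RE n v = RE 0 u" by blast
    obtain v' where v': "\<forall>x\<in>V I n. v' x = v x" "RE (Suc n) v' = RE n v" using att by blast
    have "\<forall>x\<in>V0. v' x = u x" using v(1) v'(1) V0_subset_V by simp
    then show ?case using v(2) v'(2) by auto
  qed auto
  define u0 where "u0 x = (if x = p3 then 1 else 0 :: real)" for x
  define C where "C = RE 0 u0"
  have "0 < X 0" "0 < Y 0" "0 < T 0" by (rule XYT0)+
  then have C0: "0 < C" by (simp add: C_def RE_def u0_def tri3_def)
  have upper: "T n + X n * Y n / (X n + Y n) \<le> C * 7 ^ n" for n
  proof -
    (* The effective conductance of one cell between its corners p1 and p3. *)
    define Rn where "Rn = T n + X n * Y n / (X n + Y n)"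
    have Rn0: "0 < Rn" using XYT0[of n] by (simp add: Rn_def add_pos_pos)
    obtain v where v: "\<forall>x\<in>V0. v x = u0 x" "RE n v = C" using RE_att[of u0 n] unfolding C_def by blast
    have "Rn * (\<Sum>w\<in>words I n. (v (word_map w p1) - v (word_map w p3))\<^sup>2) \<le> RE n v"
      unfolding RE_def wform_def prod_list_one mult_1 sum_distrib_left
    proof (rule sum_mono)
      fix w
      show "Rn * (v (word_map w p1) - v (word_map w p3))\<^sup>2 \<le> tri3 (X n) (Y n) (T n) (v \<circ> word_map w) (v \<circ> word_map w)"
        unfolding Rn_def tri3_def comp_def
        using series_bound[OF XYT0(1,2), of "T n" n n "v (word_map w p1)" "v (word_map w p3)" "v (word_map w p2)"]
        by (simp add: power2_eq_square mult.assoc)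
    qed
    moreover have "(v p1 - v p3)\<^sup>2 = 1" using v(1) by (simp add: u0_def)
    ultimately have "Rn * 1 \<le> Rn * (7 ^ n * (\<Sum>w\<in>words I n. (v (word_map w p1) - v (word_map w p3))\<^sup>2))"
      using path13[of v n] Rn0 by (intro mult_left_mono) auto
    also have "\<dots> = 7 ^ n * (Rn * (\<Sum>w\<in>words I n. (v (word_map w p1) - v (word_map w p3))\<^sup>2))" by (simp only: mult_ac)
    also have "\<dots> \<le> 7 ^ n * RE n v"
      using \<open>Rn * _ \<le> RE n v\<close> by (rule mult_left_mono) simp
    finally show ?thesis using v(2) by (simp add: Rn_def mult.commute)
  qed
  (* The minimum of X and Y is at most their harmonic mean. *)
  have mincost: "min (X n) (Y n) + T n \<le> 2 * C * 7 ^ n" for n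
  proof -
    have "min (X n) (Y n) \<le> 2 * (X n * Y n / (X n + Y n))"
    proof -
      have "min (X n) (Y n) * (X n + Y n) \<le> 2 * (X n * Y n)"
      proof (cases "X n \<le> Y n")
        case True
        then have "X n * X n \<le> X n * Y n" using XYT0(1)[of n] by (intro mult_left_mono) auto
        then show ?thesis using True by (simp add: algebra_simps)
      next
        case False
        then have "Y n * Y n \<le> Y n * X n" using XYT0(2)[of n] by (intro mult_left_mono) auto
        then show ?thesis using False by (simp add: algebra_simps)
      qed
      then show ?thesis using XYT0[of n] by (simp add: pos_le_divide_eq add_pos_pos)
    qed
    then show ?thesis using upper[of n] XYT0(3)[of n] by linarith
  qed
  obtain H C' where S: "flat_spec H C'" using flat_decay_functions by blast
  define a where "a x = (if x = p2 then 1 else 0 :: real)" for x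
  define g where "g = H a"
  have a13: "a p1 = a p3" by (simp add: a_def)
  have gV0: "g p = a p" if "p \<in> V0" for p unfolding g_def by (rule flat_specD(2)[OF S that])
  have gflat: "g (word_map w p1) = g (word_map w p3)" if "w \<in> words I n" for n w
    unfolding g_def by (rule flat_specD(7)[OF S a13 that])
  have PEg: "(\<Sum>w\<in>words I m. (g (word_map w p2) - g (word_map w p1))\<^sup>2) = (2/17) ^ m" for m
  proof -
    have "2 * (\<Sum>w\<in>words I m. (g (word_map w p2) - g (word_map w p1))\<^sup>2) = PE m g"
      unfolding PE_eq sum_distrib_left
      using gflat by (intro sum.cong refl) (simp add: tri3_square power2_commute)
    also have "\<dots> = 2 * (2/17) ^ m" unfolding g_def flat_specD(6)[OF S a13] by (simp add: a_def)
    finally show ?thesis by simp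
  qed
  (* Flat at level m, and one sharp jump inside each cell: only the jump cells contribute. *)
  have lower: "X 0 + Y 0 \<le> (2/17) ^ m * (min (X (Suc m)) (Y (Suc m)) + T (Suc m))" for m
  proof -
    obtain s where s: "s p1 = 0" "s p2 = 1" "s p3 = 0"
      and sE: "wform (\<lambda>_. 1) (X (Suc m)) (Y (Suc m)) (T (Suc m)) 1 s s = min (X (Suc m)) (Y (Suc m)) + T (Suc m)"
    proof (cases "X (Suc m) \<le> Y (Suc m)")
      case True
      obtain k0 where k0: "k0 \<in> {1..9}" "{ea k0, eb k0} = {p1, p2}" using ex_edge(1) by blast
      obtain s where s: "s p1 = 0" "s p2 = 1" "s p3 = 0"
        "\<And>a b c. wform (\<lambda>_. 1) a b c 1 s s = (if p1 = p1 then a else b) + c"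
        by (rule jump_function[OF k0]) auto
      show ?thesis by (rule that[OF s(1-3)]) (unfold s(4), simp add: True)
    next
      case False
      obtain k0 where k0: "k0 \<in> {1..9}" "{ea k0, eb k0} = {p3, p2}" using ex_edge(2) by (auto simp: insert_commute)
      obtain s where s: "s p1 = 0" "s p2 = 1" "s p3 = 0"
        "\<And>a b c. wform (\<lambda>_. 1) a b c 1 s s = (if p3 = p1 then a else b) + c"
        by (rule jump_function[OF k0]) auto
      have "min (X (Suc m)) (Y (Suc m)) = Y (Suc m)" using False by simp
      then show ?thesis by (intro that[OF s(1-3)]) (simp only: s(4) V0_distinct if_False)
    qed
    define h where "h w x = g (word_map w p1) + (g (word_map w p2) - g (word_map w p1)) * s x" for w x
    have hV: "h w p = g (word_map w p)" if w: "w \<in> words I m" and p: "p \<in> V0" for w p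
    proof -
      have "p = p1 \<or> p = p2 \<or> p = p3" using p unfolding V0_def by blast
      then show ?thesis using gflat[OF w] s by (elim disjE) (simp_all add: h_def)
    qed
    obtain v where v: "\<And>w x. w \<in> words I m \<Longrightarrow> x \<in> K \<Longrightarrow> v (word_map w x) = h w x"
      by (rule glue[of m h g]) (use hV in auto)
    have "v p = a p" if p: "p \<in> V0" for p
    proof -
      have "p \<in> V I m" by (rule V0_subset_V[OF p])
      then obtain w p' where w: "w \<in> words I m" "p' \<in> V0" "p = word_map w p'" unfolding V_words by blast
      have "p' \<in> K" using w(2) V0_K by blast
      then have "v p = g p" using v[OF w(1)] hV[OF w(1,2)] w(3) by simp
      then show ?thesis using gV0[OF p] by simp
    qed
    then have "RE 0 v = RE 0 a" unfolding RE_def wform_0 by (intro tri3_cong) auto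
    also have "RE 0 a = X 0 + Y 0" by (simp add: RE_def a_def tri3_def)
    finally have "X 0 + Y 0 \<le> RE (Suc m) v" using RE_le[of v "Suc m"] by simp
    also have "\<dots> = (\<Sum>w\<in>words I m. wform (\<lambda>_. 1) (X (Suc m)) (Y (Suc m)) (T (Suc m)) 1 (v \<circ> word_map w) (v \<circ> word_map w))"
      unfolding RE_def wform_Suc'[of _ _ _ _ m] prod_list_one mult_1 ..
    also have "\<dots> = (\<Sum>w\<in>words I m. wform (\<lambda>_. 1) (X (Suc m)) (Y (Suc m)) (T (Suc m)) 1 (h w) (h w))"
      using v by (intro sum.cong refl wform_cong) auto
    also have "\<dots> = (\<Sum>w\<in>words I m. (g (word_map w p2) - g (word_map w p1))\<^sup>2 * (min (X (Suc m)) (Y (Suc m)) + T (Suc m)))"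
    proof (rule sum.cong[OF refl])
      fix w
      have "wform (\<lambda>_. 1) (X (Suc m)) (Y (Suc m)) (T (Suc m)) 1 (h w) (h w)
        = (g (word_map w p2) - g (word_map w p1))\<^sup>2 * wform (\<lambda>_. 1) (X (Suc m)) (Y (Suc m)) (T (Suc m)) 1 s s"
        unfolding wform_1 mult_1 sum_distrib_left h_def comp_def
        using tri3_affine[of _ _ _ "g (word_map w p1)" "g (word_map w p2) - g (word_map w p1)" "\<lambda>x. s (cell_map _ x)"]
        by (intro sum.cong refl)
      then show "wform (\<lambda>_. 1) (X (Suc m)) (Y (Suc m)) (T (Suc m)) 1 (h w) (h w)
        = (g (word_map w p2) - g (word_map w p1))\<^sup>2 * (min (X (Suc m)) (Y (Suc m)) + T (Suc m))" unfolding sE .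
    qed
    finally show ?thesis unfolding sum_distrib_right[symmetric] PEg .
  qed
  have "X 0 + Y 0 \<le> 14 * C * (14/17) ^ m" for m
  proof -
    have "X 0 + Y 0 \<le> (2/17) ^ m * (2 * C * 7 ^ Suc m)"
      by (rule order_trans[OF lower[of m]]) (intro mult_left_mono mincost, simp)
    also have "\<dots> = 14 * C * ((2/17) ^ m * 7 ^ m)" by simp
    also have "(2/17) ^ m * 7 ^ m = (14/17 :: real) ^ m" by (simp flip: power_mult_distrib)
    finally show ?thesis .
  qed
  moreover have "(\<lambda>m. 14 * C * (14/17) ^ m) \<longlonglongrightarrow> 14 * C * 0"
    by (intro tendsto_mult tendsto_const LIMSEQ_realpow_zero) auto
  ultimately have "X 0 + Y 0 \<le> 14 * C * 0" by (intro LIMSEQ_le_const) blast+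
  then show False using XYT0[of 0] by simp
qed

end

context sickle
begin

lemma main_results:
  "sigma_star \<mu> K \<alpha> = ereal (1/2 * (1 + ln 17 / ln 7)) \<and>
   sigma_sharp \<mu> \<alpha> = ereal (1/2 * ((2 * ln 17 - ln 2) / ln 7)) \<and>
   (\<forall>u\<in>besov \<mu> \<alpha> (1/2 * (1 + ln 17 / ln 7)). has_continuous_rep \<mu> K u) \<and>
   dense_in_C K (besov \<mu> \<alpha> (1/2 * (1 + ln 17 / ln 7))) \<and>
   dense_in_L2 \<mu> (besov \<mu> \<alpha> (1/2 * ((2 * ln 17 - ln 2) / ln 7))) \<and>
   (\<exists>c. dirichlet_form_on I K c \<and> non_primal I c \<and> energy_self_similar I K c) \<and>
   \<not> (\<exists>d c. reverse_recursive I d c)"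
  using sigma_star_value sigma_sharp_value continuous_rep_star dense_C_star dense_L2_sharp
    dirichlet_exists no_reverse_recursion
  by (intro conjI ballI) auto

end

theorem theorem1p3:
  fixes r :: "nat \<Rightarrow> cell" and z :: "nat \<Rightarrow> plane" and K :: "plane set"
    and I :: "cell set" and \<mu> :: "plane measure" and \<alpha> :: real
  assumes chain: "right_chain r z"
    and I: "I = sickle_cells r"
    and K: "is_attractor I K"
    and alpha: "\<alpha> = ln 17 / ln 7"
    and mu: "\<mu> = normalized_hausdorff \<alpha> K"
  shows
    "sigma_star \<mu> K \<alpha> = ereal (1/2 * (1 + ln 17 / ln 7)) \<and>
     sigma_sharp \<mu> \<alpha> = ereal (1/2 * ((2 * ln 17 - ln 2) / ln 7)) \<and>
     (\<forall>u\<in>besov \<mu> \<alpha> (1/2 * (1 + ln 17 / ln 7)). has_continuous_rep \<mu> K u) \<and>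
     dense_in_C K (besov \<mu> \<alpha> (1/2 * (1 + ln 17 / ln 7))) \<and>
     dense_in_L2 \<mu> (besov \<mu> \<alpha> (1/2 * ((2 * ln 17 - ln 2) / ln 7))) \<and>
     (\<exists>c. dirichlet_form_on I K c \<and> non_primal I c \<and> energy_self_similar I K c) \<and>
     \<not> (\<exists>d c. reverse_recursive I d c)"
proof -
  have s: "sickle r z K" unfolding sickle_def using chain K I by simp
  have a: "sickle.\<alpha> = \<alpha>" by (simp add: sickle.\<alpha>_def[OF s] alpha)
  have m: "sickle.\<mu> K = \<mu>" by (simp add: sickle.\<mu>_def[OF s] a mu)
  show ?thesis using sickle.main_results[OF s] unfolding a m I[symmetric] .
qed

end
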